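(* Let $N>K\ge2$, let $V\in\mathcal C^{\mathcal G(K)}(\mathbb{R}^N)$ satisfy (V1) and let $f$ satisfy (F1)–(F4). Then either $c_1$ is a critical value of $\mathcal J_1$ (i.e. there is $u\in X_1^{\mathcal G(K)}\setminus\{0\}$ with $\mathcal J_1'(u)=0$ and $\mathcal J_1(u)=c_1$), or $c_1\ge m_{V_\infty}$.
   Context: Throughout, $N>K\ge 2$ are integers, $2^*=\frac{2N}{N-2}$, and points of $\mathbb{R}^N$ are written $x=(y,z)$ with $y\in\mathbb{R}^K$, $z\in\mathbb{R}^{N-K}$. $\mathcal G(K)=\mathcal O(K)\times I_{N-K}\subset\mathcal O(N)$; a function $u$ on $\mathbb{R}^N$ is $\mathcal G(K)$-invariant if $u(Ay,z)=u(y,z)$ for all $A\in\mathcal O(K)$. $\mathcal C^{\mathcal G(K)}(\mathbb{R}^N)$ is the set of continuous $\mathcal G(K)$-invariant functions and $H^1_{\mathcal G(K)}(\mathbb{R}^N)$ the set of $\mathcal G(K)$-invariant functions in $H^1(\mathbb{R}^N)$. Assumptions on $f:\mathbb{R}\to\mathbb{R}$, with $F(u)=\int_0^u f(s)\,ds$: (F1) $f$ is continuous and there is $p\in(2,2^* )$ with $|f(u)|\le C(1+|u|^{p-1})$ for all $u$; (F2) $f(u)=o(u)$ as $u\to0$; (F3) $F(u)/u^2\to+\infty$ as $|u|\to\infty$; (F4) $u\mapsto f(u)/|u|$ is increasing on $(-\infty,0)$ and on $(0,\infty)$. Assumption on $V$: (V1) $V$ is continuous and $0<V_0:=\inf V\le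 V(0)<V_\infty\le\liminf_{|x|\to\infty}V(x)$ for some real number $V_\infty$ (the $\liminf$ may be $+\infty$). $X_1=\{u\in H^1(\mathbb{R}^N):\int\frac{u^2}{|y|^2}+Vu^2\,dx<\infty\}$ with $\|u\|_1^2=\int|\nabla u|^2+\frac{u^2}{|y|^2}+Vu^2\,dx$, $X_1^{\mathcal G(K)}=X_1\cap H^1_{\mathcal G(K)}(\mathbb{R}^N)$; $\mathcal J_1(u)=\frac12\|u\|_1^2-\int F(u)\,dx$; $\mathcal N_1=\{u\in X_1^{\mathcal G(K)}\setminus\{0\}:\|u\|_1^2=\int f(u)u\}$, $c_1=\inf_{\mathcal N_1}\mathcal J_1$. $Y=\{u\in H^1(\mathbb{R}^N):\int\frac{u^2}{|y|^2}<\infty\}$, $Y^{\mathcal G(K)}$ its invariant subspace; for $k>0$: $\Phi_k(u)=\frac12\int|\nabla u|^2+\frac{u^2}{|y|^2}+ku^2\,dx-\int F(u)\,dx$, $\mathcal M_k=\{u\in Y^{\mathcal G(K)}\setminus\{0\}:\int|\nabla u|^2+\frac{u^2}{|y|^2}+ku^2=\int f(u)u\}$, $m_k=\inf_{\mathcal M_k}\Phi_k$. *)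

theory Defs
  imports "HOL-Analysis.Analysis"
begin

text \<open>Points of R^N are pairs (y,z) with y in a K-dimensional and z in an
(N-K)-dimensional Euclidean space.\<close>

definition test_fun :: "('a::euclidean_space \<Rightarrow> real) \<Rightarrow> bool" where
  "test_fun \<phi> \<longleftrightarrow> (\<forall>x. \<phi> differentiable (at x))
     \<and> (\<forall>e\<in>Basis. continuous_on UNIV (\<lambda>x. frechet_derivative \<phi> (at x) e))
     \<and> compact (closure {x. \<phi> x \<noteq> 0})"

definition weak_gradient :: "('a::euclidean_space \<Rightarrow> real) \<Rightarrow> ('a \<Rightarrow> 'a) \<Rightarrow> bool" where
  "weak_gradient u g \<longleftrightarrow> g \<in> borel_measurable lebesgue \<and>
     (\<forall>\<phi>. test_fun \<phi> \<longrightarrow> (\<forall>e\<in>Basis.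
        (LINT x|lebesgue. u x * frechet_derivative \<phi> (at x) e)
          = - (LINT x|lebesgue. (g x \<bullet> e) * \<phi> x)))"

definition H1 :: "('a::euclidean_space \<Rightarrow> real) \<Rightarrow> bool" where
  "H1 u \<longleftrightarrow> u \<in> borel_measurable lebesgue \<and> integrable lebesgue (\<lambda>x. (u x)^2) \<and>
     (\<exists>g. weak_gradient u g \<and> integrable lebesgue (\<lambda>x. (norm (g x))^2))"

definition grad :: "('a::euclidean_space \<Rightarrow> real) \<Rightarrow> ('a \<Rightarrow> 'a)" where
  "grad u = (SOME g. weak_gradient u g \<and> integrable lebesgue (\<lambda>x. (norm (g x))^2))"

definition G_invariant :: "('y::real_inner \<times> 'z \<Rightarrow> 'b) \<Rightarrow> bool" where
  "G_invariant u \<longleftrightarrow> (\<forall>A y z. orthogonal_transformation A \<longrightarrow> u (A y, z) = u (y, z))"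

definition prim :: "(real \<Rightarrow> real) \<Rightarrow> real \<Rightarrow> real" where
  "prim f u = (if 0 \<le> u then integral {0..u} f else - integral {u..0} f)"

definition X1 :: "('y::euclidean_space \<times> 'z::euclidean_space \<Rightarrow> real)
                    \<Rightarrow> ('y \<times> 'z \<Rightarrow> real) \<Rightarrow> bool" where
  "X1 V u \<longleftrightarrow> H1 u \<and>
     integrable lebesgue (\<lambda>x. (u x)^2 / (norm (fst x))^2 + V x * (u x)^2)"

definition X1G :: "('y::euclidean_space \<times> 'z::euclidean_space \<Rightarrow> real)
                    \<Rightarrow> ('y \<times> 'z \<Rightarrow> real) \<Rightarrow> bool" where
  "X1G V u \<longleftrightarrow> X1 V u \<and> G_invariant u"

definition norm1sq :: "('y::euclidean_space \<times> 'z::euclidean_space \<Rightarrow> real)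
                    \<Rightarrow> ('y \<times> 'z \<Rightarrow> real) \<Rightarrow> real" where
  "norm1sq V u = (LINT x|lebesgue. (norm (grad u x))^2 + (u x)^2 / (norm (fst x))^2 + V x * (u x)^2)"

definition J1 :: "('y::euclidean_space \<times> 'z::euclidean_space \<Rightarrow> real) \<Rightarrow> (real \<Rightarrow> real)
                    \<Rightarrow> ('y \<times> 'z \<Rightarrow> real) \<Rightarrow> real" where
  "J1 V f u = norm1sq V u / 2 - (LINT x|lebesgue. prim f (u x))"

definition Nehari1 :: "('y::euclidean_space \<times> 'z::euclidean_space \<Rightarrow> real) \<Rightarrow> (real \<Rightarrow> real)
                    \<Rightarrow> ('y \<times> 'z \<Rightarrow> real) set" where
  "Nehari1 V f = {u. X1G V u \<and> \<not> (AE x in lebesgue. u x = 0)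
                     \<and> norm1sq V u = (LINT x|lebesgue. f (u x) * u x)}"

definition c1 :: "('y::euclidean_space \<times> 'z::euclidean_space \<Rightarrow> real) \<Rightarrow> (real \<Rightarrow> real) \<Rightarrow> real" where
  "c1 V f = Inf (J1 V f ` Nehari1 V f)"

definition J1_critical :: "('y::euclidean_space \<times> 'z::euclidean_space \<Rightarrow> real) \<Rightarrow> (real \<Rightarrow> real)
                    \<Rightarrow> ('y \<times> 'z \<Rightarrow> real) \<Rightarrow> bool" where
  "J1_critical V f u \<longleftrightarrow> (\<forall>\<epsilon>>0. \<exists>\<delta>>0. \<forall>h. X1 V h \<and> sqrt (norm1sq V h) < \<delta> \<longrightarrow>
      \<bar>J1 V f (\<lambda>x. u x + h x) - J1 V f u\<bar> \<le> \<epsilon> * sqrt (norm1sq V h))"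

definition Yspace :: "('y::euclidean_space \<times> 'z::euclidean_space \<Rightarrow> real) \<Rightarrow> bool" where
  "Yspace u \<longleftrightarrow> H1 u \<and> integrable lebesgue (\<lambda>x. (u x)^2 / (norm (fst x))^2)"

definition YG :: "('y::euclidean_space \<times> 'z::euclidean_space \<Rightarrow> real) \<Rightarrow> bool" where
  "YG u \<longleftrightarrow> Yspace u \<and> G_invariant u"

definition Qk :: "real \<Rightarrow> ('y::euclidean_space \<times> 'z::euclidean_space \<Rightarrow> real) \<Rightarrow> real" where
  "Qk k u = (LINT x|lebesgue. (norm (grad u x))^2 + (u x)^2 / (norm (fst x))^2 + k * (u x)^2)"

definition Phi :: "real \<Rightarrow> (real \<Rightarrow> real) \<Rightarrow> ('y::euclidean_space \<times> 'z::euclidean_space \<Rightarrow> real) \<Rightarrow> real" where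
  "Phi k f u = Qk k u / 2 - (LINT x|lebesgue. prim f (u x))"

definition Mk :: "real \<Rightarrow> (real \<Rightarrow> real) \<Rightarrow> ('y::euclidean_space \<times> 'z::euclidean_space \<Rightarrow> real) set" where
  "Mk k f = {u. YG u \<and> \<not> (AE x in lebesgue. u x = 0)
                \<and> Qk k u = (LINT x|lebesgue. f (u x) * u x)}"

definition mk :: "'y::euclidean_space itself \<Rightarrow> 'z::euclidean_space itself
                  \<Rightarrow> real \<Rightarrow> (real \<Rightarrow> real) \<Rightarrow> real" where
  "mk _ _ k f = Inf (Phi k f ` (Mk k f :: ('y \<times> 'z \<Rightarrow> real) set))"

end

theory Submission
  imports Defs "HOL-Complex_Analysis.Great_Picard" "HOL-Real_Asymp.Real_Asymp"
begin

text \<open>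
  A minimising sequence on the Nehari set is bounded, by superquadraticity of the primitive, and almost critical. Up to
  a subsequence it converges almost everywhere and locally in L2 to some U. If U vanishes, the mass escapes to infinity,
  where the potential is essentially at least Vinf; rescaling the sequence onto the Nehari set of the constant potential
  Vinf raises the energy by o(1) at most, which gives the second alternative. If U does not vanish, it is critical in the
  invariant directions, and Fatou's lemma for the nonnegative density f(u)u/2 - F(u) gives J1(U) = c1. Criticality
  in all directions follows because J1'(U) takes the same value at h and at some invariant function, the weak limit of
  norm-minimising midpoint combinations of the orbit of h.

  The subcritical Sobolev inequality and local compactness both come from averages over balls of radius 2^-k:
  the translation estimate for weak gradients bounds u minus its average in L2 by 2^-k times the norm of the gradient,
  while the averages are bounded by a multiple of 2^(k(N/2-1)), so comparing |u| with these levels and summing gives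
  the L^q bound exactly for q < 2N/(N-2).
\<close>

section \<open>Square integrable functions\<close>

lemma mult_le_weighted_squares:
  fixes a b e :: real
  assumes "e > 0" shows "a * b \<le> e * a\<^sup>2 + 1 / (4 * e) * b\<^sup>2"
proof -
  have "0 \<le> e * (a - b / (2 * e))\<^sup>2" using assms by simp
  also have "\<dots> = e * a\<^sup>2 - a * b + 1 / (4 * e) * b\<^sup>2" using assms by (simp add: power2_eq_square field_simps)
  finally show ?thesis by simp
qed

definition L2 :: "('a::euclidean_space \<Rightarrow> 'b::euclidean_space) \<Rightarrow> bool" where
  "L2 g \<longleftrightarrow> g \<in> borel_measurable lebesgue \<and> integrable lebesgue (\<lambda>x. (norm (g x))\<^sup>2)"

definition norm2sq :: "('a::euclidean_space \<Rightarrow> 'b::euclidean_space) \<Rightarrow> real" where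
  "norm2sq g = (LINT x|lebesgue. (norm (g x))\<^sup>2)"

abbreviation norm2 :: "('a::euclidean_space \<Rightarrow> 'b::euclidean_space) \<Rightarrow> real" where
  "norm2 g \<equiv> sqrt (norm2sq g)"

definition inner2 :: "('a::euclidean_space \<Rightarrow> 'b::euclidean_space) \<Rightarrow> ('a \<Rightarrow> 'b) \<Rightarrow> real" where
  "inner2 g h = (LINT x|lebesgue. g x \<bullet> h x)"

lemma L2_measurable [measurable_dest]: "L2 g \<Longrightarrow> g \<in> borel_measurable lebesgue"
  by (simp add: L2_def)

lemma L2_integrable_norm_sq: "L2 g \<Longrightarrow> integrable lebesgue (\<lambda>x. (norm (g x))\<^sup>2)"
  by (simp add: L2_def)

lemma L2_norm_mult_integrable:
  assumes "L2 g" "L2 h" shows "integrable lebesgue (\<lambda>x. norm (g x) * norm (h x))"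
proof (rule Bochner_Integration.integrable_bound)
  note [measurable] = assms
  show "integrable lebesgue (\<lambda>x. (norm (g x))\<^sup>2 + (norm (h x))\<^sup>2)"
    using assms by (auto simp: L2_def)
  show "(\<lambda>x. norm (g x) * norm (h x)) \<in> borel_measurable lebesgue" by measurable
  have "a * b \<le> a\<^sup>2 + b\<^sup>2" if "0 \<le> a" "0 \<le> b" for a b :: real
    using sum_squares_bound[of a b] mult_nonneg_nonneg[OF that] by linarith
  then show "AE x in lebesgue. norm (norm (g x) * norm (h x)) \<le> norm ((norm (g x))\<^sup>2 + (norm (h x))\<^sup>2)"
    by simp
qed

lemma L2_inner_integrable:
  assumes "L2 g" "L2 h" shows "integrable lebesgue (\<lambda>x. g x \<bullet> h x)"
proof (rule Bochner_Integration.integrable_bound[OF L2_norm_mult_integrable[OF assms]])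
  note [measurable] = assms
  show "(\<lambda>x. g x \<bullet> h x) \<in> borel_measurable lebesgue" by measurable
qed (use Cauchy_Schwarz_ineq2 in auto)

lemma L2_mult_integrable:
  fixes u v :: "'a::euclidean_space \<Rightarrow> real"
  assumes "L2 u" "L2 v" shows "integrable lebesgue (\<lambda>x. u x * v x)"
  using L2_inner_integrable[OF assms] by simp

lemma norm2sq_eq_inner2: "norm2sq g = inner2 g g"
  by (simp add: norm2sq_def inner2_def power2_norm_eq_inner)

lemma norm2sq_nonneg [simp]: "0 \<le> norm2sq g"
  by (simp add: norm2sq_def)

lemma inner2_commute: "inner2 g h = inner2 h g"
  by (simp add: inner2_def inner_commute)

lemma L2_add: assumes "L2 g" "L2 h" shows "L2 (\<lambda>x. g x + h x)"
proof -
  have "integrable lebesgue (\<lambda>x. g x \<bullet> g x + 2 * (g x \<bullet> h x) + h x \<bullet> h x)"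
    using L2_inner_integrable[OF assms] L2_inner_integrable[OF assms(1,1)] L2_inner_integrable[OF assms(2,2)]
    by simp
  then show ?thesis using assms
    by (auto simp: L2_def power2_norm_eq_inner inner_add_left inner_add_right inner_commute algebra_simps)
qed

lemma L2_scaleR: assumes "L2 g" shows "L2 (\<lambda>x. c *\<^sub>R g x)"
  using assms by (auto simp: L2_def power_mult_distrib)

lemma L2_cmult: fixes g :: "'a::euclidean_space \<Rightarrow> real" assumes "L2 g" shows "L2 (\<lambda>x. c * g x)"
  using L2_scaleR[OF assms, of c] by simp

lemma L2_minus: assumes "L2 g" shows "L2 (\<lambda>x. - g x)"
  using assms by (auto simp: L2_def)

lemma L2_diff: assumes "L2 g" "L2 h" shows "L2 (\<lambda>x. g x - h x)"
  using L2_add[OF assms(1) L2_minus[OF assms(2)]] by simp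

lemma norm2sq_minus_commute: "norm2sq (\<lambda>x. g x - h x) = norm2sq (\<lambda>x. h x - g x)"
  by (simp add: norm2sq_def norm_minus_commute)

lemma inner2_add_left: "L2 g \<Longrightarrow> L2 g' \<Longrightarrow> L2 h \<Longrightarrow> inner2 (\<lambda>x. g x + g' x) h = inner2 g h + inner2 g' h"
  by (simp add: inner2_def inner_add_left L2_inner_integrable)

lemma inner2_diff_left: "L2 g \<Longrightarrow> L2 g' \<Longrightarrow> L2 h \<Longrightarrow> inner2 (\<lambda>x. g x - g' x) h = inner2 g h - inner2 g' h"
  by (simp add: inner2_def inner_diff_left L2_inner_integrable)

lemma inner2_diff_right: "L2 g \<Longrightarrow> L2 h \<Longrightarrow> L2 h' \<Longrightarrow> inner2 g (\<lambda>x. h x - h' x) = inner2 g h - inner2 g h'"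
  by (simp add: inner2_def inner_diff_right L2_inner_integrable)

lemma inner2_scaleR_left: "inner2 (\<lambda>x. c *\<^sub>R g x) h = c * inner2 g h"
  by (simp add: inner2_def)

lemma norm2sq_scaleR: "norm2sq (\<lambda>x. c *\<^sub>R g x) = c\<^sup>2 * norm2sq g"
  by (simp add: norm2sq_def power_mult_distrib)

lemma norm2sq_add: assumes "L2 g" "L2 h"
  shows "norm2sq (\<lambda>x. g x + h x) = norm2sq g + 2 * inner2 g h + norm2sq h"
  using L2_inner_integrable[OF assms] L2_inner_integrable[OF assms(1,1)] L2_inner_integrable[OF assms(2,2)]
  by (simp add: norm2sq_eq_inner2 inner2_def inner_add_left inner_add_right inner_commute)

lemma norm2sq_diff: assumes "L2 g" "L2 h"
  shows "norm2sq (\<lambda>x. g x - h x) = norm2sq g - 2 * inner2 g h + norm2sq h"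
  using L2_inner_integrable[OF assms] L2_inner_integrable[OF assms(1,1)] L2_inner_integrable[OF assms(2,2)]
  by (simp add: norm2sq_eq_inner2 inner2_def inner_diff_left inner_diff_right inner_commute)

lemma norm2sq_parallelogram: assumes "L2 g" "L2 h"
  shows "norm2sq (\<lambda>x. g x - h x)
    = 2 * norm2sq g + 2 * norm2sq h - 4 * norm2sq (\<lambda>x. (1/2) *\<^sub>R (g x + h x))"
  by (simp only: norm2sq_scaleR[of "1/2"] norm2sq_add[OF assms] norm2sq_diff[OF assms])
     (simp add: power2_eq_square field_simps)

lemma inner2_Cauchy_Schwarz:
  assumes "L2 g" "L2 h" shows "\<bar>inner2 g h\<bar> \<le> norm2 g * norm2 h"
proof -
  note [measurable] = assms
  define I where "I = (LINT x|lebesgue. norm (g x) * norm (h x))"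
  have I: "0 \<le> I" by (simp add: I_def)
  have "ennreal (I\<^sup>2) = (\<integral>\<^sup>+x. ennreal (norm (g x)) * ennreal (norm (h x)) \<partial>lebesgue)\<^sup>2"
    using nn_integral_eq_integral[OF L2_norm_mult_integrable[OF assms]] I
    by (simp add: I_def ennreal_mult flip: ennreal_power)
  also have "\<dots> \<le> (\<integral>\<^sup>+x. ennreal (norm (g x)) ^ 2 \<partial>lebesgue) * (\<integral>\<^sup>+x. ennreal (norm (h x)) ^ 2 \<partial>lebesgue)"
    by (rule Cauchy_Schwarz_nn_integral) measurable
  also have "\<dots> = ennreal (norm2sq g * norm2sq h)"
    using assms by (simp add: ennreal_power L2_def norm2sq_def nn_integral_eq_integral ennreal_mult)
  finally have "I\<^sup>2 \<le> norm2sq g * norm2sq h" by (subst (asm) ennreal_le_iff) auto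
  then have "I \<le> norm2 g * norm2 h" by (simp add: real_le_rsqrt flip: real_sqrt_mult)
  moreover have "\<bar>inner2 g h\<bar> \<le> I"
    unfolding inner2_def I_def
    using Cauchy_Schwarz_ineq2
    by (intro order_trans[OF integral_abs_bound] integral_mono integrable_abs L2_inner_integrable
        L2_norm_mult_integrable assms)
  ultimately show ?thesis by simp
qed

lemma norm2_triangle: assumes "L2 g" "L2 h" shows "norm2 (\<lambda>x. g x + h x) \<le> norm2 g + norm2 h"
proof (rule real_le_lsqrt)
  show "norm2sq (\<lambda>x. g x + h x) \<le> (norm2 g + norm2 h)\<^sup>2"
    using inner2_Cauchy_Schwarz[OF assms] by (simp add: norm2sq_add[OF assms] power2_sum)
qed auto

lemma norm2sq_add_le: assumes "L2 g" "L2 h" shows "norm2sq (\<lambda>x. g x + h x) \<le> 2 * norm2sq g + 2 * norm2sq h"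
  using norm2sq_parallelogram[OF assms] norm2sq_scaleR[of "1/2" "\<lambda>x. g x + h x"] norm2sq_nonneg[of "\<lambda>x. g x - h x"]
  by (simp add: power2_eq_square)

lemma norm2sq_diff_le: assumes "L2 g" "L2 h" shows "norm2sq (\<lambda>x. g x - h x) \<le> 2 * norm2sq g + 2 * norm2sq h"
  using norm2sq_add_le[OF assms(1) L2_minus[OF assms(2)]] by (simp add: norm2sq_def)

lemma norm2sq_midpoint_le:
  assumes "L2 g" "L2 h" "norm2sq g \<le> M" "norm2sq h \<le> M"
  shows "norm2sq (\<lambda>x. (1/2) *\<^sub>R (g x + h x)) \<le> M"
  using norm2sq_parallelogram[OF assms(1,2)] norm2sq_nonneg[of "\<lambda>x. g x - h x"] assms(3,4) by linarith

lemma norm2sq_mono: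
  assumes "L2 h" "AE x in lebesgue. norm (g x) \<le> norm (h x)" shows "norm2sq g \<le> norm2sq h"
  unfolding norm2sq_def
proof (rule integral_mono_AE')
  show "integrable lebesgue (\<lambda>x. (norm (h x))\<^sup>2)" using assms(1) by (rule L2_integrable_norm_sq)
  show "AE x in lebesgue. (norm (g x))\<^sup>2 \<le> (norm (h x))\<^sup>2"
    using assms(2) by (auto intro: power_mono)
qed auto

lemma L2_bound:
  assumes "L2 h" "g \<in> borel_measurable lebesgue" "AE x in lebesgue. norm (g x) \<le> norm (h x)" shows "L2 g"
proof -
  have "integrable lebesgue (\<lambda>x. (norm (g x))\<^sup>2)"
    by (rule Bochner_Integration.integrable_bound[OF L2_integrable_norm_sq[OF assms(1)]])
       (use assms in \<open>auto intro: power_mono\<close>)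
  then show ?thesis using assms by (simp add: L2_def)
qed

lemma AE_measurable_lebesgue:
  fixes g :: "'a::euclidean_space \<Rightarrow> 'b::euclidean_space"
  assumes "g \<in> borel_measurable lebesgue" "AE x in lebesgue. h x = g x"
  shows "h \<in> borel_measurable lebesgue"
proof (rule borel_measurable_AE[OF assms(1)])
  show "AE x in lebesgue. g x = h x" using assms(2) by (simp add: eq_commute)
qed

lemma L2_AE_cong:
  assumes "L2 g" "AE x in lebesgue. h x = g x" shows "L2 h"
  using assms(2)
  by (intro L2_bound[OF assms(1) AE_measurable_lebesgue[OF L2_measurable[OF assms(1)] assms(2)]]) auto

lemma norm2sq_AE_cong:
  assumes "g \<in> borel_measurable lebesgue" "AE x in lebesgue. h x = g x" shows "norm2sq h = norm2sq g"
proof -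
  note [measurable] = assms(1) AE_measurable_lebesgue[OF assms]
  show ?thesis unfolding norm2sq_def by (rule integral_cong_AE) (use assms(2) in auto)
qed

lemma inner2_AE_cong:
  assumes "L2 g" "L2 h" "AE x in lebesgue. g' x = g x" "AE x in lebesgue. h' x = h x"
  shows "inner2 g' h' = inner2 g h"
proof -
  note [measurable] = assms(1,2) L2_AE_cong[OF assms(1,3)] L2_AE_cong[OF assms(2,4)]
  show ?thesis unfolding inner2_def
  proof (rule integral_cong_AE)
    show "AE x in lebesgue. g' x \<bullet> h' x = g x \<bullet> h x" using assms(3,4) by eventually_elim simp
  qed measurable
qed

lemma norm2sq_eq_0: assumes "L2 g" "norm2sq g = 0" shows "AE x in lebesgue. g x = 0"
  using assms integral_nonneg_eq_0_iff_AE[of lebesgue "\<lambda>x. (norm (g x))\<^sup>2"]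
  by (auto simp: L2_def norm2sq_def)

lemma
  assumes "L2 g"
  shows L2_component: "L2 (\<lambda>x. g x \<bullet> v)"
    and norm2_component_le: "norm2 (\<lambda>x. g x \<bullet> v) \<le> norm v * norm2 g"
proof -
  note [measurable] = assms
  have in_L2: "L2 (\<lambda>x. norm v *\<^sub>R g x)" by (rule L2_scaleR[OF assms])
  have bound: "AE x in lebesgue. norm (g x \<bullet> v) \<le> norm (norm v *\<^sub>R g x)"
    using Cauchy_Schwarz_ineq2[of "g x" v for x] by (intro AE_I2) (simp add: mult.commute[of "norm v"])
  show "L2 (\<lambda>x. g x \<bullet> v)" by (rule L2_bound[OF in_L2 _ bound]) measurable
  show "norm2 (\<lambda>x. g x \<bullet> v) \<le> norm v * norm2 g"
    using real_sqrt_le_mono[OF norm2sq_mono[OF in_L2 bound]] by (simp add: norm2sq_scaleR real_sqrt_mult)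
qed

lemma L2_scaleR_const: fixes u :: "'a::euclidean_space \<Rightarrow> real" assumes "L2 u" shows "L2 (\<lambda>x. u x *\<^sub>R v)"
proof -
  note [measurable] = assms
  show ?thesis
    by (rule L2_bound[OF L2_cmult[OF assms, of "norm v"]]) (auto simp: mult.commute[of "norm v"])
qed

lemma inner2_component: "inner2 (\<lambda>x. g x \<bullet> v) u = inner2 g (\<lambda>x. u x *\<^sub>R v)"
  by (simp add: inner2_def mult.commute)

lemma inner2_eq_sum_components:
  assumes "L2 g" "L2 h" shows "inner2 g h = (\<Sum>e\<in>Basis. inner2 (\<lambda>x. g x \<bullet> e) (\<lambda>x. h x \<bullet> e))"
proof -
  have "inner2 g h = (LINT x|lebesgue. (\<Sum>e\<in>Basis. (g x \<bullet> e) * (h x \<bullet> e)))"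
    unfolding inner2_def by (intro Bochner_Integration.integral_cong refl) (rule euclidean_inner)
  also have "\<dots> = (\<Sum>e\<in>Basis. LINT x|lebesgue. (g x \<bullet> e) * (h x \<bullet> e))"
    by (intro Bochner_Integration.integral_sum L2_mult_integrable L2_component assms)
  finally show ?thesis by (simp add: inner2_def)
qed

lemma L2_Pair_iff: "L2 (\<lambda>x. (g x, h x)) \<longleftrightarrow> L2 g \<and> L2 h"
proof
  assume in_L2: "L2 (\<lambda>x. (g x, h x))"
  have "(\<lambda>x. fst (g x, h x)) \<in> borel_measurable lebesgue" "(\<lambda>x. snd (g x, h x)) \<in> borel_measurable lebesgue"
    by (rule measurable_compose[OF L2_measurable[OF in_L2]], intro borel_measurable_continuous_onI continuous_intros)+
  then show "L2 g \<and> L2 h" by (auto intro!: L2_bound[OF in_L2] simp: norm_fst_le norm_snd_le)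
next
  assume in_L2: "L2 g \<and> L2 h"
  have "(norm (g x, h x))\<^sup>2 = (norm (g x))\<^sup>2 + (norm (h x))\<^sup>2" for x by (simp add: norm_Pair)
  then show "L2 (\<lambda>x. (g x, h x))" using in_L2 by (auto simp: L2_def intro!: borel_measurable_Pair)
qed

lemma inner2_Pair:
  assumes "L2 g" "L2 h" "L2 g'" "L2 h'"
  shows "inner2 (\<lambda>x. (g x, h x)) (\<lambda>x. (g' x, h' x)) = inner2 g g' + inner2 h h'"
  using assms by (simp add: inner2_def L2_inner_integrable)

lemma norm2sq_Pair: "L2 g \<Longrightarrow> L2 h \<Longrightarrow> norm2sq (\<lambda>x. (g x, h x)) = norm2sq g + norm2sq h"
  by (simp add: norm2sq_eq_inner2 inner2_Pair)

lemma nn_integral_norm2sq: "L2 g \<Longrightarrow> (\<integral>\<^sup>+x. ennreal ((norm (g x))\<^sup>2) \<partial>lebesgue) = ennreal (norm2sq g)"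
  by (simp add: L2_def norm2sq_def nn_integral_eq_integral)

lemma L2_if_nn_integral_le:
  assumes "g \<in> borel_measurable lebesgue" "(\<integral>\<^sup>+x. ennreal ((norm (g x))\<^sup>2) \<partial>lebesgue) \<le> ennreal C" "0 \<le> C"
  shows "L2 g" "norm2sq g \<le> C"
proof -
  have "integrable lebesgue (\<lambda>x. (norm (g x))\<^sup>2)"
    using assms by (intro integrableI_nonneg) (auto intro: le_less_trans)
  then show in_L2: "L2 g" using assms by (simp add: L2_def)
  show "norm2sq g \<le> C" using assms(2,3) unfolding nn_integral_norm2sq[OF in_L2] by simp
qed

subsection \<open>Fatou's lemma, almost everywhere convergence and completeness\<close>

lemma AE_LIMSEQ_measurable:
  fixes g :: "nat \<Rightarrow> 'a::euclidean_space \<Rightarrow> 'b::euclidean_space"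
  assumes "\<And>n. g n \<in> borel_measurable lebesgue" "AE x in lebesgue. (\<lambda>n. g n x) \<longlonglongrightarrow> G x"
  shows "G \<in> borel_measurable lebesgue"
proof (rule AE_measurable_lebesgue)
  show "(\<lambda>x. lim (\<lambda>n. g n x)) \<in> borel_measurable lebesgue" using assms(1) by measurable
  show "AE x in lebesgue. G x = lim (\<lambda>n. g n x)" using assms(2) by (auto simp: limI)
qed

lemma nn_integral_Fatou_continuous:
  fixes \<Phi> :: "'b::euclidean_space \<Rightarrow> real" and g :: "nat \<Rightarrow> 'a::euclidean_space \<Rightarrow> 'b"
  assumes \<Phi>: "continuous_on UNIV \<Phi>" and g: "\<And>n. g n \<in> borel_measurable lebesgue"
    and lim: "AE x in lebesgue. (\<lambda>n. g n x) \<longlonglongrightarrow> G x"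
  shows "(\<integral>\<^sup>+x. ennreal (\<Phi> (G x)) \<partial>lebesgue) \<le> liminf (\<lambda>n. \<integral>\<^sup>+x. ennreal (\<Phi> (g n x)) \<partial>lebesgue)"
proof -
  have [measurable]: "\<Phi> \<in> borel_measurable borel" by (rule borel_measurable_continuous_onI[OF \<Phi>])
  note [measurable] = g
  have "(\<integral>\<^sup>+x. ennreal (\<Phi> (G x)) \<partial>lebesgue) = (\<integral>\<^sup>+x. liminf (\<lambda>n. ennreal (\<Phi> (g n x))) \<partial>lebesgue)"
  proof (rule nn_integral_cong_AE, use lim in eventually_elim)
    fix x assume "(\<lambda>n. g n x) \<longlonglongrightarrow> G x"
    then have "(\<lambda>n. \<Phi> (g n x)) \<longlonglongrightarrow> \<Phi> (G x)"
      using \<Phi> by (intro continuous_on_tendsto_compose[where s=UNIV and f=\<Phi>]) auto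
    then have "(\<lambda>n. ennreal (\<Phi> (g n x))) \<longlonglongrightarrow> ennreal (\<Phi> (G x))" by (rule tendsto_ennrealI)
    then show "ennreal (\<Phi> (G x)) = liminf (\<lambda>n. ennreal (\<Phi> (g n x)))"
      by (intro lim_imp_Liminf[symmetric]) auto
  qed
  also have "\<dots> \<le> liminf (\<lambda>n. \<integral>\<^sup>+x. ennreal (\<Phi> (g n x)) \<partial>lebesgue)"
    by (rule nn_integral_liminf) measurable
  finally show ?thesis .
qed

lemma L2_Fatou:
  assumes g: "\<And>n. L2 (g n)" and C: "\<And>n. norm2sq (g n) \<le> C"
    and lim: "AE x in lebesgue. (\<lambda>n. g n x) \<longlonglongrightarrow> G x"
  shows "L2 G" "norm2sq G \<le> C"
proof -
  have "(\<integral>\<^sup>+x. ennreal ((norm (G x))\<^sup>2) \<partial>lebesgue) \<le> liminf (\<lambda>n. \<integral>\<^sup>+x. ennreal ((norm (g n x))\<^sup>2) \<partial>lebesgue)"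
    by (intro nn_integral_Fatou_continuous L2_measurable g lim continuous_intros)
  also have "\<dots> \<le> ennreal C"
    using g C by (intro Liminf_le) (auto simp: nn_integral_norm2sq intro!: ennreal_leI always_eventually)
  finally show "L2 G" "norm2sq G \<le> C"
    using L2_if_nn_integral_le[OF AE_LIMSEQ_measurable[OF L2_measurable[OF g] lim]] order_trans[OF norm2sq_nonneg C]
    by auto
qed

lemma AE_summable_if_norm2sq_le_geometric:
  fixes d :: "nat \<Rightarrow> 'a::euclidean_space \<Rightarrow> 'b::euclidean_space"
  assumes d: "\<And>j. L2 (d j)" "\<And>j. norm2sq (d j) \<le> C * (1/4)^j"
  shows "AE x in lebesgue. summable (\<lambda>j. norm (d j x))"
proof -
  note [measurable] = d(1)
  have C: "0 \<le> C" using order_trans[OF norm2sq_nonneg d(2)[of 0]] by simp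
  have "(\<integral>\<^sup>+x. (\<Sum>j. ennreal (2^j * (norm (d j x))\<^sup>2)) \<partial>lebesgue) = (\<Sum>j. ennreal (2^j * norm2sq (d j)))"
    by (subst nn_integral_suminf) (simp_all add: ennreal_mult' nn_integral_cmult nn_integral_norm2sq d(1))
  also have "\<dots> \<le> (\<Sum>j. ennreal (C * (1/2)^j))"
  proof (intro suminf_le ennreal_leI)
    fix j :: nat
    have "2^j * norm2sq (d j) \<le> 2^j * (C * (1/4)^j)" using d(2) by (intro mult_left_mono) auto
    also have "\<dots> = C * (1/2)^j" by (simp flip: power_mult_distrib)
    finally show "2^j * norm2sq (d j) \<le> C * (1/2)^j" .
  qed auto
  also have "\<dots> < \<infinity>"
    using C by (subst suminf_ennreal2) (auto intro!: summable_mult simp: top.not_eq_extremum[symmetric])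
  finally have "AE x in lebesgue. (\<Sum>j. ennreal (2^j * (norm (d j x))\<^sup>2)) \<noteq> \<infinity>"
    by (intro nn_integral_noteq_infinite) auto
  then show ?thesis
  proof eventually_elim
    fix x assume "(\<Sum>j. ennreal (2^j * (norm (d j x))\<^sup>2)) \<noteq> \<infinity>"
    then have "summable (\<lambda>j. 2^j * (norm (d j x))\<^sup>2)"
      by (intro summable_suminf_not_top) auto
    then have "summable (\<lambda>j. 2^j * (norm (d j x))\<^sup>2 + 1/4 * (1/2)^j)" by (intro summable_add summable_mult) auto
    then show "summable (\<lambda>j. norm (d j x))"
    proof (rule summable_comparison_test'[where N=0])
      show "norm (norm (d j x)) \<le> 2^j * (norm (d j x))\<^sup>2 + 1/4 * (1/2)^j" for j
        using mult_le_weighted_squares[of "2^j" "norm (d j x)" 1] by (simp add: power_divide)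
    qed
  qed
qed

lemma convergent_if_summable_increments:
  fixes a :: "nat \<Rightarrow> 'a::banach"
  assumes "summable (\<lambda>j. a (Suc j) - a j)" shows "convergent a"
proof -
  have "convergent (\<lambda>n. \<Sum>j<n. a (Suc j) - a j)" using assms by (simp add: summable_iff_convergent)
  then have "convergent (\<lambda>n. (a n - a 0) + a 0)"
    by (intro convergent_add convergent_const) (simp add: sum_lessThan_telescope[of a])
  then show ?thesis by simp
qed

definition norm2sq_on :: "'a::euclidean_space set \<Rightarrow> ('a \<Rightarrow> 'b::euclidean_space) \<Rightarrow> real" where
  "norm2sq_on S g = norm2sq (\<lambda>x. indicator S x *\<^sub>R g x)"

definition L2_Cauchy_on :: "'a::euclidean_space set \<Rightarrow> (nat \<Rightarrow> 'a \<Rightarrow> 'b::euclidean_space) \<Rightarrow> bool" where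
  "L2_Cauchy_on S g \<longleftrightarrow> (\<forall>e>0. \<exists>N. \<forall>m\<ge>N. \<forall>n\<ge>N. norm2sq_on S (\<lambda>x. g m x - g n x) \<le> e)"

lemma L2_indicator:
  assumes "L2 g" "S \<in> sets lebesgue" shows "L2 (\<lambda>x. indicator S x *\<^sub>R g x)"
proof (rule L2_bound[OF assms(1)])
  note [measurable] = assms
  show "(\<lambda>x. indicat_real S x *\<^sub>R g x) \<in> borel_measurable lebesgue" by measurable
qed (auto simp: indicator_def)

lemma norm2sq_on_nonneg [simp]: "0 \<le> norm2sq_on S g"
  by (simp add: norm2sq_on_def)

lemma norm2sq_on_UNIV [simp]: "norm2sq_on UNIV g = norm2sq g"
  by (simp add: norm2sq_on_def)

lemma norm2sq_on_le: assumes "L2 g" shows "norm2sq_on S g \<le> norm2sq g"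
  unfolding norm2sq_on_def by (rule norm2sq_mono[OF assms]) (auto simp: indicator_def)

lemma L2_Cauchy_on_if_UNIV:
  assumes "\<And>n. L2 (g n)" "L2_Cauchy_on UNIV g" shows "L2_Cauchy_on S g"
  using assms norm2sq_on_le[OF L2_diff[OF assms(1) assms(1)], of S]
  unfolding L2_Cauchy_on_def norm2sq_on_UNIV by (meson order_trans)

lemma strict_mono_dominating:
  fixes N :: "nat \<Rightarrow> nat"
  obtains r :: "nat \<Rightarrow> nat" where "strict_mono r" "\<And>j. N j \<le> r j"
proof
  define r where "r j = (\<Sum>i\<le>j. Suc (N i))" for j
  show "strict_mono r" by (rule strict_mono_Suc_iff[THEN iffD2]) (auto simp: r_def)
  have "N j \<le> Suc (N j)" for j by simp
  also have "Suc (N j) \<le> r j" for j unfolding r_def by (intro member_le_sum) auto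
  finally show "N j \<le> r j" for j .
qed

lemma AE_convergent_subseq_if_locally_L2_Cauchy:
  fixes g :: "nat \<Rightarrow> 'a::euclidean_space \<Rightarrow> 'b::euclidean_space"
  assumes g: "\<And>n. L2 (g n)" and Cauchy: "\<And>R. L2_Cauchy_on (ball 0 R) g"
  obtains r :: "nat \<Rightarrow> nat" where "strict_mono r" "AE x in lebesgue. convergent (\<lambda>n. g (r n) x)"
proof -
  have "\<exists>N. \<forall>m\<ge>N. \<forall>n\<ge>N. norm2sq_on (ball 0 (real j)) (\<lambda>x. g m x - g n x) \<le> (1/4)^j" for j
    using Cauchy[of "real j"] unfolding L2_Cauchy_on_def by (elim allE[of _ "(1/4)^j"]) simp
  then obtain N where N: "\<And>j m n. N j \<le> m \<Longrightarrow> N j \<le> n \<Longrightarrow>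
      norm2sq_on (ball 0 (real j)) (\<lambda>x. g m x - g n x) \<le> (1/4)^j" by metis
  obtain r where r: "strict_mono r" "\<And>j. N j \<le> r j" by (rule strict_mono_dominating[of N]) (rule that)
  define d where "d j x = indicator (ball 0 (real j)) x *\<^sub>R (g (r (Suc j)) x - g (r j) x)" for j x
  have "L2 (d j)" for j unfolding d_def[abs_def] by (intro L2_indicator L2_diff g) simp
  moreover have "norm2sq (d j) \<le> 1 * (1/4)^j" for j
  proof -
    have "N j \<le> r (Suc j)" using r(2)[of j] strict_monoD[OF r(1), of j "Suc j"] by simp
    then show ?thesis using N[OF _ r(2)] by (simp add: d_def[abs_def] norm2sq_on_def)
  qed
  ultimately have "AE x in lebesgue. summable (\<lambda>j. norm (d j x))"
    by (rule AE_summable_if_norm2sq_le_geometric)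
  then have "AE x in lebesgue. convergent (\<lambda>j. g (r j) x)"
  proof eventually_elim
    fix x assume "summable (\<lambda>j. norm (d j x))"
    then have "summable (\<lambda>j. d j x)" by (rule summable_norm_cancel)
    moreover obtain J :: nat where J: "norm x < real J" using reals_Archimedean2 by blast
    have "\<forall>\<^sub>F j in sequentially. d j x = g (r (Suc j)) x - g (r j) x"
      by (rule eventually_sequentiallyI[of J]) (use J in \<open>auto simp: d_def\<close>)
    ultimately have "summable (\<lambda>j. g (r (Suc j)) x - g (r j) x)"
      using summable_cong by fastforce
    then show "convergent (\<lambda>j. g (r j) x)" by (rule convergent_if_summable_increments)
  qed
  then show ?thesis using r(1) that by blast
qed

lemma L2_Cauchy_on_imp_tendsto:
  fixes g :: "nat \<Rightarrow> 'a::euclidean_space \<Rightarrow> 'b::euclidean_space"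
  assumes g: "\<And>n. L2 (g n)" and S: "S \<in> sets lebesgue" and Cauchy: "L2_Cauchy_on S g"
    and r: "strict_mono r" and lim: "AE x in lebesgue. (\<lambda>i. g (r i) x) \<longlonglongrightarrow> G x"
  shows "L2 (\<lambda>x. indicator S x *\<^sub>R (g n x - G x))" and "(\<lambda>n. norm2sq_on S (\<lambda>x. g n x - G x)) \<longlonglongrightarrow> 0"
proof -
  have lim_diff: "AE x in lebesgue. (\<lambda>i. indicator S x *\<^sub>R (g n x - g (r (i + N)) x)) \<longlonglongrightarrow> indicator S x *\<^sub>R (g n x - G x)"
    for n N using lim by eventually_elim (intro tendsto_intros LIMSEQ_ignore_initial_segment)
  have in_L2: "L2 (\<lambda>x. indicator S x *\<^sub>R (g n x - g m x))" for n m by (intro L2_indicator L2_diff g S)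
  have close: "norm2sq_on S (\<lambda>x. g n x - G x) \<le> e"
    if N: "\<forall>m\<ge>N. \<forall>n\<ge>N. norm2sq_on S (\<lambda>x. g m x - g n x) \<le> e" and n: "N \<le> n" for e N n
    unfolding norm2sq_on_def
  proof (rule L2_Fatou(2)[OF in_L2 _ lim_diff])
    have "N \<le> r (i + N)" for i using seq_suble[OF r, of "i + N"] by simp
    then show "norm2sq (\<lambda>x. indicator S x *\<^sub>R (g n x - g (r (i + N)) x)) \<le> e" for i
      using N n by (simp add: norm2sq_on_def)
  qed
  show "(\<lambda>n. norm2sq_on S (\<lambda>x. g n x - G x)) \<longlonglongrightarrow> 0"
  proof (rule LIMSEQ_I)
    fix e :: real assume "0 < e"
    then obtain N where "\<forall>m\<ge>N. \<forall>n\<ge>N. norm2sq_on S (\<lambda>x. g m x - g n x) \<le> e / 2"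
      using Cauchy unfolding L2_Cauchy_on_def by (meson half_gt_zero)
    from close[OF this] show "\<exists>no. \<forall>n\<ge>no. norm (norm2sq_on S (\<lambda>x. g n x - G x) - 0) < e"
      using \<open>0 < e\<close> by (intro exI[of _ N]) fastforce
  qed
  obtain N where N: "\<forall>m\<ge>N. \<forall>n\<ge>N. norm2sq_on S (\<lambda>x. g m x - g n x) \<le> 1"
    using Cauchy unfolding L2_Cauchy_on_def by (meson zero_less_one)
  have "L2 (\<lambda>x. indicator S x *\<^sub>R (g N x - G x))"
  proof (rule L2_Fatou(1)[OF in_L2 _ lim_diff[of N N]])
    have "N \<le> r (i + N)" for i using seq_suble[OF r, of "i + N"] by simp
    then show "norm2sq (\<lambda>x. indicator S x *\<^sub>R (g N x - g (r (i + N)) x)) \<le> 1" for i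
      using N by (simp add: norm2sq_on_def)
  qed
  from L2_add[OF in_L2[of n N] this] show "L2 (\<lambda>x. indicator S x *\<^sub>R (g n x - G x))"
    by (simp add: algebra_simps)
qed

lemma L2_complete:
  fixes g :: "nat \<Rightarrow> 'a::euclidean_space \<Rightarrow> 'b::euclidean_space"
  assumes g: "\<And>n. L2 (g n)" and Cauchy: "L2_Cauchy_on UNIV g"
  obtains G where "L2 G" "(\<lambda>n. norm2sq (\<lambda>x. g n x - G x)) \<longlonglongrightarrow> 0"
proof -
  obtain r :: "nat \<Rightarrow> nat" where r: "strict_mono r" and conv: "AE x in lebesgue. convergent (\<lambda>n. g (r n) x)"
    by (rule AE_convergent_subseq_if_locally_L2_Cauchy[OF g L2_Cauchy_on_if_UNIV[OF g Cauchy]]) (rule that)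
  define G where "G x = lim (\<lambda>n. g (r n) x)" for x
  have "AE x in lebesgue. (\<lambda>n. g (r n) x) \<longlonglongrightarrow> G x"
    using conv unfolding G_def by eventually_elim (simp add: convergent_LIMSEQ_iff)
  note lim = L2_Cauchy_on_imp_tendsto[OF g _ Cauchy r this, simplified]
  have "L2 G" using L2_diff[OF g lim(1), of 0 0] by simp
  then show ?thesis using lim(2) by (rule that)
qed

subsection \<open>Near-minimisers and weak limits\<close>

lemma minimising_sequence:
  fixes q :: "'a \<Rightarrow> real"
  assumes "\<And>n::nat. S n \<noteq> {}"
  obtains w where "\<And>n. w n \<in> S n" "\<And>n. q (w n) < Inf (q ` S n) + 1 / real (Suc n)"
proof -
  have "\<exists>v\<in>S n. q v < Inf (q ` S n) + 1 / real (Suc n)" for n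
    using cInf_lessD[of "q ` S n" "Inf (q ` S n) + 1 / real (Suc n)"] assms[of n] by auto
  then show ?thesis using that by metis
qed

inductive_set midpoint_hull :: "('a \<Rightarrow> 'b::real_vector) set \<Rightarrow> ('a \<Rightarrow> 'b) set" for S where
  base: "v \<in> S \<Longrightarrow> v \<in> midpoint_hull S"
| midpoint: "v \<in> midpoint_hull S \<Longrightarrow> w \<in> midpoint_hull S \<Longrightarrow> (\<lambda>x. (1/2) *\<^sub>R (v x + w x)) \<in> midpoint_hull S"

lemma midpoint_hull_mono: "v \<in> midpoint_hull S \<Longrightarrow> S \<subseteq> T \<Longrightarrow> v \<in> midpoint_hull T"
  by (induction rule: midpoint_hull.induct) (blast intro: midpoint_hull.intros)+

lemma midpoint_hull_L2_bounded:
  assumes "v \<in> midpoint_hull S" "\<And>v. v \<in> S \<Longrightarrow> L2 v \<and> norm2sq v \<le> M" shows "L2 v \<and> norm2sq v \<le> M"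
  using assms(1)
  by induction (auto simp: assms(2) intro!: L2_scaleR L2_add norm2sq_midpoint_le)

lemma L2_Cauchy_if_diff_le:
  assumes d: "convergent d" and e: "e \<longlonglongrightarrow> 0"
    and bound: "\<And>n m. n \<le> m \<Longrightarrow> norm2sq (\<lambda>x. w n x - w m x) \<le> (d m - d n) + e n"
  shows "L2_Cauchy_on UNIV w"
  unfolding L2_Cauchy_on_def norm2sq_on_UNIV
proof (intro allI impI)
  fix \<epsilon> :: real assume \<epsilon>: "0 < \<epsilon>"
  have "Cauchy d" using d by (simp add: Cauchy_convergent_iff)
  then obtain N1 where N1: "\<And>m n. m \<ge> N1 \<Longrightarrow> n \<ge> N1 \<Longrightarrow> \<bar>d m - d n\<bar> < \<epsilon> / 2"
    using CauchyD[of d "\<epsilon>/2"] \<epsilon> by auto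
  obtain N2 where N2: "\<And>n. n \<ge> N2 \<Longrightarrow> \<bar>e n\<bar> < \<epsilon> / 2" using LIMSEQ_D[OF e, of "\<epsilon>/2"] \<epsilon> by auto
  have "norm2sq (\<lambda>x. w n x - w m x) \<le> \<epsilon>" if "n \<le> m" "max N1 N2 \<le> n" for n m
  proof -
    have "N1 \<le> m" "N1 \<le> n" "N2 \<le> n" using that by auto
    then show ?thesis using bound[OF that(1)] N1[of m n] N2[of n] by linarith
  qed
  then show "\<exists>N. \<forall>m\<ge>N. \<forall>n\<ge>N. norm2sq (\<lambda>x. w m x - w n x) \<le> \<epsilon>"
    by (metis linear norm2sq_minus_commute)
qed

text \<open>Near-minimisers of the norm over the midpoint hulls of the tails form a Cauchy sequence by the
  parallelogram law; this replaces weak sequential compactness.\<close>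

lemma L2_Mazur:
  fixes g :: "nat \<Rightarrow> 'a::euclidean_space \<Rightarrow> 'b::euclidean_space"
  assumes g: "\<And>n. L2 (g n)" "\<And>n. norm2sq (g n) \<le> C"
  obtains w G where "\<And>n. w n \<in> midpoint_hull (g ` {n..})" "L2 G" "(\<lambda>n. norm2sq (\<lambda>x. w n x - G x)) \<longlonglongrightarrow> 0"
proof -
  define H where "H n = midpoint_hull (g ` {n..})" for n
  define d where "d n = Inf (norm2sq ` H n)" for n
  have H: "L2 v \<and> norm2sq v \<le> C" if "v \<in> H n" for v n
    by (rule midpoint_hull_L2_bounded) (use that g in \<open>auto simp: H_def\<close>)
  have H_antimono: "H m \<subseteq> H n" if "n \<le> m" for m n
    unfolding H_def using that midpoint_hull_mono[of _ "g ` {m..}" "g ` {n..}"] by fastforce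
  have g_H: "g n \<in> H n" for n unfolding H_def by (rule midpoint_hull.base) auto
  have d_le: "d n \<le> norm2sq v" if "v \<in> H n" for v n
    unfolding d_def using that by (intro cInf_lower bdd_belowI[of _ 0]) auto
  have d_mono: "d n \<le> d m" if "n \<le> m" for n m
    unfolding d_def[of m] using g_H[of m] d_le H_antimono[OF that] by (intro cInf_greatest) auto
  have "convergent d"
  proof -
    have "0 \<le> d n" for n unfolding d_def using g_H by (intro cInf_greatest) auto
    moreover have "d n \<le> C" for n using d_le[OF g_H] g(2) by (rule order_trans)
    ultimately have "Bseq d" by (intro BseqI'[of _ C]) auto
    then show ?thesis using d_mono Bseq_mono_convergent by auto
  qed
  then have d_conv: "convergent (\<lambda>n. 2 * d n)" by (intro convergent_mult convergent_const)
  obtain w where w: "\<And>n. w n \<in> H n" "\<And>n. norm2sq (w n) < d n + 1 / real (Suc n)"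
    using minimising_sequence[of H norm2sq] g_H unfolding d_def by blast
  have near: "norm2sq (\<lambda>x. w n x - w m x) \<le> (2 * d m - 2 * d n) + 4 * (1 / real (Suc n))" if "n \<le> m" for n m
  proof -
    have w_mem: "w m \<in> H n" using w(1)[of m] H_antimono[OF that] by auto
    then have "(\<lambda>x. (1/2) *\<^sub>R (w n x + w m x)) \<in> H n"
      using w(1)[of n] unfolding H_def by (intro midpoint_hull.midpoint)
    then have "d n \<le> norm2sq (\<lambda>x. (1/2) *\<^sub>R (w n x + w m x))" by (rule d_le)
    moreover have "1 / real (Suc m) \<le> 1 / real (Suc n)" using that by (simp add: field_simps)
    ultimately show ?thesis
      using norm2sq_parallelogram[of "w n" "w m"] H[OF w(1)[of n]] H[OF w_mem] w(2)[of n] w(2)[of m] by simp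
  qed
  have "L2_Cauchy_on UNIV w"
    by (rule L2_Cauchy_if_diff_le[OF d_conv tendsto_mult_right_zero[OF LIMSEQ_Suc[OF lim_1_over_n]] near])
  then show ?thesis using L2_complete[of w] H[OF w(1)] that w(1) unfolding H_def by blast
qed


lemma integral_tendsto_0_almost_dominated:
  fixes F :: "nat \<Rightarrow> 'a \<Rightarrow> real"
  assumes F: "\<And>n. integrable M (F n)" and lim: "AE x in M. (\<lambda>n. F n x) \<longlonglongrightarrow> 0"
    and B: "\<And>n. integrable M (B n)" "\<And>n x. 0 \<le> B n x" "\<And>n. (LINT x|M. B n x) \<le> K"
    and dom: "\<And>e. e > 0 \<Longrightarrow> \<exists>G. integrable M G \<and> (\<forall>n. AE x in M. \<bar>F n x\<bar> \<le> G x + e * B n x)"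
  shows "(\<lambda>n. LINT x|M. F n x) \<longlonglongrightarrow> 0"
proof (rule LIMSEQ_I)
  fix e :: real assume e: "0 < e"
  have K: "0 \<le> K" using B(2,3)[of 0] by (meson Bochner_Integration.integral_nonneg order_trans)
  define d where "d = e / (2 * (K + 1))"
  have d: "d > 0" using e K by (simp add: d_def)
  obtain G where G: "integrable M G" "\<And>n. AE x in M. \<bar>F n x\<bar> \<le> G x + d * B n x"
    using dom[OF d] by blast
  note [measurable] = F B(1) G(1)
  define W where "W n x = max 0 (\<bar>F n x\<bar> - d * B n x)" for n x
  have "(\<lambda>n. LINT x|M. W n x) \<longlonglongrightarrow> (LINT x|M. (0::real))"
  proof (rule integral_dominated_convergence[where w="\<lambda>x. \<bar>G x\<bar>"])
    show "AE x in M. (\<lambda>n. W n x) \<longlonglongrightarrow> 0" using lim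
    proof eventually_elim
      fix x assume "(\<lambda>n. F n x) \<longlonglongrightarrow> 0"
      then have "(\<lambda>n. \<bar>F n x\<bar>) \<longlonglongrightarrow> 0" by (simp add: tendsto_rabs_zero)
      then show "(\<lambda>n. W n x) \<longlonglongrightarrow> 0"
        by (rule tendsto_sandwich[rotated 3]) (use B(2) d in \<open>auto simp: W_def\<close>)
    qed
    show "AE x in M. norm (W n x) \<le> \<bar>G x\<bar>" for n
      using G(2)[of n] by eventually_elim (auto simp: W_def)
  qed (use G(1) in \<open>auto simp: W_def[abs_def]\<close>)
  then obtain N where N: "\<And>n. n \<ge> N \<Longrightarrow> \<bar>LINT x|M. W n x\<bar> < e / 2"
    using LIMSEQ_D[of _ _ "e/2"] e by fastforce
  have "\<bar>LINT x|M. F n x\<bar> < e" if "n \<ge> N" for n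
  proof -
    have W: "integrable M (W n)"
      by (rule Bochner_Integration.integrable_bound[OF F[of n]]) (use B(2) d in \<open>auto simp: W_def[abs_def]\<close>)
    have "\<bar>LINT x|M. F n x\<bar> \<le> (LINT x|M. W n x + d * B n x)"
      by (intro order_trans[OF integral_abs_bound] integral_mono) (use F W B in \<open>auto simp: W_def\<close>)
    also have "\<dots> = (LINT x|M. W n x) + d * (LINT x|M. B n x)" using W B(1) by simp
    also have "\<dots> \<le> (LINT x|M. W n x) + d * K" using B(3) d by simp
    also have "d * K \<le> e / 2" using K e by (simp add: d_def field_simps)
    finally show ?thesis using N[OF that] by linarith
  qed
  then show "\<exists>no. \<forall>n\<ge>no. norm ((LINT x|M. F n x) - 0) < e" by auto
qed

lemma inner2_tendsto_if_AE:
  assumes g: "\<And>n. L2 (g n)" "\<And>n. norm2sq (g n) \<le> C" "AE x in lebesgue. (\<lambda>n. g n x) \<longlonglongrightarrow> G x" and h: "L2 h"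
  shows "(\<lambda>n. inner2 (g n) h) \<longlonglongrightarrow> inner2 G h"
proof -
  have G: "L2 G" "norm2sq G \<le> C" using L2_Fatou[OF g] by auto
  have "(\<lambda>n. LINT x|lebesgue. (g n x - G x) \<bullet> h x) \<longlonglongrightarrow> 0"
  proof (rule integral_tendsto_0_almost_dominated[where B="\<lambda>n x. (norm (g n x - G x))\<^sup>2" and K="4 * C"])
    show "integrable lebesgue (\<lambda>x. (g n x - G x) \<bullet> h x)" for n by (intro L2_inner_integrable L2_diff g G h)
    show "AE x in lebesgue. (\<lambda>n. (g n x - G x) \<bullet> h x) \<longlonglongrightarrow> 0"
      using g(3) by eventually_elim (auto intro!: tendsto_eq_intros)
    show "integrable lebesgue (\<lambda>x. (norm (g n x - G x))\<^sup>2)" for n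
      by (intro L2_integrable_norm_sq L2_diff g G)
    show "(LINT x|lebesgue. (norm (g n x - G x))\<^sup>2) \<le> 4 * C" for n
      using norm2sq_diff_le[OF g(1)[of n] G(1)] g(2)[of n] G(2) by (simp add: norm2sq_def)
    show "\<exists>W. integrable lebesgue W \<and> (\<forall>n. AE x in lebesgue. \<bar>(g n x - G x) \<bullet> h x\<bar> \<le> W x + e * (norm (g n x - G x))\<^sup>2)"
      if e: "e > 0" for e
    proof (intro exI[of _ "\<lambda>x. 1/(4*e) * (norm (h x))\<^sup>2"] conjI allI AE_I2)
      show "integrable lebesgue (\<lambda>x. 1/(4*e) * (norm (h x))\<^sup>2)"
        by (intro integrable_mult_right L2_integrable_norm_sq h)
      show "\<bar>(g n x - G x) \<bullet> h x\<bar> \<le> 1/(4*e) * (norm (h x))\<^sup>2 + e * (norm (g n x - G x))\<^sup>2" for n x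
        using Cauchy_Schwarz_ineq2[of "g n x - G x" "h x"]
          mult_le_weighted_squares[OF e, of "norm (g n x - G x)" "norm (h x)"] by linarith
    qed
  qed auto
  then have "(\<lambda>n. inner2 (\<lambda>x. g n x - G x) h) \<longlonglongrightarrow> 0" by (simp add: inner2_def)
  then have "(\<lambda>n. inner2 (g n) h - inner2 G h) \<longlonglongrightarrow> 0" by (simp add: inner2_diff_left[OF g(1) G(1) h])
  then show ?thesis by (simp add: LIM_zero_iff)
qed

lemma inner2_tendsto_if_norm2sq:
  assumes "\<And>n. L2 (g n)" "L2 G" "L2 h" "(\<lambda>n. norm2sq (\<lambda>x. g n x - G x)) \<longlonglongrightarrow> 0"
  shows "(\<lambda>n. inner2 (g n) h) \<longlonglongrightarrow> inner2 G h"
proof -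
  have "(\<lambda>n. inner2 (\<lambda>x. g n x - G x) h) \<longlonglongrightarrow> 0"
  proof (rule Lim_null_comparison)
    show "\<forall>\<^sub>F n in sequentially. norm (inner2 (\<lambda>x. g n x - G x) h) \<le> norm2 (\<lambda>x. g n x - G x) * norm2 h"
      using inner2_Cauchy_Schwarz[OF L2_diff[OF assms(1,2)] assms(3)] by simp
    show "(\<lambda>n. norm2 (\<lambda>x. g n x - G x) * norm2 h) \<longlonglongrightarrow> 0"
      using tendsto_real_sqrt[OF assms(4)] by (intro tendsto_mult_left_zero) simp
  qed
  then show ?thesis by (simp add: inner2_diff_left[OF assms(1-3)] LIM_zero_iff)
qed

lemma norm2sq_tendsto_0_dominated:
  fixes d :: "nat \<Rightarrow> 'a::euclidean_space \<Rightarrow> 'b::euclidean_space"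
  assumes "\<And>n. d n \<in> borel_measurable lebesgue" "L2 h" "\<And>n. AE x in lebesgue. norm (d n x) \<le> norm (h x)"
    "AE x in lebesgue. (\<lambda>n. d n x) \<longlonglongrightarrow> 0"
  shows "(\<lambda>n. norm2sq (d n)) \<longlonglongrightarrow> 0"
proof -
  note [measurable] = assms(1)
  have "(\<lambda>n. LINT x|lebesgue. (norm (d n x))\<^sup>2) \<longlonglongrightarrow> (LINT x|(lebesgue::'a measure). (0::real))"
  proof (rule integral_dominated_convergence[where w="\<lambda>x. (norm (h x))\<^sup>2"])
    show "integrable lebesgue (\<lambda>x. (norm (h x))\<^sup>2)" using assms(2) by (rule L2_integrable_norm_sq)
    show "AE x in lebesgue. (\<lambda>n. (norm (d n x))\<^sup>2) \<longlonglongrightarrow> 0"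
      using assms(4) by eventually_elim (auto intro!: tendsto_eq_intros)
    show "AE x in lebesgue. norm ((norm (d n x))\<^sup>2) \<le> (norm (h x))\<^sup>2" for n
      using assms(3)[of n] by eventually_elim (auto intro: power_mono)
  qed auto
  then show ?thesis by (simp add: norm2sq_def)
qed

section \<open>Measure preserving maps\<close>

definition measure_preserving :: "('a::euclidean_space \<Rightarrow> 'a) \<Rightarrow> bool" where
  "measure_preserving T \<longleftrightarrow> T \<in> borel_measurable borel \<and> distr lborel borel T = lborel"

lemma measure_preserving_translation: "measure_preserving (\<lambda>x. x + c)"
  using lborel_distr_plus[of c] by (simp add: measure_preserving_def add.commute[of _ c])

lemma measure_preserving_vimage_null_sets:
  assumes "measure_preserving T" "N \<in> null_sets lborel" shows "T -` N \<in> null_sets lborel"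
proof -
  have [measurable]: "T \<in> borel_measurable borel" "N \<in> sets borel" using assms by (auto simp: measure_preserving_def)
  have "emeasure (distr lborel borel T) N = emeasure lborel (T -` N \<inter> space lborel)"
    by (rule emeasure_distr) auto
  then have "emeasure lborel (T -` N) = 0" using assms by (simp add: measure_preserving_def null_sets_def)
  moreover have "T -` N \<in> sets lborel" using measurable_sets[of T borel borel N] by simp
  ultimately show ?thesis by (simp add: null_sets_def)
qed

lemma measure_preserving_AE:
  assumes "measure_preserving T" "AE x in lebesgue. P x" shows "AE x in lebesgue. P (T x)"
proof -
  have "AE x in lborel. P x" using assms by (simp add: AE_completion_iff)
  then obtain N where N: "N \<in> null_sets lborel" "{x. \<not> P x} \<subseteq> N" by (auto simp: eventually_ae_filter)
  have "T -` N \<in> null_sets lborel" by (rule measure_preserving_vimage_null_sets[OF assms(1) N(1)])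
  moreover have "{x. \<not> P (T x)} \<subseteq> T -` N" using N by auto
  ultimately have "AE x in lborel. P (T x)" by (auto simp: eventually_ae_filter)
  then show ?thesis by (simp add: AE_completion_iff)
qed

lemma
  assumes "measure_preserving T"
  shows measure_preserving_measurable: "T \<in> measurable lebesgue lebesgue"
    and measure_preserving_distr: "distr lebesgue lebesgue T = lebesgue"
proof -
  have T: "T \<in> measurable lebesgue lborel" using assms by (simp add: measure_preserving_def measurable_completion)
  have "distr lebesgue lborel T = distr lborel lborel T"
    using assms by (intro distr_completion) (simp add: measure_preserving_def)
  also have "\<dots> = distr lborel borel T" by (rule distr_cong) auto
  finally have distr: "distr lebesgue lborel T = lborel" using assms by (simp add: measure_preserving_def)
  show "T \<in> measurable lebesgue lebesgue"
    by (rule completion.measurable_completion2[OF T]) (simp add: distr)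
  show "distr lebesgue lebesgue T = lebesgue"
    using completion.completion_distr_eq[OF T] by (simp add: distr)
qed

lemma measure_preserving_comp_measurable:
  assumes "measure_preserving T" "u \<in> borel_measurable lebesgue" shows "(\<lambda>x. u (T x)) \<in> borel_measurable lebesgue"
  using measurable_compose[OF measure_preserving_measurable[OF assms(1)] assms(2)] .

lemma measure_preserving_integral:
  fixes u :: "'a::euclidean_space \<Rightarrow> 'b::euclidean_space"
  assumes "measure_preserving T" "u \<in> borel_measurable lebesgue"
  shows "(LINT x|lebesgue. u (T x)) = (LINT x|lebesgue. u x)"
  using integral_distr[OF measure_preserving_measurable[OF assms(1)] assms(2)]
  by (simp add: measure_preserving_distr assms(1))

lemma measure_preserving_integrable:
  fixes u :: "'a::euclidean_space \<Rightarrow> 'b::euclidean_space"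
  assumes "measure_preserving T" "integrable lebesgue u"
  shows "integrable lebesgue (\<lambda>x. u (T x))"
  using integrable_distr_eq[OF measure_preserving_measurable[OF assms(1)], of u] assms
  by (simp add: measure_preserving_distr)

lemma L2_measure_preserving: assumes "measure_preserving T" "L2 u" shows "L2 (\<lambda>x. u (T x))"
  using measure_preserving_integrable[OF assms(1), of "\<lambda>x. (norm (u x))\<^sup>2"]
    measure_preserving_comp_measurable[OF assms(1), of u] assms(2)
  by (auto simp: L2_def)

lemma norm2sq_measure_preserving:
  assumes "measure_preserving T" "L2 u" shows "norm2sq (\<lambda>x. u (T x)) = norm2sq u"
  using measure_preserving_integral[OF assms(1), of "\<lambda>x. (norm (u x))\<^sup>2"] assms(2)
  by (auto simp: L2_def norm2sq_def)

lemma inner2_measure_preserving: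
  assumes "measure_preserving T" "L2 u" "L2 v" shows "inner2 (\<lambda>x. u (T x)) (\<lambda>x. v (T x)) = inner2 u v"
  using measure_preserving_integral[OF assms(1), of "\<lambda>x. u x \<bullet> v x"] L2_inner_integrable[OF assms(2,3)]
  by (auto simp: inner2_def)

lemma nn_integral_translation:
  fixes M :: "'a::euclidean_space measure"
  assumes sets: "sets M = sets borel" and inv: "distr M borel (\<lambda>x. x + c) = M" and F: "F \<in> borel_measurable borel"
  shows "(\<integral>\<^sup>+x. F (x + c) \<partial>M) = (\<integral>\<^sup>+x. F x \<partial>M)"
proof -
  have "(\<lambda>x. x + c) \<in> measurable M borel" unfolding measurable_cong_sets[OF sets refl] by measurable
  then have "(\<integral>\<^sup>+x. F x \<partial>distr M borel (\<lambda>x. x + c)) = (\<integral>\<^sup>+x. F (x + c) \<partial>M)" using F by (simp add: nn_integral_distr)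
  then show ?thesis by (simp add: inv)
qed

text \<open>Uniqueness of Haar measure: both sides of \<open>lborel B * M A = M B * lborel A\<close>, for a ball \<open>B\<close>, are by Tonelli and
  translation invariance the integral of \<open>indicator B (x - y) * indicator A x\<close>.\<close>

lemma translation_invariant_eq_lborel:
  fixes M :: "'a::euclidean_space measure"
  assumes sets: "sets M = sets borel" and inv: "\<And>c. distr M borel (\<lambda>x. x + c) = M"
    and ball: "\<And>r. emeasure M (ball 0 r) = emeasure lborel (ball (0::'a) r)"
  shows "M = lborel"
proof -
  note [measurable_cong] = sets
  have space: "space M = UNIV" using sets_eq_imp_space_eq[OF sets] by simp
  interpret sigma_finite_measure M
    by standard
       (intro exI[of _ "range (\<lambda>n::nat. ball 0 (real n))"],
        use emeasure_lborel_ball_finite in \<open>auto simp: sets space ball less_top reals_Archimedean2\<close>)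
  interpret pair: pair_sigma_finite lborel M by unfold_locales
  have [measurable]: "ball (x::'a) r \<in> sets borel" for x r by simp
  define \<beta> where "\<beta> = emeasure lborel (ball (0::'a) 1)"
  have \<beta>: "0 < \<beta>" "\<beta> < \<infinity>" by (simp_all add: \<beta>_def emeasure_ball)
  have ball_1: "(\<integral>\<^sup>+y. indicator (ball 0 1) (x - y) \<partial>M) = \<beta>" for x :: 'a
  proof -
    have "(\<integral>\<^sup>+y. indicator (ball 0 1) (x - y) \<partial>M) = (\<integral>\<^sup>+y. indicator (ball 0 1) (x - (y + x)) \<partial>M)"
      by (rule nn_integral_translation[OF sets inv, symmetric]) measurable
    also have "\<dots> = (\<integral>\<^sup>+y. indicator (ball 0 1) y \<partial>M)" by (intro nn_integral_cong) (simp add: indicator_def)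
    finally show ?thesis by (simp add: \<beta>_def ball sets)
  qed
  have "\<beta> * emeasure M A = \<beta> * emeasure lborel A" if [measurable]: "A \<in> sets borel" for A
  proof -
    have "\<beta> * emeasure M A = (\<integral>\<^sup>+x. indicator (ball (0::'a) 1) x * (\<integral>\<^sup>+y. indicator A y \<partial>M) \<partial>lborel)"
      by (subst nn_integral_multc) (auto simp: \<beta>_def sets)
    also have "\<dots> = (\<integral>\<^sup>+x. (\<integral>\<^sup>+y. indicator (ball 0 1) x * indicator A (y + x) \<partial>M) \<partial>lborel)"
      by (intro nn_integral_cong, subst nn_integral_cmult) (simp_all add: nn_integral_translation[OF sets inv])
    also have "\<dots> = (\<integral>\<^sup>+y. (\<integral>\<^sup>+x. indicator (ball 0 1) x * indicator A (y + x) \<partial>lborel) \<partial>M)"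
      by (rule pair.Fubini'[symmetric]) measurable
    also have "\<dots> = (\<integral>\<^sup>+y. (\<integral>\<^sup>+x. indicator (ball 0 1) (x - y) * indicator A x \<partial>lborel) \<partial>M)"
      using nn_integral_translation[of lborel, OF _ measure_preserving_translation[unfolded measure_preserving_def,
          THEN conjunct2],
          of "\<lambda>x. indicator (ball 0 1) (x - y) * indicator A x" y for y]
      by (simp add: add.commute)
    also have "\<dots> = (\<integral>\<^sup>+x. (\<integral>\<^sup>+y. indicator (ball 0 1) (x - y) * indicator A x \<partial>M) \<partial>lborel)"
      by (rule pair.Fubini') measurable
    also have "\<dots> = (\<integral>\<^sup>+x. \<beta> * indicator A x \<partial>lborel)"
      by (intro nn_integral_cong, subst nn_integral_multc) (simp_all add: ball_1)
    also have "\<dots> = \<beta> * emeasure lborel A" by (simp add: nn_integral_cmult)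
    finally show ?thesis .
  qed
  then show "M = lborel" using \<beta> by (intro measure_eqI) (auto simp: sets ennreal_mult_cancel_left)
qed

lemma measure_preserving_orthogonal:
  fixes T :: "'a::euclidean_space \<Rightarrow> 'a"
  assumes "orthogonal_transformation T" shows "measure_preserving T"
proof -
  have lin: "linear T" and norm: "\<And>x. norm (T x) = norm x" using assms by (auto simp: orthogonal_transformation)
  have [measurable]: "T \<in> borel_measurable borel"
    using lin by (intro borel_measurable_continuous_onI linear_continuous_on) (simp add: linear_conv_bounded_linear)
  have "distr lborel borel T = lborel"
  proof (rule translation_invariant_eq_lborel)
    fix c
    obtain b where c: "c = T b" using orthogonal_transformation_surj[OF assms] by (metis surjD)
    have "distr (distr lborel borel T) borel (\<lambda>x. x + c) = distr (distr lborel borel (\<lambda>x. x + b)) borel T"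
      by (simp add: distr_distr o_def c linear_add[OF lin])
    then show "distr (distr lborel borel T) borel (\<lambda>x. x + c) = distr lborel borel T"
      using measure_preserving_translation[of b] by (simp add: measure_preserving_def)
  next
    have "T -` ball 0 r = ball 0 r" for r by (auto simp: norm)
    then show "emeasure (distr lborel borel T) (ball 0 r) = emeasure lborel (ball (0::'a) r)" for r
      by (simp add: emeasure_distr)
  qed simp
  then show ?thesis by (simp add: measure_preserving_def)
qed

section \<open>Test functions\<close>

subsection \<open>Continuously differentiable functions\<close>

definition C1_fun :: "('a::euclidean_space \<Rightarrow> real) \<Rightarrow> bool" where
  "C1_fun q \<longleftrightarrow> (\<exists>D. (\<forall>x. (q has_derivative D x) (at x)) \<and> (\<forall>v. continuous_on UNIV (\<lambda>x. D x v)))"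

lemma C1_fun_continuous: assumes "C1_fun q" shows "continuous_on UNIV q"
proof -
  obtain D where "\<And>x. (q has_derivative D x) (at x)" using assms unfolding C1_fun_def by blast
  then show ?thesis by (intro continuous_at_imp_continuous_on ballI has_derivative_continuous)
qed

lemma C1_fun_add: assumes "C1_fun p" "C1_fun q" shows "C1_fun (\<lambda>x. p x + q x)"
proof -
  obtain D E where D: "\<And>x. (p has_derivative D x) (at x)" "\<And>v. continuous_on UNIV (\<lambda>x. D x v)"
    and E: "\<And>x. (q has_derivative E x) (at x)" "\<And>v. continuous_on UNIV (\<lambda>x. E x v)"
    using assms unfolding C1_fun_def by blast
  show ?thesis unfolding C1_fun_def
    by (intro exI[of _ "\<lambda>x v. D x v + E x v"] conjI allI derivative_intros D E continuous_intros)
qed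

lemma C1_fun_mult: assumes "C1_fun p" "C1_fun q" shows "C1_fun (\<lambda>x. p x * q x)"
proof -
  obtain D E where D: "\<And>x. (p has_derivative D x) (at x)" "\<And>v. continuous_on UNIV (\<lambda>x. D x v)"
    and E: "\<And>x. (q has_derivative E x) (at x)" "\<And>v. continuous_on UNIV (\<lambda>x. E x v)"
    using assms unfolding C1_fun_def by blast
  show ?thesis unfolding C1_fun_def
    by (intro exI[of _ "\<lambda>x v. p x * E x v + D x v * q x"] conjI allI has_derivative_mult D E continuous_intros
        C1_fun_continuous assms)
qed

lemma C1_fun_const: "C1_fun (\<lambda>x. c)"
  unfolding C1_fun_def by (intro exI[of _ "\<lambda>x v. 0"]) auto

lemma C1_fun_diff: assumes "C1_fun p" "C1_fun q" shows "C1_fun (\<lambda>x. p x - q x)"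
  using C1_fun_add[OF assms(1) C1_fun_mult[OF C1_fun_const[of "-1"] assms(2)]] by simp

lemma C1_fun_linear: "bounded_linear l \<Longrightarrow> C1_fun l"
  unfolding C1_fun_def by (intro exI[of _ "\<lambda>x. l"]) (auto intro: bounded_linear_imp_has_derivative)

lemma C1_fun_polynomial: "real_polynomial_function p \<Longrightarrow> C1_fun p"
  by (induction rule: real_polynomial_function.induct) (auto intro: C1_fun_add C1_fun_mult C1_fun_const C1_fun_linear)

lemma C1_fun_inner_self:
  fixes l :: "'a::euclidean_space \<Rightarrow> 'b::real_inner"
  assumes "bounded_linear l" shows "C1_fun (\<lambda>x. l x \<bullet> l x)"
  unfolding C1_fun_def
proof (intro exI[of _ "\<lambda>x v. 2 * (l x \<bullet> l v)"] conjI allI)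
  show "((\<lambda>x. l x \<bullet> l x) has_derivative (\<lambda>v. 2 * (l x \<bullet> l v))) (at x)" for x
    using has_derivative_inner[OF bounded_linear_imp_has_derivative[OF assms]
        bounded_linear_imp_has_derivative[OF assms], of x]
    by (simp add: inner_commute)
qed (intro continuous_intros linear_continuous_on assms)

lemma pos_part_square_derivative: "((\<lambda>s::real. (max 0 s)\<^sup>2) has_real_derivative 2 * max 0 s) (at s)"
proof -
  consider (pos) "s > 0" | (neg) "s < 0" | (zero) "s = 0" by linarith
  then show ?thesis
  proof cases
    case pos
    have "((\<lambda>s::real. s\<^sup>2) has_real_derivative 2 * max 0 s) (at s)"
      using pos by (auto intro!: derivative_eq_intros)
    then show ?thesis
      by (rule has_field_derivative_transform_within_open[where S="{0<..}"]) (use pos in auto)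
  next
    case neg
    have "((\<lambda>s::real. 0) has_real_derivative 2 * max 0 s) (at s)"
      using neg by (auto intro!: derivative_eq_intros)
    then show ?thesis
      by (rule has_field_derivative_transform_within_open[where S="{..<0}"]) (use neg in auto)
  next
    case zero
    have "(\<lambda>h::real. (max 0 h)\<^sup>2 / h) \<midarrow>0\<rightarrow> 0"
    proof (rule tendsto_norm_zero_cancel, rule tendsto_sandwich[OF _ _ tendsto_const])
      show "\<forall>\<^sub>F h::real in at 0. norm ((max 0 h)\<^sup>2 / h) \<le> \<bar>h\<bar>"
        by (rule always_eventually) (auto simp: max_def power2_eq_square)
      show "((\<lambda>h::real. \<bar>h\<bar>) \<longlongrightarrow> 0) (at 0)" by (auto intro!: tendsto_eq_intros)
    qed simp
    then show ?thesis using zero by (simp add: DERIV_def)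
  qed
qed

lemma C1_fun_pos_part_square: assumes "C1_fun q" shows "C1_fun (\<lambda>x. (max 0 (q x))\<^sup>2)"
proof -
  obtain D where D: "\<And>x. (q has_derivative D x) (at x)" "\<And>v. continuous_on UNIV (\<lambda>x. D x v)"
    using assms unfolding C1_fun_def by blast
  show ?thesis unfolding C1_fun_def
  proof (intro exI[of _ "\<lambda>x v. D x v * (2 * max 0 (q x))"] conjI allI)
    show "((\<lambda>x. (max 0 (q x))\<^sup>2) has_derivative (\<lambda>v. D x v * (2 * max 0 (q x)))) (at x)" for x
      using DERIV_compose_FDERIV[OF pos_part_square_derivative D(1)] .
  qed (intro continuous_intros D C1_fun_continuous assms)
qed

lemma C1_fun_cutoff:
  assumes "R > 0"
  obtains \<theta> :: "'a::euclidean_space \<Rightarrow> real" where "C1_fun \<theta>" "\<And>x. 0 \<le> \<theta> x" "\<And>x. \<theta> x \<le> 1"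
    "\<And>x. norm x \<le> R \<Longrightarrow> \<theta> x = 1" "\<And>x. 2 * R \<le> norm x \<Longrightarrow> \<theta> x = 0"
proof
  define s where "s x = 1 / R\<^sup>2 * (x \<bullet> x) - 1" for x :: 'a
  define \<theta> where "\<theta> x = (max 0 (1 - (max 0 (s x))\<^sup>2))\<^sup>2" for x
  show "C1_fun \<theta>" unfolding \<theta>_def[abs_def] s_def
    by (intro C1_fun_pos_part_square C1_fun_diff C1_fun_mult C1_fun_const C1_fun_inner_self bounded_linear_ident)
  show "0 \<le> \<theta> x" for x by (simp add: \<theta>_def)
  show "\<theta> x \<le> 1" for x unfolding \<theta>_def by (rule power_le_one) auto
  show "\<theta> x = 1" if "norm x \<le> R" for x
  proof -
    have "x \<bullet> x \<le> R\<^sup>2" using that by (simp add: power2_norm_eq_inner[symmetric] power_mono)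
    then have "s x \<le> 0" using assms by (simp add: s_def field_simps)
    then show ?thesis by (simp add: \<theta>_def)
  qed
  show "\<theta> x = 0" if "2 * R \<le> norm x" for x
  proof -
    have "(2 * R)\<^sup>2 \<le> (norm x)\<^sup>2" using that assms by (intro power_mono) auto
    moreover have "2 * R\<^sup>2 \<le> (2 * R)\<^sup>2" by (simp add: power_mult_distrib)
    ultimately have "2 * R\<^sup>2 \<le> x \<bullet> x" unfolding power2_norm_eq_inner by linarith
    then have "1 \<le> s x" using assms by (simp add: s_def field_simps)
    then have "1 \<le> (max 0 (s x))\<^sup>2" by simp
    then show ?thesis by (simp add: \<theta>_def)
  qed
qed

subsection \<open>Derivatives and support of test functions\<close>

abbreviation dir_deriv :: "('a::euclidean_space \<Rightarrow> real) \<Rightarrow> 'a \<Rightarrow> 'a \<Rightarrow> real" where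
  "dir_deriv \<phi> v \<equiv> \<lambda>x. frechet_derivative \<phi> (at x) v"

lemma C1_fun_frechet_derivative:
  assumes "C1_fun q"
  shows "(q has_derivative frechet_derivative q (at x)) (at x)" "continuous_on UNIV (dir_deriv q v)"
proof -
  obtain D where D: "\<And>x. (q has_derivative D x) (at x)" "\<And>v. continuous_on UNIV (\<lambda>x. D x v)"
    using assms unfolding C1_fun_def by blast
  have "frechet_derivative q (at x) = D x" for x using frechet_derivative_at[OF D(1)] by simp
  then show "(q has_derivative frechet_derivative q (at x)) (at x)" "continuous_on UNIV (dir_deriv q v)"
    using D by simp_all
qed

lemma linear_real_eq_sum_Basis:
  fixes l :: "'a::euclidean_space \<Rightarrow> real"
  assumes "linear l" shows "l v = (\<Sum>e\<in>Basis. (v \<bullet> e) * l e)"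
  using Linear_Algebra.linear_componentwise[OF assms, of v 1] by simp

lemma test_fun_C1_fun: assumes "test_fun \<phi>" shows "C1_fun \<phi>"
  unfolding C1_fun_def
proof (intro exI[of _ "\<lambda>x. frechet_derivative \<phi> (at x)"] conjI allI)
  show has_derivative: "(\<phi> has_derivative frechet_derivative \<phi> (at x)) (at x)" for x
    using assms by (simp add: test_fun_def frechet_derivative_works)
  fix v :: 'a
  have "dir_deriv \<phi> v x = (\<Sum>e\<in>Basis. (v \<bullet> e) * dir_deriv \<phi> e x)" for x
    by (rule linear_real_eq_sum_Basis[OF has_derivative_linear[OF has_derivative]])
  then show "continuous_on UNIV (dir_deriv \<phi> v)"
    using assms by (auto simp: test_fun_def intro!: continuous_intros)
qed

lemmas test_fun_has_derivative = C1_fun_frechet_derivative(1)[OF test_fun_C1_fun]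
lemmas test_fun_continuous_dir_deriv = C1_fun_frechet_derivative(2)[OF test_fun_C1_fun]
lemmas test_fun_continuous = C1_fun_continuous[OF test_fun_C1_fun]

lemma test_funI:
  assumes "C1_fun \<phi>" "\<And>x. R < norm x \<Longrightarrow> \<phi> x = 0" shows "test_fun \<phi>"
  unfolding test_fun_def
proof (intro conjI allI ballI)
  show "\<phi> differentiable (at x)" for x
    using C1_fun_frechet_derivative(1)[OF assms(1)] unfolding differentiable_def by blast
  show "continuous_on UNIV (dir_deriv \<phi> e)" for e by (rule C1_fun_frechet_derivative(2)[OF assms(1)])
  have "{x. \<phi> x \<noteq> 0} \<subseteq> cball 0 R" using assms(2) by force
  then have "closure {x. \<phi> x \<noteq> 0} \<subseteq> cball 0 R" by (intro closure_minimal) auto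
  then show "compact (closure {x. \<phi> x \<noteq> 0})"
    by (metis bounded_cball bounded_subset closed_closure compact_eq_bounded_closed)
qed

lemma test_fun_support:
  assumes "test_fun \<phi>"
  obtains R where "R > 0" "\<And>x. R < norm x \<Longrightarrow> \<phi> x = 0" "\<And>x v. R < norm x \<Longrightarrow> dir_deriv \<phi> v x = 0"
proof -
  have "bounded {x. \<phi> x \<noteq> 0}" using assms unfolding test_fun_def
    by (meson bounded_closure_image bounded_subset closure_subset compact_imp_bounded)
  then obtain R where R: "R > 0" "\<And>x. \<phi> x \<noteq> 0 \<Longrightarrow> norm x \<le> R" by (auto simp: bounded_pos)
  have zero: "\<phi> x = 0" if "R < norm x" for x using R(2)[of x] that by auto
  have "dir_deriv \<phi> v x = 0" if "R < norm x" for x v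
  proof -
    have "((\<lambda>x. 0::real) has_derivative (\<lambda>v. 0)) (at x)" by simp
    then have "(\<phi> has_derivative (\<lambda>v. 0)) (at x)"
      by (rule has_derivative_transform_within_open[where s="- cball 0 R"]) (use that zero in auto)
    then show ?thesis using frechet_derivative_at by metis
  qed
  then show ?thesis using that R(1) zero by blast
qed

lemma test_fun_affine_isometry:
  assumes \<phi>: "test_fun \<phi>" and S: "bounded_linear S" "\<And>x. norm (S x) = norm x"
  shows "test_fun (\<lambda>x. \<phi> (S x + c))"
    and "frechet_derivative (\<lambda>x. \<phi> (S x + c)) (at x) v = frechet_derivative \<phi> (at (S x + c)) (S v)"
proof -
  have has_derivative: "((\<lambda>x. \<phi> (S x + c)) has_derivative (\<lambda>v. dir_deriv \<phi> (S v) (S x + c))) (at x)" for x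
  proof -
    have "((\<lambda>x. S x + c) has_derivative S) (at x)"
      using has_derivative_add_const[OF bounded_linear_imp_has_derivative[OF S(1)]] .
    from diff_chain_at[OF this test_fun_has_derivative[OF \<phi>]] show ?thesis by (simp add: o_def)
  qed
  show "frechet_derivative (\<lambda>x. \<phi> (S x + c)) (at x) v = frechet_derivative \<phi> (at (S x + c)) (S v)"
    using frechet_derivative_at[OF has_derivative] by metis
  obtain R where "R > 0" and R: "\<And>x. R < norm x \<Longrightarrow> \<phi> x = 0" "\<And>x v. R < norm x \<Longrightarrow> dir_deriv \<phi> v x = 0"
    using test_fun_support[OF \<phi>] by blast
  show "test_fun (\<lambda>x. \<phi> (S x + c))"
  proof (rule test_funI)
    show "C1_fun (\<lambda>x. \<phi> (S x + c))" unfolding C1_fun_def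
      by (intro exI[of _ "\<lambda>x v. dir_deriv \<phi> (S v) (S x + c)"] conjI allI has_derivative
          continuous_on_compose2[OF test_fun_continuous_dir_deriv[OF \<phi>]] continuous_intros linear_continuous_on
          S(1)) auto
    show "\<phi> (S x + c) = 0" if "R + norm c < norm x" for x
      using norm_diff_triangle_ineq[of "S x + c" c 0 0] norm_triangle_ineq4[of "S x + c" c] that
      by (intro R(1)) (simp add: S(2))
  qed
qed

lemma test_fun_shift:
  assumes "test_fun \<phi>"
  shows "test_fun (\<lambda>x. \<phi> (x + c))" "dir_deriv (\<lambda>x. \<phi> (x + c)) v x = dir_deriv \<phi> v (x + c)"
  using test_fun_affine_isometry[OF assms bounded_linear_ident] by auto

lemma L2_indicator_lmeasurable:
  assumes "S \<in> lmeasurable"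
  shows "L2 (indicat_real S)" "norm2sq (indicat_real S) = measure lebesgue S"
proof -
  have square: "(\<lambda>x. (norm (indicat_real S x))\<^sup>2) = indicat_real S" by (auto simp: indicator_def)
  show "L2 (indicat_real S)" using assms by (auto simp: L2_def square fmeasurable_def simp del: real_norm_def)
  show "norm2sq (indicat_real S) = measure lebesgue S" unfolding norm2sq_def square using assms by simp
qed

lemma L2_bounded_support:
  fixes c :: "'a::euclidean_space \<Rightarrow> real"
  assumes c: "c \<in> borel_measurable lebesgue" "\<And>x. \<bar>c x\<bar> \<le> M" "\<And>x. x \<notin> S \<Longrightarrow> c x = 0" and S: "S \<in> lmeasurable"
  shows "L2 c" "norm2sq c \<le> M\<^sup>2 * measure lebesgue S"
proof -
  have in_L2: "L2 (\<lambda>x. M *\<^sub>R indicat_real S x)" by (intro L2_scaleR L2_indicator_lmeasurable S)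
  have bound: "AE x in lebesgue. norm (c x) \<le> norm (M *\<^sub>R indicat_real S x)"
    using c(2,3) by (intro AE_I2) (auto simp: indicator_def intro: order_trans[OF _ abs_ge_self])
  show "L2 c" by (rule L2_bound[OF in_L2 c(1) bound])
  show "norm2sq c \<le> M\<^sup>2 * measure lebesgue S"
    using norm2sq_mono[OF in_L2 bound] unfolding norm2sq_scaleR by (simp add: L2_indicator_lmeasurable[OF S])
qed

lemma continuous_compact_support_bounded:
  fixes c :: "'a::euclidean_space \<Rightarrow> real"
  assumes "continuous_on UNIV c" "\<And>x. R < norm x \<Longrightarrow> c x = 0"
  obtains M where "M \<ge> 0" "\<And>x. \<bar>c x\<bar> \<le> M"
proof -
  have "bounded (c ` cball 0 R)"
    by (intro compact_imp_bounded compact_continuous_image continuous_on_subset[OF assms(1)]) auto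
  then obtain M where "\<forall>y\<in>c ` cball 0 R. norm y \<le> M" unfolding bounded_iff by blast
  then have M: "\<And>x. x \<in> cball 0 R \<Longrightarrow> \<bar>c x\<bar> \<le> M" by simp
  show ?thesis
  proof
    show "\<bar>c x\<bar> \<le> max 0 M" for x using M[of x] assms(2)[of x] by (cases "norm x \<le> R") auto
  qed auto
qed

lemma continuous_lebesgue_measurable:
  "continuous_on UNIV (c :: 'a::euclidean_space \<Rightarrow> 'b::euclidean_space) \<Longrightarrow> c \<in> borel_measurable lebesgue"
  by (simp add: borel_measurable_continuous_onI measurable_completion)

lemma L2_continuous_compact_support:
  fixes c :: "'a::euclidean_space \<Rightarrow> real"
  assumes c: "continuous_on UNIV c" "\<And>x. R < norm x \<Longrightarrow> c x = 0"
  shows "L2 c"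
proof -
  obtain M where "\<And>x. \<bar>c x\<bar> \<le> M" using continuous_compact_support_bounded[OF c] by metis
  moreover have "c x = 0" if "x \<notin> cball 0 R" for x using c(2) that by simp
  ultimately show ?thesis
    by (rule L2_bounded_support(1)[OF continuous_lebesgue_measurable[OF c(1)] _ _ lmeasurable_cball])
qed

lemma L2_test_fun: assumes "test_fun \<phi>" shows "L2 \<phi>"
  by (rule test_fun_support[OF assms]) (rule L2_continuous_compact_support[OF test_fun_continuous[OF assms]])

lemma L2_dir_deriv: assumes "test_fun \<phi>" shows "L2 (dir_deriv \<phi> v)"
  by (rule test_fun_support[OF assms]) (rule L2_continuous_compact_support[OF test_fun_continuous_dir_deriv[OF assms]])

subsection \<open>Density of the test functions\<close>

lemma continuous_approx_by_test_fun:
  fixes c :: "'a::euclidean_space \<Rightarrow> real"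
  assumes c: "continuous_on UNIV c" "\<And>x. R < norm x \<Longrightarrow> c x = 0" and R: "R > 0" and e: "e > 0"
  obtains \<phi> where "test_fun \<phi>" "norm2sq (\<lambda>x. c x - \<phi> x) \<le> e"
proof -
  define m where "m = measure lebesgue (cball (0::'a) (2*R))"
  define d where "d = sqrt (e / (m + 1))"
  have m: "m \<ge> 0" by (simp add: m_def)
  have d: "d > 0" using e m by (simp add: d_def)
  obtain \<theta> :: "'a \<Rightarrow> real" where \<theta>: "C1_fun \<theta>" "\<And>x. 0 \<le> \<theta> x" "\<And>x. \<theta> x \<le> 1"
    "\<And>x. norm x \<le> R \<Longrightarrow> \<theta> x = 1" "\<And>x. 2 * R \<le> norm x \<Longrightarrow> \<theta> x = 0"
    using C1_fun_cutoff[OF R] by metis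
  obtain p where p: "polynomial_function p" "\<And>x. x \<in> cball 0 (2*R) \<Longrightarrow> norm (c x - p x) < d"
    using Stone_Weierstrass_polynomial_function[of "cball 0 (2*R)" c d] d continuous_on_subset[OF c(1)] by auto
  define \<phi> where "\<phi> x = p x * \<theta> x" for x
  have "C1_fun \<phi>"
    unfolding \<phi>_def using p(1) by (intro C1_fun_mult \<theta> C1_fun_polynomial) (simp add: real_polynomial_function_eq)
  have "test_fun \<phi>" by (rule test_funI[OF \<open>C1_fun \<phi>\<close>, of "2*R"]) (simp add: \<phi>_def \<theta>)
  have "norm2sq (\<lambda>x. c x - \<phi> x) \<le> d\<^sup>2 * m" unfolding m_def
  proof (rule L2_bounded_support(2))
    show "(\<lambda>x. c x - \<phi> x) \<in> borel_measurable lebesgue"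
      by (intro continuous_lebesgue_measurable continuous_intros c C1_fun_continuous \<open>C1_fun \<phi>\<close>)
    show outside: "c x - \<phi> x = 0" if "x \<notin> cball 0 (2 * R)" for x using that R by (simp add: \<phi>_def \<theta> c)
    show "\<bar>c x - \<phi> x\<bar> \<le> d" for x
    proof (cases "norm x \<le> 2 * R")
      case True
      have "c x - \<phi> x = (c x - p x) * \<theta> x"
        using c(2)[of x] \<theta>(4)[of x] by (cases "norm x \<le> R") (auto simp: \<phi>_def algebra_simps)
      then have "\<bar>c x - \<phi> x\<bar> = \<bar>c x - p x\<bar> * \<theta> x" using \<theta>(2) by (simp add: abs_mult)
      also have "\<dots> \<le> d * 1" using p(2)[of x] True \<theta>(2,3)[of x] d by (intro mult_mono) auto
      finally show ?thesis by simp
    qed (use outside[of x] d in auto)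
  qed simp
  also have "\<dots> = e * (m / (m + 1))" using e m by (simp add: d_def)
  also have "\<dots> \<le> e * 1" using e m by (intro mult_left_mono) auto
  finally show ?thesis using that \<open>test_fun \<phi>\<close> by simp
qed

lemma L2_approx_by_bounded_support:
  fixes w :: "'a::euclidean_space \<Rightarrow> real"
  assumes w: "L2 w" and e: "e > 0"
  obtains v R where "L2 v" "R > 0" "\<And>x. \<bar>v x\<bar> \<le> R" "\<And>x. R < norm x \<Longrightarrow> v x = 0" "norm2sq (\<lambda>x. w x - v x) < e"
proof -
  note [measurable] = w
  define v where "v n x = indicator {x. \<bar>w x\<bar> \<le> real n} x * (indicator (cball 0 (real n)) x * w x)" for n x
  have [measurable]: "cball (0::'a) r \<in> sets lebesgue" for r by simp
  have v: "v n \<in> borel_measurable lebesgue" for n unfolding v_def[abs_def] by measurable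
  have "(\<lambda>n. norm2sq (\<lambda>x. w x - v n x)) \<longlonglongrightarrow> 0"
  proof (rule norm2sq_tendsto_0_dominated[OF _ w])
    show "AE x in lebesgue. (\<lambda>n. w x - v n x) \<longlonglongrightarrow> 0"
    proof (rule AE_I2)
      fix x
      obtain N :: nat where "max \<bar>w x\<bar> (norm x) < real N" using reals_Archimedean2 by blast
      then have "\<forall>\<^sub>F n in sequentially. w x - v n x = 0"
        by (intro eventually_sequentiallyI[of N]) (auto simp: v_def)
      then show "(\<lambda>n. w x - v n x) \<longlonglongrightarrow> 0" by (rule tendsto_eventually)
    qed
    show "(\<lambda>x. w x - v n x) \<in> borel_measurable lebesgue" for n using v by measurable
  qed (auto simp: v_def indicator_def)
  then obtain n where n: "norm2sq (\<lambda>x. w x - v n x) < e"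
    using eventually_happens'[OF sequentially_bot order_tendstoD(2)[OF _ e]] by blast
  have "L2 (v n)" by (rule L2_bound[OF w v]) (auto simp: v_def indicator_def)
  moreover have "\<bar>v n x\<bar> \<le> real n + 1" "real n + 1 < norm x \<Longrightarrow> v n x = 0" for x by (auto simp: v_def indicator_def)
  ultimately show ?thesis using n by (intro that[of "v n" "real n + 1"]) auto
qed

lemma bounded_support_approx_by_continuous:
  fixes v :: "'a::euclidean_space \<Rightarrow> real"
  assumes v: "L2 v" "\<And>x. \<bar>v x\<bar> \<le> R" "\<And>x. R < norm x \<Longrightarrow> v x = 0" and e: "e > 0"
  obtains c where "continuous_on UNIV c" "\<And>x. R + 1 < norm x \<Longrightarrow> c x = 0" "norm2sq (\<lambda>x. v x - c x) < e"
proof -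
  note [measurable] = v(1)
  have "v measurable_on UNIV" by (rule lebesgue_measurable_imp_measurable_on) auto
  then obtain N g where N: "negligible N"
    and g: "\<And>k. continuous_on UNIV (g k)" "\<And>x. x \<notin> N \<Longrightarrow> (\<lambda>k. g k x) \<longlonglongrightarrow> v x"
    unfolding measurable_on_def by auto
  have R: "R \<ge> 0" using v(2)[of 0] by linarith
  define cut where "cut x = max 0 (min 1 (R + 1 - norm x))" for x :: 'a
  define c where "c k x = max (- R) (min R (g k x)) * cut x" for k x
  have c: "continuous_on UNIV (c k)" for k unfolding c_def[abs_def] cut_def by (intro continuous_intros g)
  have vanish: "c k x = 0" if "R + 1 < norm x" for k x using that by (simp add: c_def cut_def)
  have c_le: "\<bar>c k x\<bar> \<le> R * 1" for k x
    unfolding c_def abs_mult using R by (intro mult_mono) (auto simp: cut_def)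
  have diff_le: "\<bar>v x - c k x\<bar> \<le> 2 * R" for k x using v(2)[of x] c_le[of k x] by linarith
  have "(\<lambda>k. norm2sq (\<lambda>x. v x - c k x)) \<longlonglongrightarrow> 0"
  proof (rule norm2sq_tendsto_0_dominated)
    show "L2 (\<lambda>x::'a. (2 * R) *\<^sub>R indicat_real (cball 0 (R + 1)) x)"
      by (intro L2_scaleR L2_indicator_lmeasurable lmeasurable_cball)
    show "(\<lambda>x. v x - c k x) \<in> borel_measurable lebesgue" for k
      using continuous_lebesgue_measurable[OF c[of k]] by measurable
    show "AE x in lebesgue. norm (v x - c k x) \<le> norm ((2 * R) *\<^sub>R indicat_real (cball 0 (R + 1)) x)" for k
      using diff_le vanish v(3) R by (intro AE_I2) (auto simp: indicator_def)
    have "AE x in lebesgue. x \<notin> N" using N by (simp add: negligible_iff_null_sets AE_not_in)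
    then show "AE x in lebesgue. (\<lambda>k. v x - c k x) \<longlonglongrightarrow> 0"
    proof eventually_elim
      fix x assume "x \<notin> N"
      then have "(\<lambda>k. v x - c k x) \<longlonglongrightarrow> v x - max (- R) (min R (v x)) * cut x"
        unfolding c_def by (intro tendsto_intros g)
      moreover have "max (- R) (min R (v x)) = v x" using v(2)[of x] by linarith
      moreover have "v x * cut x = v x" using v(3)[of x] by (cases "norm x \<le> R") (auto simp: cut_def)
      ultimately show "(\<lambda>k. v x - c k x) \<longlonglongrightarrow> 0" by simp
    qed
  qed
  then obtain k where "norm2sq (\<lambda>x. v x - c k x) < e"
    using eventually_happens'[OF sequentially_bot order_tendstoD(2)[OF _ e]] by blast
  then show ?thesis using that c vanish by blast
qed

lemma test_fun_dense:
  fixes w :: "'a::euclidean_space \<Rightarrow> real"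
  assumes w: "L2 w" and e: "e > 0"
  obtains \<phi> where "test_fun \<phi>" "norm2sq (\<lambda>x. w x - \<phi> x) < e"
proof -
  have pos: "e / 10 > 0" using e by simp
  obtain v R where v: "L2 v" "R > 0" "\<And>x. \<bar>v x\<bar> \<le> R" "\<And>x. R < norm x \<Longrightarrow> v x = 0"
    and close_v: "norm2sq (\<lambda>x. w x - v x) < e / 10" by (rule L2_approx_by_bounded_support[OF w pos]) (rule that)
  obtain c where c: "continuous_on UNIV c" "\<And>x. R + 1 < norm x \<Longrightarrow> c x = 0"
    and close_c: "norm2sq (\<lambda>x. v x - c x) < e / 10"
    using bounded_support_approx_by_continuous[OF v(1,3) _ pos] v(4) by blast
  have R_pos: "R + 1 > 0" using v(2) by simp
  obtain \<phi> where \<phi>: "test_fun \<phi>" and c\<phi>: "norm2sq (\<lambda>x. c x - \<phi> x) \<le> e / 10"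
    using continuous_approx_by_test_fun[OF c(1) _ R_pos pos] c(2) by blast
  have "L2 c" by (rule L2_continuous_compact_support[OF c])
  then have in_L2: "L2 (\<lambda>x. w x - v x)" "L2 (\<lambda>x. v x - c x)" "L2 (\<lambda>x. c x - \<phi> x)"
    using w v(1) L2_test_fun[OF \<phi>] by (auto intro: L2_diff)
  have "norm2sq (\<lambda>x. w x - \<phi> x) = norm2sq (\<lambda>x. (w x - v x) + ((v x - c x) + (c x - \<phi> x)))" by simp
  also have "\<dots> < e"
    using norm2sq_add_le[OF in_L2(1) L2_add[OF in_L2(2,3)]] norm2sq_add_le[OF in_L2(2,3)] close_v close_c c\<phi> by linarith
  finally show ?thesis using that \<phi> by blast
qed

lemma test_fun_approx_sequence:
  fixes w :: "'a::euclidean_space \<Rightarrow> real"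
  assumes "L2 w"
  obtains \<phi> where "\<And>n::nat. test_fun (\<phi> n)" "(\<lambda>n. norm2sq (\<lambda>x. \<phi> n x - w x)) \<longlonglongrightarrow> 0"
proof -
  have "\<exists>\<phi>. test_fun \<phi> \<and> norm2sq (\<lambda>x. \<phi> x - w x) \<le> 1 / real (Suc n)" for n
  proof -
    have "0 < 1 / real (Suc n)" by simp
    then obtain \<phi> where "test_fun \<phi>" "norm2sq (\<lambda>x. w x - \<phi> x) < 1 / real (Suc n)" by (rule test_fun_dense[OF assms])
    then show ?thesis unfolding norm2sq_minus_commute[of w] by (meson less_imp_le)
  qed
  then obtain \<phi> where \<phi>: "\<And>n. test_fun (\<phi> n)" "\<And>n. norm2sq (\<lambda>x. \<phi> n x - w x) \<le> 1 / real (Suc n)" by metis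
  have "(\<lambda>n. norm2sq (\<lambda>x. \<phi> n x - w x)) \<longlonglongrightarrow> 0"
    by (rule tendsto_sandwich[OF _ _ tendsto_const LIMSEQ_Suc[OF lim_1_over_n]]) (use \<phi>(2) in auto)
  then show ?thesis using that \<phi>(1) by blast
qed

lemma norm2_le_if_test_fun_pairing_le:
  fixes w :: "'a::euclidean_space \<Rightarrow> real"
  assumes w: "L2 w" and B: "0 \<le> B" "\<And>\<phi>. test_fun \<phi> \<Longrightarrow> inner2 \<phi> w \<le> B * norm2 \<phi>"
  shows "norm2 w \<le> B"
proof -
  obtain \<phi> where \<phi>: "\<And>n. test_fun (\<phi> n)" and lim: "(\<lambda>n. norm2sq (\<lambda>x. \<phi> n x - w x)) \<longlonglongrightarrow> 0"
    using test_fun_approx_sequence[OF w] by blast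
  note in_L2 = L2_test_fun[OF \<phi>]
  have "norm2sq w \<le> B * (0 + norm2 w)"
  proof (rule LIMSEQ_le)
    show "(\<lambda>n. inner2 (\<phi> n) w) \<longlonglongrightarrow> norm2sq w"
      unfolding norm2sq_eq_inner2[of w] by (rule inner2_tendsto_if_norm2sq[OF in_L2 w w lim])
    show "(\<lambda>n. B * (norm2 (\<lambda>x. \<phi> n x - w x) + norm2 w)) \<longlonglongrightarrow> B * (0 + norm2 w)"
      using tendsto_real_sqrt[OF lim] by (intro tendsto_intros) simp
    have "inner2 (\<phi> n) w \<le> B * (norm2 (\<lambda>x. \<phi> n x - w x) + norm2 w)" for n
      using B(2)[OF \<phi>[of n]] mult_left_mono[OF norm2_triangle[OF L2_diff[OF in_L2 w] w, of n] B(1)] by simp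
    then show "\<exists>N. \<forall>n\<ge>N. inner2 (\<phi> n) w \<le> B * (norm2 (\<lambda>x. \<phi> n x - w x) + norm2 w)" by blast
  qed
  then have "norm2 w * norm2 w \<le> B * norm2 w" by simp
  then show ?thesis
  proof (cases "0 < norm2 w")
    case False
    then show ?thesis using B(1) by linarith
  qed (rule mult_right_le_imp_le)
qed

lemma AE_eq_0_if_orthogonal_test_fun:
  fixes w :: "'a::euclidean_space \<Rightarrow> real"
  assumes w: "L2 w" and orth: "\<And>\<phi>. test_fun \<phi> \<Longrightarrow> inner2 \<phi> w = 0"
  shows "AE x in lebesgue. w x = 0"
proof -
  have "norm2 w \<le> 0" by (rule norm2_le_if_test_fun_pairing_le[OF w]) (simp_all add: orth)
  then show ?thesis using norm2sq_nonneg[of w] by (intro norm2sq_eq_0[OF w]) (simp add: order_antisym)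
qed

lemma inner2_tendsto_if_test_fun:
  fixes g :: "nat \<Rightarrow> 'a::euclidean_space \<Rightarrow> real"
  assumes g: "\<And>n. L2 (g n)" "\<And>n. norm2 (g n) \<le> B" and G: "L2 G" and h: "L2 h"
    and lim: "\<And>\<phi>. test_fun \<phi> \<Longrightarrow> (\<lambda>n. inner2 (g n) \<phi>) \<longlonglongrightarrow> inner2 G \<phi>"
  shows "(\<lambda>n. inner2 (g n) h) \<longlonglongrightarrow> inner2 G h"
proof (rule LIMSEQ_I)
  fix \<epsilon> :: real assume \<epsilon>: "\<epsilon> > 0"
  define K where "K = B + norm2 G"
  have K: "K \<ge> 0" using order_trans[OF real_sqrt_ge_zero[OF norm2sq_nonneg] g(2)[of 0]] by (simp add: K_def)
  define d where "d = \<epsilon> / (2 * (K + 1))"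
  have d: "d > 0" using \<epsilon> K by (simp add: d_def)
  obtain \<phi> where \<phi>: "test_fun \<phi>" "norm2sq (\<lambda>x. h x - \<phi> x) < d\<^sup>2" using test_fun_dense[OF h, of "d\<^sup>2"] d by auto
  have L\<phi>: "L2 \<phi>" by (rule L2_test_fun[OF \<phi>(1)])
  have near: "\<bar>inner2 q h - inner2 q \<phi>\<bar> \<le> norm2 q * d" if "L2 q" for q
  proof -
    have "norm2 (\<lambda>x. h x - \<phi> x) \<le> d" using \<phi>(2) d by (intro real_le_lsqrt) auto
    then have "norm2 q * norm2 (\<lambda>x. h x - \<phi> x) \<le> norm2 q * d" by (intro mult_left_mono) auto
    then show ?thesis
      using inner2_Cauchy_Schwarz[OF that L2_diff[OF h L\<phi>]] inner2_diff_right[OF that h L\<phi>] by simp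
  qed
  obtain N where N: "\<And>n. n \<ge> N \<Longrightarrow> \<bar>inner2 (g n) \<phi> - inner2 G \<phi>\<bar> < \<epsilon> / 2"
    using LIMSEQ_D[OF lim[OF \<phi>(1)], of "\<epsilon>/2"] \<epsilon> by auto
  have "\<bar>inner2 (g n) h - inner2 G h\<bar> < \<epsilon>" if n: "n \<ge> N" for n
  proof -
    have "norm2 (g n) * d \<le> B * d" using g(2) d by (intro mult_right_mono) auto
    then have "\<bar>inner2 (g n) h - inner2 (g n) \<phi>\<bar> + \<bar>inner2 G h - inner2 G \<phi>\<bar> \<le> K * d"
      using near[OF g(1)[of n]] near[OF G] by (simp add: K_def distrib_right)
    also have "K * d \<le> \<epsilon> / 2" using K \<epsilon> by (simp add: d_def field_simps)
    finally show ?thesis using N[OF n] by linarith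
  qed
  then show "\<exists>no. \<forall>n\<ge>no. norm (inner2 (g n) h - inner2 G h) < \<epsilon>" by auto
qed

subsection \<open>Difference quotients\<close>

lemma test_fun_line_derivative:
  assumes "test_fun \<phi>"
  shows "((\<lambda>s. \<phi> (x + s *\<^sub>R v)) has_real_derivative dir_deriv \<phi> v (x + s *\<^sub>R v)) (at s)"
proof -
  have "((\<lambda>s. x + s *\<^sub>R v) has_derivative (\<lambda>d. d *\<^sub>R v)) (at s)" by (auto intro!: derivative_eq_intros)
  from diff_chain_at[OF this test_fun_has_derivative[OF assms]]
  have "((\<lambda>s. \<phi> (x + s *\<^sub>R v)) has_derivative (\<lambda>d. dir_deriv \<phi> (d *\<^sub>R v) (x + s *\<^sub>R v))) (at s)"
    by (simp add: o_def)
  moreover have "(\<lambda>d. dir_deriv \<phi> (d *\<^sub>R v) (x + s *\<^sub>R v)) = (*) (dir_deriv \<phi> v (x + s *\<^sub>R v))"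
    using linear_scale[OF has_derivative_linear[OF test_fun_has_derivative[OF assms]]] by (auto simp: mult.commute)
  ultimately show ?thesis by (simp add: has_field_derivative_def)
qed

lemma test_fun_difference_quotient_bound:
  assumes \<phi>: "test_fun \<phi>"
  obtains M R where "\<And>x s. \<bar>s\<bar> \<le> B \<Longrightarrow> \<bar>(\<phi> (x + s *\<^sub>R v) - \<phi> x) / s - dir_deriv \<phi> v x\<bar> \<le> M * indicator (cball 0 R) x"
proof -
  obtain R where R: "R > 0" "\<And>x. R < norm x \<Longrightarrow> \<phi> x = 0" "\<And>x v. R < norm x \<Longrightarrow> dir_deriv \<phi> v x = 0"
    using test_fun_support[OF \<phi>] by blast
  obtain M where M: "M \<ge> 0" "\<And>x. \<bar>dir_deriv \<phi> v x\<bar> \<le> M"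
    using continuous_compact_support_bounded[OF test_fun_continuous_dir_deriv[OF \<phi>, of v] R(3)] by blast
  have quotient: "\<bar>(\<phi> (x + s *\<^sub>R v) - \<phi> x) / s\<bar> \<le> M" for x s
  proof -
    have "norm (\<phi> (x + s *\<^sub>R v) - \<phi> (x + 0 *\<^sub>R v)) \<le> M * norm (s - 0)"
      by (rule field_differentiable_bound[where S=UNIV and f'="\<lambda>s. dir_deriv \<phi> v (x + s *\<^sub>R v)"])
         (use test_fun_line_derivative[OF \<phi>] M(2) in auto)
    then show ?thesis using M(1) by (cases "s = 0") (auto simp: abs_divide divide_le_eq)
  qed
  have "\<bar>(\<phi> (x + s *\<^sub>R v) - \<phi> x) / s - dir_deriv \<phi> v x\<bar> \<le> (2 * M) * indicator (cball 0 (R + \<bar>B\<bar> * norm v)) x"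
    if s: "\<bar>s\<bar> \<le> B" for x s
  proof (cases "norm x \<le> R + \<bar>B\<bar> * norm v")
    case True
    then show ?thesis
      using abs_triangle_ineq4[of "(\<phi> (x + s *\<^sub>R v) - \<phi> x) / s" "dir_deriv \<phi> v x"] quotient[of x s] M(2)[of x]
      by simp
  next
    case False
    have "norm (s *\<^sub>R v) \<le> \<bar>B\<bar> * norm v" using s by (simp add: mult_right_mono)
    moreover have "norm x \<le> norm (x + s *\<^sub>R v) + norm (s *\<^sub>R v)"
      using norm_triangle_ineq4[of "x + s *\<^sub>R v" "s *\<^sub>R v"] by simp
    moreover have "0 \<le> \<bar>B\<bar> * norm v" by simp
    ultimately have "R < norm (x + s *\<^sub>R v)" "R < norm x" using False by linarith+
    then show ?thesis using False by (simp add: R)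
  qed
  then show ?thesis by (rule that)
qed

lemma test_fun_difference_quotient_tendsto:
  assumes \<phi>: "test_fun \<phi>" and h: "\<And>n. h n \<noteq> 0" "h \<longlonglongrightarrow> 0"
  shows "(\<lambda>n. norm2sq (\<lambda>x. (\<phi> (x + h n *\<^sub>R v) - \<phi> x) / h n - dir_deriv \<phi> v x)) \<longlonglongrightarrow> 0"
proof -
  obtain B where B: "\<And>n. \<bar>h n\<bar> \<le> B"
    using convergent_imp_Bseq[of h] h(2) by (auto simp: convergent_def Bseq_def)
  obtain M R where bound: "\<And>x s. \<bar>s\<bar> \<le> B \<Longrightarrow>
      \<bar>(\<phi> (x + s *\<^sub>R v) - \<phi> x) / s - dir_deriv \<phi> v x\<bar> \<le> M * indicator (cball 0 R) x"
    by (rule test_fun_difference_quotient_bound[OF \<phi>]) (rule that)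
  show ?thesis
  proof (rule norm2sq_tendsto_0_dominated)
    note [measurable] = L2_test_fun[OF \<phi>] L2_dir_deriv[OF \<phi>, of v] L2_test_fun[OF test_fun_shift(1)[OF \<phi>]]
    show "(\<lambda>x. (\<phi> (x + h n *\<^sub>R v) - \<phi> x) / h n - dir_deriv \<phi> v x) \<in> borel_measurable lebesgue" for n
      by measurable
    show "L2 (\<lambda>x. M *\<^sub>R indicat_real (cball 0 R) x)"
      by (intro L2_scaleR L2_indicator_lmeasurable lmeasurable_cball)
    show "AE x in lebesgue. norm ((\<phi> (x + h n *\<^sub>R v) - \<phi> x) / h n - dir_deriv \<phi> v x)
        \<le> norm (M *\<^sub>R indicat_real (cball 0 R) x)" for n
      using order_trans[OF bound[OF B] abs_ge_self] by (intro AE_I2) (simp add: real_scaleR_def)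
    have "(\<lambda>n. (\<phi> (x + h n *\<^sub>R v) - \<phi> x) / h n) \<longlonglongrightarrow> dir_deriv \<phi> v x" for x
      using test_fun_line_derivative[OF \<phi>, of x v 0] h
      unfolding DERIV_def tendsto_at_iff_sequentially by (auto simp: o_def)
    then show "AE x in lebesgue. (\<lambda>n. (\<phi> (x + h n *\<^sub>R v) - \<phi> x) / h n - dir_deriv \<phi> v x) \<longlonglongrightarrow> 0"
      by (intro AE_I2) (simp add: LIM_zero_iff)
  qed
qed

lemma inner2_shift_test_fun_derivative:
  assumes u: "L2 u" and \<phi>: "test_fun \<phi>"
  shows "((\<lambda>t. inner2 (\<lambda>x. \<phi> (x + t *\<^sub>R v)) u) has_real_derivative inner2 (\<lambda>x. dir_deriv \<phi> v (x + t *\<^sub>R v)) u) (at t)"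
  unfolding DERIV_def tendsto_at_iff_sequentially
proof (intro allI impI)
  fix h :: "nat \<Rightarrow> real" assume h: "\<forall>i. h i \<in> UNIV - {0}" "h \<longlonglongrightarrow> 0"
  define \<psi> where "\<psi> x = \<phi> (x + t *\<^sub>R v)" for x
  have \<psi>: "test_fun \<psi>" unfolding \<psi>_def[abs_def] by (rule test_fun_shift(1)[OF \<phi>])
  have D\<psi>: "dir_deriv \<psi> v x = dir_deriv \<phi> v (x + t *\<^sub>R v)" for x
    unfolding \<psi>_def[abs_def] by (rule test_fun_shift(2)[OF \<phi>])
  have shift: "L2 (\<lambda>x. \<psi> (x + h n *\<^sub>R v))" for n by (intro L2_test_fun test_fun_shift \<psi>)
  have in_L2: "L2 (\<lambda>x. (1 / h n) *\<^sub>R (\<psi> (x + h n *\<^sub>R v) - \<psi> x))" for n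
    by (intro L2_scaleR L2_diff shift L2_test_fun \<psi>)
  have "(\<lambda>n. inner2 (\<lambda>x. (1 / h n) *\<^sub>R (\<psi> (x + h n *\<^sub>R v) - \<psi> x)) u) \<longlonglongrightarrow> inner2 (dir_deriv \<psi> v) u"
    using test_fun_difference_quotient_tendsto[OF \<psi>, of h v] h
    by (intro inner2_tendsto_if_norm2sq in_L2 L2_dir_deriv \<psi> u) auto
  also have "(\<lambda>n. inner2 (\<lambda>x. (1 / h n) *\<^sub>R (\<psi> (x + h n *\<^sub>R v) - \<psi> x)) u)
      = (\<lambda>h. (inner2 (\<lambda>x. \<phi> (x + (t + h) *\<^sub>R v)) u - inner2 (\<lambda>x. \<phi> (x + t *\<^sub>R v)) u) / h) \<circ> h"
    unfolding inner2_scaleR_left inner2_diff_left[OF shift L2_test_fun[OF \<psi>] u]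
    by (simp add: \<psi>_def[abs_def] o_def algebra_simps diff_divide_distrib)
  finally show "((\<lambda>h. (inner2 (\<lambda>x. \<phi> (x + (t + h) *\<^sub>R v)) u - inner2 (\<lambda>x. \<phi> (x + t *\<^sub>R v)) u) / h) \<circ> h)
      \<longlonglongrightarrow> inner2 (\<lambda>x. dir_deriv \<phi> v (x + t *\<^sub>R v)) u" by (simp add: D\<psi> o_def)
qed

section \<open>Weak gradients\<close>

definition H1_gradient :: "('a::euclidean_space \<Rightarrow> real) \<Rightarrow> ('a \<Rightarrow> 'a) \<Rightarrow> bool" where
  "H1_gradient u g \<longleftrightarrow> L2 u \<and> L2 g \<and> weak_gradient u g"

lemma H1_gradient_L2: "H1_gradient u g \<Longrightarrow> L2 u" "H1_gradient u g \<Longrightarrow> L2 g"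
  by (simp_all add: H1_gradient_def)

lemma H1_gradientI:
  assumes "L2 u" "L2 g"
    and "\<And>\<phi> e. test_fun \<phi> \<Longrightarrow> e \<in> Basis \<Longrightarrow> inner2 u (dir_deriv \<phi> e) = - inner2 (\<lambda>x. g x \<bullet> e) \<phi>"
  shows "H1_gradient u g"
  using assms by (simp add: H1_gradient_def weak_gradient_def L2_measurable inner2_def)

lemma H1_gradient_test_fun:
  assumes "H1_gradient u g" "test_fun \<phi>"
  shows "inner2 u (dir_deriv \<phi> v) = - inner2 (\<lambda>x. g x \<bullet> v) \<phi>"
proof -
  note in_L2 = H1_gradient_L2[OF assms(1)]
  have "dir_deriv \<phi> v x = (\<Sum>e\<in>Basis. (v \<bullet> e) * dir_deriv \<phi> e x)" for x
    by (rule linear_real_eq_sum_Basis[OF has_derivative_linear[OF test_fun_has_derivative[OF assms(2)]]])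
  then have "inner2 u (dir_deriv \<phi> v) = (LINT x|lebesgue. (\<Sum>e\<in>Basis. (v \<bullet> e) * (u x * dir_deriv \<phi> e x)))"
    by (simp add: inner2_def sum_distrib_left mult_ac)
  also have "\<dots> = (\<Sum>e\<in>Basis. (v \<bullet> e) * inner2 u (dir_deriv \<phi> e))"
    by (simp add: inner2_def Bochner_Integration.integral_sum L2_mult_integrable in_L2 L2_dir_deriv[OF assms(2)])
  also have "\<dots> = (\<Sum>e\<in>Basis. (v \<bullet> e) * - inner2 (\<lambda>x. g x \<bullet> e) \<phi>)"
    using assms by (simp add: H1_gradient_def weak_gradient_def inner2_def)
  also have "\<dots> = - (LINT x|lebesgue. (\<Sum>e\<in>Basis. (v \<bullet> e) * ((g x \<bullet> e) * \<phi> x)))"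
    by (simp add: inner2_def sum_negf Bochner_Integration.integral_sum L2_mult_integrable L2_component in_L2
        L2_test_fun[OF assms(2)])
  also have "\<dots> = - inner2 (\<lambda>x. g x \<bullet> v) \<phi>"
  proof -
    have "(g x \<bullet> v) * \<phi> x = (\<Sum>e\<in>Basis. (v \<bullet> e) * ((g x \<bullet> e) * \<phi> x))" for x
      by (subst euclidean_inner[of "g x" v]) (simp add: sum_distrib_left mult_ac)
    then show ?thesis by (simp add: inner2_def)
  qed
  finally show ?thesis .
qed

lemma H1_gradient_unique:
  assumes g: "H1_gradient u g" "H1_gradient u h" shows "AE x in lebesgue. g x = h x"
proof -
  note in_L2 = g[THEN H1_gradient_L2(2)]
  have "AE x in lebesgue. (g x - h x) \<bullet> e = 0" if "e \<in> Basis" for e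
  proof (rule AE_eq_0_if_orthogonal_test_fun)
    show "L2 (\<lambda>x. (g x - h x) \<bullet> e)" by (intro L2_component L2_diff in_L2)
    show "inner2 \<phi> (\<lambda>x. (g x - h x) \<bullet> e) = 0" if \<phi>: "test_fun \<phi>" for \<phi>
      using g[THEN H1_gradient_test_fun, OF \<phi>, of e]
      by (simp add: inner2_commute[of \<phi>] inner_diff_left inner2_diff_left L2_component in_L2 L2_test_fun[OF \<phi>])
  qed
  then have "AE x in lebesgue. \<forall>e\<in>Basis. (g x - h x) \<bullet> e = 0" by (rule AE_finite_allI[OF finite_Basis])
  then show ?thesis
  proof eventually_elim
    fix x assume "\<forall>e\<in>Basis. (g x - h x) \<bullet> e = 0"
    then show "g x = h x" unfolding euclidean_all_zero_iff by simp
  qed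
qed

lemma H1_iff_H1_gradient: "H1 u \<longleftrightarrow> (\<exists>g. H1_gradient u g)"
  by (auto simp: H1_def L2_def H1_gradient_def weak_gradient_def)

lemma H1_gradient_grad: assumes "H1 u" shows "H1_gradient u (grad u)"
proof -
  have "\<exists>g. weak_gradient u g \<and> integrable lebesgue (\<lambda>x. (norm (g x))\<^sup>2)" using assms by (simp add: H1_def)
  from someI_ex[OF this] have "weak_gradient u (grad u) \<and> integrable lebesgue (\<lambda>x. (norm (grad u x))\<^sup>2)"
    unfolding grad_def .
  then show ?thesis using assms by (auto simp: H1_gradient_def L2_def weak_gradient_def H1_def)
qed

lemmas L2_grad = H1_gradient_L2(2)[OF H1_gradient_grad]

lemma H1_L2: "H1 u \<Longrightarrow> L2 u"
  using H1_gradient_grad H1_gradient_L2(1) by blast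

lemma H1_gradient_imp:
  assumes "H1_gradient u g" shows "H1 u" "AE x in lebesgue. grad u x = g x"
proof -
  show "H1 u" using assms by (auto simp: H1_iff_H1_gradient)
  then show "AE x in lebesgue. grad u x = g x" by (rule H1_gradient_unique[OF H1_gradient_grad assms])
qed

lemma H1_gradient_add:
  assumes "H1_gradient u g" "H1_gradient v h"
  shows "H1_gradient (\<lambda>x. u x + v x) (\<lambda>x. g x + h x)"
proof (rule H1_gradientI)
  note in_L2 = assms[THEN H1_gradient_L2(1)] assms[THEN H1_gradient_L2(2)]
  show "L2 (\<lambda>x. u x + v x)" "L2 (\<lambda>x. g x + h x)" by (intro L2_add in_L2)+
  show "inner2 (\<lambda>x. u x + v x) (dir_deriv \<phi> e) = - inner2 (\<lambda>x. (g x + h x) \<bullet> e) \<phi>" if "test_fun \<phi>" for \<phi> e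
    using assms[THEN H1_gradient_test_fun, OF that, of e]
    by (simp add: inner_add_left inner2_add_left in_L2 L2_component L2_test_fun L2_dir_deriv that)
qed

lemma H1_gradient_cmult:
  assumes "H1_gradient u g" shows "H1_gradient (\<lambda>x. c * u x) (\<lambda>x. c *\<^sub>R g x)"
proof (rule H1_gradientI)
  note in_L2 = H1_gradient_L2[OF assms]
  show "L2 (\<lambda>x. c * u x)" "L2 (\<lambda>x. c *\<^sub>R g x)" by (rule L2_cmult[OF in_L2(1)], rule L2_scaleR[OF in_L2(2)])
  show "inner2 (\<lambda>x. c * u x) (dir_deriv \<phi> e) = - inner2 (\<lambda>x. (c *\<^sub>R g x) \<bullet> e) \<phi>" if "test_fun \<phi>" for \<phi> e
    using H1_gradient_test_fun[OF assms that, of e] inner2_scaleR_left[of c u] inner2_scaleR_left[of c "\<lambda>x. g x \<bullet> e"]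
    by simp
qed

lemma H1_gradient_AE_cong:
  assumes "H1_gradient u g" "AE x in lebesgue. v x = u x" shows "H1_gradient v g"
proof (rule H1_gradientI)
  note in_L2 = H1_gradient_L2[OF assms(1)]
  show "L2 v" "L2 g" by (rule L2_AE_cong[OF in_L2(1) assms(2)]) (rule in_L2(2))
  show "inner2 v (dir_deriv \<phi> e) = - inner2 (\<lambda>x. g x \<bullet> e) \<phi>" if "test_fun \<phi>" for \<phi> e
    using H1_gradient_test_fun[OF assms(1) that, of e] inner2_AE_cong[OF in_L2(1) L2_dir_deriv[OF that, of e] assms(2)]
    by simp
qed

lemma H1_gradient_orthogonal:
  fixes T :: "'a::euclidean_space \<Rightarrow> 'a"
  assumes u: "H1_gradient u g" and T: "orthogonal_transformation T"
  shows "H1_gradient (\<lambda>x. u (T x)) (\<lambda>x. inv T (g (T x)))"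
proof (rule H1_gradientI)
  note in_L2 = H1_gradient_L2[OF u] and mT = measure_preserving_orthogonal[OF T]
  have inv_T: "T (inv T x) = x" "inv T (T x) = x" for x
    using orthogonal_transformation_bij[OF T] by (auto simp: bij_is_surj surj_f_inv_f bij_is_inj inv_f_f)
  have "orthogonal_transformation (inv T)" using T by (rule orthogonal_transformation_inv)
  then have S: "bounded_linear (inv T)" "\<And>x. norm (inv T x) = norm x"
    by (auto simp: orthogonal_transformation linear_conv_bounded_linear)
  have adjoint: "inv T a \<bullet> b = a \<bullet> T b" for a b
    using T by (metis inv_T(1) orthogonal_transformation_def)
  show "L2 (\<lambda>x. u (T x))" by (rule L2_measure_preserving[OF mT in_L2(1)])
  have L2_gT: "L2 (\<lambda>x. g (T x))" by (rule L2_measure_preserving[OF mT in_L2(2)])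
  show "L2 (\<lambda>x. inv T (g (T x)))"
  proof (rule L2_bound[OF L2_gT])
    show "(\<lambda>x. inv T (g (T x))) \<in> borel_measurable lebesgue"
      by (rule measurable_compose[OF L2_measurable[OF L2_gT] borel_measurable_continuous_onI])
         (rule linear_continuous_on[OF S(1)])
  qed (simp add: S(2))
  fix \<phi> :: "'a \<Rightarrow> real" and e :: 'a assume \<phi>: "test_fun \<phi>"
  define \<psi> where "\<psi> x = \<phi> (inv T x + 0)" for x
  have \<psi>: "test_fun \<psi>" "\<And>x v. dir_deriv \<psi> v x = dir_deriv \<phi> (inv T v) (inv T x + 0)"
    unfolding \<psi>_def[abs_def] using test_fun_affine_isometry[OF \<phi> S, where c=0] by auto
  have "inner2 (\<lambda>x. u (T x)) (dir_deriv \<phi> e) = inner2 (\<lambda>x. u (T x)) (\<lambda>x. dir_deriv \<psi> (T e) (T x))"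
    by (simp add: \<psi>(2) inv_T)
  also have "\<dots> = inner2 u (dir_deriv \<psi> (T e))"
    by (intro inner2_measure_preserving[OF mT] in_L2 L2_dir_deriv \<psi>)
  also have "\<dots> = - inner2 (\<lambda>x. g x \<bullet> T e) \<psi>" by (rule H1_gradient_test_fun[OF u \<psi>(1)])
  also have "\<dots> = - inner2 (\<lambda>x. g (T x) \<bullet> T e) (\<lambda>x. \<psi> (T x))"
    using inner2_measure_preserving[OF mT L2_component[OF in_L2(2)] L2_test_fun[OF \<psi>(1)]] by simp
  also have "\<dots> = - inner2 (\<lambda>x. inv T (g (T x)) \<bullet> e) \<phi>" by (simp add: \<psi>_def inv_T adjoint)
  finally show "inner2 (\<lambda>x. u (T x)) (dir_deriv \<phi> e) = - inner2 (\<lambda>x. inv T (g (T x)) \<bullet> e) \<phi>" .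
qed

lemma H1_test_fun: assumes \<phi>: "test_fun \<phi>" shows "H1 \<phi>"
proof -
  define g where "g x = (\<Sum>e\<in>Basis. dir_deriv \<phi> e x *\<^sub>R e)" for x
  have g: "g x \<bullet> e = dir_deriv \<phi> e x" if "e \<in> Basis" for x e
    using that by (simp add: g_def inner_sum_left inner_Basis if_distrib cong: if_cong)
  have zero: "L2 (\<lambda>x::'a. 0::'a)" by (simp add: L2_def)
  have "L2 (\<lambda>x. \<Sum>e\<in>B. dir_deriv \<phi> e x *\<^sub>R e)" if "finite B" "B \<subseteq> Basis" for B
    using that by (induction rule: finite_induct) (auto intro!: L2_add L2_scaleR_const L2_dir_deriv \<phi> zero)
  then have "L2 g" unfolding g_def[abs_def] by simp
  have "H1_gradient \<phi> g"
  proof (rule H1_gradientI[OF L2_test_fun[OF \<phi>] \<open>L2 g\<close>])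
    fix \<psi> :: "'a \<Rightarrow> real" and e :: 'a assume \<psi>: "test_fun \<psi>" and e: "e \<in> Basis"
    have shift: "inner2 (\<lambda>x. \<psi> (x + t *\<^sub>R e)) \<phi> = inner2 (\<lambda>x. \<phi> (x + t *\<^sub>R (- e))) \<psi>" for t
      using inner2_measure_preserving[OF measure_preserving_translation[of "t *\<^sub>R e"]
          L2_test_fun[OF test_fun_shift(1)[OF \<phi>, of "t *\<^sub>R (- e)"]] L2_test_fun[OF \<psi>]]
      by (simp add: inner2_commute)
    have "((\<lambda>t. inner2 (\<lambda>x. \<psi> (x + t *\<^sub>R e)) \<phi>) has_real_derivative inner2 (dir_deriv \<psi> e) \<phi>) (at 0)"
      using inner2_shift_test_fun_derivative[OF L2_test_fun[OF \<phi>] \<psi>, of e 0] by simp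
    moreover have "((\<lambda>t. inner2 (\<lambda>x. \<psi> (x + t *\<^sub>R e)) \<phi>) has_real_derivative inner2 (dir_deriv \<phi> (- e)) \<psi>) (at 0)"
      using inner2_shift_test_fun_derivative[OF L2_test_fun[OF \<psi>] \<phi>, of "- e" 0] by (simp only: shift) simp
    ultimately have "inner2 (dir_deriv \<psi> e) \<phi> = inner2 (dir_deriv \<phi> (- e)) \<psi>" by (rule DERIV_unique)
    moreover have "dir_deriv \<phi> (- e) x = - (g x \<bullet> e)" for x
      using linear_neg[OF has_derivative_linear[OF test_fun_has_derivative[OF \<phi>]]] by (simp add: g[OF e])
    ultimately show "inner2 \<phi> (dir_deriv \<psi> e) = - inner2 (\<lambda>x. g x \<bullet> e) \<psi>"
      using inner2_scaleR_left[of "-1" "\<lambda>x. g x \<bullet> e" \<psi>] by (simp add: inner2_commute[of \<phi>])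
  qed
  then show ?thesis by (rule H1_gradient_imp)
qed

section \<open>Translation estimate and ball averages\<close>

lemma translation_estimate:
  assumes grad_u: "H1_gradient u g"
  shows "norm2 (\<lambda>x. u (x + h) - u x) \<le> norm h * norm2 g"
proof (rule norm2_le_if_test_fun_pairing_le)
  note in_L2 = H1_gradient_L2[OF grad_u]
  have L2_uh: "L2 (\<lambda>x. u (x + h))" by (rule L2_measure_preserving[OF measure_preserving_translation in_L2(1)])
  then show "L2 (\<lambda>x. u (x + h) - u x)" by (intro L2_diff in_L2)
  fix \<phi> :: "'a \<Rightarrow> real" assume \<phi>: "test_fun \<phi>"
  define D where "D t = inner2 (\<lambda>x. \<phi> (x + t *\<^sub>R (- h))) u" for t
  define D' where "D' t = inner2 (\<lambda>x. dir_deriv \<phi> (- h) (x + t *\<^sub>R (- h))) u" for t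
  have D: "(D has_real_derivative D' t) (at t)" for t
    unfolding D_def[abs_def] D'_def by (rule inner2_shift_test_fun_derivative[OF in_L2(1) \<phi>])
  have D'_le: "norm (D' t) \<le> norm h * norm2 g * norm2 \<phi>" for t
  proof -
    define \<psi> where "\<psi> x = \<phi> (x + t *\<^sub>R (- h))" for x
    have \<psi>: "test_fun \<psi>" unfolding \<psi>_def[abs_def] by (rule test_fun_shift(1)[OF \<phi>])
    have "D' t = inner2 u (dir_deriv \<psi> (- h))"
      unfolding D'_def \<psi>_def test_fun_shift(2)[OF \<phi>] by (rule inner2_commute)
    also have "\<dots> = - inner2 (\<lambda>x. g x \<bullet> (- h)) \<psi>" by (rule H1_gradient_test_fun[OF grad_u \<psi>])
    finally have "norm (D' t) \<le> norm2 (\<lambda>x. g x \<bullet> (- h)) * norm2 \<psi>"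
      using inner2_Cauchy_Schwarz[OF L2_component[OF in_L2(2), of "- h"] L2_test_fun[OF \<psi>]] by simp
    also have "\<dots> \<le> (norm (- h) * norm2 g) * norm2 \<psi>"
      by (intro mult_right_mono norm2_component_le in_L2) simp
    also have "norm2sq \<psi> = norm2sq \<phi>"
      unfolding \<psi>_def[abs_def] by (rule norm2sq_measure_preserving[OF measure_preserving_translation L2_test_fun[OF \<phi>]])
    finally show ?thesis by simp
  qed
  have "inner2 \<phi> (\<lambda>x. u (x + h)) = D 1"
    using inner2_measure_preserving[OF measure_preserving_translation[of h]
        L2_test_fun[OF test_fun_shift(1)[OF \<phi>, of "- h"]] in_L2(1)]
    by (simp add: D_def)
  then have "inner2 \<phi> (\<lambda>x. u (x + h) - u x) = D 1 - D 0"
    by (simp add: inner2_diff_right[OF L2_test_fun[OF \<phi>] L2_uh in_L2(1)] D_def)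
  also have "\<dots> \<le> norm h * norm2 g * norm2 \<phi>"
    using field_differentiable_bound[where S=UNIV and f=D and f'=D' and x=1 and y=0] D D'_le by fastforce
  finally show "inner2 \<phi> (\<lambda>x. u (x + h) - u x) \<le> norm h * norm2 g * norm2 \<phi>" .
qed simp

definition ball_vol :: "'a::euclidean_space itself \<Rightarrow> real \<Rightarrow> real" where
  "ball_vol _ r = measure lebesgue (ball (0::'a) r)"

definition ball_avg :: "real \<Rightarrow> ('a::euclidean_space \<Rightarrow> real) \<Rightarrow> 'a \<Rightarrow> real" where
  "ball_avg r u x = inner2 (indicat_real (ball x r)) u / ball_vol TYPE('a) r"

lemma ball_vol_eq: "r \<ge> 0 \<Longrightarrow> ball_vol TYPE('a::euclidean_space) r = unit_ball_vol (DIM('a)) * r ^ DIM('a)"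
  by (simp add: ball_vol_def content_ball)

lemma ball_vol_pos: "r > 0 \<Longrightarrow> ball_vol TYPE('a::euclidean_space) r > 0"
  by (simp add: ball_vol_eq)

lemma content_ball_eq_ball_vol: "r \<ge> 0 \<Longrightarrow> measure lborel (ball (x::'a::euclidean_space) r) = ball_vol TYPE('a) r"
  by (simp add: ball_vol_def content_ball)

lemmas L2_indicator_ball = L2_indicator_lmeasurable(1)[OF lmeasurable_ball]

lemma ball_avg_bound:
  fixes u :: "'a::euclidean_space \<Rightarrow> real"
  assumes "L2 u" "r > 0" shows "\<bar>ball_avg r u x\<bar> \<le> norm2 u / sqrt (ball_vol TYPE('a) r)"
proof -
  define v where "v = ball_vol TYPE('a) r"
  have v: "v > 0" unfolding v_def by (rule ball_vol_pos[OF assms(2)])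
  have "\<bar>inner2 (indicat_real (ball x r)) u\<bar> \<le> sqrt v * norm2 u"
    using inner2_Cauchy_Schwarz[OF L2_indicator_ball assms(1), of x r] assms(2)
    by (simp add: L2_indicator_lmeasurable(2) content_ball_eq_ball_vol v_def)
  then have "\<bar>ball_avg r u x\<bar> \<le> (sqrt v * norm2 u) / v"
    using v by (simp add: ball_avg_def abs_divide divide_right_mono flip: v_def)
  also have "\<dots> = norm2 u / sqrt v" using v by (simp add: field_simps)
  finally show ?thesis by (simp add: v_def)
qed

lemma ball_avg_diff:
  assumes "L2 u" "L2 v" shows "ball_avg r (\<lambda>y. u y - v y) x = ball_avg r u x - ball_avg r v x"
  by (simp add: ball_avg_def inner2_diff_right[OF L2_indicator_ball assms] diff_divide_distrib)

lemma ball_avg_AE_cong: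
  fixes u v :: "'a::euclidean_space \<Rightarrow> real"
  assumes "L2 u" "AE x in lebesgue. v x = u x" shows "ball_avg r v = ball_avg r u"
proof
  fix x
  have "inner2 (indicat_real (ball x r)) v = inner2 (indicat_real (ball x r)) u"
    by (rule inner2_AE_cong[OF L2_indicator_ball assms(1) _ assms(2)]) simp
  then show "ball_avg r v x = ball_avg r u x" by (simp add: ball_avg_def)
qed

lemma ball_avg_isometry:
  assumes "L2 u" "measure_preserving T" "\<And>x y. dist (T x) (T y) = dist x y"
  shows "ball_avg r u (T x) = ball_avg r (\<lambda>y. u (T y)) x"
proof -
  have "indicat_real (ball (T x) r) (T y) = indicat_real (ball x r) y" for y by (simp add: indicator_def assms(3))
  then show ?thesis
    using inner2_measure_preserving[OF assms(2) L2_indicator_ball assms(1), of "T x" r] by (simp add: ball_avg_def)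
qed

lemma ball_avg_near:
  fixes u :: "'a::euclidean_space \<Rightarrow> real"
  assumes u: "L2 u" and r: "r > 0" and B: "\<And>y. y \<in> ball x r \<Longrightarrow> \<bar>u y - c\<bar> \<le> B"
  shows "\<bar>ball_avg r u x - c\<bar> \<le> B"
proof -
  define v where "v = ball_vol TYPE('a) r"
  have v: "v > 0" unfolding v_def by (rule ball_vol_pos[OF r])
  define b where "b = indicat_real (ball x r)"
  have b: "integrable lebesgue b" using lmeasurable_ball[of x r] by (simp add: fmeasurable_def b_def)
  have integrable_bu: "integrable lebesgue (\<lambda>y. b y * u y)"
    unfolding b_def by (intro L2_mult_integrable L2_indicator_ball u)
  have b_int: "(LINT y|lebesgue. b y) = v" using r by (simp add: b_def v_def content_ball_eq_ball_vol)
  have "ball_avg r u x - c = (LINT y|lebesgue. b y * u y - c * b y) / v"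
    using b integrable_bu b_int v by (simp add: ball_avg_def inner2_def b_def v_def field_simps)
  also have "\<bar>\<dots>\<bar> = \<bar>LINT y|lebesgue. b y * u y - c * b y\<bar> / v" using v by simp
  also have "\<bar>LINT y|lebesgue. b y * u y - c * b y\<bar> \<le> (LINT y|lebesgue. B * b y)"
  proof (rule order_trans[OF integral_abs_bound integral_mono])
    fix y show "\<bar>b y * u y - c * b y\<bar> \<le> B * b y" using B[of y] by (auto simp: b_def indicator_def)
  qed (use b integrable_bu in auto)
  also have "\<dots> = B * v" by (simp add: b_int)
  finally show ?thesis using v by (simp add: divide_right_mono)
qed

lemma ball_avg_Lipschitz:
  fixes u :: "'a::euclidean_space \<Rightarrow> real"
  assumes grad_u: "H1_gradient u g" and r: "r > 0"
  shows "\<bar>ball_avg r u x - ball_avg r u y\<bar> \<le> norm (x - y) * (norm2 g / sqrt (ball_vol TYPE('a) r))"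
proof -
  note u = H1_gradient_L2(1)[OF grad_u]
  have shift: "L2 (\<lambda>z. u (z + (x - y)))" by (rule L2_measure_preserving[OF measure_preserving_translation u])
  have "ball_avg r u (y + (x - y)) = ball_avg r (\<lambda>z. u (z + (x - y))) y"
    by (rule ball_avg_isometry[OF u measure_preserving_translation]) simp
  then have "ball_avg r u x - ball_avg r u y = ball_avg r (\<lambda>z. u (z + (x - y)) - u z) y"
    by (simp add: ball_avg_diff[OF shift u])
  then have "\<bar>ball_avg r u x - ball_avg r u y\<bar> \<le> norm2 (\<lambda>z. u (z + (x - y)) - u z) / sqrt (ball_vol TYPE('a) r)"
    using ball_avg_bound[OF L2_diff[OF shift u] r] by simp
  also have "\<dots> \<le> norm (x - y) * norm2 g / sqrt (ball_vol TYPE('a) r)"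
    using ball_vol_pos[OF r, where 'a='a] by (intro divide_right_mono translation_estimate grad_u) auto
  finally show ?thesis by simp
qed

lemma ball_avg_continuous:
  assumes "H1_gradient u g" "r > 0" shows "continuous_on UNIV (ball_avg r u)"
proof -
  have "(norm2 g / sqrt (ball_vol TYPE('a) r))-lipschitz_on UNIV (ball_avg r u)"
    using ball_avg_Lipschitz[OF assms] ball_vol_pos[OF assms(2), where 'a='a]
    by (intro lipschitz_onI) (auto simp: dist_norm mult.commute)
  then show ?thesis by (rule lipschitz_on_continuous_on)
qed

lemma L2_borel_version:
  fixes u :: "'a::euclidean_space \<Rightarrow> real"
  assumes "L2 u"
  obtains w where "w \<in> borel_measurable borel" "AE x in lebesgue. w x = u x"
proof -
  obtain w where w: "w \<in> borel_measurable lborel" "AE x in lborel. u x = w x"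
    using completion_ex_borel_measurable_real[of u lborel] assms by (auto simp: L2_def)
  have "AE x in lebesgue. w x = u x" using w(2) unfolding AE_completion_iff by eventually_elim simp
  then show ?thesis using w(1) by (intro that[of w]) simp_all
qed

lemma
  fixes w :: "'a::euclidean_space \<Rightarrow> real"
  assumes w: "L2 w" and r: "r > 0"
  shows L2_indicator_ball_diff: "L2 (\<lambda>y. indicator (ball x r) y *\<^sub>R (w y - c))"
    and ball_avg_deviation_le: "(ball_avg r w x - c)\<^sup>2 \<le> norm2sq_on (ball x r) (\<lambda>y. w y - c) / ball_vol TYPE('a) r"
proof -
  define v where "v = ball_vol TYPE('a) r"
  have v: "v > 0" unfolding v_def by (rule ball_vol_pos[OF r])
  define b where "b = indicat_real (ball x r)"
  have b: "L2 b" "norm2sq b = v" using r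
    by (simp_all add: b_def v_def L2_indicator_ball L2_indicator_lmeasurable(2) content_ball_eq_ball_vol)
  define d where "d y = b y * w y - c * b y" for y
  have d_eq: "indicator (ball x r) y *\<^sub>R (w y - c) = d y" for y by (simp add: d_def b_def algebra_simps)
  have L2_bw: "L2 (\<lambda>y. b y * w y)" using L2_indicator[OF w, of "ball x r"] by (simp add: b_def)
  have L2_cb: "L2 (\<lambda>y. c * b y)" by (rule L2_cmult[OF b(1)])
  have d: "L2 d" unfolding d_def[abs_def] by (rule L2_diff[OF L2_bw L2_cb])
  then show "L2 (\<lambda>y. indicator (ball x r) y *\<^sub>R (w y - c))" unfolding d_eq .
  have "inner2 b (\<lambda>y. b y * w y) = inner2 b w"
    unfolding inner2_def b_def by (intro Bochner_Integration.integral_cong) (auto simp: indicator_def)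
  moreover have "inner2 b (\<lambda>y. c * b y) = c * v"
    using inner2_scaleR_left[of c b b] inner2_commute[of b "\<lambda>y. c * b y"] b(2) by (simp add: norm2sq_eq_inner2)
  ultimately have "inner2 b d = inner2 b w - c * v"
    unfolding d_def[abs_def] by (simp add: inner2_diff_right[OF b(1) L2_bw L2_cb])
  then have "ball_avg r w x - c = inner2 b d / v" using v by (simp add: ball_avg_def b_def v_def field_simps)
  then have "(ball_avg r w x - c)\<^sup>2 = \<bar>inner2 b d\<bar>\<^sup>2 / v\<^sup>2" by (simp add: power_divide)
  also have "\<dots> \<le> (sqrt v * norm2 d)\<^sup>2 / v\<^sup>2"
    using inner2_Cauchy_Schwarz[OF b(1) d] b(2) by (intro divide_right_mono power_mono) auto
  also have "\<dots> = norm2sq d / v"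
    using v by (subst power_mult_distrib) (simp add: power2_eq_square[of v])
  finally show "(ball_avg r w x - c)\<^sup>2 \<le> norm2sq_on (ball x r) (\<lambda>y. w y - c) / ball_vol TYPE('a) r"
    unfolding norm2sq_on_def d_eq v_def .
qed

lemma nn_integral_ball_avg_deviation_le:
  fixes w :: "'a::euclidean_space \<Rightarrow> real"
  assumes w[measurable]: "w \<in> borel_measurable borel" and in_L2: "L2 w" and r: "r > 0"
  shows "ennreal ((norm (w x - ball_avg r w x))\<^sup>2)
    \<le> ennreal (1 / ball_vol TYPE('a) r) * (\<integral>\<^sup>+h. indicator (ball 0 r) h * ennreal ((w (x + h) - w x)\<^sup>2) \<partial>lborel)"
proof -
  define v where "v = ball_vol TYPE('a) r"
  have v: "v > 0" unfolding v_def by (rule ball_vol_pos[OF r])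
  have "ennreal ((norm (w x - ball_avg r w x))\<^sup>2) \<le> ennreal (1 / v) * ennreal (norm2sq_on (ball x r) (\<lambda>y. w y - w x))"
    using ball_avg_deviation_le[OF in_L2 r, of x "w x"] v
    by (simp add: v_def power2_commute[of "w x"] ennreal_leI flip: ennreal_mult')
  also have "ennreal (norm2sq_on (ball x r) (\<lambda>y. w y - w x))
      = (\<integral>\<^sup>+y. ennreal ((norm (indicator (ball x r) y *\<^sub>R (w y - w x)))\<^sup>2) \<partial>lborel)"
    unfolding norm2sq_on_def nn_integral_norm2sq[OF L2_indicator_ball_diff[OF in_L2 r], symmetric]
        nn_integral_completion ..
  also have "\<dots> = (\<integral>\<^sup>+y. indicator (ball 0 r) (y - x) * ennreal ((w y - w x)\<^sup>2) \<partial>lborel)"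
    by (intro nn_integral_cong) (auto simp: indicator_def dist_norm norm_minus_commute)
  also have "\<dots> = (\<integral>\<^sup>+h. indicator (ball 0 r) h * ennreal ((w (x + h) - w x)\<^sup>2) \<partial>lborel)"
  proof -
    have [measurable]: "ball (0::'a) r \<in> sets borel" by simp
    have "(\<lambda>y. indicator (ball 0 r) (y - x) * ennreal ((w y - w x)\<^sup>2)) \<in> borel_measurable borel" by measurable
    from nn_integral_translation[OF _ _ this, of lborel x] show ?thesis
      using measure_preserving_translation[of x] by (simp add: measure_preserving_def add.commute)
  qed
  finally show ?thesis by (simp add: v_def)
qed

lemma nn_integral_translation_estimate:
  assumes grad_w: "H1_gradient w g" and h: "norm h \<le> r"
  shows "(\<integral>\<^sup>+x. ennreal ((w (x + h) - w x)\<^sup>2) \<partial>lborel) \<le> ennreal (r\<^sup>2 * norm2sq g)"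
proof -
  note in_L2 = H1_gradient_L2(1)[OF grad_w]
  have "norm2 (\<lambda>x. w (x + h) - w x) \<le> r * norm2 g"
    using h by (intro order_trans[OF translation_estimate[OF grad_w] mult_right_mono]) auto
  then have "norm2sq (\<lambda>x. w (x + h) - w x) \<le> (r * norm2 g)\<^sup>2" by (rule sqrt_le_D)
  moreover have "(\<integral>\<^sup>+x. ennreal ((norm (w (x + h) - w x))\<^sup>2) \<partial>lborel) = ennreal (norm2sq (\<lambda>x. w (x + h) - w x))"
    using nn_integral_norm2sq[OF L2_diff[OF L2_measure_preserving[OF measure_preserving_translation in_L2] in_L2]]
    by (simp add: nn_integral_completion)
  ultimately show ?thesis by (simp add: ennreal_leI power_mult_distrib)
qed

lemma
  fixes u :: "'a::euclidean_space \<Rightarrow> real"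
  assumes grad_u: "H1_gradient u g" and r: "r > 0"
  shows L2_ball_avg_deviation: "L2 (\<lambda>x. u x - ball_avg r u x)"
    and norm2_ball_avg_deviation_le: "norm2 (\<lambda>x. u x - ball_avg r u x) \<le> r * norm2 g"
proof -
  note u = H1_gradient_L2(1)[OF grad_u]
  define v where "v = ball_vol TYPE('a) r"
  have v: "v > 0" unfolding v_def by (rule ball_vol_pos[OF r])
  obtain w where w[measurable]: "w \<in> borel_measurable borel" and ae_eq: "AE x in lebesgue. w x = u x"
    using L2_borel_version[OF u] by blast
  have grad_w: "H1_gradient w g" by (rule H1_gradient_AE_cong[OF grad_u ae_eq])
  note in_L2 = H1_gradient_L2(1)[OF grad_w]
  have [measurable]: "ball_avg r w \<in> borel_measurable borel"
    by (intro borel_measurable_continuous_onI ball_avg_continuous[OF grad_w r])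
  have [measurable]: "ball (0::'a) r \<in> sets borel" by simp
  have shift: "(\<integral>\<^sup>+x. indicator (ball 0 r) h * ennreal ((w (x + h) - w x)\<^sup>2) \<partial>lborel)
      \<le> ennreal (r\<^sup>2 * norm2sq g) * indicator (ball 0 r) h" for h
    using nn_integral_translation_estimate[OF grad_w, of h r] by (cases "h \<in> ball 0 r") auto
  have "(\<integral>\<^sup>+x. ennreal ((norm (w x - ball_avg r w x))\<^sup>2) \<partial>lebesgue)
      \<le> (\<integral>\<^sup>+x. ennreal (1 / v) * (\<integral>\<^sup>+h. indicator (ball 0 r) h * ennreal ((w (x + h) - w x)\<^sup>2) \<partial>lborel) \<partial>lborel)"
    using nn_integral_ball_avg_deviation_le[OF w in_L2 r] by (simp add: nn_integral_completion v_def nn_integral_mono)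
  also have "\<dots> = ennreal (1 / v)
      * (\<integral>\<^sup>+h. (\<integral>\<^sup>+x. indicator (ball 0 r) h * ennreal ((w (x + h) - w x)\<^sup>2) \<partial>lborel) \<partial>lborel)"
    by (subst nn_integral_cmult, measurable) (subst lborel_pair.Fubini', measurable)
  also have "\<dots> \<le> ennreal (1 / v) * (\<integral>\<^sup>+h. ennreal (r\<^sup>2 * norm2sq g) * indicator (ball (0::'a) r) h \<partial>lborel)"
    by (intro mult_left_mono nn_integral_mono shift) simp
  also have "\<dots> = ennreal (1 / v) * (ennreal (r\<^sup>2 * norm2sq g) * ennreal v)"
    using emeasure_ball[of r "0::'a"] r by (simp add: nn_integral_cmult v_def ball_vol_eq)
  also have "\<dots> = ennreal ((r * norm2 g)\<^sup>2)" using v by (simp add: power_mult_distrib flip: ennreal_mult')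
  finally have bound: "(\<integral>\<^sup>+x. ennreal ((norm (w x - ball_avg r w x))\<^sup>2) \<partial>lebesgue) \<le> ennreal ((r * norm2 g)\<^sup>2)" .
  have meas: "(\<lambda>x. w x - ball_avg r w x) \<in> borel_measurable lebesgue" by (intro measurable_completion) measurable
  have deviation_eq: "AE x in lebesgue. u x - ball_avg r u x = w x - ball_avg r w x"
    using ae_eq by (auto simp: ball_avg_AE_cong[OF u ae_eq])
  show "L2 (\<lambda>x. u x - ball_avg r u x)"
    using L2_if_nn_integral_le(1)[OF meas bound] by (intro L2_AE_cong[OF _ deviation_eq]) simp
  show "norm2 (\<lambda>x. u x - ball_avg r u x) \<le> r * norm2 g"
    using norm2sq_AE_cong[OF meas deviation_eq] L2_if_nn_integral_le(2)[OF meas bound] r by (intro real_le_lsqrt) auto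
qed

lemma norm2sq_ball_avg_dyadic_deviation_le:
  assumes "H1_gradient u g"
  shows "norm2sq (\<lambda>x. u x - ball_avg ((1/2)^k) u x) \<le> norm2sq g * (1/4)^k"
proof -
  have "norm2sq (\<lambda>x. u x - ball_avg ((1/2)^k) u x) \<le> ((1/2)^k * norm2 g)\<^sup>2"
    by (intro sqrt_le_D norm2_ball_avg_deviation_le[OF assms]) simp
  also have "\<dots> = norm2sq g * ((1/2)\<^sup>2)^k" by (simp add: power_mult_distrib mult.commute flip: power_mult)
  also have "(1/2::real)\<^sup>2 = 1/4" by (simp add: power2_eq_square)
  finally show ?thesis .
qed

lemma L2_ball_avg: assumes "H1_gradient u g" "r > 0" shows "L2 (ball_avg r u)"
  using L2_diff[OF H1_gradient_L2(1)[OF assms(1)] L2_ball_avg_deviation[OF assms]] by simp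

lemma ball_avg_difference_bound:
  fixes u :: "'a::euclidean_space \<Rightarrow> real"
  assumes grad_u: "H1_gradient u g" and r: "r > 0" and s: "s > 0"
  shows "\<bar>ball_avg s u x - ball_avg r u x\<bar>
      \<le> norm2 g * (r / sqrt (ball_vol TYPE('a) s) + s / sqrt (ball_vol TYPE('a) r))"
proof -
  have "\<bar>ball_avg s (ball_avg r u) x - ball_avg r u x\<bar> \<le> s * (norm2 g / sqrt (ball_vol TYPE('a) r))"
  proof (rule ball_avg_near[OF L2_ball_avg[OF grad_u r] s])
    fix y assume "y \<in> ball x s"
    then have "norm (y - x) * (norm2 g / sqrt (ball_vol TYPE('a) r)) \<le> s * (norm2 g / sqrt (ball_vol TYPE('a) r))"
      using ball_vol_pos[OF r, where 'a='a] by (intro mult_right_mono) (auto simp: dist_norm norm_minus_commute)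
    then show "\<bar>ball_avg r u y - ball_avg r u x\<bar> \<le> s * (norm2 g / sqrt (ball_vol TYPE('a) r))"
      using ball_avg_Lipschitz[OF grad_u r, of y x] by linarith
  qed
  moreover have "\<bar>ball_avg s (\<lambda>y. u y - ball_avg r u y) x\<bar> \<le> r * norm2 g / sqrt (ball_vol TYPE('a) s)"
    using ball_vol_pos[OF s, where 'a='a] norm2_ball_avg_deviation_le[OF grad_u r]
    by (intro order_trans[OF ball_avg_bound[OF L2_ball_avg_deviation[OF grad_u r] s]] divide_right_mono) auto
  moreover have "ball_avg s u x = ball_avg s (\<lambda>y. u y - ball_avg r u y) x + ball_avg s (ball_avg r u) x"
    using ball_avg_diff[OF H1_gradient_L2(1)[OF grad_u] L2_ball_avg[OF grad_u r]] by simp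
  ultimately show ?thesis by (simp add: algebra_simps)
qed

text \<open>Ball averages of a function invariant up to null sets are invariant everywhere.\<close>

lemma AE_invariant_modification:
  fixes w :: "'a::euclidean_space \<Rightarrow> real"
  assumes w: "H1 w" and T: "\<And>T. T \<in> G \<Longrightarrow> orthogonal_transformation T"
    and inv: "\<And>T. T \<in> G \<Longrightarrow> AE x in lebesgue. w (T x) = w x"
  obtains w' where "AE x in lebesgue. w' x = w x" "\<And>T x. T \<in> G \<Longrightarrow> w' (T x) = w' x"
proof
  note grad_w = H1_gradient_grad[OF w]
  define w' where "w' x = lim (\<lambda>k. ball_avg ((1/2)^k) w x)" for x
  have "AE x in lebesgue. summable (\<lambda>k. norm (w x - ball_avg ((1/2)^k) w x))"
  proof (rule AE_summable_if_norm2sq_le_geometric)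
    show "L2 (\<lambda>x. w x - ball_avg ((1/2)^k) w x)" for k by (rule L2_ball_avg_deviation[OF grad_w]) simp
  qed (rule norm2sq_ball_avg_dyadic_deviation_le[OF grad_w])
  then show "AE x in lebesgue. w' x = w x"
  proof eventually_elim
    fix x assume "summable (\<lambda>k. norm (w x - ball_avg ((1/2)^k) w x))"
    then have "(\<lambda>k. w x - ball_avg ((1/2)^k) w x) \<longlonglongrightarrow> 0" by (intro tendsto_norm_zero_cancel[OF summable_LIMSEQ_zero])
    then have "(\<lambda>k. w x - (w x - ball_avg ((1/2)^k) w x)) \<longlonglongrightarrow> w x - 0" by (intro tendsto_intros)
    then show "w' x = w x" unfolding w'_def by (intro limI) simp
  qed
  show "w' (S x) = w' x" if S: "S \<in> G" for S x
  proof -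
    have "dist (S x) (S y) = dist x y" for x y
      using T[OF S] by (metis dist_norm linear_diff orthogonal_transformation)
    then have "ball_avg r w (S x) = ball_avg r (\<lambda>y. w (S y)) x" for r
      by (intro ball_avg_isometry H1_L2 w measure_preserving_orthogonal T S)
    then show ?thesis unfolding w'_def ball_avg_AE_cong[OF H1_L2[OF w] inv[OF S]] by simp
  qed
qed

section \<open>The subcritical Sobolev embedding\<close>

lemma inverse_sqrt_ball_vol_dyadic:
  "1 / sqrt (ball_vol TYPE('a::euclidean_space) ((1/2)^k))
    = 1 / sqrt (unit_ball_vol (DIM('a))) * (2 powr (real DIM('a) / 2))^k"
proof -
  have "(2 powr (real DIM('a) / 2))^k = sqrt (2 ^ (DIM('a) * k))"
    by (simp add: powr_powr powr_half_sqrt[symmetric] algebra_simps flip: powr_realpow)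
  then show ?thesis
    by (simp add: ball_vol_eq real_sqrt_mult real_sqrt_divide power_divide mult.commute flip: power_mult)
qed

lemma geometric_growth_bound:
  fixes A :: "nat \<Rightarrow> real"
  assumes a: "a > 1" and A: "A 0 \<le> B" "\<And>k. A (Suc k) \<le> A k + D * a ^ k" and B: "B \<ge> 0"
  shows "A k \<le> (B + D / (a - 1)) * a ^ k - D / (a - 1)"
proof -
  define E where "E = D / (a - 1)"
  have D: "D = E * (a - 1)" using a by (simp add: E_def)
  have "A k \<le> (B + E) * a ^ k - E"
  proof (induction k)
    case (Suc k)
    have "A (Suc k) \<le> ((B + E) * a ^ k - E) + D * a ^ k" using A(2)[of k] Suc by linarith
    also have "\<dots> = B * a ^ k + E * a ^ Suc k - E" by (simp add: D algebra_simps)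
    also have "\<dots> \<le> B * a ^ Suc k + E * a ^ Suc k - E"
      using B a by (intro diff_right_mono add_right_mono mult_left_mono power_increasing) auto
    finally show ?case by (simp add: distrib_right)
  qed (use A(1) in simp)
  then show ?thesis by (simp add: E_def)
qed

lemma ball_avg_dyadic_bound:
  assumes dim: "DIM('a::euclidean_space) \<ge> 3"
  obtains C where "C > 0"
    "\<And>(u::'a \<Rightarrow> real) g k x S. H1_gradient u g \<Longrightarrow> norm2 u \<le> S \<Longrightarrow> norm2 g \<le> S
      \<Longrightarrow> \<bar>ball_avg ((1/2)^k) u x\<bar> \<le> C * S * (2 powr (real DIM('a) / 2 - 1)) ^ k"
proof -
  define a where "a = 2 powr (real DIM('a) / 2 - 1)"
  define c where "c = 1 / sqrt (unit_ball_vol (real DIM('a)))"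
  define D where "D = c * (2 * a + 1/2)"
  have c: "c > 0" by (simp add: c_def)
  have a: "a > 1" unfolding a_def using dim by (intro gr_one_powr) auto
  have D: "D \<ge> 0" using c a by (simp add: D_def)
  have vol: "1 / sqrt (ball_vol TYPE('a) ((1/2)^k)) = c * (2 * a)^k" for k
    unfolding inverse_sqrt_ball_vol_dyadic by (simp add: c_def a_def powr_diff)
  show ?thesis
  proof (rule that)
    show "c + D / (a - 1) > 0" using c a D by (intro add_pos_nonneg) auto
    fix u :: "'a \<Rightarrow> real" and g k x S
    assume grad_u: "H1_gradient u g" and S: "norm2 u \<le> S" "norm2 g \<le> S"
    have S_nonneg: "0 \<le> S" using order_trans[OF real_sqrt_ge_zero[OF norm2sq_nonneg] S(1)] .
    define A where "A k = \<bar>ball_avg ((1/2)^k) u x\<bar>" for k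
    have "A k \<le> (c * S + D * S / (a - 1)) * a ^ k - D * S / (a - 1)"
    proof (rule geometric_growth_bound[OF a])
      have "A 0 \<le> norm2 u * (1 / sqrt (ball_vol TYPE('a) 1))"
        using ball_avg_bound[OF H1_gradient_L2(1)[OF grad_u], of 1 x] by (simp add: A_def)
      also have "\<dots> \<le> S * c" using S S_nonneg c vol[of 0] by (intro mult_mono) auto
      finally show "A 0 \<le> c * S" by (simp add: mult.commute)
      fix k
      have "A (Suc k) - A k \<le> norm2 g * ((1/2)^k * (1 / sqrt (ball_vol TYPE('a) ((1/2)^Suc k)))
          + (1/2)^Suc k * (1 / sqrt (ball_vol TYPE('a) ((1/2)^k))))"
        using ball_avg_difference_bound[OF grad_u, of "(1/2)^k" "(1/2)^Suc k" x] unfolding A_def by simp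
      also have "\<dots> = norm2 g * (D * a ^ k)"
        unfolding vol D_def by (simp add: power_mult_distrib power_divide field_simps)
      also have "\<dots> \<le> S * (D * a ^ k)" using S D a by (intro mult_right_mono) auto
      finally show "A (Suc k) \<le> A k + D * S * a ^ k" by (simp add: mult_ac)
    qed (use c S_nonneg in simp)
    also have "\<dots> \<le> (c + D / (a - 1)) * S * a ^ k" using a D S_nonneg by (simp add: algebra_simps)
    finally show "\<bar>ball_avg ((1/2)^k) u x\<bar> \<le> (c + D / (a - 1)) * S * (2 powr (real DIM('a) / 2 - 1)) ^ k"
      by (simp add: A_def a_def)
  qed
qed

lemma geometric_level:
  fixes a \<Lambda> t :: real
  assumes "a > 1" "\<Lambda> > 0" "\<Lambda> < t"
  obtains k where "\<Lambda> * a ^ k < t" "t \<le> \<Lambda> * a ^ Suc k"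
proof -
  obtain n where "t / \<Lambda> < a ^ n" using real_arch_pow[OF assms(1)] by blast
  then have n: "t \<le> \<Lambda> * a ^ n" using assms by (simp add: field_simps)
  define j where "j = (LEAST n. t \<le> \<Lambda> * a ^ n)"
  have j: "t \<le> \<Lambda> * a ^ j" unfolding j_def using n by (rule LeastI)
  have "j \<noteq> 0" using j assms by (intro notI) simp
  then obtain k where k: "j = Suc k" by (cases j) auto
  have "\<Lambda> * a ^ k < t" using not_less_Least[of k "\<lambda>n. t \<le> \<Lambda> * a ^ n"] k by (auto simp: j_def)
  then show ?thesis using j k that by blast
qed

lemma abs_powr_split: "\<bar>t\<bar> powr q = \<bar>t\<bar> powr (q - 2) * t\<^sup>2" for t q :: real
  by (cases "t = 0") (auto simp: powr_diff field_simps)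

lemma powr_le_dyadic_deviation:
  fixes t \<Lambda> a q :: real and d :: "nat \<Rightarrow> real"
  assumes a: "a > 1" and \<Lambda>: "\<Lambda> > 0" and q: "q > 2" and d: "\<And>k. \<bar>t - d k\<bar> \<le> \<Lambda> / 2 * a ^ k"
  shows "\<bar>t\<bar> powr q \<le> \<Lambda> powr (q - 2) * t\<^sup>2
    \<or> (\<exists>k. \<bar>t\<bar> powr q \<le> 4 * (\<Lambda> * a) powr (q - 2) * (a powr (q - 2))^k * (d k)\<^sup>2)"
proof (cases "\<bar>t\<bar> \<le> \<Lambda>")
  case True
  then have "\<bar>t\<bar> powr (q - 2) * t\<^sup>2 \<le> \<Lambda> powr (q - 2) * t\<^sup>2" using q by (intro mult_right_mono powr_mono2) auto
  then show ?thesis by (simp add: abs_powr_split[of t q])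
next
  case False
  then have "\<Lambda> < \<bar>t\<bar>" by simp
  then obtain k where k: "\<Lambda> * a ^ k < \<bar>t\<bar>" "\<bar>t\<bar> \<le> \<Lambda> * a ^ Suc k" by (rule geometric_level[OF a \<Lambda>])
  have "\<bar>t\<bar> \<le> 2 * \<bar>d k\<bar>" using d[of k] k(1) by linarith
  then have "\<bar>t\<bar>\<^sup>2 \<le> (2 * \<bar>d k\<bar>)\<^sup>2" by (intro power_mono) auto
  then have "\<bar>t\<bar> powr (q - 2) * t\<^sup>2 \<le> (\<Lambda> * a ^ Suc k) powr (q - 2) * (4 * (d k)\<^sup>2)"
    using k q by (intro mult_mono powr_mono2) (auto simp: power_mult_distrib)
  also have "(\<Lambda> * a ^ Suc k) powr (q - 2) = (\<Lambda> * a) powr (q - 2) * (a ^ k) powr (q - 2)"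
    using a \<Lambda> by (simp add: powr_mult[symmetric] mult_ac)
  also have "(a ^ k) powr (q - 2) = (a powr (q - 2))^k"
    using a by (simp add: powr_powr mult.commute flip: powr_realpow)
  finally have "\<bar>t\<bar> powr q \<le> 4 * (\<Lambda> * a) powr (q - 2) * (a powr (q - 2))^k * (d k)\<^sup>2"
    by (simp add: abs_powr_split[of t q] mult_ac)
  then show ?thesis by blast
qed

lemma ennreal_powr_le_dyadic_sum:
  fixes t \<Lambda> a q :: real and d :: "nat \<Rightarrow> real"
  assumes "a > 1" "\<Lambda> > 0" "q > 2" "\<And>k. \<bar>t - d k\<bar> \<le> \<Lambda> / 2 * a ^ k"
  shows "ennreal (\<bar>t\<bar> powr q) \<le> ennreal (\<Lambda> powr (q - 2)) * ennreal ((norm t)\<^sup>2)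
    + (\<Sum>k. ennreal (4 * (\<Lambda> * a) powr (q - 2) * (a powr (q - 2))^k) * ennreal ((norm (d k))\<^sup>2))"
  using powr_le_dyadic_deviation[of a \<Lambda> q t d, OF assms]
proof (elim disjE exE)
  assume "\<bar>t\<bar> powr q \<le> \<Lambda> powr (q - 2) * t\<^sup>2"
  then show ?thesis by (simp add: add_increasing2 ennreal_leI flip: ennreal_mult')
next
  define b where "b k = 4 * (\<Lambda> * a) powr (q - 2) * (a powr (q - 2))^k" for k
  fix k assume "\<bar>t\<bar> powr q \<le> 4 * (\<Lambda> * a) powr (q - 2) * (a powr (q - 2))^k * (d k)\<^sup>2"
  then have "ennreal (\<bar>t\<bar> powr q) \<le> ennreal (b k) * ennreal ((norm (d k))\<^sup>2)"
    by (simp add: b_def ennreal_leI flip: ennreal_mult')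
  also have "\<dots> \<le> (\<Sum>k. ennreal (b k) * ennreal ((norm (d k))\<^sup>2))"
    using sum_le_suminf[of "\<lambda>k. ennreal (b k) * ennreal ((norm (d k))\<^sup>2)" "{k}"] by simp
  finally show ?thesis unfolding b_def by (rule add_increasing[OF zero_le])
qed

lemma suminf_ennreal_geometric:
  fixes c r :: real
  assumes "0 \<le> c" "0 \<le> r" "r < 1" shows "(\<Sum>k. ennreal (c * r^k)) = ennreal (c / (1 - r))"
  using assms by (subst suminf_ennreal2)
    (auto simp: suminf_mult suminf_geometric summable_geometric intro!: summable_mult)

lemma nn_integral_powr_le_dyadic:
  fixes u :: "'a::euclidean_space \<Rightarrow> real"
  assumes grad_u: "H1_gradient u g" and S: "norm2 u \<le> S" "norm2 g \<le> S" and q: "q > 2"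
    and a: "a > 1" "a powr (q - 2) < 4" and \<Lambda>: "\<Lambda> > 0" "\<And>k x. \<bar>ball_avg ((1/2)^k) u x\<bar> \<le> \<Lambda> / 2 * a ^ k"
  shows "(\<integral>\<^sup>+x. ennreal (\<bar>u x\<bar> powr q) \<partial>lebesgue)
    \<le> ennreal (\<Lambda> powr (q - 2) * S\<^sup>2 + 4 * (\<Lambda> * a) powr (q - 2) * S\<^sup>2 / (1 - a powr (q - 2) / 4))"
proof -
  define \<rho> where "\<rho> = a powr (q - 2) / 4"
  define K where "K = 4 * (\<Lambda> * a) powr (q - 2)"
  define b where "b k = K * (a powr (q - 2))^k" for k :: nat
  define d where "d k x = u x - ball_avg ((1/2)^k) u x" for k x
  have \<rho>: "0 \<le> \<rho>" "\<rho> < 1" using a by (simp_all add: \<rho>_def)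
  have K: "K \<ge> 0" "b k \<ge> 0" for k by (simp_all add: K_def b_def)
  have u: "L2 u" "norm2sq u \<le> S\<^sup>2" using H1_gradient_L2(1)[OF grad_u] sqrt_le_D[OF S(1)] by auto
  have "norm2sq g * (1/4)^k \<le> S\<^sup>2 * (1/4)^k" for k by (intro mult_right_mono sqrt_le_D S) auto
  then have d: "L2 (d k)" "norm2sq (d k) \<le> S\<^sup>2 * (1/4)^k" for k
    using L2_ball_avg_deviation[OF grad_u, of "(1/2)^k"]
        order_trans[OF norm2sq_ball_avg_dyadic_deviation_le[OF grad_u, of k]]
    by (auto simp: d_def[abs_def])
  note [measurable] = u(1) d(1)
  have "(\<integral>\<^sup>+x. ennreal (\<bar>u x\<bar> powr q) \<partial>lebesgue)
      \<le> (\<integral>\<^sup>+x. ennreal (\<Lambda> powr (q - 2)) * ennreal ((norm (u x))\<^sup>2)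
          + (\<Sum>k. ennreal (b k) * ennreal ((norm (d k x))\<^sup>2)) \<partial>lebesgue)"
    unfolding b_def K_def
    by (intro nn_integral_mono ennreal_powr_le_dyadic_sum a \<Lambda>(1) q) (use \<Lambda>(2) in \<open>simp add: d_def\<close>)
  also have "\<dots> = ennreal (\<Lambda> powr (q - 2)) * ennreal (norm2sq u) + (\<Sum>k. ennreal (b k) * ennreal (norm2sq (d k)))"
    by (simp add: nn_integral_add nn_integral_cmult nn_integral_suminf nn_integral_norm2sq[OF u(1)]
        nn_integral_norm2sq[OF d(1)] del: real_norm_def)
  also have "\<dots> \<le> ennreal (\<Lambda> powr (q - 2) * S\<^sup>2) + (\<Sum>k. ennreal (K * S\<^sup>2 * \<rho>^k))"
  proof (intro add_mono suminf_le)
    show "ennreal (\<Lambda> powr (q - 2)) * ennreal (norm2sq u) \<le> ennreal (\<Lambda> powr (q - 2) * S\<^sup>2)"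
      using u(2) by (simp add: ennreal_leI mult_left_mono flip: ennreal_mult')
    fix k
    have "b k * norm2sq (d k) \<le> b k * (S\<^sup>2 * (1/4)^k)" using K d by (intro mult_left_mono) auto
    also have "\<dots> = K * S\<^sup>2 * \<rho>^k" by (simp add: b_def \<rho>_def power_divide)
    finally show "ennreal (b k) * ennreal (norm2sq (d k)) \<le> ennreal (K * S\<^sup>2 * \<rho>^k)"
      using K by (simp add: ennreal_leI flip: ennreal_mult')
  qed auto
  also have "(\<Sum>k. ennreal (K * S\<^sup>2 * \<rho>^k)) = ennreal (K * S\<^sup>2 / (1 - \<rho>))"
    using K \<rho> by (intro suminf_ennreal_geometric) auto
  also have "ennreal (\<Lambda> powr (q - 2) * S\<^sup>2) + ennreal (K * S\<^sup>2 / (1 - \<rho>))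
      = ennreal (\<Lambda> powr (q - 2) * S\<^sup>2 + K * S\<^sup>2 / (1 - \<rho>))"
    using K \<rho> by (intro ennreal_plus[symmetric]) auto
  finally show ?thesis by (simp add: K_def \<rho>_def)
qed

theorem Sobolev_subcritical:
  assumes dim: "DIM('a::euclidean_space) \<ge> 3" and q: "2 < q" "q < 2 * real DIM('a) / (real DIM('a) - 2)"
  obtains C where "C > 0" "\<And>(u::'a \<Rightarrow> real) S. H1 u \<Longrightarrow> norm2 u \<le> S \<Longrightarrow> norm2 (grad u) \<le> S \<Longrightarrow> S > 0
    \<Longrightarrow> integrable lebesgue (\<lambda>x. \<bar>u x\<bar> powr q) \<and> (LINT x|lebesgue. \<bar>u x\<bar> powr q) \<le> C * S powr q"
proof -
  define a where "a = 2 powr (real DIM('a) / 2 - 1)"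
  have a: "a > 1" unfolding a_def using dim by (intro gr_one_powr) auto
  have ratio: "a powr (q - 2) < 4"
  proof -
    have "(real DIM('a) / 2 - 1) * (q - 2) < 2" using q dim by (simp add: field_simps)
    then have "2 powr ((real DIM('a) / 2 - 1) * (q - 2)) < 2 powr 2" by (intro powr_less_mono) auto
    then show ?thesis by (simp add: a_def powr_powr)
  qed
  obtain c where c: "c > 0" "\<And>(u::'a \<Rightarrow> real) g k x S. H1_gradient u g \<Longrightarrow> norm2 u \<le> S \<Longrightarrow> norm2 g \<le> S
      \<Longrightarrow> \<bar>ball_avg ((1/2)^k) u x\<bar> \<le> c * S * a ^ k"
    using ball_avg_dyadic_bound[OF dim] unfolding a_def by blast
  define C where "C = (2 * c) powr (q - 2) + 4 * (2 * c * a) powr (q - 2) / (1 - a powr (q - 2) / 4)"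
  have C: "C > 0" unfolding C_def using c(1) a ratio by (intro add_pos_nonneg divide_nonneg_pos) auto
  show ?thesis
  proof (rule that[OF C])
    fix u :: "'a \<Rightarrow> real" and S assume u: "H1 u" and S: "norm2 u \<le> S" "norm2 (grad u) \<le> S" "S > 0"
    note [measurable] = H1_L2[OF u]
    have "(\<integral>\<^sup>+x. ennreal (\<bar>u x\<bar> powr q) \<partial>lebesgue)
      \<le> ennreal ((2 * c * S) powr (q - 2) * S\<^sup>2 + 4 * (2 * c * S * a) powr (q - 2) * S\<^sup>2 / (1 - a powr (q - 2) / 4))"
      using c(1) S(3) c(2)[OF H1_gradient_grad[OF u] S(1,2)]
      by (intro nn_integral_powr_le_dyadic[OF H1_gradient_grad[OF u] S(1,2) q(1) a ratio]) auto
    also have "(2 * c * S) powr (q - 2) * S\<^sup>2 + 4 * (2 * c * S * a) powr (q - 2) * S\<^sup>2 / (1 - a powr (q - 2) / 4)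
        = C * (S powr (q - 2) * S\<^sup>2)"
      using c(1) S(3) a by (simp add: C_def powr_mult algebra_simps)
    also have "S powr (q - 2) * S\<^sup>2 = S powr q" using S(3) abs_powr_split[of S q] by simp
    finally have bound: "(\<integral>\<^sup>+x. ennreal (\<bar>u x\<bar> powr q) \<partial>lebesgue) \<le> ennreal (C * S powr q)" .
    have int: "integrable lebesgue (\<lambda>x. \<bar>u x\<bar> powr q)"
      using bound by (intro integrableI_nonneg) (auto intro: le_less_trans)
    moreover have "(LINT x|lebesgue. \<bar>u x\<bar> powr q) \<le> C * S powr q"
      using bound C nn_integral_eq_integral[OF int AE_I2[of _ "\<lambda>x. 0 \<le> \<bar>u x\<bar> powr q", OF powr_ge_zero]] by simp
    ultimately show "integrable lebesgue (\<lambda>x. \<bar>u x\<bar> powr q) \<and> (LINT x|lebesgue. \<bar>u x\<bar> powr q) \<le> C * S powr q" ..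
  qed
qed

section \<open>Local compactness\<close>

lemma convergent_if_convergent_on_dense:
  fixes f :: "nat \<Rightarrow> 'a::euclidean_space \<Rightarrow> real"
  assumes lip: "\<And>n x y. \<bar>f n x - f n y\<bar> \<le> norm (x - y) * L" and Q: "\<And>U. open U \<Longrightarrow> U \<noteq> {} \<Longrightarrow> \<exists>q\<in>Q. q \<in> U"
    and conv: "\<And>q. q \<in> Q \<Longrightarrow> convergent (\<lambda>n. f n q)"
  shows "convergent (\<lambda>n. f n x)"
proof -
  have "Cauchy (\<lambda>n. f n x)"
  proof (rule CauchyI)
    fix e :: real assume e: "e > 0"
    define \<delta> where "\<delta> = e / (4 * (\<bar>L\<bar> + 1))"
    have \<delta>: "\<delta> > 0" using e by (simp add: \<delta>_def)
    obtain q where q: "q \<in> Q" "q \<in> ball x \<delta>" using Q[of "ball x \<delta>"] \<delta> by auto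
    have near: "\<bar>f n x - f n q\<bar> \<le> e / 4" for n
    proof -
      have "norm (x - q) * L \<le> norm (x - q) * (\<bar>L\<bar> + 1)" by (intro mult_left_mono) auto
      also have "\<dots> \<le> \<delta> * (\<bar>L\<bar> + 1)" using q by (intro mult_right_mono) (auto simp: dist_norm)
      also have "\<dots> = e / 4" by (simp add: \<delta>_def field_simps)
      finally show ?thesis using lip[of n x q] by linarith
    qed
    have "Cauchy (\<lambda>n. f n q)" using conv[OF q(1)] by (simp add: Cauchy_convergent_iff)
    then obtain N where N: "\<And>m n. m \<ge> N \<Longrightarrow> n \<ge> N \<Longrightarrow> norm (f m q - f n q) < e / 4"
      using CauchyD[of "\<lambda>n. f n q" "e / 4"] e by auto
    have "norm (f m x - f n x) < e" if "N \<le> m" "N \<le> n" for m n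
      using N[OF that] near[of m] near[of n] e unfolding real_norm_def by linarith
    then show "\<exists>N. \<forall>m\<ge>N. \<forall>n\<ge>N. norm (f m x - f n x) < e" by blast
  qed
  then show ?thesis by (simp add: Cauchy_convergent_iff)
qed

lemma convergent_subseq_if_equi_Lipschitz:
  fixes f :: "nat \<Rightarrow> nat \<Rightarrow> 'a::euclidean_space \<Rightarrow> real"
  assumes A: "\<And>n k x. \<bar>f n k x\<bar> \<le> A k" and lip: "\<And>n k x y. \<bar>f n k x - f n k y\<bar> \<le> norm (x - y) * L k"
  obtains \<kappa> :: "nat \<Rightarrow> nat" where "strict_mono \<kappa>" "\<And>k x. convergent (\<lambda>n. f (\<kappa> n) k x)"
proof -
  obtain Q :: "'a set" where Q: "countable Q" "\<And>U. open U \<Longrightarrow> U \<noteq> {} \<Longrightarrow> \<exists>q\<in>Q. q \<in> U"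
    using countable_dense_setE by blast
  have A_nonneg: "A k \<ge> 0" for k using order_trans[OF abs_ge_zero A] .
  define F where "F n p = f n (fst p) (snd p) / (A (fst p) + 1)" for n and p :: "nat \<times> 'a"
  have F: "norm (F n p) \<le> 1" for n p
    using A[of n "fst p" "snd p"] A_nonneg[of "fst p"] by (simp add: F_def abs_divide divide_le_eq)
  have "countable (UNIV \<times> Q :: (nat \<times> 'a) set)" using Q by auto
  then obtain \<kappa> where \<kappa>: "strict_mono (\<kappa>::nat\<Rightarrow>nat)" "\<And>p. p \<in> UNIV \<times> Q \<Longrightarrow> \<exists>l. (\<lambda>n. F (\<kappa> n) p) \<longlonglongrightarrow> l"
    by (rule function_convergent_subsequence[OF _ F]) (rule that)
  have conv_Q: "convergent (\<lambda>n. f (\<kappa> n) k q)" if q: "q \<in> Q" for k q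
  proof -
    obtain l where "(\<lambda>n. F (\<kappa> n) (k, q)) \<longlonglongrightarrow> l" using \<kappa>(2)[of "(k, q)"] q by auto
    then have "(\<lambda>n. (A k + 1) * F (\<kappa> n) (k, q)) \<longlonglongrightarrow> (A k + 1) * l" by (intro tendsto_intros)
    moreover have "(A k + 1) * F (\<kappa> n) (k, q) = f (\<kappa> n) k q" for n using A_nonneg[of k] by (simp add: F_def)
    ultimately show ?thesis by (auto simp: convergent_def)
  qed
  have "convergent (\<lambda>n. f (\<kappa> n) k x)" for k x
  proof (rule convergent_if_convergent_on_dense[where f="\<lambda>n. f (\<kappa> n) k" and Q=Q])
    show "\<bar>f (\<kappa> n) k x - f (\<kappa> n) k y\<bar> \<le> norm (x - y) * L k" for n x y by (rule lip)
  qed (fact Q(2) conv_Q)+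
  then show ?thesis using \<kappa>(1) that by blast
qed

lemma ball_avg_convergent_subseq:
  fixes u :: "nat \<Rightarrow> 'a::euclidean_space \<Rightarrow> real"
  assumes grad_u: "\<And>n. H1_gradient (u n) (g n)" and M: "\<And>n. norm2 (u n) \<le> M" "\<And>n. norm2 (g n) \<le> M"
  obtains \<kappa> :: "nat \<Rightarrow> nat" where "strict_mono \<kappa>" "\<And>k x. convergent (\<lambda>n. ball_avg ((1/2)^k) (u (\<kappa> n)) x)"
proof (rule convergent_subseq_if_equi_Lipschitz[of "\<lambda>n k. ball_avg ((1/2)^k) (u n)"
      "\<lambda>k. M / sqrt (ball_vol TYPE('a) ((1/2)^k))" "\<lambda>k. M / sqrt (ball_vol TYPE('a) ((1/2)^k))"])
  have vol: "0 \<le> sqrt (ball_vol TYPE('a) ((1/2)^k))" for k using ball_vol_pos[of "(1/2)^k", where 'a='a] by simp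
  show "\<bar>ball_avg ((1/2)^k) (u n) x\<bar> \<le> M / sqrt (ball_vol TYPE('a) ((1/2)^k))" for n k x
    using ball_avg_bound[OF H1_gradient_L2(1)[OF grad_u], of "(1/2)^k" n x] divide_right_mono[OF M(1)[of n] vol[of k]]
    by simp
  show "\<bar>ball_avg ((1/2)^k) (u n) x - ball_avg ((1/2)^k) (u n) y\<bar>
      \<le> norm (x - y) * (M / sqrt (ball_vol TYPE('a) ((1/2)^k)))"
    for n k x y
    by (rule order_trans[OF ball_avg_Lipschitz[OF grad_u] mult_left_mono[OF divide_right_mono[OF M(2) vol]]]) auto
qed (rule that)

lemma L2_Cauchy_on_if_bounded_convergent:
  fixes v :: "nat \<Rightarrow> 'a::euclidean_space \<Rightarrow> real"
  assumes S: "S \<in> lmeasurable" and v: "\<And>n. v n \<in> borel_measurable lebesgue" "\<And>n x. \<bar>v n x\<bar> \<le> A"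
    and conv: "\<And>x. convergent (\<lambda>n. v n x)"
  shows "L2_Cauchy_on S v"
  unfolding L2_Cauchy_on_def
proof (intro allI impI)
  fix e :: real assume e: "0 < e"
  define V where "V x = lim (\<lambda>n. v n x)" for x
  have lim: "(\<lambda>n. v n x) \<longlonglongrightarrow> V x" for x using conv unfolding V_def by (simp add: convergent_LIMSEQ_iff)
  have V: "\<bar>V x\<bar> \<le> A" for x
    using tendsto_rabs[OF lim[of x]] v(2) by (intro LIMSEQ_le_const2[of "\<lambda>n. \<bar>v n x\<bar>"]) auto
  note [measurable] = v(1) fmeasurableD[OF S]
  have [measurable]: "V \<in> borel_measurable lebesgue" unfolding V_def[abs_def] by measurable
  define \<beta> where "\<beta> n x = indicator S x *\<^sub>R (v n x - V x)" for n x
  have \<beta>: "\<beta> n \<in> borel_measurable lebesgue" for n unfolding \<beta>_def[abs_def] by measurable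
  have dom: "L2 (\<lambda>x. (2 * A) *\<^sub>R indicat_real S x)" by (intro L2_scaleR L2_indicator_lmeasurable S)
  have \<beta>_le: "AE x in lebesgue. norm (\<beta> n x) \<le> norm ((2 * A) *\<^sub>R indicat_real S x)" for n
  proof (rule AE_I2)
    show "norm (\<beta> n x) \<le> norm ((2 * A) *\<^sub>R indicat_real S x)" for x
      using v(2)[of n x] V[of x] by (auto simp: \<beta>_def indicator_def)
  qed
  note in_L2 = L2_bound[OF dom \<beta> \<beta>_le]
  have "(\<lambda>n. norm2sq (\<beta> n)) \<longlonglongrightarrow> 0"
    using lim by (intro norm2sq_tendsto_0_dominated[OF \<beta> dom \<beta>_le] AE_I2) (auto simp: \<beta>_def intro!: tendsto_eq_intros)
  then obtain N where N: "\<And>n. n \<ge> N \<Longrightarrow> norm2sq (\<beta> n) < e / 4"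
    using e LIMSEQ_D[of "\<lambda>n. norm2sq (\<beta> n)" 0 "e/4"] by auto
  have "norm2sq_on S (\<lambda>x. v m x - v n x) \<le> e" if "N \<le> m" "N \<le> n" for m n
  proof -
    have "norm2sq_on S (\<lambda>x. v m x - v n x) = norm2sq (\<lambda>x. \<beta> m x - \<beta> n x)"
      by (simp add: norm2sq_on_def \<beta>_def algebra_simps)
    then show ?thesis using norm2sq_diff_le[OF in_L2 in_L2, of m n] N[OF that(1)] N[OF that(2)] by linarith
  qed
  then show "\<exists>N. \<forall>m\<ge>N. \<forall>n\<ge>N. norm2sq_on S (\<lambda>x. v m x - v n x) \<le> e" by blast
qed

lemma L2_Cauchy_on_if_uniformly_approximated:
  assumes u: "\<And>n. L2 (u n)" and S: "S \<in> sets lebesgue"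
    and approx: "\<And>e. e > 0 \<Longrightarrow> \<exists>v. (\<forall>n. L2 (v n) \<and> norm2sq (\<lambda>x. u n x - v n x) \<le> e) \<and> L2_Cauchy_on S v"
  shows "L2_Cauchy_on S u"
  unfolding L2_Cauchy_on_def
proof (intro allI impI)
  fix e :: real assume e: "0 < e"
  obtain v where v: "\<And>n. L2 (v n)" "\<And>n. norm2sq (\<lambda>x. u n x - v n x) \<le> e / 16" "L2_Cauchy_on S v"
    using approx[of "e / 16"] e by auto
  have "e / 4 > 0" using e by simp
  then obtain N where N: "\<And>m n. m \<ge> N \<Longrightarrow> n \<ge> N \<Longrightarrow> norm2sq_on S (\<lambda>x. v m x - v n x) \<le> e / 4"
    using v(3) unfolding L2_Cauchy_on_def by blast
  have "norm2sq_on S (\<lambda>x. u m x - u n x) \<le> e" if "N \<le> m" "N \<le> n" for m n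
  proof -
    define r where "r n x = u n x - v n x" for n x
    have r: "L2 (r n)" "norm2sq (r n) \<le> e / 16" for n using L2_diff[OF u v(1)] v(2) by (auto simp: r_def[abs_def])
    have "norm2sq_on S (\<lambda>x. r m x - r n x) \<le> norm2sq (\<lambda>x. r m x - r n x)"
      by (rule norm2sq_on_le[OF L2_diff[OF r(1) r(1)]])
    also have "\<dots> \<le> e / 4" using norm2sq_diff_le[OF r(1) r(1), of m n] r(2)[of m] r(2)[of n] by linarith
    finally have "norm2sq_on S (\<lambda>x. r m x - r n x) \<le> e / 4" .
    moreover have "norm2sq_on S (\<lambda>x. u m x - u n x)
        = norm2sq (\<lambda>x. indicator S x *\<^sub>R (r m x - r n x) + indicator S x *\<^sub>R (v m x - v n x))"
      by (simp add: norm2sq_on_def r_def algebra_simps)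
    ultimately show ?thesis
      using norm2sq_add_le[OF L2_indicator[OF L2_diff[OF r(1) r(1)] S]
          L2_indicator[OF L2_diff[OF v(1) v(1)] S], of m n m n]
        N[OF that] by (simp add: norm2sq_on_def)
  qed
  then show "\<exists>N. \<forall>m\<ge>N. \<forall>n\<ge>N. norm2sq_on S (\<lambda>x. u m x - u n x) \<le> e" by blast
qed

lemma L2_Cauchy_on_if_ball_avgs_convergent:
  fixes u :: "nat \<Rightarrow> 'a::euclidean_space \<Rightarrow> real"
  assumes grad_u: "\<And>n. H1_gradient (u n) (g n)" and M: "\<And>n. norm2 (u n) \<le> M" "\<And>n. norm2 (g n) \<le> M"
    and conv: "\<And>k x. convergent (\<lambda>n. ball_avg ((1/2)^k) (u n) x)"
  shows "L2_Cauchy_on (ball 0 R) u"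
proof (rule L2_Cauchy_on_if_uniformly_approximated)
  note in_L2 = H1_gradient_L2(1)[OF grad_u]
  show "L2 (u n)" for n by (rule in_L2)
  have M_nonneg: "M \<ge> 0" using order_trans[OF real_sqrt_ge_zero[OF norm2sq_nonneg] M(1)] .
  fix e :: real assume e: "e > 0"
  obtain k where "(1/2::real)^k < sqrt e / (M + 1)"
    using real_arch_pow_inv[of "sqrt e / (M + 1)" "1/2"] e M_nonneg by auto
  then have "(1/2)^k * (M + 1) \<le> sqrt e" using M_nonneg by (simp add: pos_less_divide_eq less_imp_le)
  moreover have "(1/2::real)^k * M \<le> (1/2)^k * (M + 1)" by (intro mult_left_mono) auto
  ultimately have k: "(1/2)^k * M \<le> sqrt e" by linarith
  have "norm2 (\<lambda>x. u n x - ball_avg ((1/2)^k) (u n) x) \<le> sqrt e" for n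
  proof -
    have "norm2 (\<lambda>x. u n x - ball_avg ((1/2)^k) (u n) x) \<le> (1/2)^k * norm2 (g n)"
      by (rule norm2_ball_avg_deviation_le[OF grad_u]) simp
    also have "\<dots> \<le> sqrt e" by (rule order_trans[OF mult_left_mono[OF M(2)] k]) simp
    finally show ?thesis .
  qed
  moreover have "L2_Cauchy_on (ball 0 R) (\<lambda>n. ball_avg ((1/2)^k) (u n))"
  proof (rule L2_Cauchy_on_if_bounded_convergent[OF lmeasurable_ball _ _ conv])
    show "ball_avg ((1/2)^k) (u n) \<in> borel_measurable lebesgue" for n
      by (intro continuous_lebesgue_measurable ball_avg_continuous[OF grad_u]) simp
    show "\<bar>ball_avg ((1/2)^k) (u n) x\<bar> \<le> M / sqrt (ball_vol TYPE('a) ((1/2)^k))" for n x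
      using ball_vol_pos[of "(1/2)^k", where 'a='a] M(1)
      by (intro order_trans[OF ball_avg_bound[OF in_L2] divide_right_mono]) auto
  qed
  ultimately show "\<exists>v. (\<forall>n. L2 (v n) \<and> norm2sq (\<lambda>x. u n x - v n x) \<le> e) \<and> L2_Cauchy_on (ball 0 R) v"
    using L2_ball_avg[OF grad_u] by (intro exI[of _ "\<lambda>n. ball_avg ((1/2)^k) (u n)"]) auto
qed simp

theorem Rellich:
  fixes u :: "nat \<Rightarrow> 'a::euclidean_space \<Rightarrow> real"
  assumes grad_u: "\<And>n. H1_gradient (u n) (g n)" and M: "\<And>n. norm2 (u n) \<le> M" "\<And>n. norm2 (g n) \<le> M"
  obtains \<kappa> :: "nat \<Rightarrow> nat" where "strict_mono \<kappa>" "AE x in lebesgue. convergent (\<lambda>n. u (\<kappa> n) x)"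
    "\<And>U R. AE x in lebesgue. (\<lambda>n. u (\<kappa> n) x) \<longlonglongrightarrow> U x \<Longrightarrow> (\<lambda>n. norm2sq_on (ball 0 R) (\<lambda>x. u (\<kappa> n) x - U x)) \<longlonglongrightarrow> 0"
proof -
  obtain \<kappa> where \<kappa>: "strict_mono (\<kappa>::nat\<Rightarrow>nat)" and conv: "\<And>k x. convergent (\<lambda>n. ball_avg ((1/2)^k) (u (\<kappa> n)) x)"
    by (rule ball_avg_convergent_subseq[OF grad_u M]) (rule that)
  note in_L2 = H1_gradient_L2(1)[OF grad_u]
  have Cauchy: "L2_Cauchy_on (ball 0 R) (\<lambda>n. u (\<kappa> n))" for R
    by (rule L2_Cauchy_on_if_ball_avgs_convergent[OF grad_u M conv])
  obtain r where r: "strict_mono r" and "AE x in lebesgue. convergent (\<lambda>n. u (\<kappa> (r n)) x)"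
    by (rule AE_convergent_subseq_if_locally_L2_Cauchy[OF in_L2 Cauchy]) (rule that)
  moreover have "(\<lambda>n. norm2sq_on (ball 0 R) (\<lambda>x. u (\<kappa> (r n)) x - U x)) \<longlonglongrightarrow> 0"
    if "AE x in lebesgue. (\<lambda>n. u (\<kappa> (r n)) x) \<longlonglongrightarrow> U x" for U R
    using LIMSEQ_subseq_LIMSEQ[OF L2_Cauchy_on_imp_tendsto(2)[OF in_L2 _ Cauchy r that] r] by (simp add: o_def)
  ultimately show ?thesis using strict_mono_o[OF \<kappa> r] by (intro that[of "\<kappa> \<circ> r"]) auto
qed

section \<open>Weak limits of gradients\<close>

lemma midpoint_hull_in_convex:
  assumes "v \<in> midpoint_hull S" "convex C" "\<And>v. v \<in> S \<Longrightarrow> v x \<in> C" shows "v x \<in> C"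
  using assms(1)
proof induction
  case (midpoint v w)
  then show ?case using convexD[OF assms(2), of "v x" "w x" "1/2" "1/2"] by (simp add: scaleR_add_right)
qed (rule assms(3))

lemma midpoint_hull_tails_tendsto:
  fixes p :: "nat \<Rightarrow> 'a \<Rightarrow> 'b::real_normed_vector \<times> 'c::real_vector"
  assumes w: "\<And>n. w n \<in> midpoint_hull (p ` {n..})" and lim: "(\<lambda>n. fst (p n x)) \<longlonglongrightarrow> l"
  shows "(\<lambda>n. fst (w n x)) \<longlonglongrightarrow> l"
proof (rule LIMSEQ_I)
  fix e :: real assume e: "0 < e"
  obtain N where N: "\<And>n. n \<ge> N \<Longrightarrow> norm (fst (p n x) - l) < e" using LIMSEQ_D[OF lim e] by blast
  have "w n x \<in> ball l e \<times> UNIV" if "n \<ge> N" for n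
    by (rule midpoint_hull_in_convex[OF w])
       (use that N in \<open>auto intro!: convex_Times simp: mem_Times_iff dist_norm norm_minus_commute\<close>)
  then show "\<exists>no. \<forall>n\<ge>no. norm (fst (w n x) - l) < e"
    by (auto simp: mem_Times_iff dist_norm norm_minus_commute)
qed

lemma H1_gradient_midpoint_hull:
  assumes "p \<in> midpoint_hull S" "\<And>p. p \<in> S \<Longrightarrow> H1_gradient (\<lambda>x. fst (p x)) (\<lambda>x. snd (p x))"
  shows "H1_gradient (\<lambda>x. fst (p x)) (\<lambda>x. snd (p x))"
  using assms(1)
proof induction
  case (midpoint v w)
  then show ?case using H1_gradient_cmult[OF H1_gradient_add[OF midpoint.IH], of "1/2"] by simp
qed (rule assms(2))

lemma H1_gradient_weak_limit:
  assumes grad_u: "\<And>n. H1_gradient (u n) (g n)" and in_L2: "L2 U" "L2 G"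
    and lim: "\<And>h. L2 h \<Longrightarrow> (\<lambda>n. inner2 (u n) h) \<longlonglongrightarrow> inner2 U h" "\<And>h. L2 h \<Longrightarrow> (\<lambda>n. inner2 (g n) h) \<longlonglongrightarrow> inner2 G h"
  shows "H1_gradient U G"
proof (rule H1_gradientI[OF in_L2])
  fix \<phi> :: "'a \<Rightarrow> real" and e :: 'a assume \<phi>: "test_fun \<phi>"
  have "(\<lambda>n. inner2 (u n) (dir_deriv \<phi> e)) \<longlonglongrightarrow> - inner2 (\<lambda>x. G x \<bullet> e) \<phi>"
    unfolding H1_gradient_test_fun[OF grad_u \<phi>] inner2_component
    by (intro tendsto_minus lim L2_scaleR_const L2_test_fun \<phi>)
  then show "inner2 U (dir_deriv \<phi> e) = - inner2 (\<lambda>x. G x \<bullet> e) \<phi>"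
    using lim(1)[OF L2_dir_deriv[OF \<phi>]] by (rule LIMSEQ_unique[rotated])
qed

text \<open>A weak limit of the gradients exists because, by Mazur's lemma, midpoint combinations of the pairs
  (function, gradient) converge strongly.\<close>

lemma H1_AE_limit:
  fixes u :: "nat \<Rightarrow> 'a::euclidean_space \<Rightarrow> real"
  assumes grad_u: "\<And>n. H1_gradient (u n) (g n)" and M: "\<And>n. norm2sq (u n) \<le> M" "\<And>n. norm2sq (g n) \<le> M"
    and U: "AE x in lebesgue. (\<lambda>n. u n x) \<longlonglongrightarrow> U x"
  shows "H1 U"
proof -
  note u = H1_gradient_L2(1)[OF grad_u] and g = H1_gradient_L2(2)[OF grad_u]
  define p where "p n x = (u n x, g n x)" for n x
  have p: "L2 (p n)" "norm2sq (p n) \<le> 2 * M" for n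
    unfolding p_def[abs_def] using M[of n] by (simp_all add: L2_Pair_iff norm2sq_Pair u g)
  obtain w G where w: "\<And>n. w n \<in> midpoint_hull (p ` {n..})" and G: "L2 G" "(\<lambda>n. norm2sq (\<lambda>x. w n x - G x)) \<longlonglongrightarrow> 0"
    using L2_Mazur[of p "2 * M", OF p] by blast
  have grad_w: "H1_gradient (\<lambda>x. fst (w n x)) (\<lambda>x. snd (w n x))" for n
    by (rule H1_gradient_midpoint_hull[OF w]) (auto simp: p_def grad_u)
  note w_L2 = H1_gradient_L2[OF grad_w]
  have w_le: "norm2sq (\<lambda>x. fst (w n x)) \<le> 2 * M" for n
  proof -
    have "norm2sq (w n) \<le> 2 * M" using midpoint_hull_L2_bounded[OF w[of n]] p by blast
    moreover have "norm2sq (w n) = norm2sq (\<lambda>x. fst (w n x)) + norm2sq (\<lambda>x. snd (w n x))"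
      using norm2sq_Pair[OF w_L2[of n]] by simp
    ultimately show ?thesis using norm2sq_nonneg[of "\<lambda>x. snd (w n x)"] by linarith
  qed
  have w_lim: "AE x in lebesgue. (\<lambda>n. fst (w n x)) \<longlonglongrightarrow> U x"
    using U by eventually_elim (rule midpoint_hull_tails_tendsto[OF w], simp add: p_def)
  have G_L2: "L2 (\<lambda>x. fst (G x))" "L2 (\<lambda>x. snd (G x))"
    using G(1) L2_Pair_iff[of "\<lambda>x. fst (G x)" "\<lambda>x. snd (G x)"] by auto
  have "(\<lambda>n. norm2sq (\<lambda>x. snd (w n x) - snd (G x))) \<longlonglongrightarrow> 0"
  proof (rule tendsto_sandwich[OF _ _ tendsto_const G(2)])
    have "norm2sq (\<lambda>x. w n x - G x) = norm2sq (\<lambda>x. fst (w n x) - fst (G x))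
        + norm2sq (\<lambda>x. snd (w n x) - snd (G x))" for n
      using norm2sq_Pair[OF L2_diff[OF w_L2(1) G_L2(1)] L2_diff[OF w_L2(2) G_L2(2)], of n n]
      by (simp add: prod_eq_iff flip: minus_prod_def)
    then show "\<forall>\<^sub>F n in sequentially. norm2sq (\<lambda>x. snd (w n x) - snd (G x)) \<le> norm2sq (\<lambda>x. w n x - G x)" by simp
  qed simp
  note G_lim = inner2_tendsto_if_norm2sq[OF w_L2(2) G_L2(2) _ this]
  have "H1_gradient U (\<lambda>x. snd (G x))"
    using inner2_tendsto_if_AE[OF w_L2(1) w_le w_lim] L2_Fatou(1)[OF w_L2(1) w_le w_lim] G_lim
    by (intro H1_gradient_weak_limit[OF grad_w _ G_L2(2)])
  then show "H1 U" by (rule H1_gradient_imp)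
qed

lemma inner2_grad_tendsto:
  fixes u :: "nat \<Rightarrow> 'a::euclidean_space \<Rightarrow> real"
  assumes grad_u: "\<And>n. H1_gradient (u n) (g n)" and M: "\<And>n. norm2sq (u n) \<le> M" "\<And>n. norm2sq (g n) \<le> M"
    and U: "AE x in lebesgue. (\<lambda>n. u n x) \<longlonglongrightarrow> U x" and h: "L2 h"
  shows "(\<lambda>n. inner2 (g n) h) \<longlonglongrightarrow> inner2 (grad U) h"
proof -
  note u = H1_gradient_L2(1)[OF grad_u] and g = H1_gradient_L2(2)[OF grad_u]
  note UG = H1_gradient_grad[OF H1_AE_limit[OF grad_u M U]]
  note G = H1_gradient_L2(2)[OF UG]
  have "(\<lambda>n. inner2 (\<lambda>x. g n x \<bullet> e) (\<lambda>x. h x \<bullet> e)) \<longlonglongrightarrow> inner2 (\<lambda>x. grad U x \<bullet> e) (\<lambda>x. h x \<bullet> e)"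
    if e: "e \<in> Basis" for e
  proof (rule inner2_tendsto_if_test_fun)
    show "L2 (\<lambda>x. g n x \<bullet> e)" "L2 (\<lambda>x. grad U x \<bullet> e)" "L2 (\<lambda>x. h x \<bullet> e)" for n by (intro L2_component g G h)+
    show "norm2 (\<lambda>x. g n x \<bullet> e) \<le> sqrt M" for n
      using norm2_component_le[OF g[of n], of e] e M(2)[of n] by (simp add: order_trans[OF _ real_sqrt_le_mono])
    show "(\<lambda>n. inner2 (\<lambda>x. g n x \<bullet> e) \<phi>) \<longlonglongrightarrow> inner2 (\<lambda>x. grad U x \<bullet> e) \<phi>" if \<phi>: "test_fun \<phi>" for \<phi>
      using tendsto_minus[OF inner2_tendsto_if_AE[OF u M(1) U L2_dir_deriv[OF \<phi>, of e]]]
      by (simp add: H1_gradient_test_fun[OF grad_u \<phi>] H1_gradient_test_fun[OF UG \<phi>])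
  qed
  then show ?thesis
    unfolding inner2_eq_sum_components[OF g h] inner2_eq_sum_components[OF G h] by (intro tendsto_sum)
qed

section \<open>The space X1\<close>

lemma inner2_grad_orthogonal:
  fixes T :: "'a::euclidean_space \<Rightarrow> 'a"
  assumes u: "H1 u" "H1 h" and T: "orthogonal_transformation T"
  shows "inner2 (grad (\<lambda>x. u (T x))) (grad (\<lambda>x. h (T x))) = inner2 (grad u) (grad h)"
proof -
  have "orthogonal_transformation (inv T)" by (rule orthogonal_transformation_inv[OF T])
  then have inv_T: "inv T a \<bullet> inv T b = a \<bullet> b" for a b unfolding orthogonal_transformation_def by blast
  note G = u[THEN H1_gradient_grad, THEN H1_gradient_orthogonal, OF T]
  have "inner2 (grad (\<lambda>x. u (T x))) (grad (\<lambda>x. h (T x))) = inner2 (\<lambda>x. inv T (grad u (T x))) (\<lambda>x. inv T (grad h (T x)))"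
    by (rule inner2_AE_cong) (intro H1_gradient_L2[OF G(1)] H1_gradient_L2[OF G(2)] G[THEN H1_gradient_imp(2)])+
  also have "\<dots> = inner2 (\<lambda>x. grad u (T x)) (\<lambda>x. grad h (T x))" by (simp add: inner2_def inv_T)
  also have "\<dots> = inner2 (grad u) (grad h)"
    by (intro inner2_measure_preserving measure_preserving_orthogonal T L2_grad u)
  finally show ?thesis .
qed

lemma orthogonal_transformation_apfst:
  fixes A :: "'y::euclidean_space \<Rightarrow> 'y"
  assumes "orthogonal_transformation A"
  shows "orthogonal_transformation (apfst A :: 'y \<times> 'z::euclidean_space \<Rightarrow> _)"
proof -
  have "linear A" "\<And>x. norm (A x) = norm x" using assms by (auto simp: orthogonal_transformation)
  then show ?thesis unfolding orthogonal_transformation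
    by (auto intro!: linearI simp: linear_add linear_scale norm_Pair)
qed

lemma G_invariant_iff_apfst:
  "G_invariant u \<longleftrightarrow> (\<forall>A x. orthogonal_transformation A \<longrightarrow> u (apfst A x) = u x)"
  by (auto simp: G_invariant_def)

locale potential =
  fixes V :: "'y::euclidean_space \<times> 'z::euclidean_space \<Rightarrow> real" and V0 :: real
  assumes V_continuous: "continuous_on UNIV V" and V0_pos: "V0 > 0" and V0_le: "\<And>x. V0 \<le> V x"
begin

definition energy_vector :: "('y \<times> 'z \<Rightarrow> real) \<Rightarrow> 'y \<times> 'z \<Rightarrow> ('y \<times> 'z) \<times> real \<times> real" where
  "energy_vector u x = (grad u x, u x / norm (fst x), sqrt (V x) * u x)"

definition inner1 :: "('y \<times> 'z \<Rightarrow> real) \<Rightarrow> ('y \<times> 'z \<Rightarrow> real) \<Rightarrow> real" where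
  "inner1 u h = inner2 (energy_vector u) (energy_vector h)"

definition norm1 :: "('y \<times> 'z \<Rightarrow> real) \<Rightarrow> real" where
  "norm1 u = sqrt (norm1sq V u)"

lemma V_pos: "V x > 0"
  using V0_le[of x] V0_pos by linarith

lemma norm_energy_vector_sq:
  "(norm (energy_vector u x))\<^sup>2 = (norm (grad u x))\<^sup>2 + (u x)\<^sup>2 / (norm (fst x))\<^sup>2 + V x * (u x)\<^sup>2"
  using V_pos[of x] by (simp add: energy_vector_def norm_Pair power_divide power_mult_distrib)

lemma norm1sq_eq_norm2sq: "norm1sq V u = norm2sq (energy_vector u)"
  unfolding norm1sq_def norm2sq_def norm_energy_vector_sq ..

lemma weighted_measurable:
  assumes "u \<in> borel_measurable lebesgue"
  shows "(\<lambda>x. u x / norm (fst x)) \<in> borel_measurable lebesgue" "(\<lambda>x. sqrt (V x) * u x) \<in> borel_measurable lebesgue"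
proof -
  have "(\<lambda>x::'y \<times> 'z. norm (fst x)) \<in> borel_measurable lebesgue"
    by (intro continuous_lebesgue_measurable continuous_intros)
  then show "(\<lambda>x. u x / norm (fst x)) \<in> borel_measurable lebesgue" by (intro borel_measurable_divide assms)
  note [measurable] = assms continuous_lebesgue_measurable[OF V_continuous]
  show "(\<lambda>x. sqrt (V x) * u x) \<in> borel_measurable lebesgue" by measurable
qed

lemma X1_iff: "X1 V u \<longleftrightarrow> H1 u \<and> L2 (\<lambda>x. u x / norm (fst x)) \<and> L2 (\<lambda>x. sqrt (V x) * u x)"
proof (cases "H1 u")
  case True
  note meas = weighted_measurable[OF L2_measurable[OF H1_L2[OF True]]]
  have square: "(norm (u x / norm (fst x), sqrt (V x) * u x))\<^sup>2 = (u x)\<^sup>2 / (norm (fst x))\<^sup>2 + V x * (u x)\<^sup>2" for x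
    using V_pos[of x] by (simp add: norm_Pair power_divide power_mult_distrib)
  have "L2 (\<lambda>x. (u x / norm (fst x), sqrt (V x) * u x))
      \<longleftrightarrow> integrable lebesgue (\<lambda>x. (u x)\<^sup>2 / (norm (fst x))\<^sup>2 + V x * (u x)\<^sup>2)"
    unfolding L2_def square using borel_measurable_Pair[OF meas] by simp
  then show ?thesis using True by (simp add: X1_def L2_Pair_iff)
qed (simp add: X1_def)

lemma X1_H1: "X1 V u \<Longrightarrow> H1 u"
  by (simp add: X1_def)

lemma X1_L2: "X1 V u \<Longrightarrow> L2 u"
  by (simp add: X1_def H1_L2)

lemma X1_L2_weighted:
  "X1 V u \<Longrightarrow> L2 (\<lambda>x. u x / norm (fst x))" "X1 V u \<Longrightarrow> L2 (\<lambda>x. sqrt (V x) * u x)"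
  by (simp_all add: X1_iff)

lemma X1_iff_energy_vector: "X1 V u \<longleftrightarrow> H1 u \<and> L2 (energy_vector u)"
  using L2_grad[of u] by (auto simp: X1_iff energy_vector_def[abs_def] L2_Pair_iff)

lemma L2_energy_vector: "X1 V u \<Longrightarrow> L2 (energy_vector u)"
  by (simp add: X1_iff_energy_vector)

lemma inner1_split:
  assumes "X1 V u" "X1 V h"
  shows "inner1 u h = inner2 (grad u) (grad h) + (inner2 (\<lambda>x. u x / norm (fst x)) (\<lambda>x. h x / norm (fst x))
      + inner2 (\<lambda>x. sqrt (V x) * u x) (\<lambda>x. sqrt (V x) * h x))"
  unfolding inner1_def energy_vector_def[abs_def]
  using assms by (simp add: inner2_Pair L2_Pair_iff X1_L2_weighted L2_grad X1_H1)

lemma norm1sq_split: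
  assumes "X1 V u"
  shows "norm1sq V u = norm2sq (grad u) + (norm2sq (\<lambda>x. u x / norm (fst x)) + norm2sq (\<lambda>x. sqrt (V x) * u x))"
  using inner1_split[OF assms assms] by (simp add: norm1sq_eq_norm2sq inner1_def norm2sq_eq_inner2)

lemma
  assumes "X1 V u"
  shows norm2sq_grad_le_norm1sq: "norm2sq (grad u) \<le> norm1sq V u"
    and norm2sq_weighted_le_norm1sq: "norm2sq (\<lambda>x. u x / norm (fst x)) \<le> norm1sq V u"
      "norm2sq (\<lambda>x. sqrt (V x) * u x) \<le> norm1sq V u"
  unfolding norm1sq_split[OF assms] by simp_all

lemma norm2sq_le_norm1sq: assumes "X1 V u" shows "norm2sq u \<le> norm1sq V u / V0"
proof -
  have "norm (sqrt V0 *\<^sub>R u x) \<le> norm (sqrt (V x) * u x)" for x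
    using V0_le[of x] V0_pos V_pos[of x] by (simp add: abs_mult mult_right_mono)
  then have "norm2sq (\<lambda>x. sqrt V0 *\<^sub>R u x) \<le> norm2sq (\<lambda>x. sqrt (V x) * u x)"
    by (intro norm2sq_mono X1_L2_weighted assms AE_I2)
  also have "\<dots> \<le> norm1sq V u" by (rule norm2sq_weighted_le_norm1sq[OF assms])
  finally show ?thesis unfolding norm2sq_scaleR using V0_pos by (simp add: field_simps)
qed

subsection \<open>The Hilbert space structure\<close>

lemma energy_vector_add:
  assumes "X1 V u" "X1 V h"
  shows "AE x in lebesgue. energy_vector (\<lambda>x. u x + h x) x = energy_vector u x + energy_vector h x"
  using H1_gradient_imp(2)[OF H1_gradient_add[OF assms[THEN X1_H1, THEN H1_gradient_grad]]]
  by eventually_elim (simp add: energy_vector_def add_divide_distrib distrib_left)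

lemma energy_vector_cmult:
  assumes "X1 V u" shows "AE x in lebesgue. energy_vector (\<lambda>x. c * u x) x = c *\<^sub>R energy_vector u x"
  using H1_gradient_imp(2)[OF H1_gradient_cmult[OF H1_gradient_grad[OF X1_H1[OF assms]], of c]]
  by eventually_elim (simp add: energy_vector_def)

lemma X1_add: assumes "X1 V u" "X1 V h" shows "X1 V (\<lambda>x. u x + h x)"
  using L2_AE_cong[OF L2_add energy_vector_add[OF assms]] assms[THEN L2_energy_vector]
    H1_gradient_imp(1)[OF H1_gradient_add[OF assms[THEN X1_H1, THEN H1_gradient_grad]]]
  by (simp add: X1_iff_energy_vector)

lemma X1_cmult: assumes "X1 V u" shows "X1 V (\<lambda>x. c * u x)"
  using L2_AE_cong[OF L2_scaleR energy_vector_cmult[OF assms, of c]] L2_energy_vector[OF assms]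
    H1_gradient_imp(1)[OF H1_gradient_cmult[OF H1_gradient_grad[OF X1_H1[OF assms]], of c]]
  by (simp add: X1_iff_energy_vector)

lemma X1_diff: assumes "X1 V u" "X1 V h" shows "X1 V (\<lambda>x. u x - h x)"
  using X1_add[OF assms(1) X1_cmult[OF assms(2), of "-1"]] by simp

lemma inner1_commute: "inner1 u h = inner1 h u"
  by (simp add: inner1_def inner2_commute)

lemma inner1_self: "inner1 u u = norm1sq V u"
  by (simp add: inner1_def norm1sq_eq_norm2sq norm2sq_eq_inner2)

lemma norm1sq_nonneg [simp]: "0 \<le> norm1sq V u"
  by (simp add: norm1sq_eq_norm2sq)

lemma norm1_nonneg [simp]: "0 \<le> norm1 u"
  by (simp add: norm1_def)

lemma norm1_sq: "(norm1 u)\<^sup>2 = norm1sq V u"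
  by (simp add: norm1_def)

lemma inner1_add_left:
  assumes "X1 V u" "X1 V v" "X1 V h" shows "inner1 (\<lambda>x. u x + v x) h = inner1 u h + inner1 v h"
proof -
  note in_L2 = assms[THEN L2_energy_vector]
  have "inner1 (\<lambda>x. u x + v x) h = inner2 (\<lambda>x. energy_vector u x + energy_vector v x) (energy_vector h)"
    unfolding inner1_def
    by (rule inner2_AE_cong[OF L2_add[OF in_L2(1,2)] in_L2(3) energy_vector_add[OF assms(1,2)]]) simp
  then show ?thesis by (simp add: inner1_def inner2_add_left in_L2)
qed

lemma inner1_cmult_left:
  assumes "X1 V u" "X1 V h" shows "inner1 (\<lambda>x. c * u x) h = c * inner1 u h"
proof -
  note in_L2 = assms[THEN L2_energy_vector]
  have "inner1 (\<lambda>x. c * u x) h = inner2 (\<lambda>x. c *\<^sub>R energy_vector u x) (energy_vector h)"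
    unfolding inner1_def
    by (rule inner2_AE_cong[OF L2_scaleR[OF in_L2(1)] in_L2(2) energy_vector_cmult[OF assms(1)]]) simp
  then show ?thesis by (simp add: inner1_def inner2_scaleR_left)
qed

lemma inner1_add_right:
  assumes "X1 V u" "X1 V v" "X1 V h" shows "inner1 h (\<lambda>x. u x + v x) = inner1 h u + inner1 h v"
  using inner1_add_left[OF assms] by (simp add: inner1_commute)

lemma inner1_cmult_right:
  assumes "X1 V u" "X1 V h" shows "inner1 h (\<lambda>x. c * u x) = c * inner1 h u"
  using inner1_cmult_left[OF assms] by (simp add: inner1_commute)

lemma norm1sq_add:
  assumes "X1 V u" "X1 V h" shows "norm1sq V (\<lambda>x. u x + h x) = norm1sq V u + 2 * inner1 u h + norm1sq V h"
  using assms by (simp add: inner1_self[symmetric] inner1_add_left inner1_add_right X1_add inner1_commute[of h u])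

lemma norm1sq_cmult:
  assumes "X1 V u" shows "norm1sq V (\<lambda>x. c * u x) = c\<^sup>2 * norm1sq V u"
  using assms by (simp add: inner1_self[symmetric] inner1_cmult_left inner1_cmult_right X1_cmult power2_eq_square)

lemma norm1sq_diff:
  assumes "X1 V u" "X1 V h" shows "norm1sq V (\<lambda>x. u x - h x) = norm1sq V u - 2 * inner1 u h + norm1sq V h"
  using norm1sq_add[OF assms(1) X1_cmult[OF assms(2), of "-1"]] norm1sq_cmult[OF assms(2), of "-1"]
    inner1_cmult_right[OF assms(2,1), of "-1"] by simp

lemma norm1sq_parallelogram:
  assumes "X1 V u" "X1 V h"
  shows "norm1sq V (\<lambda>x. u x - h x) = 2 * norm1sq V u + 2 * norm1sq V h - 4 * norm1sq V (\<lambda>x. (1/2) * (u x + h x))"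
  using norm1sq_cmult[OF X1_add[OF assms], of "1/2"] norm1sq_add[OF assms] norm1sq_diff[OF assms]
  by (simp add: power2_eq_square)

lemma norm1_cmult: assumes "X1 V u" shows "norm1 (\<lambda>x. c * u x) = \<bar>c\<bar> * norm1 u"
  by (simp add: norm1_def norm1sq_cmult[OF assms] real_sqrt_mult)

lemma inner1_Cauchy_Schwarz: assumes "X1 V u" "X1 V h" shows "\<bar>inner1 u h\<bar> \<le> norm1 u * norm1 h"
  using inner2_Cauchy_Schwarz[OF assms[THEN L2_energy_vector]] by (simp add: inner1_def norm1_def norm1sq_eq_norm2sq)

lemma norm1_triangle: assumes "X1 V u" "X1 V h" shows "norm1 (\<lambda>x. u x + h x) \<le> norm1 u + norm1 h"
proof -
  have "norm1sq V (\<lambda>x. u x + h x) \<le> (norm1 u + norm1 h)\<^sup>2"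
    using norm1sq_add[OF assms] inner1_Cauchy_Schwarz[OF assms] by (simp add: power2_sum norm1_sq)
  then show ?thesis unfolding norm1_def[of "\<lambda>x. u x + h x"] by (intro real_le_lsqrt) auto
qed

lemma
  assumes "X1 V u" "AE x in lebesgue. v x = u x"
  shows X1_AE_cong: "X1 V v" and energy_vector_AE_cong: "AE x in lebesgue. energy_vector v x = energy_vector u x"
proof -
  have "H1_gradient v (grad u)" by (rule H1_gradient_AE_cong[OF H1_gradient_grad[OF X1_H1[OF assms(1)]] assms(2)])
  note gradient = H1_gradient_imp[OF this]
  show vector_eq: "AE x in lebesgue. energy_vector v x = energy_vector u x"
    using gradient(2) assms(2) by eventually_elim (simp add: energy_vector_def)
  show "X1 V v" using gradient(1) L2_AE_cong[OF L2_energy_vector[OF assms(1)] vector_eq]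
    by (simp add: X1_iff_energy_vector)
qed

lemma inner1_AE_cong:
  assumes "X1 V u" "AE x in lebesgue. v x = u x" "X1 V h" shows "inner1 v h = inner1 u h"
  unfolding inner1_def
  by (rule inner2_AE_cong[OF L2_energy_vector[OF assms(1)] L2_energy_vector[OF assms(3)]
      energy_vector_AE_cong[OF assms(1,2)]]) simp

lemma norm1_eq_0_iff: assumes "X1 V u" shows "norm1 u = 0 \<longleftrightarrow> (AE x in lebesgue. u x = 0)"
proof
  assume "norm1 u = 0"
  then have "norm2sq u \<le> 0" using norm2sq_le_norm1sq[OF assms] by (simp add: norm1_def)
  then show "AE x in lebesgue. u x = 0" using norm2sq_nonneg[of u] by (intro norm2sq_eq_0 X1_L2 assms) linarith
next
  assume "AE x in lebesgue. u x = 0"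
  then have "inner1 u u = inner1 (\<lambda>x. 0 * u x) u" by (intro inner1_AE_cong X1_cmult assms) simp
  then show "norm1 u = 0" unfolding inner1_cmult_left[OF assms assms] by (simp add: inner1_self norm1_def)
qed

subsection \<open>Weak compactness and invariance\<close>

lemma
  assumes u: "\<And>n. X1 V (u n)" and M: "\<And>n. norm1sq V (u n) \<le> M"
    and lim: "AE x in lebesgue. (\<lambda>n. u n x) \<longlonglongrightarrow> U x"
  shows X1_AE_limit: "X1 V U" and inner1_tendsto: "X1 V h \<Longrightarrow> (\<lambda>n. inner1 (u n) h) \<longlonglongrightarrow> inner1 U h"
proof -
  note grad = H1_gradient_grad[OF X1_H1[OF u]] and in_L2 = X1_L2_weighted[OF u]
  define K where "K = max M (M / V0)"
  have bound: "norm2sq (u n) \<le> K" "norm2sq (grad (u n)) \<le> K"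
    "norm2sq (\<lambda>x. u n x / norm (fst x)) \<le> M" "norm2sq (\<lambda>x. sqrt (V x) * u n x) \<le> M" for n
    using norm2sq_le_norm1sq[OF u[of n]] norm2sq_grad_le_norm1sq[OF u[of n]] norm2sq_weighted_le_norm1sq[OF u[of n]]
      M[of n] divide_right_mono[OF M[of n], of V0] V0_pos by (auto simp: K_def)
  have lim_y: "AE x in lebesgue. (\<lambda>n. u n x / norm (fst x)) \<longlonglongrightarrow> U x / norm (fst x)"
    using lim unfolding divide_inverse by eventually_elim (intro tendsto_intros)
  have lim_V: "AE x in lebesgue. (\<lambda>n. sqrt (V x) * u n x) \<longlonglongrightarrow> sqrt (V x) * U x"
    using lim by eventually_elim (intro tendsto_intros)
  show U: "X1 V U"
    using H1_AE_limit[OF grad bound(1,2) lim] L2_Fatou(1)[OF in_L2(1) bound(3) lim_y]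
        L2_Fatou(1)[OF in_L2(2) bound(4) lim_V]
    by (simp add: X1_iff)
  show "(\<lambda>n. inner1 (u n) h) \<longlonglongrightarrow> inner1 U h" if h: "X1 V h"
    unfolding inner1_split[OF u h] inner1_split[OF U h]
    by (intro tendsto_add inner2_grad_tendsto[OF grad bound(1,2) lim] inner2_tendsto_if_AE[OF in_L2(1) bound(3) lim_y]
        inner2_tendsto_if_AE[OF in_L2(2) bound(4) lim_V] L2_grad X1_H1 X1_L2_weighted h)
qed

lemma X1_null_limit:
  assumes u: "\<And>n. X1 V (u n)" and null: "(\<lambda>n. norm1sq V (u n)) \<longlonglongrightarrow> 0"
    and lim: "AE x in lebesgue. (\<lambda>n. u n x) \<longlonglongrightarrow> U x"
  shows "AE x in lebesgue. U x = 0"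
proof -
  obtain M where M: "\<And>n. norm1sq V (u n) \<le> M"
    using convergent_imp_Bseq[OF convergentI[OF null]] by (auto simp: Bseq_def)
  have U: "X1 V U" by (rule X1_AE_limit[OF u M lim])
  have "(\<lambda>n. norm1 (u n)) \<longlonglongrightarrow> sqrt 0" unfolding norm1_def by (intro tendsto_intros null)
  then have "(\<lambda>n. norm1 (u n) * norm1 U) \<longlonglongrightarrow> 0" by (intro tendsto_mult_left_zero) simp
  then have "(\<lambda>n. inner1 (u n) U) \<longlonglongrightarrow> 0"
    by (rule Lim_null_comparison[rotated]) (simp add: inner1_Cauchy_Schwarz u U)
  then have "inner1 U U = 0" using LIMSEQ_unique[OF inner1_tendsto[OF u M lim U]] by simp
  then show ?thesis by (simp add: norm1_eq_0_iff[OF U, symmetric] inner1_self norm1_def)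
qed

lemma X1_compact:
  fixes u :: "nat \<Rightarrow> 'y \<times> 'z \<Rightarrow> real"
  assumes u: "\<And>n. X1 V (u n)" and M: "\<And>n. norm1sq V (u n) \<le> M"
  obtains \<kappa> :: "nat \<Rightarrow> nat" and U where "strict_mono \<kappa>" "\<And>x. U x = lim (\<lambda>n. u (\<kappa> n) x)" "X1 V U"
    "AE x in lebesgue. (\<lambda>n. u (\<kappa> n) x) \<longlonglongrightarrow> U x"
    "\<And>R. (\<lambda>n. norm2sq_on (ball 0 R) (\<lambda>x. u (\<kappa> n) x - U x)) \<longlonglongrightarrow> 0"
proof -
  define K where "K = sqrt (max M (M / V0))"
  have K: "norm2 (u n) \<le> K" "norm2 (grad (u n)) \<le> K" for n
    using norm2sq_le_norm1sq[OF u[of n]] norm2sq_grad_le_norm1sq[OF u[of n]] M[of n]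
        divide_right_mono[OF M[of n], of V0] V0_pos
    by (auto simp: K_def le_max_iff_disj)
  obtain \<kappa> where \<kappa>: "strict_mono (\<kappa>::nat\<Rightarrow>nat)" and conv: "AE x in lebesgue. convergent (\<lambda>n. u (\<kappa> n) x)"
    and loc: "\<And>U R. AE x in lebesgue. (\<lambda>n. u (\<kappa> n) x) \<longlonglongrightarrow> U x \<Longrightarrow>
      (\<lambda>n. norm2sq_on (ball 0 R) (\<lambda>x. u (\<kappa> n) x - U x)) \<longlonglongrightarrow> 0"
    by (rule Rellich[OF H1_gradient_grad[OF X1_H1[OF u]] K]) (rule that)
  have lim: "AE x in lebesgue. (\<lambda>n. u (\<kappa> n) x) \<longlonglongrightarrow> lim (\<lambda>n. u (\<kappa> n) x)"
    using conv by eventually_elim (simp add: convergent_LIMSEQ_iff)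
  show ?thesis
    by (rule that[OF \<kappa> refl X1_AE_limit[OF u M lim] lim loc[OF lim]])
qed

lemma
  fixes A :: "'y \<Rightarrow> 'y"
  assumes V: "G_invariant V" and A: "orthogonal_transformation A"
  shows X1_apfst: "X1 V u \<Longrightarrow> X1 V (\<lambda>x. u (apfst A x))"
    and inner1_apfst: "X1 V u \<Longrightarrow> X1 V h \<Longrightarrow> inner1 (\<lambda>x. u (apfst A x)) (\<lambda>x. h (apfst A x)) = inner1 u h"
proof -
  note T = orthogonal_transformation_apfst[OF A, where 'z='z]
  note mT = measure_preserving_orthogonal[OF T]
  have weights: "V (apfst A x) = V x" "norm (A (fst x)) = norm (fst x)" for x
    using V A unfolding G_invariant_iff_apfst by (simp_all add: orthogonal_transformation_norm del: split_paired_All)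
  have weighted: "(\<lambda>x. u (apfst A x) / norm (fst x)) = (\<lambda>x. (\<lambda>x. u x / norm (fst x)) (apfst A x))"
    "(\<lambda>x. sqrt (V x) * u (apfst A x)) = (\<lambda>x. (\<lambda>x. sqrt (V x) * u x) (apfst A x))" for u
    by (simp_all add: weights)
  show X1: "X1 V (\<lambda>x. u (apfst A x))" if u: "X1 V u" for u
    unfolding X1_iff weighted
    using H1_gradient_imp(1)[OF H1_gradient_orthogonal[OF H1_gradient_grad[OF X1_H1[OF u]] T]]
    by (intro conjI L2_measure_preserving[OF mT] X1_L2_weighted u)
  show "inner1 (\<lambda>x. u (apfst A x)) (\<lambda>x. h (apfst A x)) = inner1 u h" if u: "X1 V u" and h: "X1 V h"
    unfolding inner1_split[OF X1[OF u] X1[OF h]] inner1_split[OF u h] weighted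
    using inner2_grad_orthogonal[OF X1_H1[OF u] X1_H1[OF h] T]
      inner2_measure_preserving[OF mT X1_L2_weighted(1)[OF u] X1_L2_weighted(1)[OF h]]
      inner2_measure_preserving[OF mT X1_L2_weighted(2)[OF u] X1_L2_weighted(2)[OF h]] by simp
qed

lemma X1G_X1: "X1G V u \<Longrightarrow> X1 V u"
  by (simp add: X1G_def)

lemma X1G_add: "X1G V u \<Longrightarrow> X1G V h \<Longrightarrow> X1G V (\<lambda>x. u x + h x)"
  by (auto simp: X1G_def X1_add G_invariant_def)

lemma X1G_cmult: "X1G V u \<Longrightarrow> X1G V (\<lambda>x. c * u x)"
  by (auto simp: X1G_def X1_cmult G_invariant_def)

end

section \<open>The nonlinearity\<close>

definition annulus :: "real \<Rightarrow> real \<Rightarrow> real set" where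
  "annulus \<eta> M = {a. \<eta> \<le> \<bar>a\<bar> \<and> \<bar>a\<bar> \<le> M}"

lemma annulus_measurable [measurable]: "annulus \<eta> M \<in> sets borel"
  unfolding annulus_def by measurable

locale nonlinearity =
  fixes f :: "real \<Rightarrow> real" and q :: real
  assumes f_continuous: "continuous_on UNIV f"
    and q_gt_2: "2 < q"
    and f_sublinear_at_0: "((\<lambda>u. f u / u) \<longlongrightarrow> 0) (at 0)"
    and f_subcritical: "\<And>e. e > 0 \<Longrightarrow> \<exists>M>0. \<forall>a. M \<le> \<bar>a\<bar> \<longrightarrow> \<bar>f a\<bar> \<le> e * \<bar>a\<bar> powr (q - 1)"
    and prim_superquadratic_at_infinity: "filterlim (\<lambda>u. prim f u / u\<^sup>2) at_top at_infinity"
    and f_ratio_strict_mono_pos: "strict_mono_on {0<..} (\<lambda>u. f u / \<bar>u\<bar>)"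
    and f_ratio_strict_mono_neg: "strict_mono_on {..<0} (\<lambda>u. f u / \<bar>u\<bar>)"
begin

subsection \<open>Growth\<close>

definition growth :: "real \<Rightarrow> real" where
  "growth a = \<bar>a\<bar> + \<bar>a\<bar> powr (q - 1)"

definition growth_density :: "real \<Rightarrow> real" where
  "growth_density a = a\<^sup>2 + \<bar>a\<bar> powr q"

lemma growth_nonneg [simp]: "0 \<le> growth a"
  by (simp add: growth_def)

lemma growth_density_nonneg [simp]: "0 \<le> growth_density a"
  by (simp add: growth_density_def)

lemma growth_measurable [measurable]: "growth \<in> borel_measurable borel"
  unfolding growth_def[abs_def] by measurable

lemma growth_mono: "\<bar>a\<bar> \<le> \<bar>b\<bar> \<Longrightarrow> growth a \<le> growth b"
  unfolding growth_def using q_gt_2 by (intro add_mono powr_mono2) auto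

lemma growth_times_abs: "growth a * \<bar>a\<bar> = growth_density a"
  by (cases "a = 0") (simp_all add: growth_def growth_density_def distrib_right power2_eq_square powr_diff)

lemma growth_scale_le: assumes "0 < d" "d \<le> 1" shows "growth (d * a) \<le> d * growth a"
proof -
  have "d powr (q - 1) \<le> d powr 1" using assms q_gt_2 by (intro powr_mono') auto
  then have "d powr (q - 1) * \<bar>a\<bar> powr (q - 1) \<le> d * \<bar>a\<bar> powr (q - 1)" using assms by (intro mult_right_mono) auto
  then show ?thesis using assms by (simp add: growth_def abs_mult powr_mult distrib_left)
qed

lemma growth_dilate_le: assumes "1 \<le> t" shows "growth (t * a) \<le> t powr (q - 1) * growth a"
proof -
  have "t powr 1 \<le> t powr (q - 1)" using assms q_gt_2 by (intro powr_mono) auto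
  then have "t * \<bar>a\<bar> \<le> t powr (q - 1) * \<bar>a\<bar>" using assms by (intro mult_right_mono) auto
  then show ?thesis using assms by (simp add: growth_def abs_mult powr_mult distrib_left)
qed

lemma growth_mult_le: "growth a * \<bar>b\<bar> \<le> growth_density a + growth_density b"
proof (cases "\<bar>a\<bar> \<le> \<bar>b\<bar>")
  case True
  then have "growth a * \<bar>b\<bar> \<le> growth b * \<bar>b\<bar>" by (intro mult_right_mono growth_mono) auto
  then show ?thesis using growth_density_nonneg[of a] unfolding growth_times_abs by linarith
next
  case False
  then have "growth a * \<bar>b\<bar> \<le> growth a * \<bar>a\<bar>" by (intro mult_left_mono) auto
  then show ?thesis using growth_density_nonneg[of b] unfolding growth_times_abs by linarith
qed

lemma growth_Young:
  assumes "e > 0"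
  obtains C where "C > 0" "\<And>a b. growth a * \<bar>b\<bar> \<le> e * growth_density a + C * growth_density b"
    "\<And>a b. growth b * \<bar>a\<bar> \<le> e * growth_density a + C * growth_density b"
proof -
  define d where "d = min e 1"
  define C where "C = (1 / d) powr (q - 1)"
  have d: "0 < d" "d \<le> 1" "d \<le> e" using assms by (auto simp: d_def)
  have C: "C > 0" "1 / d \<le> C"
    using d q_gt_2 powr_mono[of 1 "q - 1" "1 / d"] by (simp_all add: C_def)
  have "growth a * \<bar>b\<bar> \<le> e * growth_density a + C * growth_density b
      \<and> growth b * \<bar>a\<bar> \<le> e * growth_density a + C * growth_density b" for a b
  proof (cases "\<bar>b\<bar> \<le> d * \<bar>a\<bar>")
    case True
    have "growth b \<le> growth (d * a)" using True d by (intro growth_mono) (simp add: abs_mult)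
    also have "\<dots> \<le> d * growth a" by (rule growth_scale_le[OF d(1,2)])
    finally have "growth b * \<bar>a\<bar> \<le> d * growth a * \<bar>a\<bar>" by (rule mult_right_mono) simp
    moreover have "growth a * \<bar>b\<bar> \<le> growth a * (d * \<bar>a\<bar>)" by (rule mult_left_mono[OF True growth_nonneg])
    moreover have "d * growth_density a \<le> e * growth_density a" by (rule mult_right_mono[OF d(3) growth_density_nonneg])
    moreover have "0 \<le> C * growth_density b" using C by simp
    ultimately show ?thesis unfolding growth_times_abs[symmetric] by (simp add: mult_ac)
  next
    case False
    then have a: "\<bar>a\<bar> \<le> 1 / d * \<bar>b\<bar>" using d by (simp add: field_simps)
    have "growth a \<le> growth (1 / d * b)" using a d by (intro growth_mono) (simp add: abs_mult)
    also have "\<dots> \<le> C * growth b" unfolding C_def using d by (intro growth_dilate_le) simp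
    finally have "growth a * \<bar>b\<bar> \<le> C * growth b * \<bar>b\<bar>" by (rule mult_right_mono) simp
    moreover have "growth b * \<bar>a\<bar> \<le> growth b * (C * \<bar>b\<bar>)"
      using a mult_right_mono[OF C(2), of "\<bar>b\<bar>"] by (intro mult_left_mono) auto
    moreover have "0 \<le> e * growth_density a" using assms by simp
    ultimately show ?thesis unfolding growth_times_abs[symmetric] by (simp add: mult_ac)
  qed
  then show ?thesis using that[OF C(1)] by blast
qed

lemma f_0 [simp]: "f 0 = 0"
proof -
  have "((\<lambda>u. f u / u * u) \<longlongrightarrow> 0 * 0) (at 0)" by (intro tendsto_intros f_sublinear_at_0)
  moreover have "\<forall>\<^sub>F u in at 0. f u / u * u = f u" by (auto simp: eventually_at_filter)
  ultimately have "(f \<longlongrightarrow> 0) (at 0)" using Lim_transform_eventually by fastforce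
  moreover have "(f \<longlongrightarrow> f 0) (at 0)" using f_continuous by (simp add: continuous_on_eq_continuous_at isCont_def)
  ultimately show ?thesis using tendsto_unique[of "at (0::real)"] by auto
qed

lemma f_small_near_0:
  assumes "e > 0" obtains \<eta> where "\<eta> > 0" "\<And>a. \<bar>a\<bar> < \<eta> \<Longrightarrow> \<bar>f a\<bar> \<le> e * \<bar>a\<bar>"
proof -
  obtain d where d: "d > 0" "\<And>a. a \<noteq> 0 \<Longrightarrow> \<bar>a\<bar> < d \<Longrightarrow> \<bar>f a / a\<bar> < e"
    using LIM_D[OF f_sublinear_at_0 assms] by auto
  have "\<bar>f a\<bar> \<le> e * \<bar>a\<bar>" if "\<bar>a\<bar> < d" for a
    using d(2)[OF _ that] by (cases "a = 0") (auto simp: field_simps)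
  then show ?thesis by (rule that[OF d(1)])
qed

lemma f_small_off_annulus:
  assumes "e > 0"
  obtains \<eta> M where "0 < \<eta>" "\<eta> < M" "\<And>a. a \<notin> annulus \<eta> M \<Longrightarrow> \<bar>f a\<bar> \<le> e * growth a"
proof -
  obtain \<eta> where \<eta>: "\<eta> > 0" "\<And>a. \<bar>a\<bar> < \<eta> \<Longrightarrow> \<bar>f a\<bar> \<le> e * \<bar>a\<bar>" using f_small_near_0[OF assms] by blast
  obtain M where M: "M > 0" "\<And>a. M \<le> \<bar>a\<bar> \<Longrightarrow> \<bar>f a\<bar> \<le> e * \<bar>a\<bar> powr (q - 1)" using f_subcritical[OF assms] by blast
  show ?thesis
  proof (rule that[OF \<eta>(1), of "max M (\<eta> + 1)"])
    fix a assume "a \<notin> annulus \<eta> (max M (\<eta> + 1))"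
    then have "\<bar>a\<bar> < \<eta> \<or> M \<le> \<bar>a\<bar>" unfolding annulus_def by simp linarith
    then have "\<bar>f a\<bar> \<le> e * \<bar>a\<bar> \<or> \<bar>f a\<bar> \<le> e * \<bar>a\<bar> powr (q - 1)" using \<eta>(2) M(2) by blast
    moreover have "0 \<le> e * \<bar>a\<bar>" "0 \<le> e * \<bar>a\<bar> powr (q - 1)" using assms by simp_all
    ultimately show "\<bar>f a\<bar> \<le> e * growth a" unfolding growth_def distrib_left by linarith
  qed simp
qed

lemma f_bounded_on_bounded: obtains K where "K > 0" "\<And>a. \<bar>a\<bar> \<le> M \<Longrightarrow> \<bar>f a\<bar> \<le> K"
proof -
  have "bounded (f ` {-M..M})"
    by (intro compact_imp_bounded compact_continuous_image continuous_on_subset[OF f_continuous]) auto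
  then obtain K where "K > 0" "\<forall>y\<in>f ` {-M..M}. norm y \<le> K" unfolding bounded_pos by blast
  then show ?thesis by (intro that[of K]) (auto simp: abs_le_iff)
qed

lemma f_times_le_annulus:
  assumes "e > 0"
  obtains \<eta> M C where "0 < \<eta>" "\<eta> < M" "C > 0"
    "\<And>a. \<bar>f a * a\<bar> \<le> e * growth_density a + C * (indicator (annulus \<eta> M) a * a\<^sup>2)"
proof -
  obtain \<eta> M where \<eta>: "0 < \<eta>" "\<eta> < M" and off: "\<And>a. a \<notin> annulus \<eta> M \<Longrightarrow> \<bar>f a\<bar> \<le> e * growth a"
    using f_small_off_annulus[OF assms] by blast
  obtain K where K: "K > 0" "\<And>a. \<bar>a\<bar> \<le> M \<Longrightarrow> \<bar>f a\<bar> \<le> K" using f_bounded_on_bounded by blast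
  show ?thesis
  proof (rule that[OF \<eta>, of "K / \<eta>"])
    fix a
    show "\<bar>f a * a\<bar> \<le> e * growth_density a + K / \<eta> * (indicator (annulus \<eta> M) a * a\<^sup>2)"
    proof (cases "a \<in> annulus \<eta> M")
      case True
      then have a: "\<eta> \<le> \<bar>a\<bar>" "\<bar>f a\<bar> \<le> K" using K(2) by (auto simp: annulus_def)
      have "K / \<eta> * \<eta> \<le> K / \<eta> * \<bar>a\<bar>" using a K \<eta> by (intro mult_left_mono) auto
      then have "\<bar>f a\<bar> * \<bar>a\<bar> \<le> K / \<eta> * \<bar>a\<bar> * \<bar>a\<bar>" using a \<eta> by (intro mult_right_mono) auto
      also have "\<dots> = K / \<eta> * a\<^sup>2" by (simp add: power2_eq_square)
      finally have "\<bar>f a * a\<bar> \<le> K / \<eta> * a\<^sup>2" unfolding abs_mult .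
      then show ?thesis using True assms by (simp add: add_increasing)
    next
      case False
      then show ?thesis using mult_right_mono[OF off[OF False], of "\<bar>a\<bar>"]
        by (simp add: abs_mult mult.assoc growth_times_abs)
    qed
  qed (use K \<eta> in simp)
qed

lemma f_dominated: obtains C where "C > 0" "\<And>a. \<bar>f a\<bar> \<le> C * growth a"
proof -
  obtain \<eta> M where \<eta>: "0 < \<eta>" "\<eta> < M" and off: "\<And>a. a \<notin> annulus \<eta> M \<Longrightarrow> \<bar>f a\<bar> \<le> 1 * growth a"
    using f_small_off_annulus[OF zero_less_one] by blast
  obtain K where K: "K > 0" "\<And>a. \<bar>a\<bar> \<le> M \<Longrightarrow> \<bar>f a\<bar> \<le> K" using f_bounded_on_bounded by blast
  have "\<bar>f a\<bar> \<le> max 1 (K / \<eta>) * growth a" for a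
  proof (cases "a \<in> annulus \<eta> M")
    case True
    then have a: "\<eta> \<le> \<bar>a\<bar>" "\<bar>f a\<bar> \<le> K" using K(2) by (auto simp: annulus_def)
    have "K / \<eta> * \<eta> \<le> K / \<eta> * growth a" using a K \<eta> by (intro mult_left_mono) (auto simp: growth_def add_increasing2)
    then have "\<bar>f a\<bar> \<le> K / \<eta> * growth a" using a \<eta> by simp
    also have "\<dots> \<le> max 1 (K / \<eta>) * growth a" by (intro mult_right_mono) auto
    finally show ?thesis .
  next
    case False
    have "1 * growth a \<le> max 1 (K / \<eta>) * growth a" by (intro mult_right_mono) auto
    then show ?thesis using off[OF False] by linarith
  qed
  then show ?thesis using that[of "max 1 (K / \<eta>)"] by auto
qed

lemma f_times_le_powr:
  assumes "e > 0" obtains C where "C > 0" "\<And>a. f a * a \<le> e * a\<^sup>2 + C * \<bar>a\<bar> powr q"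
proof -
  obtain \<eta> where \<eta>: "\<eta> > 0" "\<And>a. \<bar>a\<bar> < \<eta> \<Longrightarrow> \<bar>f a\<bar> \<le> e * \<bar>a\<bar>" using f_small_near_0[OF assms] by blast
  obtain D where D: "D > 0" "\<And>a. \<bar>f a\<bar> \<le> D * growth a" using f_dominated by blast
  define C where "C = D * (1 / \<eta> powr (q - 2) + 1)"
  have C: "C > 0" using D by (simp add: C_def add_nonneg_pos)
  have "f a * a \<le> e * a\<^sup>2 + C * \<bar>a\<bar> powr q" for a
  proof (cases "\<bar>a\<bar> < \<eta>")
    case True
    have "\<bar>f a\<bar> * \<bar>a\<bar> \<le> e * \<bar>a\<bar> * \<bar>a\<bar>" by (rule mult_right_mono[OF \<eta>(2)[OF True]]) simp
    then have "f a * a \<le> e * a\<^sup>2" using abs_ge_self[of "f a * a"] by (simp add: abs_mult power2_eq_square)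
    then show ?thesis using C by (simp add: add_increasing2)
  next
    case False
    have "\<eta> powr (q - 2) * a\<^sup>2 \<le> \<bar>a\<bar> powr (q - 2) * a\<^sup>2" using False \<eta> q_gt_2 by (intro mult_right_mono powr_mono2) auto
    then have a: "a\<^sup>2 \<le> 1 / \<eta> powr (q - 2) * \<bar>a\<bar> powr q" using \<eta> by (simp add: abs_powr_split[of a q] field_simps)
    have "f a * a \<le> D * growth a * \<bar>a\<bar>"
      using mult_right_mono[OF D(2)[of a], of "\<bar>a\<bar>"] abs_ge_self[of "f a * a"] by (simp add: abs_mult)
    also have "\<dots> = D * (a\<^sup>2 + \<bar>a\<bar> powr q)" by (simp add: mult.assoc growth_times_abs growth_density_def)
    also have "\<dots> \<le> D * (1 / \<eta> powr (q - 2) * \<bar>a\<bar> powr q + \<bar>a\<bar> powr q)"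
      using a D by (intro mult_left_mono add_right_mono) auto
    also have "\<dots> = C * \<bar>a\<bar> powr q" by (simp add: C_def algebra_simps)
    finally show ?thesis using assms by (simp add: add_increasing)
  qed
  then show ?thesis by (rule that[OF C])
qed

lemma f_small_increment:
  assumes e: "e > 0"
  obtains \<delta> where "0 < \<delta>" "\<delta> \<le> 1" "\<And>a b. \<bar>b\<bar> < \<delta> * \<bar>a\<bar> \<Longrightarrow> \<bar>f (a + b) - f a\<bar> \<le> e * growth a"
proof -
  define c where "c = 2 powr (q - 1) + 1"
  have c: "c > 0" by (simp add: c_def add_nonneg_pos)
  have "e / c > 0" using e c by simp
  then obtain \<eta> M where \<eta>: "0 < \<eta>" "\<eta> < M" and off: "\<And>a. a \<notin> annulus \<eta> M \<Longrightarrow> \<bar>f a\<bar> \<le> e / c * growth a"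
    using f_small_off_annulus by blast
  have "uniformly_continuous_on (cball 0 (4 * M)) f"
    by (intro compact_uniformly_continuous continuous_on_subset[OF f_continuous]) auto
  moreover have "e * (\<eta> / 2) > 0" using e \<eta> by simp
  ultimately obtain d where d: "d > 0"
    "\<And>a b. \<bar>a\<bar> \<le> 4 * M \<Longrightarrow> \<bar>b\<bar> \<le> 4 * M \<Longrightarrow> \<bar>b - a\<bar> < d \<Longrightarrow> \<bar>f b - f a\<bar> < e * (\<eta> / 2)"
    unfolding uniformly_continuous_on_def dist_real_def by (metis mem_cball_0 real_norm_def)
  show ?thesis
  proof (rule that[of "min (1/2) (d / (2 * M))"])
    fix a b assume "\<bar>b\<bar> < min (1/2) (d / (2 * M)) * \<bar>a\<bar>"
    moreover have "min (1/2) (d / (2 * M)) * \<bar>a\<bar> \<le> 1 / 2 * \<bar>a\<bar>" "min (1/2) (d / (2 * M)) * \<bar>a\<bar> \<le> d / (2 * M) * \<bar>a\<bar>"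
      by (intro mult_right_mono; simp)+
    ultimately have b: "\<bar>b\<bar> < 1 / 2 * \<bar>a\<bar>" "\<bar>b\<bar> < d / (2 * M) * \<bar>a\<bar>" by linarith+
    show "\<bar>f (a + b) - f a\<bar> \<le> e * growth a"
    proof (cases "2 * \<bar>a\<bar> < \<eta> \<or> 2 * M < \<bar>a\<bar>")
      case True
      then have "a \<notin> annulus \<eta> M" "a + b \<notin> annulus \<eta> M" using b(1) \<eta> by (auto simp: annulus_def)
      then have "\<bar>f (a + b) - f a\<bar> \<le> e / c * (growth (a + b) + growth a)"
        using off[of a] off[of "a + b"] abs_triangle_ineq4[of "f (a + b)" "f a"] unfolding distrib_left by linarith
      moreover have "growth (a + b) + growth a \<le> c * growth a"
        using order_trans[OF growth_mono growth_dilate_le, of "a + b" 2 a] b(1) by (simp add: c_def distrib_right)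
      then have "e / c * (growth (a + b) + growth a) \<le> e / c * (c * growth a)" using e c by (intro mult_left_mono) auto
      ultimately show ?thesis using c by simp
    next
      case False
      have "d / (2 * M) * \<bar>a\<bar> \<le> d / (2 * M) * (2 * M)" using False d \<eta> by (intro mult_left_mono) auto
      then have "\<bar>b\<bar> < d" using b(2) \<eta> by simp
      then have "\<bar>f (a + b) - f a\<bar> < e * (\<eta> / 2)" using False b(1) \<eta> by (intro d(2)) auto
      also have "\<dots> \<le> e * growth a" using False e by (intro mult_left_mono) (auto simp: growth_def add_increasing2)
      finally show ?thesis by simp
    qed
  qed (use d \<eta> in auto)
qed

lemma f_increment:
  assumes e: "e > 0"
  obtains C where "C > 0" "\<And>a b. \<bar>f (a + b) - f a\<bar> \<le> e * growth a + C * growth b"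
proof -
  obtain \<delta> where \<delta>: "0 < \<delta>" "\<delta> \<le> 1" and small: "\<And>a b. \<bar>b\<bar> < \<delta> * \<bar>a\<bar> \<Longrightarrow> \<bar>f (a + b) - f a\<bar> \<le> e * growth a"
    using f_small_increment[OF e] by blast
  obtain D where D: "D > 0" "\<And>a. \<bar>f a\<bar> \<le> D * growth a" using f_dominated by blast
  define C where "C = 2 * (D * (2 / \<delta>) powr (q - 1))"
  have C: "C > 0" using D \<delta> by (simp add: C_def)
  have "\<bar>f (a + b) - f a\<bar> \<le> e * growth a + C * growth b" for a b
  proof (cases "\<bar>b\<bar> < \<delta> * \<bar>a\<bar>")
    case True
    then show ?thesis using small[OF True] C by (simp add: add_increasing2)
  next
    case False
    have comparable: "\<bar>f c\<bar> \<le> C / 2 * growth b" if "\<bar>c\<bar> \<le> \<bar>2 / \<delta> * b\<bar>" for c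
    proof -
      have "growth c \<le> (2 / \<delta>) powr (q - 1) * growth b"
        using order_trans[OF growth_mono[OF that] growth_dilate_le] \<delta> by simp
      then have "D * growth c \<le> D * ((2 / \<delta>) powr (q - 1) * growth b)" using D by (intro mult_left_mono) auto
      then show ?thesis using D(2)[of c] by (simp add: C_def mult.assoc)
    qed
    have "\<bar>a\<bar> \<le> 1 / \<delta> * \<bar>b\<bar>" "\<bar>b\<bar> \<le> 1 / \<delta> * \<bar>b\<bar>" using False \<delta> by (simp_all add: field_simps mult_left_le_one_le)
    moreover have "\<bar>2 / \<delta> * b\<bar> = 1 / \<delta> * \<bar>b\<bar> + 1 / \<delta> * \<bar>b\<bar>" using \<delta> by (simp add: abs_mult field_simps)
    ultimately have "\<bar>a\<bar> \<le> \<bar>2 / \<delta> * b\<bar>" "\<bar>a + b\<bar> \<le> \<bar>2 / \<delta> * b\<bar>" by linarith+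
    then have "\<bar>f (a + b) - f a\<bar> \<le> C / 2 * growth b + C / 2 * growth b"
      using comparable[of a] comparable[of "a + b"] abs_triangle_ineq4[of "f (a + b)" "f a"] by linarith
    then show ?thesis using e by (simp add: add_increasing)
  qed
  then show ?thesis by (rule that[OF C])
qed

lemma f_increment_segment:
  assumes "e > 0"
  obtains C where "C > 0" "\<And>a b \<theta>. \<theta> \<in> {0..1} \<Longrightarrow> \<bar>f (a + \<theta> * b) - f a\<bar> \<le> e * growth a + C * growth b"
proof -
  obtain C where C: "C > 0" "\<And>a b. \<bar>f (a + b) - f a\<bar> \<le> e * growth a + C * growth b"
    using f_increment[OF assms] by blast
  show ?thesis
  proof (rule that[OF C(1)])
    fix a b \<theta> :: real assume "\<theta> \<in> {0..1}"
    then have "growth (\<theta> * b) \<le> growth b" by (intro growth_mono) (simp add: abs_mult mult_left_le_one_le)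
    then have "C * growth (\<theta> * b) \<le> C * growth b" using C(1) by simp
    then show "\<bar>f (a + \<theta> * b) - f a\<bar> \<le> e * growth a + C * growth b" using C(2)[of a "\<theta> * b"] by linarith
  qed
qed

subsection \<open>The primitive\<close>

lemma prim_derivative: "(prim f has_real_derivative f u) (at u)"
proof -
  define R where "R = \<bar>u\<bar> + 1"
  have u: "u \<in> {-R<..<R}" by (auto simp: R_def)
  have integrable: "f integrable_on {a..b}" for a b
    by (intro integrable_continuous_real continuous_on_subset[OF f_continuous]) auto
  have prim_eq: "integral {-R..x} f - integral {-R..0} f = prim f x" if "x \<in> {-R<..<R}" for x
    using that Henstock_Kurzweil_Integration.integral_combine[OF _ _ integrable, of "-R" 0 x]
      Henstock_Kurzweil_Integration.integral_combine[OF _ _ integrable, of "-R" x 0] by (auto simp: prim_def R_def)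
  have "((\<lambda>x. integral {-R..x} f) has_real_derivative f u) (at u within {-R..R})"
    by (rule integral_has_real_derivative) (use u continuous_on_subset[OF f_continuous] in auto)
  then have "((\<lambda>x. integral {-R..x} f) has_real_derivative f u) (at u)"
    using u at_within_interior[of u "{-R..R}"] by (simp add: interior_atLeastAtMost_real)
  then have "((\<lambda>x. integral {-R..x} f - integral {-R..0} f) has_real_derivative f u) (at u)"
    by (auto intro!: derivative_eq_intros)
  then show ?thesis by (rule has_field_derivative_transform_within_open[OF _ open_greaterThanLessThan u]) (rule prim_eq)
qed

lemma prim_0 [simp]: "prim f 0 = 0"
  by (simp add: prim_def)

lemma prim_continuous: "continuous_on UNIV (prim f)"
  using prim_derivative by (intro DERIV_continuous_on) (auto intro: has_field_derivative_at_within)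

lemma f_measurable [measurable]: "f \<in> borel_measurable borel"
  by (rule borel_measurable_continuous_onI[OF f_continuous])

lemma prim_measurable [measurable]: "prim f \<in> borel_measurable borel"
  by (rule borel_measurable_continuous_onI[OF prim_continuous])

lemma prim_line_derivative: "((\<lambda>t. prim f (a + t * b)) has_real_derivative f (a + t * b) * b) (at t)"
  by (rule DERIV_chain'[OF _ prim_derivative]) (auto intro!: derivative_eq_intros)

lemma prim_mean_value:
  obtains \<theta> where "0 \<le> \<theta>" "\<theta> \<le> 1" "prim f (a + b) - prim f a = f (a + \<theta> * b) * b"
proof -
  obtain z where "0 < z" "z < 1" "prim f (a + 1 * b) - prim f (a + 0 * b) = (1 - 0) * (f (a + z * b) * b)"
    using MVT2[of 0 1 "\<lambda>t. prim f (a + t * b)" "\<lambda>t. f (a + t * b) * b"] prim_line_derivative by auto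
  then show ?thesis using that[of z] by simp
qed

subsection \<open>Monotonicity along rays\<close>

lemma f_ray_strict_mono:
  assumes "a \<noteq> 0" "0 < s" "s < t" shows "f (s * a) * a / s < f (t * a) * a / t"
proof (cases "a > 0")
  case True
  have "f (s * a) / \<bar>s * a\<bar> < f (t * a) / \<bar>t * a\<bar>"
    by (rule strict_mono_onD[OF f_ratio_strict_mono_pos]) (use True assms in auto)
  then have "f (s * a) / \<bar>s * a\<bar> * a\<^sup>2 < f (t * a) / \<bar>t * a\<bar> * a\<^sup>2" using assms by (intro mult_strict_right_mono) auto
  then show ?thesis using True assms by (simp add: abs_mult power2_eq_square field_simps)
next
  case False
  then have a: "a < 0" using assms by simp
  have "f (t * a) / \<bar>t * a\<bar> < f (s * a) / \<bar>s * a\<bar>"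
    by (rule strict_mono_onD[OF f_ratio_strict_mono_neg]) (use a assms in \<open>auto simp: mult_less_0_iff\<close>)
  then have "f (t * a) / \<bar>t * a\<bar> * a\<^sup>2 < f (s * a) / \<bar>s * a\<bar> * a\<^sup>2" using assms by (intro mult_strict_right_mono) auto
  moreover have "f (r * a) / \<bar>r * a\<bar> * a\<^sup>2 = - (f (r * a) * a / r)" if "r > 0" for r
    using a that by (simp add: abs_mult power2_eq_square field_simps)
  ultimately show ?thesis using assms by simp
qed

lemma f_times_nonneg: "0 \<le> f a * a"
proof (cases "a = 0")
  case False
  have "filterlim (\<lambda>s. s * a) (at 0) (at_right 0)"
    unfolding filterlim_at using False
      by (auto intro!: tendsto_eq_intros simp: eventually_at_right_less eventually_at_filter)
  then have "((\<lambda>s. f (s * a) / (s * a) * a\<^sup>2) \<longlongrightarrow> 0 * a\<^sup>2) (at_right 0)"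
    by (intro tendsto_intros filterlim_compose[OF f_sublinear_at_0])
  moreover have "\<forall>\<^sub>F s in at_right 0. f (s * a) / (s * a) * a\<^sup>2 \<le> f a * a"
    unfolding eventually_at_right_field
  proof (intro exI[of _ 1] conjI allI impI)
    fix s :: real assume s: "s > 0" "s < 1"
    show "f (s * a) / (s * a) * a\<^sup>2 \<le> f a * a"
      using f_ray_strict_mono[OF False s] False s by (simp add: power2_eq_square)
  qed simp
  ultimately have "0 * a\<^sup>2 \<le> f a * a" by (intro tendsto_le[OF _ tendsto_const]) auto
  then show ?thesis by simp
qed simp

lemma f_times_pos: assumes "a \<noteq> 0" shows "0 < f a * a"
  using f_ray_strict_mono[OF assms, of "1/2" 1] f_times_nonneg[of "a/2"] by simp

lemma f_ray_gap_pos: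
  assumes "a \<noteq> 0" "s > 0" "s \<noteq> 1" shows "0 < sgn (1 - s) * (f a * a - f (s * a) * a / s)"
  using f_ray_strict_mono[OF assms(1), of s 1] f_ray_strict_mono[OF assms(1), of 1 s] assms(2,3)
  by (cases "s < 1") auto

lemma f_ray_gap:
  assumes s: "s > 0" "s \<noteq> 1" and \<eta>: "0 < \<eta>" "\<eta> < M"
  obtains m where "m > 0"
    "\<And>a. m * (indicator (annulus \<eta> M) a * a\<^sup>2) \<le> sgn (1 - s) * (f a * a - f (s * a) * a / s)"
proof -
  define k where "k a = sgn (1 - s) * (f a * a - f (s * a) * a / s)" for a
  have k_pos: "0 < k a" if "a \<noteq> 0" for a unfolding k_def by (rule f_ray_gap_pos[OF that s])
  have "annulus \<eta> M = {-M..-\<eta>} \<union> {\<eta>..M}" using \<eta> by (auto simp: annulus_def abs_if split: if_splits)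
  then have "compact (annulus \<eta> M)" by (simp add: compact_Un)
  moreover have "M \<in> annulus \<eta> M" using \<eta> by (simp add: annulus_def)
  moreover have "continuous_on (annulus \<eta> M) k"
    unfolding k_def using s by (intro continuous_intros continuous_on_compose2[OF f_continuous]) auto
  ultimately obtain b where b: "b \<in> annulus \<eta> M" "\<And>a. a \<in> annulus \<eta> M \<Longrightarrow> k b \<le> k a"
    using continuous_attains_inf[of "annulus \<eta> M" k] by (metis empty_iff)
  have kb_pos: "k b > 0" using b(1) \<eta> by (intro k_pos) (auto simp: annulus_def)
  have "k b / M\<^sup>2 * (indicator (annulus \<eta> M) a * a\<^sup>2) \<le> k a" for a
  proof (cases "a \<in> annulus \<eta> M")
    case True
    have "a\<^sup>2 \<le> M\<^sup>2" using True by (intro abs_le_square_iff[THEN iffD1]) (auto simp: annulus_def)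
    then have "k b / M\<^sup>2 * a\<^sup>2 \<le> k b / M\<^sup>2 * M\<^sup>2" using kb_pos by (intro mult_left_mono) auto
    then show ?thesis using b(2)[OF True] True \<eta> by simp
  next
    case False
    then show ?thesis using k_pos[of a] by (cases "a = 0") (simp_all add: k_def)
  qed
  then show ?thesis using that[of "k b / M\<^sup>2"] kb_pos \<eta> by (simp add: k_def)
qed

lemma prim_ray_le:
  assumes "t \<ge> 0" shows "prim f a + (t\<^sup>2 - 1) / 2 * (f a * a) \<le> prim f (t * a)"
proof (cases "a = 0")
  case False
  define \<psi> where "\<psi> t = prim f (0 + t * a) - t\<^sup>2 / 2 * (f a * a)" for t
  have deriv: "(\<psi> has_real_derivative f (t * a) * a - t * (f a * a)) (at t)" for t
    unfolding \<psi>_def[abs_def] using prim_line_derivative[of 0 a t] by (auto intro!: derivative_eq_intros)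
  have decreasing: "f (x * a) * a - x * (f a * a) \<le> 0" if "0 \<le> x" "x \<le> 1" for x
    using f_ray_strict_mono[OF False, of x 1] that by (cases "x = 0 \<or> x = 1") (auto simp: field_simps)
  have increasing: "0 \<le> f (x * a) * a - x * (f a * a)" if "1 \<le> x" for x
    using f_ray_strict_mono[OF False, of 1 x] that by (cases "x = 1") (auto simp: field_simps)
  have "\<psi> 1 \<le> \<psi> t"
  proof (cases "t \<le> 1")
    case True
    show ?thesis
      by (rule DERIV_nonpos_imp_nonincreasing[OF True]) (use deriv decreasing assms in \<open>meson order_trans\<close>)
  next
    case False
    show ?thesis
      by (rule DERIV_nonneg_imp_nondecreasing[where f=\<psi>]) (use False deriv increasing in force)+
  qed
  then show ?thesis by (simp add: \<psi>_def field_simps)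
qed simp

lemma prim_le_half: "prim f a \<le> f a * a / 2"
  using prim_ray_le[of 0 a] by simp

lemma prim_nonneg: "0 \<le> prim f a"
proof -
  obtain \<theta> where \<theta>: "0 \<le> \<theta>" "prim f (0 + a) - prim f 0 = f (0 + \<theta> * a) * a" using prim_mean_value by blast
  have "0 \<le> f (\<theta> * a) * a"
    using f_times_nonneg[of "\<theta> * a"] \<theta>(1) by (cases "\<theta> = 0") (auto simp: zero_le_mult_iff mult_le_0_iff)
  then show ?thesis using \<theta>(2) by simp
qed

lemma prim_superquadratic_annulus:
  assumes "\<eta> > 0"
  obtains T where "T > 0" "\<And>t a. T \<le> t \<Longrightarrow> A * t\<^sup>2 * (indicator (annulus \<eta> M) a * a\<^sup>2) \<le> prim f (t * a)"
proof -
  have "\<forall>\<^sub>F u in at_infinity. A \<le> prim f u / u\<^sup>2" using prim_superquadratic_at_infinity by (simp add: filterlim_at_top)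
  then obtain b where b: "\<And>s. b \<le> \<bar>s\<bar> \<Longrightarrow> A \<le> prim f s / s\<^sup>2" unfolding eventually_at_infinity by auto
  show ?thesis
  proof (rule that[of "max b 1 / \<eta>"])
    show "max b 1 / \<eta> > 0" using assms by simp
    fix t a assume t: "max b 1 / \<eta> \<le> t"
    have "0 < max b 1 / \<eta>" using assms by simp
    then have "0 < t" using t by linarith
    show "A * t\<^sup>2 * (indicator (annulus \<eta> M) a * a\<^sup>2) \<le> prim f (t * a)"
    proof (cases "a \<in> annulus \<eta> M")
      case True
      have "max b 1 \<le> t * \<eta>" using t assms by (simp add: field_simps)
      also have "\<dots> \<le> \<bar>t * a\<bar>" using True \<open>0 < t\<close> by (simp add: annulus_def abs_mult)
      finally have "b \<le> \<bar>t * a\<bar>" "t * a \<noteq> 0" by auto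
      then have "A * (t * a)\<^sup>2 \<le> prim f (t * a)" using b[of "t * a"] by (simp add: pos_le_divide_eq)
      then show ?thesis using True by (simp add: power_mult_distrib mult.assoc)
    qed (simp add: prim_nonneg)
  qed
qed

end

section \<open>The energy functional\<close>

locale variational = potential V V0 + nonlinearity f q
  for V :: "'y::euclidean_space \<times> 'z::euclidean_space \<Rightarrow> real" and V0 f q +
  assumes dim_ge_3: "3 \<le> DIM('y) + DIM('z)"
    and q_subcritical: "q < 2 * real (DIM('y) + DIM('z)) / (real (DIM('y) + DIM('z)) - 2)"
begin

lemma X1_measurable: "X1 V u \<Longrightarrow> u \<in> borel_measurable lebesgue"
  by (intro L2_measurable X1_L2)

subsection \<open>Integrability\<close>

lemma Sobolev_X1:
  obtains C where "C > 0" "\<And>u R. X1 V u \<Longrightarrow> norm1 u \<le> R \<Longrightarrow> R > 0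
    \<Longrightarrow> integrable lebesgue (\<lambda>x. \<bar>u x\<bar> powr q) \<and> (LINT x|lebesgue. \<bar>u x\<bar> powr q) \<le> C * R powr q"
proof -
  obtain C where C: "C > 0" "\<And>(u::'y \<times> 'z \<Rightarrow> real) S. H1 u \<Longrightarrow> norm2 u \<le> S \<Longrightarrow> norm2 (grad u) \<le> S \<Longrightarrow> S > 0
    \<Longrightarrow> integrable lebesgue (\<lambda>x. \<bar>u x\<bar> powr q) \<and> (LINT x|lebesgue. \<bar>u x\<bar> powr q) \<le> C * S powr q"
    using Sobolev_subcritical[where 'a="'y \<times> 'z" and q=q] dim_ge_3 q_gt_2 q_subcritical by auto
  define k where "k = max 1 (1 / sqrt V0)"
  have k: "k > 0" by (simp add: k_def)
  show ?thesis
  proof (rule that[of "C * k powr q"])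
    fix u R assume u: "X1 V u" and R: "norm1 u \<le> R" "R > 0"
    have "norm2 u \<le> 1 / sqrt V0 * norm1 u"
      using norm2sq_le_norm1sq[OF u] by (simp add: norm1_def real_sqrt_divide[symmetric])
    moreover have "norm2 (grad u) \<le> 1 * norm1 u" using norm2sq_grad_le_norm1sq[OF u] by (simp add: norm1_def)
    moreover have "1 / sqrt V0 * norm1 u \<le> k * R" "1 * norm1 u \<le> k * R"
      using R V0_pos by (intro mult_mono; simp add: k_def)+
    ultimately have "norm2 u \<le> k * R" "norm2 (grad u) \<le> k * R" by linarith+
    then show "integrable lebesgue (\<lambda>x. \<bar>u x\<bar> powr q) \<and> (LINT x|lebesgue. \<bar>u x\<bar> powr q) \<le> C * k powr q * R powr q"
      using C(2)[OF X1_H1[OF u], of "k * R"] k R by (simp add: powr_mult mult.assoc)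
  qed (use C k in simp)
qed

lemma X1_powr_integrable: assumes "X1 V u" shows "integrable lebesgue (\<lambda>x. \<bar>u x\<bar> powr q)"
  using Sobolev_X1 assms norm1_nonneg[of u] by (metis add_nonneg_pos less_add_one order_less_imp_le zero_less_one)

lemma X1_square_integrable: "X1 V u \<Longrightarrow> integrable lebesgue (\<lambda>x. (u x)\<^sup>2)"
  using L2_integrable_norm_sq[OF X1_L2] by simp

lemma growth_density_integrable: "X1 V u \<Longrightarrow> integrable lebesgue (\<lambda>x. growth_density (u x))"
  unfolding growth_density_def by (intro Bochner_Integration.integrable_add X1_square_integrable X1_powr_integrable)

lemma growth_density_integral_le:
  obtains K where "K > 0" "\<And>u. X1 V u \<Longrightarrow> norm1 u \<le> R \<Longrightarrow> (LINT x|lebesgue. growth_density (u x)) \<le> K"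
proof -
  obtain C where C: "C > 0" "\<And>u R. X1 V u \<Longrightarrow> norm1 u \<le> R \<Longrightarrow> R > 0 \<Longrightarrow> (LINT x|lebesgue. \<bar>u x\<bar> powr q) \<le> C * R powr q"
    using Sobolev_X1 by metis
  define S where "S = max 1 R"
  have S: "S > 0" by (simp add: S_def)
  show ?thesis
  proof (rule that[of "S\<^sup>2 / V0 + C * S powr q"])
    fix u assume u: "X1 V u" and "norm1 u \<le> R"
    then have norm_le: "norm1 u \<le> S" by (simp add: S_def)
    have "(LINT x|lebesgue. (u x)\<^sup>2) \<le> (norm1 u)\<^sup>2 / V0"
      using norm2sq_le_norm1sq[OF u] by (simp add: norm2sq_def norm1_sq)
    also have "\<dots> \<le> S\<^sup>2 / V0" using norm_le V0_pos by (intro divide_right_mono power_mono) auto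
    finally show "(LINT x|lebesgue. growth_density (u x)) \<le> S\<^sup>2 / V0 + C * S powr q"
      using C(2)[OF u norm_le S] X1_square_integrable[OF u] X1_powr_integrable[OF u] by (simp add: growth_density_def)
  qed (use C V0_pos S in \<open>simp add: add_pos_pos\<close>)
qed

lemma growth_integrable:
  assumes u: "X1 V u" and h: "X1 V h" shows "integrable lebesgue (\<lambda>x. growth (u x) * \<bar>h x\<bar>)"
proof (rule Bochner_Integration.integrable_bound)
  show "integrable lebesgue (\<lambda>x. growth_density (u x) + growth_density (h x))"
    by (intro Bochner_Integration.integrable_add growth_density_integrable u h)
  note [measurable] = X1_measurable[OF u] X1_measurable[OF h]
  show "(\<lambda>x. growth (u x) * \<bar>h x\<bar>) \<in> borel_measurable lebesgue" by measurable
  show "AE x in lebesgue. norm (growth (u x) * \<bar>h x\<bar>) \<le> norm (growth_density (u x) + growth_density (h x))"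
    using growth_mult_le by (intro AE_I2) (simp add: abs_mult)
qed

lemma growth_integral_le:
  obtains K where "K > 0"
    "\<And>u h. X1 V u \<Longrightarrow> X1 V h \<Longrightarrow> norm1 u \<le> R \<Longrightarrow> (LINT x|lebesgue. growth (u x) * \<bar>h x\<bar>) \<le> K * norm1 h"
proof -
  obtain K where K: "K > 0" "\<And>u. X1 V u \<Longrightarrow> norm1 u \<le> max 1 R \<Longrightarrow> (LINT x|lebesgue. growth_density (u x)) \<le> K"
    using growth_density_integral_le by blast
  have unit: "(LINT x|lebesgue. growth (u x) * \<bar>h x\<bar>) \<le> 2 * K"
    if u: "X1 V u" "norm1 u \<le> R" and h: "X1 V h" "norm1 h \<le> 1" for u h
  proof -
    have "(LINT x|lebesgue. growth (u x) * \<bar>h x\<bar>) \<le> (LINT x|lebesgue. growth_density (u x) + growth_density (h x))"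
      using u h by (intro integral_mono growth_integrable Bochner_Integration.integrable_add
          growth_density_integrable growth_mult_le)
    also have "\<dots> = (LINT x|lebesgue. growth_density (u x)) + (LINT x|lebesgue. growth_density (h x))"
      by (simp add: growth_density_integrable u h)
    also have "\<dots> \<le> K + K" using u h by (intro add_mono K(2)) auto
    finally show ?thesis by simp
  qed
  show ?thesis
  proof (rule that[of "2 * K"])
    fix u h assume u: "X1 V u" and h: "X1 V h" and norm_le: "norm1 u \<le> R"
    show "(LINT x|lebesgue. growth (u x) * \<bar>h x\<bar>) \<le> 2 * K * norm1 h"
    proof (cases "norm1 h = 0")
      case True
      then have "AE x in lebesgue. h x = 0" by (simp add: norm1_eq_0_iff[OF h])
      then have "(LINT x|lebesgue. growth (u x) * \<bar>h x\<bar>) = 0" by (intro integral_eq_zero_AE) auto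
      then show ?thesis using True by simp
    next
      case False
      then have h_pos: "norm1 h > 0" using norm1_nonneg[of h] by linarith
      then have "norm1 (\<lambda>x. 1 / norm1 h * h x) = 1" using norm1_cmult[OF h, of "1 / norm1 h"] by simp
      then have "(LINT x|lebesgue. growth (u x) * \<bar>1 / norm1 h * h x\<bar>) \<le> 2 * K"
        by (intro unit u norm_le X1_cmult h) simp
      then show ?thesis using h_pos by (simp add: abs_mult field_simps)
    qed
  qed (use K in simp)
qed

lemma growth_integral_le_small:
  obtains K where "K > 0" "\<And>w h d. X1 V w \<Longrightarrow> X1 V h \<Longrightarrow> norm1 w \<le> d \<Longrightarrow> 0 < d \<Longrightarrow> d \<le> 1
    \<Longrightarrow> (LINT x|lebesgue. growth (w x) * \<bar>h x\<bar>) \<le> d * (K * norm1 h)"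
proof -
  obtain K where K: "K > 0"
    "\<And>u h. X1 V u \<Longrightarrow> X1 V h \<Longrightarrow> norm1 u \<le> 1 \<Longrightarrow> (LINT x|lebesgue. growth (u x) * \<bar>h x\<bar>) \<le> K * norm1 h"
    using growth_integral_le by blast
  show ?thesis
  proof (rule that[OF K(1)])
    fix w h d assume w: "X1 V w" and h: "X1 V h" and d: "norm1 w \<le> d" "0 < d" "d \<le> 1"
    note w' = X1_cmult[OF w, of "1 / d"]
    have "(LINT x|lebesgue. growth (w x) * \<bar>h x\<bar>) \<le> (LINT x|lebesgue. d * (growth (1 / d * w x) * \<bar>h x\<bar>))"
    proof (intro integral_mono growth_integrable integrable_mult_right w h w')
      fix x
      show "growth (w x) * \<bar>h x\<bar> \<le> d * (growth (1 / d * w x) * \<bar>h x\<bar>)"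
        using mult_right_mono[OF growth_scale_le[OF d(2,3), of "1 / d * w x"], of "\<bar>h x\<bar>"] d by (simp add: mult.assoc)
    qed
    also have "\<dots> \<le> d * (K * norm1 h)"
      using K(2)[OF w' h] d norm1_cmult[OF w, of "1 / d"] by simp
    finally show "(LINT x|lebesgue. growth (w x) * \<bar>h x\<bar>) \<le> d * (K * norm1 h)" .
  qed
qed

lemma f_integrable: assumes u: "X1 V u" and h: "X1 V h" shows "integrable lebesgue (\<lambda>x. f (u x) * h x)"
proof -
  obtain C where C: "C > 0" "\<And>a. \<bar>f a\<bar> \<le> C * growth a" using f_dominated by blast
  note [measurable] = X1_measurable[OF u] X1_measurable[OF h]
  show ?thesis
  proof (rule Bochner_Integration.integrable_bound[OF integrable_mult_right[OF growth_integrable[OF u h], of C]])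
    show "(\<lambda>x. f (u x) * h x) \<in> borel_measurable lebesgue" by measurable
    show "AE x in lebesgue. norm (f (u x) * h x) \<le> norm (C * (growth (u x) * \<bar>h x\<bar>))"
      using C by (intro AE_I2) (simp add: abs_mult mult_right_mono flip: mult.assoc)
  qed
qed

lemma f_integral_le:
  obtains K where "K > 0"
    "\<And>u h. X1 V u \<Longrightarrow> X1 V h \<Longrightarrow> norm1 u \<le> R \<Longrightarrow> \<bar>LINT x|lebesgue. f (u x) * h x\<bar> \<le> K * norm1 h"
proof -
  obtain C where C: "C > 0" "\<And>a. \<bar>f a\<bar> \<le> C * growth a" using f_dominated by blast
  obtain K where K: "K > 0"
    "\<And>u h. X1 V u \<Longrightarrow> X1 V h \<Longrightarrow> norm1 u \<le> R \<Longrightarrow> (LINT x|lebesgue. growth (u x) * \<bar>h x\<bar>) \<le> K * norm1 h"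
    using growth_integral_le by blast
  show ?thesis
  proof (rule that[of "C * K"])
    fix u h assume u: "X1 V u" and h: "X1 V h" and norm_le: "norm1 u \<le> R"
    have "\<bar>LINT x|lebesgue. f (u x) * h x\<bar> \<le> (LINT x|lebesgue. \<bar>f (u x) * h x\<bar>)" by (rule integral_abs_bound)
    also have "\<dots> \<le> (LINT x|lebesgue. C * (growth (u x) * \<bar>h x\<bar>))"
      using C(2) by (intro integral_mono integrable_abs f_integrable integrable_mult_right growth_integrable u h)
        (simp add: abs_mult mult_right_mono flip: mult.assoc)
    also have "\<dots> \<le> C * K * norm1 h" using K(2)[OF u h norm_le] C(1) by (simp add: mult.assoc)
    finally show "\<bar>LINT x|lebesgue. f (u x) * h x\<bar> \<le> C * K * norm1 h" .
  qed (use C K in simp)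
qed

lemma prim_integrable: assumes "X1 V u" shows "integrable lebesgue (\<lambda>x. prim f (u x))"
proof (rule Bochner_Integration.integrable_bound[OF f_integrable[OF assms assms]])
  note [measurable] = X1_measurable[OF assms]
  show "(\<lambda>x. prim f (u x)) \<in> borel_measurable lebesgue" by measurable
  have "norm (prim f a) \<le> norm (f a * a)" for a
    using prim_le_half[of a] prim_nonneg[of a] f_times_nonneg[of a] by simp
  then show "AE x in lebesgue. norm (prim f (u x)) \<le> norm (f (u x) * u x)" by simp
qed

lemma prim_integral_le_half:
  assumes "X1 V u" shows "(LINT x|lebesgue. prim f (u x)) \<le> (LINT x|lebesgue. f (u x) * u x) / 2"
  using integral_mono[OF prim_integrable[OF assms] integrable_divide[OF f_integrable[OF assms assms], of 2]
      prim_le_half] by simp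

subsection \<open>Uniform differentiability on bounded sets\<close>

lemma increment_integral_le:
  assumes e: "e > 0"
  obtains d where "d > 0" "\<And>u w h \<Phi>. X1 V u \<Longrightarrow> X1 V w \<Longrightarrow> X1 V h \<Longrightarrow> norm1 u \<le> R \<Longrightarrow> norm1 w \<le> d \<Longrightarrow>
    integrable lebesgue \<Phi> \<Longrightarrow> (\<And>x. \<exists>\<theta>\<in>{0..1}. \<bar>\<Phi> x\<bar> = \<bar>f (u x + \<theta> * w x) - f (u x)\<bar> * \<bar>h x\<bar>) \<Longrightarrow>
    \<bar>LINT x|lebesgue. \<Phi> x\<bar> \<le> e * norm1 h"
proof -
  obtain K where K: "K > 0"
    "\<And>u h. X1 V u \<Longrightarrow> X1 V h \<Longrightarrow> norm1 u \<le> R \<Longrightarrow> (LINT x|lebesgue. growth (u x) * \<bar>h x\<bar>) \<le> K * norm1 h"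
    using growth_integral_le by blast
  obtain L where L: "L > 0" "\<And>w h d. X1 V w \<Longrightarrow> X1 V h \<Longrightarrow> norm1 w \<le> d \<Longrightarrow> 0 < d \<Longrightarrow> d \<le> 1
    \<Longrightarrow> (LINT x|lebesgue. growth (w x) * \<bar>h x\<bar>) \<le> d * (L * norm1 h)"
    using growth_integral_le_small by blast
  have "e / (2 * K) > 0" using e K by simp
  then obtain C where C: "C > 0"
    "\<And>a b \<theta>. \<theta> \<in> {0..1} \<Longrightarrow> \<bar>f (a + \<theta> * b) - f a\<bar> \<le> e / (2 * K) * growth a + C * growth b"
    using f_increment_segment by blast
  define d where "d = min 1 (e / (2 * C * L))"
  have d: "0 < d" "d \<le> 1" "C * d * L \<le> e / 2" using e C L by (auto simp: d_def min_def field_simps)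
  show ?thesis
  proof (rule that[OF d(1)])
    fix u w h \<Phi>
    assume u: "X1 V u" and w: "X1 V w" and h: "X1 V h" and norm_le: "norm1 u \<le> R" "norm1 w \<le> d"
      and \<Phi>: "integrable lebesgue \<Phi>" "\<And>x. \<exists>\<theta>\<in>{0..1}. \<bar>\<Phi> x\<bar> = \<bar>f (u x + \<theta> * w x) - f (u x)\<bar> * \<bar>h x\<bar>"
    have \<Phi>_le: "\<bar>\<Phi> x\<bar> \<le> e / (2 * K) * (growth (u x) * \<bar>h x\<bar>) + C * (growth (w x) * \<bar>h x\<bar>)" for x
    proof -
      obtain \<theta> where \<theta>: "\<theta> \<in> {0..1}" "\<bar>\<Phi> x\<bar> = \<bar>f (u x + \<theta> * w x) - f (u x)\<bar> * \<bar>h x\<bar>" using \<Phi>(2) by blast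
      from mult_right_mono[OF C(2)[OF \<theta>(1), of "u x" "w x"], of "\<bar>h x\<bar>"]
      show ?thesis unfolding \<theta>(2) by (simp add: distrib_right mult.assoc)
    qed
    have "\<bar>LINT x|lebesgue. \<Phi> x\<bar> \<le> (LINT x|lebesgue. \<bar>\<Phi> x\<bar>)" by (rule integral_abs_bound)
    also have "\<dots> \<le> (LINT x|lebesgue. e / (2 * K) * (growth (u x) * \<bar>h x\<bar>) + C * (growth (w x) * \<bar>h x\<bar>))"
      by (intro integral_mono integrable_abs \<Phi>(1) Bochner_Integration.integrable_add integrable_mult_right
          growth_integrable u w h \<Phi>_le)
    also have "\<dots> = e / (2 * K) * (LINT x|lebesgue. growth (u x) * \<bar>h x\<bar>) + C * (LINT x|lebesgue. growth (w x) * \<bar>h x\<bar>)"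
      using growth_integrable[OF u h] growth_integrable[OF w h] by simp
    also have "\<dots> \<le> e / (2 * K) * (K * norm1 h) + C * (d * (L * norm1 h))"
      using e K C K(2)[OF u h norm_le(1)] L(2)[OF w h norm_le(2) d(1,2)] by (intro add_mono mult_left_mono) auto
    also have "\<dots> = (e / 2 + C * d * L) * norm1 h" using K by (simp add: distrib_right)
    also have "\<dots> \<le> e * norm1 h" using d(3) by (intro mult_right_mono) auto
    finally show "\<bar>LINT x|lebesgue. \<Phi> x\<bar> \<le> e * norm1 h" .
  qed
qed

lemma f_integral_uniformly_continuous:
  assumes "e > 0"
  obtains d where "d > 0" "\<And>u w h. X1 V u \<Longrightarrow> X1 V w \<Longrightarrow> X1 V h \<Longrightarrow> norm1 u \<le> R \<Longrightarrow> norm1 w \<le> d \<Longrightarrow>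
      \<bar>(LINT x|lebesgue. f (u x + w x) * h x) - (LINT x|lebesgue. f (u x) * h x)\<bar> \<le> e * norm1 h"
proof -
  obtain d where d: "d > 0" "\<And>u w h \<Phi>. X1 V u \<Longrightarrow> X1 V w \<Longrightarrow> X1 V h \<Longrightarrow> norm1 u \<le> R \<Longrightarrow> norm1 w \<le> d \<Longrightarrow>
    integrable lebesgue \<Phi> \<Longrightarrow> (\<And>x. \<exists>\<theta>\<in>{0..1}. \<bar>\<Phi> x\<bar> = \<bar>f (u x + \<theta> * w x) - f (u x)\<bar> * \<bar>h x\<bar>) \<Longrightarrow>
    \<bar>LINT x|lebesgue. \<Phi> x\<bar> \<le> e * norm1 h" using increment_integral_le[OF assms] by blast
  show ?thesis
  proof (rule that[OF d(1)])
    fix u w h assume u: "X1 V u" and w: "X1 V w" and h: "X1 V h" and norm_le: "norm1 u \<le> R" "norm1 w \<le> d"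
    note int = f_integrable[OF X1_add[OF u w] h] f_integrable[OF u h]
    have "\<bar>LINT x|lebesgue. f (u x + w x) * h x - f (u x) * h x\<bar> \<le> e * norm1 h"
      by (rule d(2)[OF u w h norm_le Bochner_Integration.integrable_diff[OF int]])
        (rule bexI[of _ 1]; simp add: abs_mult flip: left_diff_distrib)
    then show "\<bar>(LINT x|lebesgue. f (u x + w x) * h x) - (LINT x|lebesgue. f (u x) * h x)\<bar> \<le> e * norm1 h"
      by (simp add: int)
  qed
qed

lemma prim_integral_expansion:
  assumes "e > 0"
  obtains d where "d > 0" "\<And>u w. X1 V u \<Longrightarrow> X1 V w \<Longrightarrow> norm1 u \<le> R \<Longrightarrow> norm1 w \<le> d \<Longrightarrow>
      \<bar>LINT x|lebesgue. prim f (u x + w x) - prim f (u x) - f (u x) * w x\<bar> \<le> e * norm1 w"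
proof -
  obtain d where d: "d > 0" "\<And>u w h \<Phi>. X1 V u \<Longrightarrow> X1 V w \<Longrightarrow> X1 V h \<Longrightarrow> norm1 u \<le> R \<Longrightarrow> norm1 w \<le> d \<Longrightarrow>
    integrable lebesgue \<Phi> \<Longrightarrow> (\<And>x. \<exists>\<theta>\<in>{0..1}. \<bar>\<Phi> x\<bar> = \<bar>f (u x + \<theta> * w x) - f (u x)\<bar> * \<bar>h x\<bar>) \<Longrightarrow>
    \<bar>LINT x|lebesgue. \<Phi> x\<bar> \<le> e * norm1 h" using increment_integral_le[OF assms] by blast
  show ?thesis
  proof (rule that[OF d(1)])
    fix u w assume u: "X1 V u" and w: "X1 V w" and norm_le: "norm1 u \<le> R" "norm1 w \<le> d"
    show "\<bar>LINT x|lebesgue. prim f (u x + w x) - prim f (u x) - f (u x) * w x\<bar> \<le> e * norm1 w"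
    proof (rule d(2)[OF u w w norm_le])
      show "integrable lebesgue (\<lambda>x. prim f (u x + w x) - prim f (u x) - f (u x) * w x)"
        by (intro Bochner_Integration.integrable_diff prim_integrable f_integrable X1_add u w)
      fix x
      obtain \<theta> where "0 \<le> \<theta>" "\<theta> \<le> 1" "prim f (u x + w x) - prim f (u x) = f (u x + \<theta> * w x) * w x"
        using prim_mean_value by blast
      then show "\<exists>\<theta>\<in>{0..1}. \<bar>prim f (u x + w x) - prim f (u x) - f (u x) * w x\<bar> = \<bar>f (u x + \<theta> * w x) - f (u x)\<bar> * \<bar>w x\<bar>"
        by (intro bexI[of _ \<theta>]) (simp_all add: left_diff_distrib flip: abs_mult)
    qed
  qed
qed

definition J1_deriv :: "('y \<times> 'z \<Rightarrow> real) \<Rightarrow> ('y \<times> 'z \<Rightarrow> real) \<Rightarrow> real" where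
  "J1_deriv u h = inner1 u h - (LINT x|lebesgue. f (u x) * h x)"

lemma J1_deriv_cmult: assumes "X1 V u" "X1 V h" shows "J1_deriv u (\<lambda>x. c * h x) = c * J1_deriv u h"
  using inner1_cmult_right[OF assms(2,1), of c] by (simp add: J1_deriv_def mult.left_commute[of _ c] right_diff_distrib)

lemma J1_deriv_add:
  assumes "X1 V u" "X1 V h" "X1 V k" shows "J1_deriv u (\<lambda>x. h x + k x) = J1_deriv u h + J1_deriv u k"
  using inner1_add_right[OF assms(2,3,1)] f_integrable[OF assms(1,2)] f_integrable[OF assms(1,3)]
  by (simp add: J1_deriv_def distrib_left)

lemma J1_deriv_AE_cong:
  assumes u: "X1 V u" and h: "X1 V h" and ae_eq: "AE x in lebesgue. k x = h x" shows "J1_deriv u k = J1_deriv u h"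
proof -
  note [measurable] = X1_measurable[OF u] X1_measurable[OF h] X1_measurable[OF X1_AE_cong[OF h ae_eq]]
  have "(LINT x|lebesgue. f (u x) * k x) = (LINT x|lebesgue. f (u x) * h x)"
    by (rule integral_cong_AE, measurable) (use ae_eq in eventually_elim, simp)
  moreover have "inner1 u k = inner1 u h" using inner1_AE_cong[OF h ae_eq u] by (simp add: inner1_commute)
  ultimately show ?thesis by (simp add: J1_deriv_def)
qed

lemma J1_deriv_uniformly_continuous:
  assumes "e > 0"
  obtains d where "d > 0" "\<And>u w h. X1 V u \<Longrightarrow> X1 V w \<Longrightarrow> X1 V h \<Longrightarrow> norm1 u \<le> R \<Longrightarrow> norm1 w \<le> d \<Longrightarrow>
      \<bar>J1_deriv (\<lambda>x. u x + w x) h - J1_deriv u h\<bar> \<le> e * norm1 h"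
proof -
  have "e / 2 > 0" using assms by simp
  then obtain d where d: "d > 0" "\<And>u w h. X1 V u \<Longrightarrow> X1 V w \<Longrightarrow> X1 V h \<Longrightarrow> norm1 u \<le> R \<Longrightarrow> norm1 w \<le> d \<Longrightarrow>
      \<bar>(LINT x|lebesgue. f (u x + w x) * h x) - (LINT x|lebesgue. f (u x) * h x)\<bar> \<le> e / 2 * norm1 h"
    using f_integral_uniformly_continuous by blast
  show ?thesis
  proof (rule that[of "min d (e / 2)"])
    fix u w h assume u: "X1 V u" and w: "X1 V w" and h: "X1 V h" and norm_le: "norm1 u \<le> R" "norm1 w \<le> min d (e / 2)"
    have "norm1 w * norm1 h \<le> e / 2 * norm1 h" using norm_le by (intro mult_right_mono) auto
    then have "\<bar>inner1 w h\<bar> \<le> e / 2 * norm1 h" using inner1_Cauchy_Schwarz[OF w h] by linarith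
    moreover have "\<bar>(LINT x|lebesgue. f (u x + w x) * h x) - (LINT x|lebesgue. f (u x) * h x)\<bar> \<le> e / 2 * norm1 h"
      using norm_le by (intro d(2) u w h) auto
    ultimately show "\<bar>J1_deriv (\<lambda>x. u x + w x) h - J1_deriv u h\<bar> \<le> e * norm1 h"
      unfolding J1_deriv_def inner1_add_left[OF u w h] by linarith
  qed (use d assms in auto)
qed

lemma J1_expansion:
  assumes "e > 0"
  obtains d where "d > 0" "\<And>u w. X1 V u \<Longrightarrow> X1 V w \<Longrightarrow> norm1 u \<le> R \<Longrightarrow> norm1 w \<le> d \<Longrightarrow>
      \<bar>J1 V f (\<lambda>x. u x + w x) - J1 V f u - J1_deriv u w\<bar> \<le> e * norm1 w"
proof -
  have "e / 2 > 0" using assms by simp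
  then obtain d where d: "d > 0" "\<And>u w. X1 V u \<Longrightarrow> X1 V w \<Longrightarrow> norm1 u \<le> R \<Longrightarrow> norm1 w \<le> d \<Longrightarrow>
      \<bar>LINT x|lebesgue. prim f (u x + w x) - prim f (u x) - f (u x) * w x\<bar> \<le> e / 2 * norm1 w"
    using prim_integral_expansion by blast
  show ?thesis
  proof (rule that[of "min d e"])
    fix u w assume u: "X1 V u" and w: "X1 V w" and norm_le: "norm1 u \<le> R" "norm1 w \<le> min d e"
    have "norm1 w * norm1 w \<le> e * norm1 w" using norm_le by (intro mult_right_mono) auto
    then have "norm1sq V w / 2 \<le> e / 2 * norm1 w" using norm1_sq[of w] by (simp add: power2_eq_square)
    moreover have "J1 V f (\<lambda>x. u x + w x) - J1 V f u - J1_deriv u w = norm1sq V w / 2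
        - (LINT x|lebesgue. prim f (u x + w x) - prim f (u x) - f (u x) * w x)"
      using prim_integrable[OF X1_add[OF u w]] prim_integrable[OF u] f_integrable[OF u w]
      unfolding J1_def J1_deriv_def norm1sq_add[OF u w] add_divide_distrib by simp
    moreover have "\<bar>LINT x|lebesgue. prim f (u x + w x) - prim f (u x) - f (u x) * w x\<bar> \<le> e / 2 * norm1 w"
      using norm_le by (intro d(2) u w) auto
    ultimately show "\<bar>J1 V f (\<lambda>x. u x + w x) - J1 V f u - J1_deriv u w\<bar> \<le> e * norm1 w"
      using norm1sq_nonneg[of w] by linarith
  qed (use d assms in auto)
qed

lemma J1_critical_if_J1_deriv_eq_0:
  assumes u: "X1 V u" and deriv: "\<And>h. X1 V h \<Longrightarrow> J1_deriv u h = 0" shows "J1_critical V f u"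
  unfolding J1_critical_def
proof (intro allI impI)
  fix e :: real assume "e > 0"
  then obtain d where d: "d > 0" "\<And>v w. X1 V v \<Longrightarrow> X1 V w \<Longrightarrow> norm1 v \<le> norm1 u \<Longrightarrow> norm1 w \<le> d \<Longrightarrow>
      \<bar>J1 V f (\<lambda>x. v x + w x) - J1 V f v - J1_deriv v w\<bar> \<le> e * norm1 w"
    using J1_expansion by blast
  show "\<exists>\<delta>>0. \<forall>h. X1 V h \<and> sqrt (norm1sq V h) < \<delta> \<longrightarrow> \<bar>J1 V f (\<lambda>x. u x + h x) - J1 V f u\<bar> \<le> e * sqrt (norm1sq V h)"
    using d(1) d(2)[OF u _ order_refl] deriv by (intro exI[of _ d]) (simp add: norm1_def)
qed

subsection \<open>Weak continuity of the nonlinear term\<close>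

lemma integral_tendsto_if_growth_dominated:
  assumes v: "\<And>n. X1 V (v n)" "\<And>n. norm1 (v n) \<le> R" and h: "X1 V h"
    and \<Phi>: "\<And>n. integrable lebesgue (\<Phi> n)" "integrable lebesgue \<Psi>"
    and lim: "AE x in lebesgue. (\<lambda>n. \<Phi> n x) \<longlonglongrightarrow> \<Psi> x"
    and bound: "\<And>n x. \<bar>\<Phi> n x\<bar> \<le> C * max (growth (v n x) * \<bar>h x\<bar>) (growth (h x) * \<bar>v n x\<bar>)" and C: "C > 0"
  shows "(\<lambda>n. LINT x|lebesgue. \<Phi> n x) \<longlonglongrightarrow> (LINT x|lebesgue. \<Psi> x)"
proof -
  obtain K where K: "\<And>u. X1 V u \<Longrightarrow> norm1 u \<le> R \<Longrightarrow> (LINT x|lebesgue. growth_density (u x)) \<le> K"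
    using growth_density_integral_le by blast
  have "(\<lambda>n. LINT x|lebesgue. \<Phi> n x - \<Psi> x) \<longlonglongrightarrow> 0"
  proof (rule integral_tendsto_0_almost_dominated[where B="\<lambda>n x. growth_density (v n x)" and K=K])
    show "AE x in lebesgue. (\<lambda>n. \<Phi> n x - \<Psi> x) \<longlonglongrightarrow> 0" using lim by (simp add: LIM_zero_iff)
    show "\<exists>G. integrable lebesgue G \<and> (\<forall>n. AE x in lebesgue. \<bar>\<Phi> n x - \<Psi> x\<bar> \<le> G x + e * growth_density (v n x))"
      if "e > 0" for e
    proof -
      have "e / C > 0" using that C by simp
      then obtain D where D: "D > 0" "\<And>a b. growth a * \<bar>b\<bar> \<le> e / C * growth_density a + D * growth_density b"
        "\<And>a b. growth b * \<bar>a\<bar> \<le> e / C * growth_density a + D * growth_density b" using growth_Young by blast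
      have "\<bar>\<Phi> n x - \<Psi> x\<bar> \<le> (C * D * growth_density (h x) + \<bar>\<Psi> x\<bar>) + e * growth_density (v n x)" for n x
      proof -
        have "\<bar>\<Phi> n x\<bar> \<le> C * (e / C * growth_density (v n x) + D * growth_density (h x))"
          using D C by (intro order_trans[OF bound] mult_left_mono) auto
        also have "\<dots> = e * growth_density (v n x) + C * D * growth_density (h x)" using C by (simp add: distrib_left)
        finally show ?thesis using abs_triangle_ineq4[of "\<Phi> n x" "\<Psi> x"] by linarith
      qed
      moreover have "integrable lebesgue (\<lambda>x. C * D * growth_density (h x) + \<bar>\<Psi> x\<bar>)"
        by (intro Bochner_Integration.integrable_add integrable_mult_right growth_density_integrable h
            integrable_abs \<Phi>(2))
      ultimately show ?thesis by (intro exI[of _ "\<lambda>x. C * D * growth_density (h x) + \<bar>\<Psi> x\<bar>"]) simp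
    qed
  qed (use \<Phi> v K growth_density_integrable in auto)
  then show ?thesis by (simp add: \<Phi> LIM_zero_iff)
qed

lemma
  assumes v: "\<And>n. X1 V (v n)" "\<And>n. norm1 (v n) \<le> R" and w: "X1 V w" and h: "X1 V h"
    and lim: "AE x in lebesgue. (\<lambda>n. v n x) \<longlonglongrightarrow> w x"
  shows f_integral_tendsto: "(\<lambda>n. LINT x|lebesgue. f (v n x) * h x) \<longlonglongrightarrow> (LINT x|lebesgue. f (w x) * h x)"
    and f_integral_tendsto_right: "(\<lambda>n. LINT x|lebesgue. f (h x) * v n x) \<longlonglongrightarrow> (LINT x|lebesgue. f (h x) * w x)"
proof -
  obtain C where C: "C > 0" "\<And>a. \<bar>f a\<bar> \<le> C * growth a" using f_dominated by blast
  have bound: "\<bar>f a * b\<bar> \<le> C * max (growth a * \<bar>b\<bar>) c" "\<bar>f a * b\<bar> \<le> C * max c (growth a * \<bar>b\<bar>)" for a b c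
  proof -
    have "\<bar>f a * b\<bar> \<le> C * (growth a * \<bar>b\<bar>)" using C(2) by (simp add: abs_mult mult_right_mono flip: mult.assoc)
    also have "\<dots> \<le> C * max (growth a * \<bar>b\<bar>) c" using C(1) by (intro mult_left_mono) auto
    finally show "\<bar>f a * b\<bar> \<le> C * max (growth a * \<bar>b\<bar>) c" .
    then show "\<bar>f a * b\<bar> \<le> C * max c (growth a * \<bar>b\<bar>)" by (simp add: max.commute)
  qed
  have cont: "isCont f a" for a using f_continuous by (simp add: continuous_on_eq_continuous_at)
  have "AE x in lebesgue. (\<lambda>n. f (v n x) * h x) \<longlonglongrightarrow> f (w x) * h x"
    using lim by eventually_elim (intro tendsto_intros isCont_tendsto_compose[OF cont])
  then show "(\<lambda>n. LINT x|lebesgue. f (v n x) * h x) \<longlonglongrightarrow> (LINT x|lebesgue. f (w x) * h x)"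
    by (intro integral_tendsto_if_growth_dominated[OF v h _ _ _ bound(1) C(1)] f_integrable v w h)
  have "AE x in lebesgue. (\<lambda>n. f (h x) * v n x) \<longlonglongrightarrow> f (h x) * w x"
    using lim by eventually_elim (intro tendsto_intros)
  then show "(\<lambda>n. LINT x|lebesgue. f (h x) * v n x) \<longlonglongrightarrow> (LINT x|lebesgue. f (h x) * w x)"
    by (intro integral_tendsto_if_growth_dominated[OF v h _ _ _ bound(2) C(1)] f_integrable v w h)
qed

lemma
  assumes v: "\<And>n. X1 V (v n)" "\<And>n. norm1 (v n) \<le> R" and h: "X1 V h"
    and lim: "AE x in lebesgue. (\<lambda>n. v n x) \<longlonglongrightarrow> w x"
  shows J1_deriv_tendsto: "(\<lambda>n. J1_deriv (v n) h) \<longlonglongrightarrow> J1_deriv w h"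
    and J1_deriv_tendsto_right: "(\<lambda>n. J1_deriv h (v n)) \<longlonglongrightarrow> J1_deriv h w"
proof -
  have bound: "norm1sq V (v n) \<le> R\<^sup>2" for n using power_mono[OF v(2) norm1_nonneg, of n 2] by (simp add: norm1_sq)
  have w: "X1 V w" by (rule X1_AE_limit[OF v(1) bound lim])
  show "(\<lambda>n. J1_deriv (v n) h) \<longlonglongrightarrow> J1_deriv w h" "(\<lambda>n. J1_deriv h (v n)) \<longlonglongrightarrow> J1_deriv h w"
    unfolding J1_deriv_def inner1_commute[of h]
    by (intro tendsto_diff inner1_tendsto[OF v(1) bound lim h] f_integral_tendsto[OF v w h lim]
        f_integral_tendsto_right[OF v w h lim])+
qed

end

section \<open>The Nehari manifold\<close>

definition intermediate_mass :: "real \<Rightarrow> real \<Rightarrow> ('a::euclidean_space \<Rightarrow> real) \<Rightarrow> real" where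
  "intermediate_mass \<eta> M u = (LINT x|lebesgue. indicator (annulus \<eta> M) (u x) * (u x)\<^sup>2)"

context variational
begin

definition Nehari_functional :: "('y \<times> 'z \<Rightarrow> real) \<Rightarrow> real" where
  "Nehari_functional u = norm1sq V u - (LINT x|lebesgue. f (u x) * u x)"


lemma J1_deriv_self: "J1_deriv u u = Nehari_functional u"
  by (simp add: J1_deriv_def Nehari_functional_def inner1_self)

lemma norm1_pos_iff: "X1 V u \<Longrightarrow> 0 < norm1 u \<longleftrightarrow> \<not> (AE x in lebesgue. u x = 0)"
  using norm1_eq_0_iff[of u] norm1_nonneg[of u] by linarith

lemma Nehari1_iff: "u \<in> Nehari1 V f \<longleftrightarrow> X1G V u \<and> 0 < norm1 u \<and> Nehari_functional u = 0"
  by (auto simp: Nehari1_def Nehari_functional_def norm1_pos_iff X1G_X1)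

lemma Nehari1_X1: "u \<in> Nehari1 V f \<Longrightarrow> X1 V u"
  by (simp add: Nehari1_iff X1G_X1)

lemma Nehari1_norm1_sq: "u \<in> Nehari1 V f \<Longrightarrow> (LINT x|lebesgue. f (u x) * u x) = (norm1 u)\<^sup>2"
  by (simp add: Nehari1_def norm1_sq)

lemma intermediate_mass_integrable:
  assumes "X1 V u" shows "integrable lebesgue (\<lambda>x. indicator (annulus \<eta> M) (u x) * (u x)\<^sup>2)"
proof (rule Bochner_Integration.integrable_bound[OF X1_square_integrable[OF assms]])
  note [measurable] = X1_measurable[OF assms]
  show "(\<lambda>x. indicator (annulus \<eta> M) (u x) * (u x)\<^sup>2) \<in> borel_measurable lebesgue" by measurable
qed (auto simp: indicator_def)

lemma Nehari_functional_pos_near_0: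
  obtains \<rho> where "\<rho> > 0" "\<And>w. X1 V w \<Longrightarrow> 0 < norm1 w \<Longrightarrow> norm1 w < \<rho> \<Longrightarrow> Nehari_functional w > 0"
proof -
  obtain S where S: "S > 0" "\<And>u R. X1 V u \<Longrightarrow> norm1 u \<le> R \<Longrightarrow> R > 0 \<Longrightarrow> (LINT x|lebesgue. \<bar>u x\<bar> powr q) \<le> S * R powr q"
    using Sobolev_X1 by metis
  have "V0 / 2 > 0" using V0_pos by simp
  then obtain C where C: "C > 0" "\<And>a. f a * a \<le> V0 / 2 * a\<^sup>2 + C * \<bar>a\<bar> powr q" using f_times_le_powr by blast
  define \<rho> where "\<rho> = (1 / (2 * (C * S))) powr (1 / (q - 2))"
  have \<rho>: "\<rho> > 0" "\<rho> powr (q - 2) = 1 / (2 * (C * S))" using C S q_gt_2 by (auto simp: \<rho>_def powr_powr)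
  show ?thesis
  proof (rule that[OF \<rho>(1)])
    fix w assume w: "X1 V w" and norm_le: "0 < norm1 w" "norm1 w < \<rho>"
    have "(LINT x|lebesgue. f (w x) * w x) \<le> (LINT x|lebesgue. V0 / 2 * (w x)\<^sup>2 + C * \<bar>w x\<bar> powr q)"
      by (intro integral_mono f_integrable w Bochner_Integration.integrable_add integrable_mult_right
          X1_square_integrable X1_powr_integrable C(2))
    also have "\<dots> = V0 / 2 * norm2sq w + C * (LINT x|lebesgue. \<bar>w x\<bar> powr q)"
      using X1_square_integrable[OF w] X1_powr_integrable[OF w] by (simp add: norm2sq_def)
    also have "\<dots> \<le> V0 / 2 * ((norm1 w)\<^sup>2 / V0) + C * (S * norm1 w powr q)"
      using norm2sq_le_norm1sq[OF w] V0_pos C S(2)[OF w order_refl norm_le(1)]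
      by (intro add_mono mult_left_mono) (simp_all add: norm1_sq)
    also have "\<dots> = (norm1 w)\<^sup>2 / 2 + C * S * norm1 w powr (q - 2) * (norm1 w)\<^sup>2"
      using abs_powr_split[of "norm1 w" q] V0_pos by simp
    also have "\<dots> < (norm1 w)\<^sup>2 / 2 + C * S * \<rho> powr (q - 2) * (norm1 w)\<^sup>2"
      using norm_le C S q_gt_2 by (intro add_strict_left_mono mult_strict_right_mono mult_strict_left_mono
          powr_less_mono2) auto
    also have "\<dots> = (norm1 w)\<^sup>2" unfolding \<rho>(2) using C S by simp
    finally show "Nehari_functional w > 0" by (simp add: Nehari_functional_def norm1_sq)
  qed
qed

lemma intermediate_mass_lower_bound:
  assumes l: "l > 0"
  obtains \<eta> M \<delta> where "0 < \<eta>" "\<eta> < M" "\<delta> > 0"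
    "\<And>w. X1 V w \<Longrightarrow> norm1 w \<le> R \<Longrightarrow> l \<le> (LINT x|lebesgue. f (w x) * w x) \<Longrightarrow> \<delta> \<le> intermediate_mass \<eta> M w"
proof -
  obtain K where K: "K > 0" "\<And>u. X1 V u \<Longrightarrow> norm1 u \<le> R \<Longrightarrow> (LINT x|lebesgue. growth_density (u x)) \<le> K"
    using growth_density_integral_le by blast
  define e where "e = l / (2 * K)"
  have e: "e > 0" using K l by (simp add: e_def)
  obtain \<eta> M C where \<eta>: "0 < \<eta>" "\<eta> < M" and C: "C > 0"
    "\<And>a. \<bar>f a * a\<bar> \<le> e * growth_density a + C * (indicator (annulus \<eta> M) a * a\<^sup>2)"
    using f_times_le_annulus[OF e] by blast
  show ?thesis
  proof (rule that[OF \<eta>, of "l / (2 * C)"])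
    fix w assume w: "X1 V w" and norm_le: "norm1 w \<le> R" and "l \<le> (LINT x|lebesgue. f (w x) * w x)"
    note integrable = growth_density_integrable[OF w] intermediate_mass_integrable[OF w, of \<eta> M]
    note \<open>l \<le> (LINT x|lebesgue. f (w x) * w x)\<close>
    also have "(LINT x|lebesgue. f (w x) * w x)
        \<le> (LINT x|lebesgue. e * growth_density (w x) + C * (indicator (annulus \<eta> M) (w x) * (w x)\<^sup>2))"
      by (intro integral_mono f_integrable w Bochner_Integration.integrable_add integrable_mult_right integrable
          order_trans[OF abs_ge_self C(2)])
    also have "\<dots> = e * (LINT x|lebesgue. growth_density (w x)) + C * intermediate_mass \<eta> M w"
      by (simp add: intermediate_mass_def integrable)
    also have "\<dots> \<le> e * K + C * intermediate_mass \<eta> M w" using K(2)[OF w norm_le] e by simp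
    also have "e * K = l / 2" using K by (simp add: e_def)
    finally show "l / (2 * C) \<le> intermediate_mass \<eta> M w" using C(1) by (simp add: field_simps)
  qed (use l C in simp)
qed

lemma prim_integral_superquadratic:
  assumes "\<eta> > 0" "\<delta> > 0" "A > 0"
  obtains T where "T > 0"
    "\<And>t w. T \<le> t \<Longrightarrow> X1 V w \<Longrightarrow> \<delta> \<le> intermediate_mass \<eta> M w \<Longrightarrow> A * t\<^sup>2 \<le> (LINT x|lebesgue. prim f (t * w x))"
proof -
  obtain T where T: "T > 0" "\<And>t a. T \<le> t \<Longrightarrow> A / \<delta> * t\<^sup>2 * (indicator (annulus \<eta> M) a * a\<^sup>2) \<le> prim f (t * a)"
    using prim_superquadratic_annulus[OF assms(1)] by blast
  show ?thesis
  proof (rule that[OF T(1)])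
    fix t w assume t: "T \<le> t" and w: "X1 V w" and mass: "\<delta> \<le> intermediate_mass \<eta> M w"
    have "A * t\<^sup>2 = A / \<delta> * t\<^sup>2 * \<delta>" using assms by simp
    also have "\<dots> \<le> A / \<delta> * t\<^sup>2 * intermediate_mass \<eta> M w" using mass assms by (intro mult_left_mono) auto
    also have "\<dots> = (LINT x|lebesgue. A / \<delta> * t\<^sup>2 * (indicator (annulus \<eta> M) (w x) * (w x)\<^sup>2))"
      by (simp add: intermediate_mass_def)
    also have "\<dots> \<le> (LINT x|lebesgue. prim f (t * w x))"
      by (intro integral_mono integrable_mult_right intermediate_mass_integrable prim_integrable X1_cmult w T(2) t)
    finally show "A * t\<^sup>2 \<le> (LINT x|lebesgue. prim f (t * w x))" .
  qed
qed

subsection \<open>The functional on the Nehari manifold\<close>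

lemma J1_cmult:
  assumes "X1 V u" shows "J1 V f (\<lambda>x. t * u x) = t\<^sup>2 * norm1sq V u / 2 - (LINT x|lebesgue. prim f (t * u x))"
  by (simp add: J1_def norm1sq_cmult[OF assms])

lemma J1_ray_le:
  assumes u: "X1 V u" and Nehari: "Nehari_functional u = 0" and t: "t \<ge> 0" shows "J1 V f (\<lambda>x. t * u x) \<le> J1 V f u"
proof -
  note integrable = prim_integrable[OF u] f_integrable[OF u u]
  have "(LINT x|lebesgue. prim f (u x)) + (t\<^sup>2 - 1) / 2 * (LINT x|lebesgue. f (u x) * u x)
      = (LINT x|lebesgue. prim f (u x) + (t\<^sup>2 - 1) / 2 * (f (u x) * u x))" by (simp add: integrable)
  also have "\<dots> \<le> (LINT x|lebesgue. prim f (t * u x))"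
    by (intro integral_mono Bochner_Integration.integrable_add integrable_mult_right integrable prim_integrable
        X1_cmult u prim_ray_le t)
  finally show ?thesis using Nehari unfolding J1_cmult[OF u] unfolding J1_def Nehari_functional_def
    by (simp add: field_simps)
qed

lemma J1_nonneg: assumes "X1 V u" "Nehari_functional u = 0" shows "0 \<le> J1 V f u"
  using J1_ray_le[OF assms, of 0] J1_cmult[OF assms(1), of 0] by simp

lemma c1_le: assumes "u \<in> Nehari1 V f" shows "c1 V f \<le> J1 V f u"
proof -
  have "bdd_below (J1 V f ` Nehari1 V f)"
    by (rule bdd_belowI[of _ 0]) (auto simp: Nehari1_iff X1G_X1 intro: J1_nonneg)
  then show ?thesis unfolding c1_def using assms by (intro cInf_lower) auto
qed

lemma Nehari_bounded:
  obtains R where "R > 0" "\<And>u. u \<in> Nehari1 V f \<Longrightarrow> J1 V f u \<le> C \<Longrightarrow> norm1 u \<le> R"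
proof -
  define s where "s = sqrt (2 * (\<bar>C\<bar> + 1))"
  have s: "s > 0" "s\<^sup>2 = 2 * (\<bar>C\<bar> + 1)" by (auto simp: s_def)
  obtain \<eta> M \<delta> where \<eta>: "0 < \<eta>" "\<eta> < M" "\<delta> > 0" and
    mass: "\<And>w. X1 V w \<Longrightarrow> norm1 w \<le> s \<Longrightarrow> 2 \<le> (LINT x|lebesgue. f (w x) * w x) \<Longrightarrow> \<delta> \<le> intermediate_mass \<eta> M w"
    by (rule intermediate_mass_lower_bound[OF zero_less_numeral]) (rule that)
  have "s\<^sup>2 > 0" using s by simp
  then obtain T where T: "T > 0" "\<And>t w. T \<le> t \<Longrightarrow> X1 V w \<Longrightarrow> \<delta> \<le> intermediate_mass \<eta> M w \<Longrightarrow>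
      s\<^sup>2 * t\<^sup>2 \<le> (LINT x|lebesgue. prim f (t * w x))"
    using prim_integral_superquadratic[OF \<eta>(1,3)] by blast
  show ?thesis
  proof (rule that[of "s * T"])
    fix u assume "u \<in> Nehari1 V f" and J: "J1 V f u \<le> C"
    then have u: "X1 V u" "Nehari_functional u = 0" and u_pos: "norm1 u > 0" by (auto simp: Nehari1_iff X1G_X1)
    show "norm1 u \<le> s * T"
    proof (rule ccontr)
      assume "\<not> norm1 u \<le> s * T"
      define w where "w x = s / norm1 u * u x" for x
      have w: "X1 V w" "norm1 w = s"
        unfolding w_def[abs_def] using X1_cmult[OF u(1)] u_pos s by (auto simp only: norm1_cmult[OF u(1)]) auto
      have "J1 V f w \<le> C" unfolding w_def[abs_def] using J1_ray_le[OF u, of "s / norm1 u"] u_pos s J by simp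
      moreover have "J1 V f w = \<bar>C\<bar> + 1 - (LINT x|lebesgue. prim f (w x))"
        unfolding J1_def norm1_sq[symmetric] w(2) s(2) by simp
      ultimately have "2 \<le> (LINT x|lebesgue. f (w x) * w x)"
        using prim_integral_le_half[OF w(1)] abs_ge_self[of C] by linarith
      then have "\<delta> \<le> intermediate_mass \<eta> M w" using mass w by simp
      moreover have "T \<le> norm1 u / s" using \<open>\<not> norm1 u \<le> s * T\<close> s by (simp add: field_simps)
      ultimately have "s\<^sup>2 * (norm1 u / s)\<^sup>2 \<le> (LINT x|lebesgue. prim f (norm1 u / s * w x))" by (intro T(2) w(1))
      moreover have "norm1 u / s * w x = u x" for x using u_pos s by (simp add: w_def)
      ultimately have "(norm1 u)\<^sup>2 \<le> (LINT x|lebesgue. prim f (u x))" using s by (simp add: power_divide)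
      moreover have "(norm1 u)\<^sup>2 > 0" using u_pos by simp
      ultimately show False using J1_nonneg[OF u] by (simp add: J1_def norm1_sq)
    qed
  qed (use s T in simp)
qed

lemma Nehari_norm1_lower_bound: obtains \<rho> where "\<rho> > 0" "\<And>u. u \<in> Nehari1 V f \<Longrightarrow> \<rho> \<le> norm1 u"
  using Nehari_functional_pos_near_0 unfolding Nehari1_iff by (metis X1G_X1 less_irrefl not_le)

lemma Nehari_intermediate_mass_lower_bound:
  obtains \<eta> M \<delta> where "0 < \<eta>" "\<eta> < M" "\<delta> > 0"
    "\<And>u. u \<in> Nehari1 V f \<Longrightarrow> norm1 u \<le> R \<Longrightarrow> \<delta> \<le> intermediate_mass \<eta> M u"
proof -
  obtain \<rho> where \<rho>: "\<rho> > 0" "\<And>u. u \<in> Nehari1 V f \<Longrightarrow> \<rho> \<le> norm1 u" using Nehari_norm1_lower_bound by blast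
  then have "\<rho>\<^sup>2 > 0" by simp
  then obtain \<eta> M \<delta> where \<eta>: "0 < \<eta>" "\<eta> < M" "\<delta> > 0" and
    mass: "\<And>w. X1 V w \<Longrightarrow> norm1 w \<le> R \<Longrightarrow> \<rho>\<^sup>2 \<le> (LINT x|lebesgue. f (w x) * w x) \<Longrightarrow> \<delta> \<le> intermediate_mass \<eta> M w"
    using intermediate_mass_lower_bound by blast
  show ?thesis
  proof (rule that[OF \<eta>])
    show "\<delta> \<le> intermediate_mass \<eta> M u" if "u \<in> Nehari1 V f" "norm1 u \<le> R" for u
      using mass[OF Nehari1_X1[OF that(1)] that(2)]
          power_mono[OF \<rho>(2)[OF that(1)], of 2] \<rho>(1) Nehari1_norm1_sq[OF that(1)] by simp
  qed
qed

subsection \<open>Projection onto the Nehari manifold\<close>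

lemma J1_deriv_bounded:
  obtains K where "K > 0" "\<And>u h. X1 V u \<Longrightarrow> X1 V h \<Longrightarrow> norm1 u \<le> R \<Longrightarrow> \<bar>J1_deriv u h\<bar> \<le> K * norm1 h"
proof -
  obtain K where K: "K > 0"
    "\<And>u h. X1 V u \<Longrightarrow> X1 V h \<Longrightarrow> norm1 u \<le> R \<Longrightarrow> \<bar>LINT x|lebesgue. f (u x) * h x\<bar> \<le> K * norm1 h"
    using f_integral_le by blast
  show ?thesis
  proof (rule that[of "\<bar>R\<bar> + K"])
    fix u h assume u: "X1 V u" and h: "X1 V h" and norm_le: "norm1 u \<le> R"
    have "norm1 u * norm1 h \<le> \<bar>R\<bar> * norm1 h" using norm_le by (intro mult_right_mono) auto
    then show "\<bar>J1_deriv u h\<bar> \<le> (\<bar>R\<bar> + K) * norm1 h"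
      using inner1_Cauchy_Schwarz[OF u h] K(2)[OF u h norm_le] unfolding J1_deriv_def distrib_right by linarith
  qed (use K in simp)
qed

lemma Nehari_functional_uniformly_continuous:
  assumes e: "e > 0"
  obtains d where "d > 0" "\<And>w k. X1 V w \<Longrightarrow> X1 V k \<Longrightarrow> norm1 w \<le> R \<Longrightarrow> norm1 k \<le> d \<Longrightarrow>
    \<bar>Nehari_functional (\<lambda>x. w x + k x) - Nehari_functional w\<bar> \<le> e"
proof -
  define e' where "e' = e / (2 * (\<bar>R\<bar> + 1))"
  have e': "e' > 0" using e by (simp add: e'_def)
  obtain d where d: "d > 0" "\<And>u w h. X1 V u \<Longrightarrow> X1 V w \<Longrightarrow> X1 V h \<Longrightarrow> norm1 u \<le> R \<Longrightarrow> norm1 w \<le> d \<Longrightarrow>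
      \<bar>J1_deriv (\<lambda>x. u x + w x) h - J1_deriv u h\<bar> \<le> e' * norm1 h"
    using J1_deriv_uniformly_continuous[OF e'] by blast
  obtain K where K: "K > 0" "\<And>u h. X1 V u \<Longrightarrow> X1 V h \<Longrightarrow> norm1 u \<le> R \<Longrightarrow> \<bar>J1_deriv u h\<bar> \<le> K * norm1 h"
    using J1_deriv_bounded by blast
  show ?thesis
  proof (rule that[of "min d (min 1 (e / (2 * K)))"])
    fix w k assume w: "X1 V w" and k: "X1 V k" and norm_le: "norm1 w \<le> R" "norm1 k \<le> min d (min 1 (e / (2 * K)))"
    note wk = X1_add[OF w k]
    have "e' * norm1 (\<lambda>x. w x + k x) \<le> e' * (\<bar>R\<bar> + 1)"
      using norm1_triangle[OF w k] norm_le e' by (intro mult_left_mono) auto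
    also have "\<dots> = e / 2" by (simp add: e'_def field_simps)
    finally have "\<bar>J1_deriv (\<lambda>x. w x + k x) (\<lambda>x. w x + k x) - J1_deriv w (\<lambda>x. w x + k x)\<bar> \<le> e / 2"
      using d(2)[OF w k wk] norm_le by (intro order_trans[OF d(2)] w k wk) auto
    moreover have "K * norm1 k \<le> K * (e / (2 * K))" using norm_le K by (intro mult_left_mono) auto
    then have "\<bar>J1_deriv w k\<bar> \<le> e / 2" using K(2)[OF w k norm_le(1)] K(1) by simp
    moreover have "J1_deriv w (\<lambda>x. w x + k x) = J1_deriv w w + J1_deriv w k" by (rule J1_deriv_add[OF w w k])
    ultimately show "\<bar>Nehari_functional (\<lambda>x. w x + k x) - Nehari_functional w\<bar> \<le> e"
      unfolding J1_deriv_self[symmetric] by linarith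
  qed (use d K e in auto)
qed

lemma Nehari_functional_line_continuous:
  assumes u: "X1 V u" and h: "X1 V h" shows "continuous_on S (\<lambda>s. Nehari_functional (\<lambda>x. s * u x + h x))"
proof (rule continuous_at_imp_continuous_on, rule ballI)
  fix s0 :: real
  define w where "w x = s0 * u x + h x" for x
  have w: "X1 V w" unfolding w_def[abs_def] by (intro X1_add X1_cmult u h)
  show "isCont (\<lambda>s. Nehari_functional (\<lambda>x. s * u x + h x)) s0"
    unfolding continuous_at_eps_delta
  proof (intro allI impI)
    fix e :: real assume e: "e > 0"
    then have "e / 2 > 0" by simp
    then obtain d where d: "d > 0" "\<And>v k. X1 V v \<Longrightarrow> X1 V k \<Longrightarrow> norm1 v \<le> norm1 w \<Longrightarrow> norm1 k \<le> d \<Longrightarrow>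
        \<bar>Nehari_functional (\<lambda>x. v x + k x) - Nehari_functional v\<bar> \<le> e / 2"
      using Nehari_functional_uniformly_continuous by blast
    have u_pos: "norm1 u + 1 > 0" by (simp add: add_nonneg_pos)
    show "\<exists>d>0. \<forall>s. dist s s0 < d \<longrightarrow>
        dist (Nehari_functional (\<lambda>x. s * u x + h x)) (Nehari_functional (\<lambda>x. s0 * u x + h x)) < e"
    proof (intro exI[of _ "d / (norm1 u + 1)"] conjI allI impI)
      fix s assume "dist s s0 < d / (norm1 u + 1)"
      then have "\<bar>s - s0\<bar> * (norm1 u + 1) < d" using u_pos by (simp add: dist_real_def pos_less_divide_eq)
      then have "\<bar>s - s0\<bar> * norm1 u \<le> d" using abs_ge_zero[of "s - s0"] by (simp add: distrib_left)
      then have "\<bar>Nehari_functional (\<lambda>x. w x + (s - s0) * u x) - Nehari_functional w\<bar> \<le> e / 2"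
        by (intro d(2) w X1_cmult u order_refl) (simp add: norm1_cmult[OF u])
      moreover have "(\<lambda>x. w x + (s - s0) * u x) = (\<lambda>x. s * u x + h x)" by (auto simp: w_def algebra_simps)
      ultimately show "dist (Nehari_functional (\<lambda>x. s * u x + h x)) (Nehari_functional (\<lambda>x. s0 * u x + h x)) < e"
        using e by (simp add: dist_real_def w_def[abs_def])
    qed (use d u_pos in simp)
  qed
qed

lemma Nehari_functional_negative_far:
  assumes "\<eta> > 0" "\<delta> > 0" "B > 0"
  obtains T where "T > 0" "\<And>t w. T \<le> t \<Longrightarrow> X1 V w \<Longrightarrow> \<delta> \<le> intermediate_mass \<eta> M w \<Longrightarrow> norm1sq V w \<le> B
    \<Longrightarrow> Nehari_functional (\<lambda>x. t * w x) < 0"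
proof -
  obtain T where T: "T > 0" "\<And>t w. T \<le> t \<Longrightarrow> X1 V w \<Longrightarrow> \<delta> \<le> intermediate_mass \<eta> M w \<Longrightarrow>
      B * t\<^sup>2 \<le> (LINT x|lebesgue. prim f (t * w x))"
    using prim_integral_superquadratic[OF assms] by blast
  show ?thesis
  proof (rule that[OF T(1)])
    fix t w assume t: "T \<le> t" and w: "X1 V w" and mass: "\<delta> \<le> intermediate_mass \<eta> M w" and norm_le: "norm1sq V w \<le> B"
    have "t\<^sup>2 * norm1sq V w \<le> t\<^sup>2 * B" using norm_le by (intro mult_left_mono) auto
    moreover have "2 * (B * t\<^sup>2) \<le> (LINT x|lebesgue. f (t * w x) * (t * w x))"
      using T(2)[OF t w mass] prim_integral_le_half[OF X1_cmult[OF w, of t]] by linarith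
    moreover have "B * t\<^sup>2 > 0" using assms T t by simp
    ultimately show "Nehari_functional (\<lambda>x. t * w x) < 0"
      unfolding Nehari_functional_def norm1sq_cmult[OF w] by (simp add: mult.commute)
  qed
qed

lemma f_integral_pos:
  assumes w: "X1 V w" "norm1 w > 0" shows "0 < (LINT x|lebesgue. f (w x) * w x)"
proof -
  have "(AE x in lebesgue. f (w x) * w x = 0) \<longleftrightarrow> (AE x in lebesgue. w x = 0)"
    using f_times_pos by (intro AE_cong) (metis less_irrefl mult_zero_right)
  then have "(LINT x|lebesgue. f (w x) * w x) \<noteq> 0"
    using integral_nonneg_eq_0_iff_AE[OF f_integrable[OF w(1,1)]] f_times_nonneg norm1_pos_iff[OF w(1)] w(2) by simp
  then show ?thesis using Bochner_Integration.integral_nonneg[OF f_times_nonneg, of lebesgue w] by linarith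
qed

lemma Nehari_projection:
  assumes w: "X1G V w" and w_pos: "norm1 w > 0"
  obtains t where "t > 0" "(\<lambda>x. t * w x) \<in> Nehari1 V f"
proof -
  have in_X1: "X1 V w" using w by (rule X1G_X1)
  let ?g = "\<lambda>s. Nehari_functional (\<lambda>x. s * w x)"
  obtain \<rho> where \<rho>: "\<rho> > 0" "\<And>w. X1 V w \<Longrightarrow> 0 < norm1 w \<Longrightarrow> norm1 w < \<rho> \<Longrightarrow> Nehari_functional w > 0"
    using Nehari_functional_pos_near_0 by blast
  obtain \<eta> M \<delta> where \<eta>: "0 < \<eta>" "\<delta> > 0" and mass: "\<delta> \<le> intermediate_mass \<eta> M w"
    by (rule intermediate_mass_lower_bound[OF f_integral_pos[OF in_X1 w_pos]]) (use in_X1 in blast)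
  have "norm1sq V w > 0" using w_pos by (simp add: norm1_def)
  from Nehari_functional_negative_far[OF \<eta> this] obtain T where T: "T > 0" "?g T < 0"
    using in_X1 mass by (metis order_refl)
  define t0 where "t0 = min T (\<rho> / (2 * norm1 w))"
  have t0: "t0 > 0" "t0 \<le> T" "t0 * norm1 w < \<rho>" using T \<rho> w_pos by (auto simp: t0_def min_def field_simps)
  have "?g t0 > 0" using t0 w_pos by (intro \<rho>(2) X1_cmult in_X1) (simp_all add: norm1_cmult[OF in_X1])
  moreover have "continuous_on {t0..T} ?g"
    using Nehari_functional_line_continuous[OF in_X1 X1_cmult[OF in_X1, of 0]] by simp
  ultimately obtain t where t: "t0 \<le> t" "t \<le> T" "?g t = 0" using IVT2'[of ?g T 0 t0] T(2) t0 by auto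
  then have "(\<lambda>x. t * w x) \<in> Nehari1 V f"
    unfolding Nehari1_iff using t0 w_pos X1G_cmult[OF w] by (simp add: norm1_cmult[OF in_X1])
  then show ?thesis using that[of t] t t0 by auto
qed

subsection \<open>Minimising sequences are almost critical\<close>

lemma Nehari_functional_ray_gap:
  assumes s: "s > 0" "s \<noteq> 1" and \<eta>: "0 < \<eta>" "\<eta> < M" and \<delta>: "\<delta> > 0"
  obtains c where "c > 0" "\<And>u. X1 V u \<Longrightarrow> Nehari_functional u = 0 \<Longrightarrow> \<delta> \<le> intermediate_mass \<eta> M u \<Longrightarrow>
      c \<le> sgn (1 - s) * Nehari_functional (\<lambda>x. s * u x)"
proof -
  obtain m where m: "m > 0"
    "\<And>a. m * (indicator (annulus \<eta> M) a * a\<^sup>2) \<le> sgn (1 - s) * (f a * a - f (s * a) * a / s)"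
    using f_ray_gap[OF s \<eta>] by blast
  show ?thesis
  proof (rule that[of "s\<^sup>2 * (m * \<delta>)"])
    fix u assume u: "X1 V u" and Nehari: "Nehari_functional u = 0" and \<delta>_le: "\<delta> \<le> intermediate_mass \<eta> M u"
    have int: "integrable lebesgue (\<lambda>x. f (u x) * u x)" "integrable lebesgue (\<lambda>x. f (s * u x) * u x)"
      by (intro f_integrable u X1_cmult)+
    have "m * \<delta> \<le> m * intermediate_mass \<eta> M u" using \<delta>_le m by simp
    also have "\<dots> = (LINT x|lebesgue. m * (indicator (annulus \<eta> M) (u x) * (u x)\<^sup>2))"
      by (simp add: intermediate_mass_def)
    also have "\<dots> \<le> (LINT x|lebesgue. sgn (1 - s) * (f (u x) * u x - f (s * u x) * u x / s))"
      using int by (intro integral_mono integrable_mult_right intermediate_mass_integrable u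
          Bochner_Integration.integrable_diff integrable_divide m(2))
    finally have "s\<^sup>2 * (m * \<delta>) \<le> s\<^sup>2 * (LINT x|lebesgue. sgn (1 - s) * (f (u x) * u x - f (s * u x) * u x / s))"
      by (rule mult_left_mono) simp
    also have "\<dots> = sgn (1 - s) * (s\<^sup>2 * (LINT x|lebesgue. f (u x) * u x) - s * (LINT x|lebesgue. f (s * u x) * u x))"
      using int s by (simp add: right_diff_distrib power2_eq_square)
    also have "\<dots> = sgn (1 - s) * Nehari_functional (\<lambda>x. s * u x)"
      using Nehari unfolding Nehari_functional_def norm1sq_cmult[OF u] by (simp add: mult.left_commute[of _ s])
    finally show "s\<^sup>2 * (m * \<delta>) \<le> sgn (1 - s) * Nehari_functional (\<lambda>x. s * u x)" .
  qed (use s m \<delta> in simp)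
qed

lemma Nehari_functional_sign_change:
  assumes \<tau>: "0 < \<tau>" "\<tau> < 1"
  obtains c where "c > 0" "\<And>u. u \<in> Nehari1 V f \<Longrightarrow> norm1 u \<le> R \<Longrightarrow>
    c \<le> Nehari_functional (\<lambda>x. (1 - \<tau>) * u x) \<and> Nehari_functional (\<lambda>x. (1 + \<tau>) * u x) \<le> - c"
proof -
  obtain \<eta> M \<delta> where \<eta>: "0 < \<eta>" "\<eta> < M" "\<delta> > 0" and
    mass: "\<And>u. u \<in> Nehari1 V f \<Longrightarrow> norm1 u \<le> R \<Longrightarrow> \<delta> \<le> intermediate_mass \<eta> M u"
    using Nehari_intermediate_mass_lower_bound by blast
  have "\<exists>c>0. \<forall>u\<in>Nehari1 V f. norm1 u \<le> R \<longrightarrow> c \<le> sgn (1 - s) * Nehari_functional (\<lambda>x. s * u x)"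
    if "0 < s" "s \<noteq> 1" for s
    using Nehari_functional_ray_gap[OF that \<eta>] mass Nehari1_X1 Nehari1_iff by metis
  from this[of "1 - \<tau>"] this[of "1 + \<tau>"] obtain c d where "c > 0" "d > 0" and
    gap: "\<forall>u\<in>Nehari1 V f. norm1 u \<le> R \<longrightarrow> c \<le> Nehari_functional (\<lambda>x. (1 - \<tau>) * u x)"
      "\<forall>u\<in>Nehari1 V f. norm1 u \<le> R \<longrightarrow> d \<le> - Nehari_functional (\<lambda>x. (1 + \<tau>) * u x)"
    using \<tau> by auto
  show ?thesis by (rule that[of "min c d"]) (use \<open>c > 0\<close> \<open>d > 0\<close> gap in \<open>force+\<close>)
qed

text \<open>The Nehari functional changes sign along the ray through \<open>u\<close> between \<open>(1 - \<tau>) u\<close> and \<open>(1 + \<tau>) u\<close>, with a gap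
  that is uniform in \<open>u\<close>; hence it still does so after a small translation.\<close>

lemma Nehari_perturbation:
  assumes \<tau>: "0 < \<tau>" "\<tau> \<le> 1 / 2"
  obtains r where "r > 0" "\<And>u k. u \<in> Nehari1 V f \<Longrightarrow> norm1 u \<le> R \<Longrightarrow> X1G V k \<Longrightarrow> norm1 k \<le> r \<Longrightarrow>
    \<exists>s. \<bar>s - 1\<bar> \<le> \<tau> \<and> (\<lambda>x. s * u x + k x) \<in> Nehari1 V f"
proof -
  obtain \<rho> where \<rho>: "\<rho> > 0" "\<And>u. u \<in> Nehari1 V f \<Longrightarrow> \<rho> \<le> norm1 u" using Nehari_norm1_lower_bound by blast
  have "\<tau> < 1" using \<tau> by simp
  then obtain c where c: "c > 0" "\<And>u. u \<in> Nehari1 V f \<Longrightarrow> norm1 u \<le> R \<Longrightarrow>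
    c \<le> Nehari_functional (\<lambda>x. (1 - \<tau>) * u x) \<and> Nehari_functional (\<lambda>x. (1 + \<tau>) * u x) \<le> - c"
    using Nehari_functional_sign_change[OF \<tau>(1)] by blast
  then have "c / 2 > 0" by simp
  then obtain r where r: "r > 0" "\<And>w k. X1 V w \<Longrightarrow> X1 V k \<Longrightarrow> norm1 w \<le> 2 * R \<Longrightarrow> norm1 k \<le> r \<Longrightarrow>
    \<bar>Nehari_functional (\<lambda>x. w x + k x) - Nehari_functional w\<bar> \<le> c / 2"
    using Nehari_functional_uniformly_continuous by blast
  show ?thesis
  proof (rule that[of "min r (\<rho> / 4)"])
    fix u k
    assume u_Nehari: "u \<in> Nehari1 V f" and norm_u: "norm1 u \<le> R"
      and kG: "X1G V k" and norm_le: "norm1 k \<le> min r (\<rho> / 4)"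
    have uG: "X1G V u" using u_Nehari by (simp add: Nehari1_iff)
    note u = X1G_X1[OF uG] and k = X1G_X1[OF kG]
    let ?g = "\<lambda>s. Nehari_functional (\<lambda>x. s * u x + k x)"
    have close: "\<bar>?g s - Nehari_functional (\<lambda>x. s * u x)\<bar> \<le> c / 2" if "\<bar>s\<bar> \<le> 2" for s
    proof (intro r(2) X1_cmult u k)
      show "norm1 (\<lambda>x. s * u x) \<le> 2 * R" unfolding norm1_cmult[OF u] using that norm_u by (intro mult_mono) auto
    qed (use norm_le in simp)
    have "?g (1 - \<tau>) > 0" "?g (1 + \<tau>) < 0"
      using close[of "1 - \<tau>"] close[of "1 + \<tau>"] c(1) c(2)[OF u_Nehari norm_u] \<tau> by linarith+
    then obtain s where s: "1 - \<tau> \<le> s" "s \<le> 1 + \<tau>" "?g s = 0"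
      using IVT2'[of ?g "1 + \<tau>" 0 "1 - \<tau>"] Nehari_functional_line_continuous[OF u k] \<tau> by auto
    note w = X1G_add[OF X1G_cmult[OF uG] kG, of s]
    have "1 / 2 * \<rho> \<le> s * norm1 u" using s \<tau> \<rho>(1) \<rho>(2)[OF u_Nehari] by (intro mult_mono) auto
    also have "s * norm1 u = norm1 (\<lambda>x. (s * u x + k x) + (-1) * k x)" using norm1_cmult[OF u, of s] s \<tau> by simp
    also have "\<dots> \<le> norm1 (\<lambda>x. s * u x + k x) + norm1 k"
      using norm1_triangle[OF X1G_X1[OF w] X1_cmult[OF k, of "-1"]] norm1_cmult[OF k, of "-1"] by simp
    finally have "norm1 (\<lambda>x. s * u x + k x) > 0" using norm_le \<rho>(1) by simp
    then show "\<exists>s. \<bar>s - 1\<bar> \<le> \<tau> \<and> (\<lambda>x. s * u x + k x) \<in> Nehari1 V f"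
      using s w by (intro exI[of _ s]) (auto simp: Nehari1_iff)
  qed (use r \<rho> in simp)
qed

lemma J1_decrease:
  assumes R: "R > 0" and \<omega>: "\<omega> > 0"
  obtains \<tau> d where "0 < \<tau>" "\<tau> \<le> 1 / 2" "0 < d" "\<And>u h s r. X1 V u \<Longrightarrow> Nehari_functional u = 0 \<Longrightarrow> norm1 u \<le> R \<Longrightarrow>
    X1 V h \<Longrightarrow> norm1 h \<le> 1 \<Longrightarrow> J1_deriv u h < - \<omega> \<Longrightarrow> \<bar>s - 1\<bar> \<le> \<tau> \<Longrightarrow> 0 < r \<Longrightarrow> r \<le> d \<Longrightarrow>
    J1 V f (\<lambda>x. s * u x + r * h x) \<le> J1 V f u - r * \<omega> / 2"
proof -
  have "\<omega> / 4 > 0" using \<omega> by simp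
  then obtain b where b: "b > 0" "\<And>u w h. X1 V u \<Longrightarrow> X1 V w \<Longrightarrow> X1 V h \<Longrightarrow> norm1 u \<le> R \<Longrightarrow> norm1 w \<le> b \<Longrightarrow>
      \<bar>J1_deriv (\<lambda>x. u x + w x) h - J1_deriv u h\<bar> \<le> \<omega> / 4 * norm1 h"
    using J1_deriv_uniformly_continuous by blast
  obtain d where d: "d > 0" "\<And>u w. X1 V u \<Longrightarrow> X1 V w \<Longrightarrow> norm1 u \<le> 2 * R \<Longrightarrow> norm1 w \<le> d \<Longrightarrow>
      \<bar>J1 V f (\<lambda>x. u x + w x) - J1 V f u - J1_deriv u w\<bar> \<le> \<omega> / 4 * norm1 w"
    using J1_expansion[OF \<open>\<omega> / 4 > 0\<close>] by blast
  define \<tau> where "\<tau> = min (1/2) (b / R)"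
  have \<tau>: "0 < \<tau>" "\<tau> \<le> 1 / 2" "\<tau> * R \<le> b" using b R by (auto simp: \<tau>_def min_def field_simps)
  show ?thesis
  proof (rule that[OF \<tau>(1,2) d(1)])
    fix u h s r
    assume u: "X1 V u" "Nehari_functional u = 0" "norm1 u \<le> R" and h: "X1 V h" "norm1 h \<le> 1"
      and neg: "J1_deriv u h < - \<omega>" and s: "\<bar>s - 1\<bar> \<le> \<tau>" and r: "0 < r" "r \<le> d"
    note su = X1_cmult[OF u(1), of s]
    have "\<bar>s - 1\<bar> * norm1 u \<le> \<tau> * R" using s u(3) \<tau> by (intro mult_mono) auto
    then have "norm1 (\<lambda>x. (s - 1) * u x) \<le> b" using \<tau>(3) by (simp add: norm1_cmult[OF u(1)])
    then have "\<bar>J1_deriv (\<lambda>x. u x + (s - 1) * u x) h - J1_deriv u h\<bar> \<le> \<omega> / 4 * norm1 h" by (intro b(2) u X1_cmult h)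
    moreover have "(\<lambda>x. u x + (s - 1) * u x) = (\<lambda>x. s * u x)" by (auto simp: algebra_simps)
    moreover have "\<omega> / 4 * norm1 h \<le> \<omega> / 4 * 1" using h \<omega> by (intro mult_left_mono) auto
    ultimately have "J1_deriv (\<lambda>x. s * u x) h \<le> - (3 * \<omega> / 4)" using neg by (simp only:)
    then have "J1_deriv (\<lambda>x. s * u x) (\<lambda>x. r * h x) \<le> r * - (3 * \<omega> / 4)"
      unfolding J1_deriv_cmult[OF su h(1)] using r by (intro mult_left_mono) auto
    moreover have "norm1 (\<lambda>x. s * u x) \<le> 2 * R"
      unfolding norm1_cmult[OF u(1)] using s \<tau> u(3) by (intro mult_mono) auto
    moreover have norm_rh: "norm1 (\<lambda>x. r * h x) \<le> r"
      using norm1_cmult[OF h(1), of r] r h(2) by (simp add: mult_left_le)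
    ultimately have "J1 V f (\<lambda>x. s * u x + r * h x)
        \<le> J1 V f (\<lambda>x. s * u x) + r * - (3 * \<omega> / 4) + \<omega> / 4 * norm1 (\<lambda>x. r * h x)"
      using d(2)[OF su X1_cmult[OF h(1)] _ order_trans[OF norm_rh r(2)]] by linarith
    moreover have "\<omega> / 4 * norm1 (\<lambda>x. r * h x) \<le> \<omega> / 4 * r" using norm_rh \<omega> by (intro mult_left_mono) auto
    moreover have "J1 V f (\<lambda>x. s * u x) \<le> J1 V f u" using s \<tau> by (intro J1_ray_le u) simp
    moreover have "r * - (3 * \<omega> / 4) + \<omega> / 4 * r = - (r * \<omega> / 2)" by simp
    ultimately show "J1 V f (\<lambda>x. s * u x + r * h x) \<le> J1 V f u - r * \<omega> / 2" by linarith
  qed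
qed

lemma Nehari_almost_critical:
  assumes \<omega>: "\<omega> > 0"
  obtains \<epsilon> where "\<epsilon> > 0" "\<And>u h. u \<in> Nehari1 V f \<Longrightarrow> J1 V f u < c1 V f + \<epsilon> \<Longrightarrow> X1G V h \<Longrightarrow> norm1 h \<le> 1 \<Longrightarrow> - \<omega> \<le> J1_deriv u h"
proof -
  obtain R where R: "R > 0" "\<And>u. u \<in> Nehari1 V f \<Longrightarrow> J1 V f u \<le> c1 V f + 1 \<Longrightarrow> norm1 u \<le> R"
    using Nehari_bounded by blast
  obtain \<tau> d where \<tau>: "0 < \<tau>" "\<tau> \<le> 1 / 2" and d: "0 < d" and decrease:
    "\<And>u h s r. X1 V u \<Longrightarrow> Nehari_functional u = 0 \<Longrightarrow> norm1 u \<le> R \<Longrightarrow> X1 V h \<Longrightarrow> norm1 h \<le> 1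
      \<Longrightarrow> J1_deriv u h < - \<omega> \<Longrightarrow> \<bar>s - 1\<bar> \<le> \<tau> \<Longrightarrow> 0 < r \<Longrightarrow> r \<le> d \<Longrightarrow>
    J1 V f (\<lambda>x. s * u x + r * h x) \<le> J1 V f u - r * \<omega> / 2"
    using J1_decrease[OF R(1) \<omega>] by blast
  obtain r0 where r0: "r0 > 0" and perturb: "\<And>u k. u \<in> Nehari1 V f \<Longrightarrow> norm1 u \<le> R \<Longrightarrow> X1G V k \<Longrightarrow> norm1 k \<le> r0 \<Longrightarrow>
    \<exists>s. \<bar>s - 1\<bar> \<le> \<tau> \<and> (\<lambda>x. s * u x + k x) \<in> Nehari1 V f"
    using Nehari_perturbation[OF \<tau>] by blast
  define r where "r = min d r0"
  have r: "0 < r" "r \<le> d" "r \<le> r0" using d r0 by (auto simp: r_def)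
  show ?thesis
  proof (rule that[of "min 1 (r * \<omega> / 2)"])
    fix u h assume u: "u \<in> Nehari1 V f" "J1 V f u < c1 V f + min 1 (r * \<omega> / 2)" and h: "X1G V h" "norm1 h \<le> 1"
    have norm_u: "norm1 u \<le> R" using u by (intro R(2)) auto
    show "- \<omega> \<le> J1_deriv u h"
    proof (rule ccontr)
      assume neg: "\<not> - \<omega> \<le> J1_deriv u h"
      have "norm1 (\<lambda>x. r * h x) \<le> r0"
        using norm1_cmult[OF X1G_X1[OF h(1)], of r] mult_left_mono[OF h(2), of r] r by linarith
      then obtain s where s: "\<bar>s - 1\<bar> \<le> \<tau>" "(\<lambda>x. s * u x + r * h x) \<in> Nehari1 V f"
        using perturb[OF u(1) norm_u X1G_cmult[OF h(1)]] by blast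
      have "c1 V f \<le> J1 V f (\<lambda>x. s * u x + r * h x)" by (rule c1_le[OF s(2)])
      also have "\<dots> \<le> J1 V f u - r * \<omega> / 2"
        using u(1) neg by (intro decrease Nehari1_X1 norm_u X1G_X1 h s(1) r) (auto simp: Nehari1_iff)
      finally show False using u(2) by simp
    qed
  qed (use r \<omega> in simp)
qed

end

section \<open>Symmetric criticality\<close>

context variational
begin

definition orbit_hull :: "('y \<times> 'z \<Rightarrow> real) \<Rightarrow> ('y \<times> 'z \<Rightarrow> real) set" where
  "orbit_hull h = midpoint_hull {\<lambda>x. h (apfst A x) | A. orthogonal_transformation A}"

lemma orbit_hull_self: "h \<in> orbit_hull h"
  unfolding orbit_hull_def
  by (rule midpoint_hull.base) (auto intro!: exI[of _ id] simp: orthogonal_transformation_id[folded id_def] apfst_id)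

lemma orbit_hull_apfst:
  assumes "v \<in> orbit_hull h" "orthogonal_transformation A" shows "(\<lambda>x. v (apfst A x)) \<in> orbit_hull h"
  using assms(1) unfolding orbit_hull_def
proof induction
  case (base v)
  then obtain B where B: "orthogonal_transformation B" "v = (\<lambda>x. h (apfst B x))" by blast
  have "orthogonal_transformation (B \<circ> A)" by (rule orthogonal_transformation_compose[OF B(1) assms(2)])
  moreover have "(\<lambda>x. v (apfst A x)) = (\<lambda>x. h (apfst (B \<circ> A) x))" by (simp add: B(2) apfst_compose)
  ultimately show ?case by (blast intro: midpoint_hull.base)
next
  case (midpoint v w)
  then show ?case using midpoint_hull.midpoint[of "\<lambda>x. v (apfst A x)" _ "\<lambda>x. w (apfst A x)"] by simp
qed

lemma J1_deriv_apfst: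
  assumes V: "G_invariant V" and u: "X1G V u" and v: "X1 V v" and A: "orthogonal_transformation A"
  shows "J1_deriv u (\<lambda>x. v (apfst A x)) = J1_deriv u v"
proof -
  have u_inv: "u (apfst A x) = u x" for x using u A by (simp add: X1G_def G_invariant_iff_apfst del: split_paired_All)
  have "(LINT x|lebesgue. f (u (apfst A x)) * v (apfst A x)) = (LINT x|lebesgue. f (u x) * v x)"
    using f_integrable[OF X1G_X1[OF u] v]
    by (intro measure_preserving_integral[of _ "\<lambda>x. f (u x) * v x"]
        measure_preserving_orthogonal orthogonal_transformation_apfst A) auto
  then show ?thesis using inner1_apfst[OF V A X1G_X1[OF u] v] by (simp add: J1_deriv_def u_inv)
qed

lemma orbit_hull_X1:
  assumes "G_invariant V" "X1 V h" "v \<in> orbit_hull h" shows "X1 V v"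
  using assms(3) unfolding orbit_hull_def
proof induction
  case (base v)
  then show ?case using X1_apfst[OF assms(1) _ assms(2)] by blast
next
  case (midpoint v w)
  then show ?case using X1_cmult[OF X1_add, of v w "1/2"] by simp
qed

lemma J1_deriv_orbit_hull:
  assumes V: "G_invariant V" and u: "X1G V u" and h: "X1 V h" and "v \<in> orbit_hull h"
  shows "J1_deriv u v = J1_deriv u h"
  using assms(4) unfolding orbit_hull_def
proof induction
  case (base v)
  then show ?case using J1_deriv_apfst[OF V u h] by blast
next
  case (midpoint v w)
  note vw = midpoint.hyps[folded orbit_hull_def, THEN orbit_hull_X1[OF V h]]
  show ?case
    using J1_deriv_cmult[OF X1G_X1[OF u] X1_add[OF vw], of "1/2"] J1_deriv_add[OF X1G_X1[OF u] vw] midpoint.IH by simp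
qed

lemma orbit_hull_near_minimiser:
  assumes V: "G_invariant V" and h: "X1 V h" and v: "v \<in> orbit_hull h" and A: "orthogonal_transformation A"
    and near: "norm1sq V v < Inf (norm1sq V ` orbit_hull h) + e"
  shows "norm1sq V (\<lambda>x. v x - v (apfst A x)) \<le> 4 * e"
proof -
  note vA = orbit_hull_apfst[OF v A]
  note in_X1 = orbit_hull_X1[OF V h v] orbit_hull_X1[OF V h vA]
  have "norm1sq V (\<lambda>x. v (apfst A x)) = norm1sq V v"
    using inner1_apfst[OF V A in_X1(1) in_X1(1)] by (simp add: inner1_self)
  moreover have "Inf (norm1sq V ` orbit_hull h) \<le> norm1sq V (\<lambda>x. 1 / 2 * (v x + v (apfst A x)))"
  proof (rule cInf_lower)
    have "(\<lambda>x. 1 / 2 * (v x + v (apfst A x))) \<in> orbit_hull h"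
      using midpoint_hull.midpoint[OF v[unfolded orbit_hull_def] vA[unfolded orbit_hull_def]]
      by (simp add: orbit_hull_def)
    then show "norm1sq V (\<lambda>x. 1 / 2 * (v x + v (apfst A x))) \<in> norm1sq V ` orbit_hull h" by (rule imageI)
  qed (auto intro: bdd_belowI[of _ 0])
  ultimately show ?thesis using near norm1sq_parallelogram[OF in_X1] by linarith
qed

text \<open>The limit of norm-minimising elements of the midpoint hull of the orbit replaces the average of \<open>h\<close> over
  the group; it is invariant because near-minimisers are close to their translates.\<close>

lemma invariant_representative:
  assumes V: "G_invariant V" and u: "X1G V u" and h: "X1 V h"
  obtains h' where "X1G V h'" "J1_deriv u h' = J1_deriv u h"
proof -
  let ?d = "Inf (norm1sq V ` orbit_hull h)"
  obtain w where w: "\<And>n. w n \<in> orbit_hull h" "\<And>n. norm1sq V (w n) < ?d + 1 / real (Suc n)"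
    using minimising_sequence[of "\<lambda>_. orbit_hull h" "norm1sq V"] orbit_hull_self by blast
  note in_X1 = orbit_hull_X1[OF V h w(1)]
  have bound: "norm1sq V (w n) \<le> ?d + 1" for n
  proof -
    have "1 / real (Suc n) \<le> 1" by simp
    then show ?thesis using w(2)[of n] by linarith
  qed
  obtain \<kappa> U where \<kappa>: "strict_mono \<kappa>" and U: "X1 V U" and lim: "AE x in lebesgue. (\<lambda>n. w (\<kappa> n) x) \<longlonglongrightarrow> U x"
    by (rule X1_compact[OF in_X1 bound]) (rule that)
  have "norm1 (w (\<kappa> n)) \<le> sqrt (?d + 1)" for n unfolding norm1_def using bound by simp
  then have "(\<lambda>n. J1_deriv u (w (\<kappa> n))) \<longlonglongrightarrow> J1_deriv u U" by (rule J1_deriv_tendsto_right[OF in_X1 _ X1G_X1[OF u] lim])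
  then have deriv: "J1_deriv u U = J1_deriv u h" by (simp add: J1_deriv_orbit_hull[OF V u h w(1)] LIMSEQ_const_iff)
  have invariant: "AE x in lebesgue. U (apfst A x) = U x" if A: "orthogonal_transformation A" for A
  proof -
    define g where "g n x = w (\<kappa> n) x - w (\<kappa> n) (apfst A x)" for n x
    note mp = measure_preserving_orthogonal[OF orthogonal_transformation_apfst[OF A, where 'z='z]]
    have small: "norm1sq V (g n) \<le> 4 * (1 / real (Suc (\<kappa> n)))" for n
      unfolding g_def[abs_def] by (rule orbit_hull_near_minimiser[OF V h w(1) A w(2)])
    have "(\<lambda>n. 4 * (1 / real (Suc (\<kappa> n)))) \<longlonglongrightarrow> 0"
      using tendsto_mult_right_zero[OF LIMSEQ_subseq_LIMSEQ[OF LIMSEQ_Suc[OF lim_1_over_n] \<kappa>], of 4]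
      by (simp add: o_def)
    then have "(\<lambda>n. norm1sq V (g n)) \<longlonglongrightarrow> 0"
      by (rule Lim_null_comparison[rotated]) (use small in simp)
    moreover have "AE x in lebesgue. (\<lambda>n. g n x) \<longlonglongrightarrow> U x - U (apfst A x)"
      using lim measure_preserving_AE[OF mp lim] unfolding g_def by eventually_elim (intro tendsto_intros)
    moreover have "X1 V (g n)" for n unfolding g_def[abs_def] by (intro X1_diff in_X1 X1_apfst V A)
    ultimately have "AE x in lebesgue. U x - U (apfst A x) = 0" by (intro X1_null_limit)
    then show ?thesis by eventually_elim simp
  qed
  obtain U' where U': "AE x in lebesgue. U' x = U x" "\<And>A x. orthogonal_transformation A \<Longrightarrow> U' (apfst A x) = U' x"
  proof (rule AE_invariant_modification[OF X1_H1[OF U], of "apfst ` {A. orthogonal_transformation A}"])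
  qed (use orthogonal_transformation_apfst invariant in auto)
  have "X1G V U'" using X1_AE_cong[OF U U'(1)] U'(2) by (auto simp: X1G_def G_invariant_def)
  then show ?thesis using that J1_deriv_AE_cong[OF X1G_X1[OF u] U U'(1)] deriv by simp
qed

lemma symmetric_criticality:
  assumes "G_invariant V" "X1G V u" "\<And>h. X1G V h \<Longrightarrow> J1_deriv u h = 0" shows "J1_critical V f u"
proof (rule J1_critical_if_J1_deriv_eq_0[OF X1G_X1[OF assms(2)]])
  show "J1_deriv u h = 0" if "X1 V h" for h using invariant_representative[OF assms(1,2) that] assms(3) by metis
qed

section \<open>Limits of minimising sequences\<close>

lemma limit_critical_on_X1G:
  assumes u: "\<And>n. u n \<in> Nehari1 V f" "\<And>n. norm1 (u n) \<le> R" and J: "(\<lambda>n. J1 V f (u n)) \<longlonglongrightarrow> c1 V f"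
    and lim: "AE x in lebesgue. (\<lambda>n. u n x) \<longlonglongrightarrow> U x" and U: "X1 V U" and h: "X1G V h"
  shows "J1_deriv U h = 0"
proof -
  have nonneg: "0 \<le> J1_deriv U h" if h: "X1G V h" "norm1 h \<le> 1" for h
  proof (rule field_le_epsilon)
    fix \<omega> :: real assume "\<omega> > 0"
    then obtain \<epsilon> where \<epsilon>: "\<epsilon> > 0"
      "\<And>u h. u \<in> Nehari1 V f \<Longrightarrow> J1 V f u < c1 V f + \<epsilon> \<Longrightarrow> X1G V h \<Longrightarrow> norm1 h \<le> 1 \<Longrightarrow> - \<omega> \<le> J1_deriv u h"
      using Nehari_almost_critical by blast
    have "\<forall>\<^sub>F n in sequentially. J1 V f (u n) < c1 V f + \<epsilon>" using order_tendstoD(2)[OF J] \<epsilon>(1) by simp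
    then have "\<forall>\<^sub>F n in sequentially. - \<omega> \<le> J1_deriv (u n) h" by eventually_elim (rule \<epsilon>(2)[OF u(1) _ h])
    then have "- \<omega> \<le> J1_deriv U h"
      by (rule tendsto_lowerbound[OF J1_deriv_tendsto[OF Nehari1_X1[OF u(1)] u(2) X1G_X1[OF h(1)] lim]]) simp
    then show "0 \<le> J1_deriv U h + \<omega>" by simp
  qed
  define t where "t = 1 / (norm1 h + 1)"
  have "norm1 h + 1 > 0" by (simp add: add_nonneg_pos)
  then have t: "t > 0" "t * norm1 h \<le> 1" by (simp_all add: t_def)
  have "0 \<le> s * J1_deriv U h" if "\<bar>s\<bar> = t" for s
    using nonneg[OF X1G_cmult[OF h, of s]] that t norm1_cmult[OF X1G_X1[OF h], of s]
        J1_deriv_cmult[OF U X1G_X1[OF h], of s] by simp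
  from this[of t] this[of "- t"] show ?thesis using t(1) by (simp add: zero_le_mult_iff mult_le_0_iff)
qed

lemma J1_Nehari_eq:
  assumes "X1 V u" "Nehari_functional u = 0"
  shows "ennreal (J1 V f u) = (\<integral>\<^sup>+x. ennreal (f (u x) * u x / 2 - prim f (u x)) \<partial>lebesgue)"
proof -
  note integrable = f_integrable[OF assms(1,1)] prim_integrable[OF assms(1)]
  have "J1 V f u = (LINT x|lebesgue. f (u x) * u x / 2 - prim f (u x))"
    using assms(2) by (simp add: J1_def Nehari_functional_def integrable)
  then show ?thesis using prim_le_half integrable by (subst nn_integral_eq_integral) auto
qed

lemma J1_limit_le:
  assumes u: "\<And>n. X1 V (u n)" "\<And>n. Nehari_functional (u n) = 0" and U: "X1 V U" "Nehari_functional U = 0"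
    and lim: "AE x in lebesgue. (\<lambda>n. u n x) \<longlonglongrightarrow> U x" and J: "(\<lambda>n. J1 V f (u n)) \<longlonglongrightarrow> c"
  shows "J1 V f U \<le> c"
proof -
  have cont: "continuous_on UNIV (\<lambda>a. f a * a / 2 - prim f a)"
    by (intro continuous_intros f_continuous prim_continuous) auto
  have "ennreal (J1 V f U) \<le> liminf (\<lambda>n. ennreal (J1 V f (u n)))"
    unfolding J1_Nehari_eq[OF u] J1_Nehari_eq[OF U]
    by (rule nn_integral_Fatou_continuous[OF cont X1_measurable[OF u(1)] lim])
  also have "\<dots> = ennreal c" using J by (intro lim_imp_Liminf tendsto_ennrealI) auto
  finally show ?thesis using LIMSEQ_le_const[OF J, of 0] J1_nonneg[OF u] by (auto simp: ennreal_le_iff)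
qed

lemma nontrivial_limit_critical:
  assumes V: "G_invariant V" and u: "\<And>n. u n \<in> Nehari1 V f" "\<And>n. norm1 (u n) \<le> R"
    and J: "(\<lambda>n. J1 V f (u n)) \<longlonglongrightarrow> c1 V f" and lim: "AE x in lebesgue. (\<lambda>n. u n x) \<longlonglongrightarrow> U x"
    and U: "X1G V U" "\<not> (AE x in lebesgue. U x = 0)"
  shows "J1_critical V f U \<and> J1 V f U = c1 V f"
proof -
  note in_X1 = X1G_X1[OF U(1)]
  have deriv: "J1_deriv U h = 0" if "X1G V h" for h by (rule limit_critical_on_X1G[OF u J lim in_X1 that])
  then have Nehari: "Nehari_functional U = 0" using U(1) by (simp add: J1_deriv_self[symmetric])
  then have "U \<in> Nehari1 V f" using U by (simp add: Nehari1_iff norm1_pos_iff[OF in_X1])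
  then have "c1 V f \<le> J1 V f U" by (rule c1_le)
  moreover have "J1 V f U \<le> c1 V f"
    using u(1) by (intro J1_limit_le[OF _ _ in_X1 Nehari lim J]) (auto simp: Nehari1_iff X1G_X1)
  ultimately show ?thesis using symmetric_criticality[OF V U(1) deriv] by simp
qed

end

section \<open>Comparison with the problem at infinity\<close>

lemma X1_const_iff: "X1 (\<lambda>_. k) u \<longleftrightarrow> Yspace u"
proof (cases "H1 u")
  case True
  then have k: "integrable lebesgue (\<lambda>x. k * (u x)\<^sup>2)" by (simp add: H1_def)
  have "integrable lebesgue (\<lambda>x. (u x)\<^sup>2 / (norm (fst x))\<^sup>2 + k * (u x)\<^sup>2)
      \<longleftrightarrow> integrable lebesgue (\<lambda>x. (u x)\<^sup>2 / (norm (fst x))\<^sup>2)"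
    by (auto dest: Bochner_Integration.integrable_diff[OF _ k] intro: Bochner_Integration.integrable_add[OF _ k])
  then show ?thesis by (simp add: X1_def Yspace_def)
qed (simp add: X1_def Yspace_def)

lemma mk_eq_c1: "mk TYPE('y::euclidean_space) TYPE('z::euclidean_space) k f = c1 (\<lambda>_::'y \<times> 'z. k) f"
proof -
  have "Qk k = norm1sq (\<lambda>_::'y \<times> 'z. k)" by (rule ext) (simp add: Qk_def norm1sq_def)
  then have "Mk k f = Nehari1 (\<lambda>_::'y \<times> 'z. k) f" "Phi k f = J1 (\<lambda>_::'y \<times> 'z. k) f"
    by (auto simp: Mk_def Nehari1_def YG_def X1G_def X1_const_iff Phi_def J1_def fun_eq_iff)
  then show ?thesis by (simp add: mk_def c1_def)
qed

lemma potential_const: "k > 0 \<Longrightarrow> potential (\<lambda>_. k) k"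
  by unfold_locales auto

context potential
begin

lemma X1_const: assumes u: "X1 V u" and k: "k > 0" shows "X1 (\<lambda>_. k) u"
  unfolding potential.X1_iff[OF potential_const[OF k]]
  using X1_H1[OF u] X1_L2_weighted(1)[OF u] L2_cmult[OF X1_L2[OF u], of "sqrt k"] by simp

lemma norm1sq_const_le:
  assumes u: "X1 V u" and k: "k > 0" and e: "e \<ge> 0" and far: "\<And>x. \<rho> \<le> norm x \<Longrightarrow> k - e \<le> V x"
  shows "norm1sq (\<lambda>_. k) u \<le> norm1sq V u + (e * norm2sq u + k * norm2sq_on (ball 0 \<rho>) u)"
proof -
  have square: "(norm (sqrt (V x) * u x))\<^sup>2 = V x * (u x)\<^sup>2" "(norm (sqrt k * u x))\<^sup>2 = k * (u x)\<^sup>2"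
    "(norm (indicat_real (ball 0 \<rho>) x *\<^sub>R u x))\<^sup>2 = indicator (ball 0 \<rho>) x * (u x)\<^sup>2" for x
    using V_pos[of x] k by (simp_all add: power_mult_distrib indicator_def)
  have "L2 (\<lambda>x. indicat_real (ball 0 \<rho>) x *\<^sub>R u x)" by (intro L2_indicator X1_L2 u) simp
  from this[THEN L2_integrable_norm_sq] X1_L2_weighted(2)[OF u, THEN L2_integrable_norm_sq]
      X1_L2[OF u, THEN L2_integrable_norm_sq]
  have int: "integrable lebesgue (\<lambda>x. indicator (ball 0 \<rho>) x * (u x)\<^sup>2)" "integrable lebesgue (\<lambda>x. V x * (u x)\<^sup>2)"
    "integrable lebesgue (\<lambda>x. (u x)\<^sup>2)"
    unfolding square by simp_all
  have "k * (u x)\<^sup>2 \<le> V x * (u x)\<^sup>2 + (e * (u x)\<^sup>2 + k * (indicator (ball 0 \<rho>) x * (u x)\<^sup>2))" for x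
  proof (cases "\<rho> \<le> norm x")
    case True
    then show ?thesis using mult_right_mono[OF far, of x "(u x)\<^sup>2"] by (simp add: left_diff_distrib)
  next
    case False
    then show ?thesis using e V_pos[of x] by simp
  qed
  then have "(LINT x|lebesgue. k * (u x)\<^sup>2)
      \<le> (LINT x|lebesgue. V x * (u x)\<^sup>2 + (e * (u x)\<^sup>2 + k * (indicator (ball 0 \<rho>) x * (u x)\<^sup>2)))"
    by (intro integral_mono Bochner_Integration.integrable_add integrable_mult_right int)
  also have "\<dots> = norm2sq (\<lambda>x. sqrt (V x) * u x) + (e * norm2sq u + k * norm2sq_on (ball 0 \<rho>) u)"
    unfolding norm2sq_on_def norm2sq_def square using int by simp
  finally have "norm2sq (\<lambda>x. sqrt k * u x)
      \<le> norm2sq (\<lambda>x. sqrt (V x) * u x) + (e * norm2sq u + k * norm2sq_on (ball 0 \<rho>) u)"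
    unfolding norm2sq_def[of "\<lambda>x. sqrt k * u x"] square .
  then show ?thesis
    unfolding norm1sq_split[OF u] potential.norm1sq_split[OF potential_const[OF k] X1_const[OF u k]] by simp
qed

lemma norm1sq_const_le_norm1sq:
  assumes u: "X1 V u" and k: "k > 0" shows "norm1sq (\<lambda>_. k) u \<le> (1 + k / V0) * norm1sq V u"
proof -
  have "norm1sq (\<lambda>_. k) u \<le> norm1sq V u + (k * norm2sq u + k * norm2sq_on (ball 0 0) u)"
    using V_pos by (intro norm1sq_const_le u k) (simp_all add: less_imp_le k)
  also have "norm2sq_on (ball 0 0) u = 0" by (simp add: norm2sq_on_def norm2sq_def)
  also have "k * norm2sq u \<le> k * (norm1sq V u / V0)" using k norm2sq_le_norm1sq[OF u] by (intro mult_left_mono) auto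
  finally show ?thesis by (simp add: distrib_right)
qed

end

context variational
begin

lemma variational_const: "k > 0 \<Longrightarrow> variational (\<lambda>_::'y \<times> 'z. k) k f q"
  using nonlinearity_axioms dim_ge_3 q_subcritical by (simp add: variational_def variational_axioms_def potential_const)

lemma Nehari_projection_const_bounded:
  assumes k: "k > 0"
  obtains T where "T > 0" "\<And>u. u \<in> Nehari1 V f \<Longrightarrow> norm1 u \<le> R \<Longrightarrow>
    \<exists>t. 0 < t \<and> t \<le> T \<and> (\<lambda>x. t * u x) \<in> Nehari1 (\<lambda>_. k) f"
proof -
  interpret const: variational "\<lambda>_::'y \<times> 'z. k" k f q by (rule variational_const[OF k])
  obtain \<eta> M \<delta> where \<eta>: "0 < \<eta>" "\<delta> > 0" and
    mass: "\<And>u. u \<in> Nehari1 V f \<Longrightarrow> norm1 u \<le> R \<Longrightarrow> \<delta> \<le> intermediate_mass \<eta> M u"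
    by (rule Nehari_intermediate_mass_lower_bound) (rule that)
  define B where "B = (1 + k / V0) * R\<^sup>2 + 1"
  have B: "B > 0" using k V0_pos by (simp add: B_def add_nonneg_pos)
  obtain T where T: "T > 0" "\<And>t w. T \<le> t \<Longrightarrow> X1 (\<lambda>_. k) w \<Longrightarrow> \<delta> \<le> intermediate_mass \<eta> M w \<Longrightarrow> norm1sq (\<lambda>_. k) w \<le> B
    \<Longrightarrow> const.Nehari_functional (\<lambda>x. t * w x) < 0"
    using const.Nehari_functional_negative_far[OF \<eta> B] by blast
  show ?thesis
  proof (rule that[OF T(1)])
    fix u assume u: "u \<in> Nehari1 V f" and norm_u: "norm1 u \<le> R"
    note in_X1 = X1_const[OF Nehari1_X1[OF u] k]
    have "norm1sq V u \<le> R\<^sup>2" using power_mono[OF norm_u norm1_nonneg, of 2] by (simp add: norm1_sq)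
    then have "(1 + k / V0) * norm1sq V u \<le> (1 + k / V0) * R\<^sup>2" using k V0_pos by (intro mult_left_mono) auto
    then have bound: "norm1sq (\<lambda>_. k) u \<le> B" using norm1sq_const_le_norm1sq[OF Nehari1_X1[OF u] k] by (simp add: B_def)
    have "X1G (\<lambda>_. k) u" "0 < const.norm1 u"
      using u in_X1 by (auto simp: Nehari1_def X1G_def const.norm1_pos_iff)
    then obtain t where t: "t > 0" "(\<lambda>x. t * u x) \<in> Nehari1 (\<lambda>_. k) f" by (rule const.Nehari_projection)
    have "t \<le> T"
    proof (rule ccontr)
      assume "\<not> t \<le> T"
      then have "const.Nehari_functional (\<lambda>x. t * u x) < 0" by (intro T(2) in_X1 mass u norm_u bound) simp
      then show False using t(2) by (simp add: const.Nehari1_iff)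
    qed
    then show "\<exists>t. 0 < t \<and> t \<le> T \<and> (\<lambda>x. t * u x) \<in> Nehari1 (\<lambda>_. k) f" using t by blast
  qed
qed

lemma c1_const_le:
  assumes k: "k > 0"
  obtains T where "T > 0" "\<And>u e \<rho>. u \<in> Nehari1 V f \<Longrightarrow> norm1 u \<le> R \<Longrightarrow> e \<ge> 0 \<Longrightarrow> (\<And>x. \<rho> \<le> norm x \<Longrightarrow> k - e \<le> V x) \<Longrightarrow>
    c1 (\<lambda>_::'y \<times> 'z. k) f \<le> J1 V f u + T * (e * (R\<^sup>2 / V0) + k * norm2sq_on (ball 0 \<rho>) u)"
proof -
  interpret const: variational "\<lambda>_::'y \<times> 'z. k" k f q by (rule variational_const[OF k])
  obtain T where T: "T > 0" "\<And>u. u \<in> Nehari1 V f \<Longrightarrow> norm1 u \<le> R \<Longrightarrow>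
    \<exists>t. 0 < t \<and> t \<le> T \<and> (\<lambda>x. t * u x) \<in> Nehari1 (\<lambda>_. k) f" using Nehari_projection_const_bounded[OF k] by blast
  show ?thesis
  proof (rule that[of "T\<^sup>2 / 2"])
    fix u e \<rho>
    assume u: "u \<in> Nehari1 V f" and norm_u: "norm1 u \<le> R"
      and e: "e \<ge> 0" and far: "\<And>x. \<rho> \<le> norm x \<Longrightarrow> k - e \<le> V x"
    obtain t where t: "0 < t" "t \<le> T" "(\<lambda>x. t * u x) \<in> Nehari1 (\<lambda>_. k) f" using T(2)[OF u norm_u] by blast
    note in_X1 = Nehari1_X1[OF u]
    define D where "D = e * norm2sq u + k * norm2sq_on (ball 0 \<rho>) u"
    have "norm1sq V u \<le> R\<^sup>2" using power_mono[OF norm_u norm1_nonneg, of 2] by (simp add: norm1_sq)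
    then have "norm2sq u \<le> R\<^sup>2 / V0"
      using norm2sq_le_norm1sq[OF in_X1] divide_right_mono[of _ _ V0] V0_pos by (meson less_imp_le order_trans)
    then have "e * norm2sq u \<le> e * (R\<^sup>2 / V0)" using e by (rule mult_left_mono)
    then have D: "0 \<le> D" "D \<le> e * (R\<^sup>2 / V0) + k * norm2sq_on (ball 0 \<rho>) u"
      using e k by (simp_all add: D_def)
    have "c1 (\<lambda>_::'y \<times> 'z. k) f \<le> t\<^sup>2 * norm1sq (\<lambda>_. k) u / 2 - (LINT x|lebesgue. prim f (t * u x))"
      using const.c1_le[OF t(3)] by (simp add: const.J1_cmult[OF X1_const[OF in_X1 k]])
    also have "\<dots> \<le> t\<^sup>2 * (norm1sq V u + D) / 2 - (LINT x|lebesgue. prim f (t * u x))"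
      unfolding D_def by (intro diff_right_mono divide_right_mono mult_left_mono norm1sq_const_le in_X1 k e far) auto
    also have "\<dots> = J1 V f (\<lambda>x. t * u x) + t\<^sup>2 / 2 * D" unfolding J1_cmult[OF in_X1] by (simp add: field_simps)
    also have "\<dots> \<le> J1 V f u + T\<^sup>2 / 2 * (e * (R\<^sup>2 / V0) + k * norm2sq_on (ball 0 \<rho>) u)"
      using t D u by (intro add_mono J1_ray_le in_X1 mult_mono divide_right_mono power_mono) (auto simp: Nehari1_iff)
    finally show "c1 (\<lambda>_::'y \<times> 'z. k) f \<le> J1 V f u + T\<^sup>2 / 2 * (e * (R\<^sup>2 / V0) + k * norm2sq_on (ball 0 \<rho>) u)" .
  qed (use T in simp)
qed

lemma vanishing_limit_c1_const_le:
  assumes k: "k > 0" and at_infinity: "\<And>e. e > 0 \<Longrightarrow> \<forall>\<^sub>F x in at_infinity. k - e \<le> V x"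
    and u: "\<And>n. u n \<in> Nehari1 V f" "\<And>n. norm1 (u n) \<le> R" and J: "(\<lambda>n. J1 V f (u n)) \<longlonglongrightarrow> c1 V f"
    and vanish: "\<And>\<rho>. (\<lambda>n. norm2sq_on (ball 0 \<rho>) (u n)) \<longlonglongrightarrow> 0"
  shows "c1 (\<lambda>_::'y \<times> 'z. k) f \<le> c1 V f"
proof -
  obtain T where T: "T > 0" "\<And>u e \<rho>. u \<in> Nehari1 V f \<Longrightarrow> norm1 u \<le> R \<Longrightarrow> e \<ge> 0 \<Longrightarrow> (\<And>x. \<rho> \<le> norm x \<Longrightarrow> k - e \<le> V x) \<Longrightarrow>
    c1 (\<lambda>_::'y \<times> 'z. k) f \<le> J1 V f u + T * (e * (R\<^sup>2 / V0) + k * norm2sq_on (ball 0 \<rho>) u)"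
    using c1_const_le[OF k] by blast
  have bound: "c1 (\<lambda>_::'y \<times> 'z. k) f \<le> c1 V f + T * (e * (R\<^sup>2 / V0) + k * 0)" if e: "e > 0" for e
  proof -
    obtain \<rho> where \<rho>: "\<And>x. \<rho> \<le> norm x \<Longrightarrow> k - e \<le> V x" using at_infinity[OF e] unfolding eventually_at_infinity by blast
    have "(\<lambda>n. J1 V f (u n) + T * (e * (R\<^sup>2 / V0) + k * norm2sq_on (ball 0 \<rho>) (u n)))
        \<longlonglongrightarrow> c1 V f + T * (e * (R\<^sup>2 / V0) + k * 0)"
      by (intro tendsto_intros J vanish)
    then show ?thesis by (rule LIMSEQ_le_const) (use T(2)[OF u less_imp_le[OF e] \<rho>] in blast)
  qed
  have "((\<lambda>e. c1 V f + T * (e * (R\<^sup>2 / V0) + k * 0)) \<longlongrightarrow> c1 V f + T * (0 * (R\<^sup>2 / V0) + k * 0)) (at_right 0)"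
    by (intro tendsto_intros)
  then have "c1 (\<lambda>_::'y \<times> 'z. k) f \<le> c1 V f + T * (0 * (R\<^sup>2 / V0) + k * 0)"
    by (rule tendsto_lowerbound) (rule eventually_mono[OF eventually_at_right_less[of 0] bound], auto)
  then show ?thesis by simp
qed

end

section \<open>The dichotomy\<close>

lemma invariant_bump:
  obtains \<phi> :: "'y::euclidean_space \<times> 'z::euclidean_space \<Rightarrow> real"
  where "test_fun \<phi>" "G_invariant \<phi>" "\<not> (AE x in lebesgue. \<phi> x = 0)" "\<And>x. \<phi> x \<noteq> 0 \<Longrightarrow> 1 \<le> norm (fst x)"
proof
  define p where "p x = 1 - (fst x \<bullet> fst x - 4) * (fst x \<bullet> fst x - 4) - snd x \<bullet> snd x" for x :: "'y \<times> 'z"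
  let ?\<phi> = "\<lambda>x::'y \<times> 'z. (max 0 (p x))\<^sup>2"
  have "C1_fun p" unfolding p_def[abs_def]
    by (intro C1_fun_diff C1_fun_mult C1_fun_const C1_fun_inner_self bounded_linear_fst bounded_linear_snd)
  then have C1: "C1_fun ?\<phi>" by (rule C1_fun_pos_part_square)
  have support: "1 \<le> norm (fst x) \<and> norm x \<le> 3" if "?\<phi> x \<noteq> 0" for x
  proof -
    have "0 < 1 - (fst x \<bullet> fst x - 4)\<^sup>2 - snd x \<bullet> snd x"
      using that by (simp add: p_def power2_eq_square max_def split: if_splits)
    then have "(fst x \<bullet> fst x - 4)\<^sup>2 < 1" "snd x \<bullet> snd x < 1"
      using zero_le_power2[of "fst x \<bullet> fst x - 4"] inner_ge_zero[of "snd x"] by linarith+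
    then have "\<bar>fst x \<bullet> fst x - 4\<bar> < 1" "snd x \<bullet> snd x < 1" by (simp_all add: abs_square_less_1)
    then have "1\<^sup>2 \<le> (norm (fst x))\<^sup>2" "(norm x)\<^sup>2 \<le> 3\<^sup>2" by (simp_all add: power2_norm_eq_inner inner_prod_def)
    then show ?thesis using power2_le_imp_le[of 1 "norm (fst x)"] power2_le_imp_le[of "norm x" 3] by simp
  qed
  then show "1 \<le> norm (fst x)" if "?\<phi> x \<noteq> 0" for x using that by blast
  show "test_fun ?\<phi>" by (rule test_funI[OF C1, of 3]) (use support in force)
  show "G_invariant ?\<phi>" by (auto simp: G_invariant_def p_def orthogonal_transformation_def)
  obtain b :: 'y where b: "b \<in> Basis" using nonempty_Basis by blast
  have "?\<phi> (2 *\<^sub>R b, 0) \<noteq> 0" using b by (simp add: p_def)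
  then have "{x. ?\<phi> x \<noteq> 0} \<noteq> {}" by blast
  moreover have "open {x. ?\<phi> x \<noteq> 0}" by (intro open_Collect_neq C1_fun_continuous[OF C1] continuous_on_const)
  ultimately have "\<not> negligible {x. ?\<phi> x \<noteq> 0}" by (intro open_not_negligible)
  then show "\<not> (AE x in lebesgue. ?\<phi> x = 0)" unfolding completion.AE_iff_null_sets negligible_iff_null_sets by simp
qed

context potential
begin

lemma X1_test_fun:
  assumes \<phi>: "test_fun \<phi>" and away: "\<And>x. \<phi> x \<noteq> 0 \<Longrightarrow> 1 \<le> norm (fst x)" shows "X1 V \<phi>"
  unfolding X1_iff
proof (intro conjI)
  note L2 = L2_test_fun[OF \<phi>]
  show "H1 \<phi>" by (rule H1_test_fun[OF \<phi>])
  have "norm (\<phi> x / norm (fst x)) \<le> norm (\<phi> x)" for x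
  proof (cases "\<phi> x = 0")
    case False
    have "\<bar>\<phi> x\<bar> * 1 \<le> \<bar>\<phi> x\<bar> * norm (fst x)" using away[OF False] by (intro mult_left_mono) auto
    then show ?thesis using away[OF False] by (simp add: divide_le_eq)
  qed simp
  then show "L2 (\<lambda>x. \<phi> x / norm (fst x))" by (intro L2_bound[OF L2] weighted_measurable(1) L2_measurable[OF L2]) simp
  obtain R where "\<And>x. R < norm x \<Longrightarrow> \<phi> x = 0" using test_fun_support[OF \<phi>] by metis
  then show "L2 (\<lambda>x. sqrt (V x) * \<phi> x)"
    by (intro L2_continuous_compact_support[of _ R] continuous_intros V_continuous test_fun_continuous \<phi>) auto
qed

lemma X1G_nontrivial: obtains u where "X1G V u" "\<not> (AE x in lebesgue. u x = 0)"
  using invariant_bump X1_test_fun unfolding X1G_def by metis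

end

context variational
begin

lemma Nehari_minimising_sequence:
  obtains u R where "\<And>n. u n \<in> Nehari1 V f" "\<And>n. norm1 (u n) \<le> R" "(\<lambda>n. J1 V f (u n)) \<longlonglongrightarrow> c1 V f"
proof -
  obtain w where "X1G V w" "norm1 w > 0" using X1G_nontrivial norm1_pos_iff X1G_X1 by metis
  then have "Nehari1 V f \<noteq> {}" using Nehari_projection by (metis empty_iff)
  then obtain u where u: "\<And>n. u n \<in> Nehari1 V f" "\<And>n. J1 V f (u n) < c1 V f + 1 / real (Suc n)"
    using minimising_sequence[of "\<lambda>_. Nehari1 V f" "J1 V f"] unfolding c1_def by blast
  obtain R where R: "\<And>u. u \<in> Nehari1 V f \<Longrightarrow> J1 V f u \<le> c1 V f + 1 \<Longrightarrow> norm1 u \<le> R"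
    using Nehari_bounded by blast
  show ?thesis
  proof (rule that[OF u(1)])
    show "norm1 (u n) \<le> R" for n
    proof (rule R[OF u(1)])
      have "1 / real (Suc n) \<le> 1" by simp
      then show "J1 V f (u n) \<le> c1 V f + 1" using u(2)[of n] by linarith
    qed
    have "(\<lambda>n. c1 V f + 1 / real (Suc n)) \<longlonglongrightarrow> c1 V f"
      using tendsto_add[OF tendsto_const[of "c1 V f"] LIMSEQ_Suc[OF lim_1_over_n]] by simp
    then show "(\<lambda>n. J1 V f (u n)) \<longlonglongrightarrow> c1 V f"
      by (rule tendsto_sandwich[OF _ _ tendsto_const, rotated 2])
        (use u c1_le in \<open>auto intro!: always_eventually less_imp_le\<close>)
  qed
qed

theorem Nehari_dichotomy:
  assumes V: "G_invariant V" and k: "k > 0" and at_infinity: "\<And>e. e > 0 \<Longrightarrow> \<forall>\<^sub>F x in at_infinity. k - e \<le> V x"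
  shows "(\<exists>u. X1G V u \<and> \<not> (AE x in lebesgue. u x = 0) \<and> J1_critical V f u \<and> J1 V f u = c1 V f)
    \<or> c1 (\<lambda>_::'y \<times> 'z. k) f \<le> c1 V f"
proof -
  obtain v R where v: "\<And>n. v n \<in> Nehari1 V f" "\<And>n. norm1 (v n) \<le> R" and J: "(\<lambda>n. J1 V f (v n)) \<longlonglongrightarrow> c1 V f"
    using Nehari_minimising_sequence by blast
  have bound: "norm1sq V (v n) \<le> R\<^sup>2" for n using power_mono[OF v(2) norm1_nonneg, of n 2] by (simp add: norm1_sq)
  obtain \<kappa> U where \<kappa>: "strict_mono \<kappa>" and U_lim: "\<And>x. U x = lim (\<lambda>n. v (\<kappa> n) x)" and U: "X1 V U"
    and lim: "AE x in lebesgue. (\<lambda>n. v (\<kappa> n) x) \<longlonglongrightarrow> U x"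
    and loc: "\<And>\<rho>. (\<lambda>n. norm2sq_on (ball 0 \<rho>) (\<lambda>x. v (\<kappa> n) x - U x)) \<longlonglongrightarrow> 0"
    by (rule X1_compact[OF Nehari1_X1[OF v(1)] bound]) (rule that)
  have J_\<kappa>: "(\<lambda>n. J1 V f (v (\<kappa> n))) \<longlonglongrightarrow> c1 V f" using LIMSEQ_subseq_LIMSEQ[OF J \<kappa>] by (simp add: o_def)
  have UG: "X1G V U" using U v(1) by (simp add: X1G_def G_invariant_def U_lim Nehari1_def)
  show ?thesis
  proof (cases "AE x in lebesgue. U x = 0")
    case True
    have "norm2sq_on (ball 0 \<rho>) (v (\<kappa> n)) = norm2sq_on (ball 0 \<rho>) (\<lambda>x. v (\<kappa> n) x - U x)" for \<rho> n
      unfolding norm2sq_on_def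
    proof (rule norm2sq_AE_cong)
      show "(\<lambda>x. indicator (ball 0 \<rho>) x *\<^sub>R (v (\<kappa> n) x - U x)) \<in> borel_measurable lebesgue"
        by (intro L2_measurable L2_indicator L2_diff X1_L2 Nehari1_X1 v U) simp
    qed (use True in eventually_elim, simp)
    then have vanish: "(\<lambda>n. norm2sq_on (ball 0 \<rho>) (v (\<kappa> n))) \<longlonglongrightarrow> 0" for \<rho> using loc by simp
    show ?thesis using vanishing_limit_c1_const_le[OF k at_infinity v J_\<kappa> vanish] by simp
  next
    case False
    then show ?thesis using nontrivial_limit_critical[OF V v J_\<kappa> lim UG False] UG by blast
  qed
qed

end

lemma powr_lower_order:
  fixes p q :: real
  assumes p: "1 < p" "p < q" and f: "\<And>u. \<bar>f u\<bar> \<le> C * (1 + \<bar>u\<bar> powr (p - 1))" and e: "e > 0"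
  shows "\<exists>M>0. \<forall>a. M \<le> \<bar>a\<bar> \<longrightarrow> \<bar>f a\<bar> \<le> e * \<bar>a\<bar> powr (q - 1)"
proof -
  have "((\<lambda>t. C * (1 + t powr (p - 1)) / t powr (q - 1)) \<longlongrightarrow> 0) at_top" using p by real_asymp
  then have "\<forall>\<^sub>F t in at_top. C * (1 + t powr (p - 1)) / t powr (q - 1) < e" using e by (rule order_tendstoD)
  then obtain M where M: "\<And>t. M \<le> t \<Longrightarrow> C * (1 + t powr (p - 1)) / t powr (q - 1) < e"
    unfolding eventually_at_top_linorder by blast
  have "\<bar>f a\<bar> \<le> e * \<bar>a\<bar> powr (q - 1)" if "max M 1 \<le> \<bar>a\<bar>" for a
  proof -
    have "0 < \<bar>a\<bar> powr (q - 1)" using that by auto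
    then have "C * (1 + \<bar>a\<bar> powr (p - 1)) < e * \<bar>a\<bar> powr (q - 1)"
      using M[of "\<bar>a\<bar>"] that by (simp add: pos_divide_less_eq)
    then show ?thesis using f[of a] by linarith
  qed
  then show ?thesis by (intro exI[of _ "max M 1"]) auto
qed

lemma eventually_ge_if_less_Liminf:
  fixes V :: "'a \<Rightarrow> real"
  assumes "ereal k \<le> Liminf F (\<lambda>x. ereal (V x))" "e > 0" shows "\<forall>\<^sub>F x in F. k - e \<le> V x"
proof -
  have "ereal (k - e) < Liminf F (\<lambda>x. ereal (V x))" using assms(2) by (intro less_le_trans[OF _ assms(1)]) simp
  then show ?thesis by (auto dest!: less_LiminfD elim: eventually_mono)
qed

theorem theorem4p2:
  fixes V :: "'y::euclidean_space \<times> 'z::euclidean_space \<Rightarrow> real"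
    and f :: "real \<Rightarrow> real"
    and Vinf :: real
  defines "N \<equiv> real (DIM('y) + DIM('z))"
  assumes K2: "DIM('y) \<ge> 2"
    and Vcont: "continuous_on UNIV V"
    and Vinv: "G_invariant V"
    and Vbdd: "bdd_below (range V)"
    and V0pos: "0 < (INF x. V x)"
    and V0le: "(INF x. V x) \<le> V 0"
    and Vinf: "V 0 < Vinf"
    and Vliminf: "ereal Vinf \<le> Liminf at_infinity (\<lambda>x. ereal (V x))"
    and F1: "continuous_on UNIV f"
    and F1g: "\<exists>p C. 2 < p \<and> p < 2 * N / (N - 2) \<and> (\<forall>u. \<bar>f u\<bar> \<le> C * (1 + \<bar>u\<bar> powr (p - 1)))"
    and F2: "((\<lambda>u. f u / u) \<longlongrightarrow> 0) (at 0)"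
    and F3: "filterlim (\<lambda>u. prim f u / u^2) at_top at_infinity"
    and F4pos: "strict_mono_on {0<..} (\<lambda>u. f u / \<bar>u\<bar>)"
    and F4neg: "strict_mono_on {..<0} (\<lambda>u. f u / \<bar>u\<bar>)"
  shows "(\<exists>u. X1G V u \<and> \<not> (AE x in lebesgue. u x = 0) \<and> J1_critical V f u \<and> J1 V f u = c1 V f)
         \<or> c1 V f \<ge> mk TYPE('y) TYPE('z) Vinf f"
proof -
  obtain p C where p: "2 < p" "p < 2 * N / (N - 2)" and growth: "\<And>u. \<bar>f u\<bar> \<le> C * (1 + \<bar>u\<bar> powr (p - 1))"
    using F1g by blast
  obtain q where q: "p < q" "q < 2 * N / (N - 2)" using dense[OF p(2)] by blast
  interpret variational V "INF x. V x" f q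
  proof unfold_locales
    show "(INF x. V x) \<le> V x" for x using Vbdd by (intro cINF_lower) auto
    show "\<exists>M>0. \<forall>a. M \<le> \<bar>a\<bar> \<longrightarrow> \<bar>f a\<bar> \<le> e * \<bar>a\<bar> powr (q - 1)" if "e > 0" for e
      using p q by (intro powr_lower_order[OF _ _ growth that]) auto
    show "3 \<le> DIM('y) + DIM('z)" using K2 DIM_positive[where 'a='z] by linarith
    show "2 < q" using p q by linarith
    show "q < 2 * real (DIM('y) + DIM('z)) / (real (DIM('y) + DIM('z)) - 2)" using q(2) unfolding N_def .
  qed (fact Vcont V0pos F1 F2 F3 F4pos F4neg)+
  show ?thesis
    using Nehari_dichotomy[OF Vinv, of Vinf] eventually_ge_if_less_Liminf[OF Vliminf] V0pos V0le Vinf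
    unfolding mk_eq_c1 by force
qed

end
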